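(* Let $X=\mathbb C^n$, $z_0^*=(0;1,0,\dots,0)$ and $[\psi(z,w,\eta)\,dw],[\varphi(z,w,\eta)\,dw]\in\mathscr E^{\mathbb R}_{X,z_0^*}$. Set $$\sigma(\psi)\odot\sigma(\varphi)(z,\zeta,\eta)=\sum_\alpha\frac1{\alpha!}\,\partial_\zeta^\alpha\sigma(\psi)(z,\zeta,\eta)\,\partial_z^\alpha\sigma(\varphi)(z,\zeta,\eta).$$ Then: (1) $\sigma(\psi)\odot\sigma(\varphi)(z,\zeta,\eta)\in\mathfrak S_{z_0^*}$. (2) $\sigma(\psi)\odot\sigma(\varphi)(z,\zeta,\eta)-\sigma(\psi)\circ\sigma(\varphi)(t;z,\zeta,\eta)\in\widehat{\mathfrak N}_{{\rm cl},z_0^*}$. (3) $\sigma(\mu(\psi\otimes\varphi))(z,\zeta,\eta)-\sigma(\psi)\odot\sigma(\varphi)(z,\zeta,\eta)\in\mathfrak N_{z_0^*}$. In other words, the product in $\mathscr E^{\mathbb R}_{X,z_0^*}$ coincides with the product $\circ$ of the classical formal symbols through the symbol mapping $\sigma$.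
   Context: Notation: $\|z\|=\max_i|z_i|$, $T^*X=\{(z;\zeta)\}$, $\langle w,\zeta\rangle=\sum w_i\zeta_i$. Operators. For positive $\boldsymbol\kappa=(r,r',\varrho,\theta)$ with $\theta<\pi/2$, $\varrho<1$, $r<\varrho r'$ let $S_{\boldsymbol\kappa}=\{\eta;\ 0<|\eta|<r,\ |\arg\eta|<\theta/4\}$, $\widehat U_{\Delta,\boldsymbol\kappa}=\{(z,w,\eta);\ \|z\|<r',\ \eta\in S_{\boldsymbol\kappa},\ |z_1-w_1|<\varrho|\eta|,\ |z_i-w_i|<r'\ (2\le i\le n)\}$, $\widehat V^{(1)}=\{(z,w,\eta)\in\widehat U_{\Delta,\boldsymbol\kappa};\ \frac\pi2-\theta<\arg(z_1-w_1)<\frac{3\pi}2+\theta\}$, $\widehat V^{(i)}=\{(z,w,\eta)\in\widehat U_{\Delta,\boldsymbol\kappa};\ \varrho|z_i-w_i|>|\eta|\}$ ($2\le i\le n$), $\widehat V^{(\alpha)}=\bigcap_{i\in\alpha}\widehat V^{(i)}$ ($=\widehat U_{\Delta,\boldsymbol\kappa}$ if $\alpha=\emptyset$), $*=\{1,\dots,n\}$. $E^{\mathbb R}_X(\boldsymbol\kappa)$ is the kernel of $\partial_\eta$ on the quotient of the space of holomorphic forms $\psi(z,w,\eta)\,dw$ on $\widehat V^{( * )}$ by the sum over $\#\alpha=n-1$ of the spaces of such forms on $\widehat V^{(\alpha)}$. The stalk of the sheaf $\mathscr E^{\mathbb R}_X$ of pseudodifferential operators is canonically identified with $\varinjlim_{\boldsymbol\kappa}E^{\mathbb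 R}_X(\boldsymbol\kappa)$ ($\boldsymbol\kappa\to0$), and its product with $\mu(\psi\otimes\varphi)(z,w,\eta)=\int_{\gamma(z,\eta;\varrho,\theta)}\psi(z,\widetilde w,\eta)\varphi(\widetilde w,w,\eta)\,d\widetilde w$. Paths: $\beta_0=\frac\varrho2e^{-\sqrt{-1}(\pi+\theta)/2}$, $\beta_1=\frac\varrho2e^{\sqrt{-1}(\pi+\theta)/2}$, $\varepsilon>0$ small; $\gamma(z,\eta;\varrho,\theta)=\gamma_1\times\dots\times\gamma_n$ where $\gamma_1$ consists of the segment $w_1=z_1+t\beta_0\eta$ ($t$ from $1$ to $\varepsilon$), the arc $w_1=z_1+\frac{\varepsilon\varrho\eta}2e^{\sqrt{-1}(\pi+\theta)t/2}$ ($-1\le t\le1$) and the segment $w_1=z_1+t\beta_1\eta$ ($t$ from $\varepsilon$ to $1$); $\gamma_i$ ($i\ge2$) is the circle $w_i=z_i+(\frac{|\eta|}\varrho+\varepsilon)e^{2\pi\sqrt{-1}t}$, $0\le t\le1$. Symbol mapping: $\sigma(\psi)(z,\zeta,\eta)=\int_{\gamma(0,\eta;\varrho,\theta)}\psi(z,z+w,\eta)e^{\langle w,\zeta\rangle}dw$, whose class in $\mathfrak S_{z_0^*}/\mathfrak N_{z_0^*}$ is well defined. Symbols. For open conic $\varOmega$, $\varOmega_\rho$ is the closure of $\bigcup_{(z;\zeta)\in\varOmega}\{(z+z';\zeta+\zeta');\ \|z'\|\le\rho,\ \|\zeta'\|\le\rho\|\zeta\|\}$; $V[d]=\{(z;\zeta)\in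 V;\ \|\zeta\|\ge d\}$; $d_\rho=d(1-\rho)$; $S=\{\eta;\ 0<|\eta|<r,\ |\arg\eta|<\theta/4\}$ with $r,\theta\in]0,\frac12[$. All functions are holomorphic near $\varOmega_\rho[d_\rho]\times S$ for some $d>0$, $\rho\in]0,1[$. $\mathfrak N(\varOmega;S)$: functions $P$ for which there is $\delta>0$ such that for every $Z\Subset S$ there is $C_Z$ with $|P|\le C_Ze^{-\delta\|\eta\zeta\|}$ on $\varOmega_\rho[d_\rho]\times Z$. $\mathfrak S(\varOmega;S)$: functions $P$ with $\partial_\eta P\in\mathfrak N(\varOmega;S)$ and, for every $h>0$, $Z\Subset S$, some $C_{h,Z}$ with $|P|\le C_{h,Z}e^{h\|\zeta\|}$ on $\varOmega_\rho[d_\rho]\times Z$. $\widehat{\mathfrak N}_{\rm cl}(\varOmega;S)$: formal series $\sum_{\nu\ge0}t^\nu P_\nu$ for which there is $A>0$ such that for every $Z\Subset S$, $h>0$ there is $C_{h,Z}$ with $|\sum_{\nu<m}P_\nu|\le C_{h,Z}\,m!\,A^me^{h\|\zeta\|}/\|\eta\zeta\|^m$ on $\varOmega_\rho[d_\rho]\times Z$ for all $m\in\mathbb N$. $\mathfrak S_{z_0^*},\mathfrak N_{z_0^*},\widehat{\mathfrak N}_{{\rm cl},z_0^*}$ are the inductive limits over open conic neighborhoods $\varOmega$ of $z_0^*$ (relatively compact modulo $\mathbb R_{>0}$) and $r,\theta\to0$. A function is regarded as a formal series in $t$ concentrated in degree $0$. For functions $p,q$, $q\circ p(t;z,\zeta,\eta)=\sum_\alpha\frac{t^{|\alpha|}}{\alpha!}\partial_\zeta^\alpha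 q\,\partial_z^\alpha p$ (the product $e^{t\langle\partial_{\zeta'},\partial_{z'}\rangle}q(z,\zeta+\zeta',\eta)p(z+z',\zeta,\eta)|_{z'=\zeta'=0}$ of classical formal symbols). *)

theory Defs
  imports "HOL-Complex_Analysis.Complex_Analysis"
begin

unbundle no fps_syntax

text \<open>
  \<open>X = \<complex>\<^sup>n\<close> is \<open>complex ^ 'n\<close> with a finite linearly ordered index type; the least index plays the
  role of the index 1.  Points \<open>(z, w, \<eta>)\<close> of \<open>X \<times> X \<times> \<complex>\<close> and points \<open>(z, \<zeta>, \<eta>)\<close> of
  \<open>T\<^sup>*X \<times> \<complex>\<close> have the same type.
\<close>

type_synonym 'n cvec = "complex ^ 'n"
type_synonym 'n triple = "'n cvec \<times> 'n cvec \<times> complex"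

definition idx1 :: "'n::{finite,linorder}" where
  "idx1 = Min UNIV"

definition maxnorm :: "'n::finite cvec \<Rightarrow> real" where
  "maxnorm z = Max (range (\<lambda>i. cmod (z $ i)))"

definition pairing :: "'n::finite cvec \<Rightarrow> 'n cvec \<Rightarrow> complex" where
  "pairing w \<zeta> = (\<Sum>i\<in>UNIV. w $ i * \<zeta> $ i)"


section \<open>Holomorphic functions of several variables\<close>

definition cscale :: "complex \<Rightarrow> 'n::finite triple \<Rightarrow> 'n triple" where
  "cscale c = (\<lambda>(z, w, \<eta>). (c *s z, c *s w, c * \<eta>))"

definition holo_on :: "('n::finite triple \<Rightarrow> complex) \<Rightarrow> 'n triple set \<Rightarrow> bool" where
  "holo_on f U \<longleftrightarrow>
     (\<forall>x\<in>U. \<exists>D. (f has_derivative D) (at x) \<and> (\<forall>c v. D (cscale c v) = c * D v))"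

definition holo_near :: "('n::finite triple \<Rightarrow> complex) \<Rightarrow> 'n triple set \<Rightarrow> bool" where
  "holo_near f K \<longleftrightarrow> (\<exists>W. open W \<and> K \<subseteq> W \<and> holo_on f W)"

definition pd1 :: "'n \<Rightarrow> ('n::finite triple \<Rightarrow> complex) \<Rightarrow> 'n triple \<Rightarrow> complex" where
  "pd1 i f = (\<lambda>(z, w, \<eta>). deriv (\<lambda>s. f (z + axis i s, w, \<eta>)) 0)"

definition pd2 :: "'n \<Rightarrow> ('n::finite triple \<Rightarrow> complex) \<Rightarrow> 'n triple \<Rightarrow> complex" where
  "pd2 i f = (\<lambda>(z, w, \<eta>). deriv (\<lambda>s. f (z, w + axis i s, \<eta>)) 0)"

definition pd_eta :: "('n::finite triple \<Rightarrow> complex) \<Rightarrow> 'n triple \<Rightarrow> complex" where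
  "pd_eta f = (\<lambda>(z, w, \<eta>). deriv (\<lambda>s. f (z, w, s)) \<eta>)"

text \<open>Multi-indices are functions \<open>'n \<Rightarrow> nat\<close>.\<close>

definition mi_abs :: "('n::finite \<Rightarrow> nat) \<Rightarrow> nat" where
  "mi_abs \<alpha> = (\<Sum>i\<in>UNIV. \<alpha> i)"

definition mi_fact :: "('n::finite \<Rightarrow> nat) \<Rightarrow> complex" where
  "mi_fact \<alpha> = (\<Prod>i\<in>UNIV. fact (\<alpha> i))"

definition pd1_multi ::
    "('n::{finite,linorder} \<Rightarrow> nat) \<Rightarrow> ('n triple \<Rightarrow> complex) \<Rightarrow> 'n triple \<Rightarrow> complex" where
  "pd1_multi \<alpha> f = foldr (\<lambda>i. pd1 i ^^ \<alpha> i) (sorted_list_of_set UNIV) f"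

definition pd2_multi ::
    "('n::{finite,linorder} \<Rightarrow> nat) \<Rightarrow> ('n triple \<Rightarrow> complex) \<Rightarrow> 'n triple \<Rightarrow> complex" where
  "pd2_multi \<alpha> f = foldr (\<lambda>i. pd2 i ^^ \<alpha> i) (sorted_list_of_set UNIV) f"


section \<open>The spaces of operators\<close>

datatype kappa = Kappa (rad: real) (rad': real) (rho: real) (theta: real)

definition admissible :: "kappa \<Rightarrow> bool" where
  "admissible k \<longleftrightarrow> 0 < rad k \<and> 0 < rad' k \<and> 0 < rho k \<and> 0 < theta k \<and>
     theta k < pi / 2 \<and> rho k < 1 \<and> rad k < rho k * rad' k"

definition kappa_le :: "kappa \<Rightarrow> kappa \<Rightarrow> bool" where
  "kappa_le k l \<longleftrightarrow> rad k \<le> rad l \<and> rad' k \<le> rad' l \<and> rho k \<le> rho l \<and> theta k \<le> theta l"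

definition sector :: "real \<Rightarrow> real \<Rightarrow> complex set" where
  "sector r \<theta> = {\<eta>. 0 < cmod \<eta> \<and> cmod \<eta> < r \<and> \<bar>Arg \<eta>\<bar> < \<theta> / 4}"

definition U_hat :: "kappa \<Rightarrow> 'n::{finite,linorder} triple set" where
  "U_hat k = {(z, w, \<eta>). maxnorm z < rad' k \<and> \<eta> \<in> sector (rad k) (theta k) \<and>
     cmod (z $ idx1 - w $ idx1) < rho k * cmod \<eta> \<and>
     (\<forall>i. i \<noteq> idx1 \<longrightarrow> cmod (z $ i - w $ i) < rad' k)}"

text \<open>
  \<open>Arg2pi\<close> takes values in \<open>[0, 2\<pi>)\<close>.  Since \<open>\<theta> < \<pi>/2\<close>, the interval \<open>(\<pi>/2 - \<theta>, 3\<pi>/2 + \<theta>)\<close>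
  lies in \<open>(0, 2\<pi>)\<close>; as \<open>Arg2pi 0 = 0\<close>, the condition also excludes \<open>z\<^sub>1 = w\<^sub>1\<close>.
\<close>
definition V_hat :: "kappa \<Rightarrow> 'n::{finite,linorder} \<Rightarrow> 'n triple set" where
  "V_hat k i =
     (if i = idx1 then {(z, w, \<eta>) \<in> U_hat k.
          pi / 2 - theta k < Arg2pi (z $ idx1 - w $ idx1) \<and>
          Arg2pi (z $ idx1 - w $ idx1) < 3 * pi / 2 + theta k}
      else {(z, w, \<eta>) \<in> U_hat k. rho k * cmod (z $ i - w $ i) > cmod \<eta>})"

definition V_multi :: "kappa \<Rightarrow> 'n::{finite,linorder} set \<Rightarrow> 'n triple set" where
  "V_multi k \<alpha> = U_hat k \<inter> (\<Inter>i\<in>\<alpha>. V_hat k i)"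

text \<open>
  A form \<open>\<psi> dw\<close> is represented by its coefficient \<open>\<psi>\<close>, and functions on \<open>V_multi k \<alpha>\<close> by total
  functions whose values elsewhere are irrelevant; restriction to a smaller \<open>\<kappa>\<close> therefore does not
  change the function.
\<close>
definition null_forms :: "kappa \<Rightarrow> ('n::{finite,linorder} triple \<Rightarrow> complex) set" where
  "null_forms k = {u. \<exists>h. (\<forall>\<alpha>. card \<alpha> = CARD('n) - 1 \<longrightarrow> holo_on (h \<alpha>) (V_multi k \<alpha>)) \<and>
     (\<forall>x\<in>V_multi k UNIV. u x = (\<Sum>\<alpha> | card \<alpha> = CARD('n) - 1. h \<alpha> x))}"

text \<open>The functions whose classes modulo \<open>null_forms k\<close> are the elements of \<open>E\<^sup>\<real>\<^sub>X(\<kappa>)\<close>.\<close>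
definition ER :: "kappa \<Rightarrow> ('n::{finite,linorder} triple \<Rightarrow> complex) set" where
  "ER k = {\<psi>. holo_on \<psi> (V_multi k UNIV) \<and> pd_eta \<psi> \<in> null_forms k}"

text \<open>The inductive limit of the \<open>E\<^sup>\<real>\<^sub>X(\<kappa>)\<close>: classes of pairs \<open>(\<kappa>, \<psi>)\<close>.\<close>
definition ER_pairs :: "(kappa \<times> ('n::{finite,linorder} triple \<Rightarrow> complex)) set" where
  "ER_pairs = {(k, \<psi>). admissible k \<and> \<psi> \<in> ER k}"

definition ER_rel ::
    "((kappa \<times> ('n::{finite,linorder} triple \<Rightarrow> complex)) \<times>
      (kappa \<times> ('n triple \<Rightarrow> complex))) set" where
  "ER_rel = {((k, \<psi>), (l, \<phi>)). (k, \<psi>) \<in> ER_pairs \<and> (l, \<phi>) \<in> ER_pairs \<and>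
     (\<exists>m. admissible m \<and> kappa_le m k \<and> kappa_le m l \<and> (\<lambda>x. \<psi> x - \<phi> x) \<in> null_forms m)}"

definition ER_stalk :: "(kappa \<times> ('n::{finite,linorder} triple \<Rightarrow> complex)) set set" where
  "ER_stalk = ER_pairs // ER_rel"


section \<open>Integration paths, symbol mapping and product\<close>

definition beta0 :: "real \<Rightarrow> real \<Rightarrow> complex" where
  "beta0 \<rho> \<theta> = of_real (\<rho> / 2) * exp (- \<i> * of_real ((pi + \<theta>) / 2))"

definition beta1 :: "real \<Rightarrow> real \<Rightarrow> complex" where
  "beta1 \<rho> \<theta> = of_real (\<rho> / 2) * exp (\<i> * of_real ((pi + \<theta>) / 2))"

text \<open>In \<open>arc_path\<close> the parameter \<open>s \<in> [0,1]\<close> corresponds to \<open>t = 2 s - 1 \<in> [-1,1]\<close>.\<close>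
definition arc_path :: "complex \<Rightarrow> complex \<Rightarrow> real \<Rightarrow> real \<Rightarrow> real \<Rightarrow> real \<Rightarrow> complex" where
  "arc_path a \<eta> \<rho> \<theta> \<epsilon> = (\<lambda>s. a + of_real (\<epsilon> * \<rho>) * \<eta> / 2 *
     exp (\<i> * of_real ((pi + \<theta>) * (2 * s - 1) / 2)))"

definition gamma_path ::
    "'n::{finite,linorder} cvec \<Rightarrow> complex \<Rightarrow> real \<Rightarrow> real \<Rightarrow> real \<Rightarrow> 'n \<Rightarrow> real \<Rightarrow> complex" where
  "gamma_path z \<eta> \<rho> \<theta> \<epsilon> i =
     (if i = idx1 then
        linepath (z $ i + beta0 \<rho> \<theta> * \<eta>) (z $ i + of_real \<epsilon> * beta0 \<rho> \<theta> * \<eta>) +++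
        arc_path (z $ i) \<eta> \<rho> \<theta> \<epsilon> +++
        linepath (z $ i + of_real \<epsilon> * beta1 \<rho> \<theta> * \<eta>) (z $ i + beta1 \<rho> \<theta> * \<eta>)
      else circlepath (z $ i) (cmod \<eta> / \<rho> + \<epsilon>))"

definition set_coord :: "'n::finite cvec \<Rightarrow> 'n \<Rightarrow> complex \<Rightarrow> 'n cvec" where
  "set_coord w i s = (\<chi> j. if j = i then s else w $ j)"

text \<open>
  \<open>\<integral> f dw\<close> over \<open>g\<^sub>1 \<times> \<dots> \<times> g\<^sub>n\<close>, as an iterated contour integral.  Every coordinate of the start
  vector \<open>0\<close> is overwritten by an integration variable.
\<close>
definition prod_integral ::
    "('n::{finite,linorder} \<Rightarrow> real \<Rightarrow> complex) \<Rightarrow> ('n cvec \<Rightarrow> complex) \<Rightarrow> complex" where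
  "prod_integral g f =
     foldr (\<lambda>i F w. contour_integral (g i) (\<lambda>s. F (set_coord w i s)))
       (sorted_list_of_set UNIV) f 0"

text \<open>
  The path integrals do not depend on \<open>\<epsilon>\<close> as long as it is small enough, but for the product the
  required smallness depends on the point.  We take the common value for all small \<open>\<epsilon> > 0\<close>.
\<close>
definition small_value :: "(real \<Rightarrow> complex) \<Rightarrow> complex" where
  "small_value F = (THE c. eventually (\<lambda>\<epsilon>. F \<epsilon> = c) (at_right 0))"

definition symbol_map ::
    "kappa \<Rightarrow> ('n::{finite,linorder} triple \<Rightarrow> complex) \<Rightarrow> 'n triple \<Rightarrow> complex" where
  "symbol_map k \<psi> = (\<lambda>(z, \<zeta>, \<eta>). small_value (\<lambda>\<epsilon>.
     prod_integral (gamma_path 0 \<eta> (rho k) (theta k) \<epsilon>)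
       (\<lambda>w. \<psi> (z, z + w, \<eta>) * exp (pairing w \<zeta>))))"

definition mu_prod ::
    "kappa \<Rightarrow> ('n::{finite,linorder} triple \<Rightarrow> complex) \<Rightarrow> ('n triple \<Rightarrow> complex) \<Rightarrow>
     'n triple \<Rightarrow> complex" where
  "mu_prod k \<psi> \<phi> = (\<lambda>(z, w, \<eta>). small_value (\<lambda>\<epsilon>.
     prod_integral (gamma_path z \<eta> (rho k) (theta k) \<epsilon>)
       (\<lambda>w'. \<psi> (z, w', \<eta>) * \<phi> (w', w, \<eta>))))"


section \<open>Symbols\<close>

definition thicken ::
    "('n::finite cvec \<times> 'n cvec) set \<Rightarrow> real \<Rightarrow> ('n cvec \<times> 'n cvec) set" where
  "thicken \<Omega> \<rho> = closure (\<Union>(z, \<zeta>)\<in>\<Omega>.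
     {(z + z', \<zeta> + \<zeta>') | z' \<zeta>'. maxnorm z' \<le> \<rho> \<and> maxnorm \<zeta>' \<le> \<rho> * maxnorm \<zeta>})"

text \<open>The set \<open>\<Omega>\<^sub>\<rho>[d\<^sub>\<rho>]\<close> with \<open>d\<^sub>\<rho> = d (1 - \<rho>)\<close>.\<close>
definition sym_dom ::
    "('n::finite cvec \<times> 'n cvec) set \<Rightarrow> real \<Rightarrow> real \<Rightarrow>
     ('n cvec \<times> 'n cvec) set" where
  "sym_dom \<Omega> \<rho> d = {(z, \<zeta>) \<in> thicken \<Omega> \<rho>. d * (1 - \<rho>) \<le> maxnorm \<zeta>}"

definition sym_dom_times ::
    "('n::finite cvec \<times> 'n cvec) set \<Rightarrow> real \<Rightarrow> real \<Rightarrow> complex set \<Rightarrow> 'n triple set" where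
  "sym_dom_times \<Omega> \<rho> d Z = {(z, \<zeta>, \<eta>). (z, \<zeta>) \<in> sym_dom \<Omega> \<rho> d \<and> \<eta> \<in> Z}"

definition rel_compact :: "complex set \<Rightarrow> complex set \<Rightarrow> bool" where
  "rel_compact Z S \<longleftrightarrow> compact (closure Z) \<and> closure Z \<subseteq> S"

definition frakN ::
    "('n::finite cvec \<times> 'n cvec) set \<Rightarrow> complex set \<Rightarrow> ('n triple \<Rightarrow> complex) set" where
  "frakN \<Omega> S = {P. \<exists>d>0. \<exists>\<rho>\<in>{0<..<1}. holo_near P (sym_dom_times \<Omega> \<rho> d S) \<and>
     (\<exists>\<delta>>0. \<forall>Z. rel_compact Z S \<longrightarrow> (\<exists>C. \<forall>(z, \<zeta>, \<eta>) \<in> sym_dom_times \<Omega> \<rho> d Z.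
        cmod (P (z, \<zeta>, \<eta>)) \<le> C * exp (- \<delta> * maxnorm (\<eta> *s \<zeta>))))}"

definition frakS ::
    "('n::finite cvec \<times> 'n cvec) set \<Rightarrow> complex set \<Rightarrow> ('n triple \<Rightarrow> complex) set" where
  "frakS \<Omega> S = {P. pd_eta P \<in> frakN \<Omega> S \<and>
     (\<exists>d>0. \<exists>\<rho>\<in>{0<..<1}. holo_near P (sym_dom_times \<Omega> \<rho> d S) \<and>
       (\<forall>h>0. \<forall>Z. rel_compact Z S \<longrightarrow> (\<exists>C. \<forall>(z, \<zeta>, \<eta>) \<in> sym_dom_times \<Omega> \<rho> d Z.
          cmod (P (z, \<zeta>, \<eta>)) \<le> C * exp (h * maxnorm \<zeta>))))}"

text \<open>A formal series \<open>\<Sum> t\<^sup>\<nu> P\<^sub>\<nu>\<close> is the sequence of its coefficients.\<close>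
definition frakN_cl ::
    "('n::finite cvec \<times> 'n cvec) set \<Rightarrow> complex set \<Rightarrow>
     (nat \<Rightarrow> 'n triple \<Rightarrow> complex) set" where
  "frakN_cl \<Omega> S = {P. \<exists>d>0. \<exists>\<rho>\<in>{0<..<1}. (\<forall>\<nu>. holo_near (P \<nu>) (sym_dom_times \<Omega> \<rho> d S)) \<and>
     (\<exists>A>0. \<forall>Z. rel_compact Z S \<longrightarrow> (\<forall>h>0. \<exists>C. \<forall>m. \<forall>(z, \<zeta>, \<eta>) \<in> sym_dom_times \<Omega> \<rho> d Z.
        cmod (\<Sum>\<nu><m. P \<nu> (z, \<zeta>, \<eta>)) \<le>
          C * fact m * A ^ m * exp (h * maxnorm \<zeta>) / maxnorm (\<eta> *s \<zeta>) ^ m))}"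

text \<open>Relative compactness modulo \<open>\<real>\<^sub>>\<^sub>0\<close> is meant in the quotient of \<open>T\<^sup>*X\<close> minus its zero section.\<close>
definition conic_nbhd ::
    "'n::finite cvec \<times> 'n cvec \<Rightarrow> ('n cvec \<times> 'n cvec) set \<Rightarrow> bool" where
  "conic_nbhd p \<Omega> \<longleftrightarrow> open \<Omega> \<and> p \<in> \<Omega> \<and>
     (\<forall>z \<zeta>. \<forall>c>0. (z, \<zeta>) \<in> \<Omega> \<longrightarrow> (z, c *\<^sub>R \<zeta>) \<in> \<Omega>) \<and>
     (\<exists>K. compact K \<and> (\<forall>(z, \<zeta>)\<in>K. \<zeta> \<noteq> 0) \<and>
       \<Omega> \<subseteq> {(z, c *\<^sub>R \<zeta>) | z \<zeta> c. (z, \<zeta>) \<in> K \<and> c > 0})"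

text \<open>The elements of the inductive limits are represented by functions, respectively by series.\<close>
definition germs ::
    "'n::finite cvec \<times> 'n cvec \<Rightarrow>
     (('n cvec \<times> 'n cvec) set \<Rightarrow> complex set \<Rightarrow> 'a set) \<Rightarrow> 'a set" where
  "germs p F = {P. \<exists>\<Omega>. conic_nbhd p \<Omega> \<and> (\<exists>r\<in>{0<..<1/2}. \<exists>\<theta>\<in>{0<..<1/2}. P \<in> F \<Omega> (sector r \<theta>))}"

definition z0star :: "'n::{finite,linorder} cvec \<times> 'n cvec" where
  "z0star = (0, axis idx1 1)"

definition comp_term ::
    "('n::{finite,linorder} triple \<Rightarrow> complex) \<Rightarrow> ('n triple \<Rightarrow> complex) \<Rightarrow> ('n \<Rightarrow> nat) \<Rightarrow>
     'n triple \<Rightarrow> complex" where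
  "comp_term q p \<alpha> x = 1 / mi_fact \<alpha> * pd2_multi \<alpha> q x * pd1_multi \<alpha> p x"

definition odot ::
    "('n::{finite,linorder} triple \<Rightarrow> complex) \<Rightarrow> ('n triple \<Rightarrow> complex) \<Rightarrow> 'n triple \<Rightarrow> complex" where
  "odot q p x = (\<Sum>\<^sub>\<infinity>\<alpha>. comp_term q p \<alpha> x)"

text \<open>
  \<open>infsum\<close> is 0 where the series diverges.  The next set consists of the pairs for which the series
  defining \<open>odot\<close> converges (absolutely) on the whole of some \<open>\<Omega>\<^sub>\<rho>[d\<^sub>\<rho>] \<times> S\<close>.
\<close>
definition odot_conv ::
    "('n::{finite,linorder} cvec \<times> 'n cvec) set \<Rightarrow> complex set \<Rightarrow>
     (('n triple \<Rightarrow> complex) \<times> ('n triple \<Rightarrow> complex)) set" where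
  "odot_conv \<Omega> S = {(q, p). \<exists>d>0. \<exists>\<rho>\<in>{0<..<1}. \<forall>x\<in>sym_dom_times \<Omega> \<rho> d S.
     (\<lambda>\<alpha>. comp_term q p \<alpha> x) summable_on UNIV}"

definition formal_comp ::
    "('n::{finite,linorder} triple \<Rightarrow> complex) \<Rightarrow> ('n triple \<Rightarrow> complex) \<Rightarrow> nat \<Rightarrow>
     'n triple \<Rightarrow> complex" where
  "formal_comp q p \<nu> x = (\<Sum>\<alpha> | mi_abs \<alpha> = \<nu>. comp_term q p \<alpha> x)"

definition series_const :: "('n triple \<Rightarrow> complex) \<Rightarrow> nat \<Rightarrow> 'n triple \<Rightarrow> complex" where
  "series_const P \<nu> x = (if \<nu> = 0 then P x else 0)"

end

theory Submission
 imports Defs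
begin

text \<open>Write |zeta| for the maximum norm. After the substitution w = z + eta u, Cauchy's
  theorem in each variable turns every integral over gamma(z, eta) into an integral over a contour
  \<open>G\<close> in u that does not depend on z or eta; only epsilon has to be small. Symbols and
  products are therefore parameter integrals of holomorphic functions. The first component of
  \<open>G\<close> ends at beta0 and beta1. For eta in the sector, Re (eta u_1) <= - c |eta| at both
  ends and on the segment between them, so for zeta in a narrow cone about (1,0,...,0) the factor
  exp <eta u, zeta> is at most exp (- c' |eta| |zeta|) there. All exponentially small errors come
  from this (\<open>Re_beta_le\<close>, \<open>exp_decay\<close>).

  Differentiation in eta produces boundary terms at the two ends and the integral of the
  eta-derivative of psi, which is a null form. Its summands that extend over a disc in some w_i, i
  >= 2, integrate to zero; for the summand that extends in w_1 the first path may be replaced by the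
  segment. Hence the eta-derivative of sigma(psi) is exponentially small
  (\<open>pd_eta_symbol_decay\<close>). Comparing the values at eta and at tau eta for small tau
  then shows that sigma(psi) grows subexponentially (\<open>symbol_subexp\<close>). The same
  computation for mu yields a null form again: boundary terms and segment integral are holomorphic
  without the sector condition on z_1 - w_1, and the null forms of phi stay under the product
  (\<open>pd_eta_mu\<close>, \<open>mu_ER\<close>).

  Expand sigma(phi)(z + eta u, zeta, eta) in its Taylor series at z and integrate it against psi exp
  <eta u, zeta>. Derivatives of sigma(psi) in zeta bring down powers of eta u, so the composition
  series converges absolutely and its sum is the integral \<open>Iop\<close>
  (\<open>comp_term_has_sum\<close>). By Fubini, sigma(mu(psi, phi)) is a double integral of the
  same integrand; only the inner path differs, since in \<open>Iop\<close> it is centred at u.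
  Circles about different centres are homotopic in the domain, and in the first variable the two
  paths differ by two segments joining their ends, on which the exponential decays. This is (3)
  (\<open>inner_deform\<close>, \<open>mu_NB\<close>). As sigma(mu(psi, phi)) satisfies the
  estimates of a symbol, so does the composition, the error passing to eta-derivatives by Cauchy's
  inequality; this is (1).

  For (2), a term of order N has two bounds, both up to C exp (h |zeta|): Cauchy estimates give N! /
  (kappa |zeta|)^N, and direct estimation of the integral gives tau^N exp (b |eta| |zeta|) with tau
  proportional to |eta|. For small eta the first is good while N <= b |eta| |zeta|, the second
  beyond. Both yield m! / (|eta| |zeta|)^m times 2^(-N) for every m <= N, and this can be summed
  over the tail (\<open>split_bound\<close>, \<open>odot_tail\<close>). An error exp (- d |eta|
  |zeta|) is itself at most m! / (d |eta| |zeta|)^m, so the symbol of the product is covered as well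
  (\<open>ncl_final\<close>).\<close>

unbundle no fps_syntax

section \<open>Contour integrals over joins of C1 paths\<close>

inductive npath :: "(real => complex) => bool" where
 npath_C1: "g C1_differentiable_on {0..1} ==> npath g"
| npath_join: "npath g ==> npath h ==> pathfinish g = pathstart h ==> npath (g +++ h)"

lemma C1_pathD:
 assumes "g C1_differentiable_on {0..1}"
 shows "valid_path g" "continuous_on {0..1} (%t. vector_derivative g (at t))" "continuous_on {0..1} g"
 "!!t. t \<in> {0..1} ==> g differentiable at t"
 using assms C1_differentiable_imp_piecewise[OF assms]
 by (auto simp: valid_path_def C1_differentiable_on_eq piecewise_C1_differentiable_on_def)

lemma npath_valid: "npath g ==> valid_path g"
 by (induction rule: npath.induct) (auto intro: valid_path_join C1_pathD)

lemma path_image_compact: "npath g ==> compact (path_image g)"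
 by (simp add: compact_path_image npath_valid valid_path_imp_path)

text \<open>The pattern for which \<open>npath\<close> is made: on a C1 path the speed is
  continuous, so the claim is one about ordinary integrals over [0,1], and joins add. The inductive
  closure reduces every fact about integrals to these two cases.\<close>

lemma npath_integrable:
 assumes "npath g" "continuous_on (path_image g) f"
 shows "f contour_integrable_on g"
 using assms
proof (induction arbitrary: f rule: npath.induct)
 case (npath_C1 g)
 have "continuous_on {0..1} (%t. f (g t))"
 using C1_pathD[OF npath_C1(1)]
 by (intro continuous_on_compose2[OF npath_C1.prems]) (auto simp: path_image_def)
 then show ?case
 unfolding contour_integrable_on
 by (intro integrable_continuous_real continuous_intros C1_pathD[OF npath_C1(1)])
next
 case (npath_join g h)
 then show ?case
 by (intro contour_integrable_joinI npath_join.IH npath_valid)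
 (auto intro: continuous_on_subset[OF npath_join.prems] simp: path_image_join)
qed

lemma CI_join:
 assumes "npath g" "npath h" "pathfinish g = pathstart h" "continuous_on (path_image (g +++ h)) f"
 shows "contour_integral (g +++ h) f = contour_integral g f + contour_integral h f"
 using assms
 by (intro contour_integral_join npath_integrable npath_valid)
 (auto intro: continuous_on_subset[OF assms(4)] simp: path_image_join)

lemma continuous_on_slice:
 assumes "continuous_on (A \<times> B) (%(x,y). f x y)"
 shows "x \<in> A ==> continuous_on B (f x)" "y \<in> B ==> continuous_on A (%x. f x y)"
proof -
 show "continuous_on B (f x)" if "x \<in> A"
 using continuous_on_compose2[OF assms,of B "%y. (x,y)"] that
 by (force intro!: continuous_intros)
 show "continuous_on A (%x. f x y)" if "y \<in> B"
 using continuous_on_compose2[OF assms,of A "%x. (x,y)"] that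
 by (force intro!: continuous_intros)
qed

lemma continuous_on_CI:
 fixes f :: "'a::topological_space => complex => complex"
 assumes "npath g" "continuous_on (U \<times> path_image g) (%(x,s). f x s)"
 shows "continuous_on U (%x. contour_integral g (f x))"
 using assms
proof (induction arbitrary: f rule: npath.induct)
 case (npath_C1 g)
 note g = C1_pathD[OF npath_C1(1)]
 have 1: "continuous_on (U \<times> {0..1}) (%p. (fst p,g (snd p)))"
 by (intro continuous_intros continuous_on_compose2[OF g(3)]) auto
 have 2: "continuous_on (U \<times> {0..1}) (%p. vector_derivative g (at (snd p)))"
 by (intro continuous_on_compose2[OF g(2)] continuous_intros) auto
 have 3: "(%p. (fst p,g (snd p))) ` (U \<times> {0..1}) <= U \<times> path_image g"
 by (auto simp: path_image_def)
 have "continuous_on (U \<times> cbox 0 1) (%(x,t). f x (g t) * vector_derivative g (at t))"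
 using continuous_on_mult[OF continuous_on_compose2[OF npath_C1.prems 1 3] 2]
 by (simp add: case_prod_unfold)
 from integral_continuous_on_param[OF this] show ?case
 by (simp add: contour_integral_integral)
next
 case (npath_join g h)
 have "continuous_on U (%x. contour_integral g (f x) + contour_integral h (f x))"
 using npath_join by (intro continuous_intros npath_join.IH) (auto intro: continuous_on_subset[OF npath_join.prems] simp: path_image_join)
 moreover have "contour_integral (g +++ h) (f x) = contour_integral g (f x) + contour_integral h (f x)" if "x \<in> U" for x
 using npath_join that
 by (intro CI_join continuous_on_slice(1)[OF npath_join.prems(1)]) auto
 ultimately show ?case by (simp cong: continuous_on_cong)
qed

lemma continuous_on_swap_args:
 assumes "continuous_on (A \<times> B) (%(x,y). f x y)"
 shows "continuous_on (B \<times> A) (%(y,x). f x y)"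
proof -
 have "continuous_on (B \<times> A) (%p. (snd p,fst p))" "(%p. (snd p,fst p)) ` (B \<times> A) <= A \<times> B"
 by (auto intro!: continuous_intros)
 from continuous_on_compose2[OF assms this] show ?thesis by (simp add: case_prod_unfold)
qed

text \<open>For two C1 paths this is \<open>contour_integral_swap\<close>. One path at a time is
  then extended to joins, here g and in \<open>CI_swap\<close> the other one.\<close>

lemma CI_swap_C1:
 assumes "npath g" "h C1_differentiable_on {0..1}"
 and "continuous_on (path_image g \<times> path_image h) (%(x,y). f x y)"
 shows "contour_integral g (%x. contour_integral h (f x)) = contour_integral h (%y. contour_integral g (%x. f x y))"
 using assms
proof (induction arbitrary: f rule: npath.induct)
 case (npath_C1 g)
 then show ?case by (intro contour_integral_swap C1_pathD) auto
next
 case (npath_join g g')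
 note hyps = npath_join(1-3)
 have h: "npath h" using npath_join(6) by (rule npath.npath_C1)
 have c: "continuous_on (path_image g \<times> path_image h) (%(x,y). f x y)"
 "continuous_on (path_image g' \<times> path_image h) (%(x,y). f x y)"
 using hyps(3) by (auto intro: continuous_on_subset[OF npath_join.prems(2)] simp: path_image_join)
 have "contour_integral (g +++ g') (%x. contour_integral h (f x)) =
 contour_integral g (%x. contour_integral h (f x)) + contour_integral g' (%x. contour_integral h (f x))"
 by (rule CI_join[OF hyps continuous_on_CI[OF h npath_join.prems(2)]])
 also have "\<dots> = contour_integral h (%y. contour_integral g (%x. f x y)) + contour_integral h (%y. contour_integral g' (%x. f x y))"
 by (simp only: npath_join.IH(1)[OF npath_join.prems(1) c(1)] npath_join.IH(2)[OF npath_join.prems(1) c(2)])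
 also have "\<dots> = contour_integral h (%y. contour_integral g (%x. f x y) + contour_integral g' (%x. f x y))"
 by (rule contour_integral_add[OF npath_integrable[OF h] npath_integrable[OF h],symmetric])
 (rule continuous_on_CI hyps c continuous_on_swap_args)+
 also have "\<dots> = contour_integral h (%y. contour_integral (g +++ g') (%x. f x y))"
 by (intro contour_integral_eq CI_join[symmetric] hyps continuous_on_slice(2)[OF npath_join.prems(2)])
 finally show ?case .
qed

lemma CI_swap:
 assumes "npath h" "npath g"
 and "continuous_on (path_image g \<times> path_image h) (%(x,y). f x y)"
 shows "contour_integral g (%x. contour_integral h (f x)) = contour_integral h (%y. contour_integral g (%x. f x y))"
 using assms
proof (induction arbitrary: f rule: npath.induct)
 case (npath_C1 h)
 then show ?case by (intro CI_swap_C1) auto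
next
 case (npath_join h h')
 note hyps = npath_join(1-3) and g = npath_join.prems(1)
 have c: "continuous_on (path_image g \<times> path_image h) (%(x,y). f x y)"
 "continuous_on (path_image g \<times> path_image h') (%(x,y). f x y)"
 using hyps(3) by (auto intro: continuous_on_subset[OF npath_join.prems(2)] simp: path_image_join)
 have "contour_integral g (%x. contour_integral (h +++ h') (f x)) =
 contour_integral g (%x. contour_integral h (f x) + contour_integral h' (f x))"
 by (intro contour_integral_eq CI_join hyps continuous_on_slice(1)[OF npath_join.prems(2)])
 also have "\<dots> = contour_integral g (%x. contour_integral h (f x)) + contour_integral g (%x. contour_integral h' (f x))"
 by (rule contour_integral_add[OF npath_integrable[OF g] npath_integrable[OF g]])
 (rule continuous_on_CI hyps c)+
 also have "\<dots> = contour_integral h (%y. contour_integral g (%x. f x y)) + contour_integral h' (%y. contour_integral g (%x. f x y))"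
 by (simp only: npath_join.IH(1)[OF g c(1)] npath_join.IH(2)[OF g c(2)])
 also have "\<dots> = contour_integral (h +++ h') (%y. contour_integral g (%x. f x y))"
 by (rule CI_join[OF hyps,symmetric]) (rule continuous_on_CI[OF g] npath_join.prems continuous_on_swap_args)+
 finally show ?case .
qed

text \<open>The constant comes from the speed of the path alone, so a single one serves for all
  integrands.\<close>

lemma CI_bound:
 assumes "npath g"
 obtains B where "B > 0"
 "!!f M. continuous_on (path_image g) f ==> (!!s. s \<in> path_image g ==> cmod (f s) <= M) ==>
 cmod (contour_integral g f) <= B * M"
proof -
 have "\<exists>B>0. ALL f M. continuous_on (path_image g) f --> (\<forall>s\<in>path_image g. cmod (f s) <= M) -->
 cmod (contour_integral g f) <= B * M"
 using assms
 proof (induction rule: npath.induct)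
 case (npath_C1 g)
 have "compact ((%t. vector_derivative g (at t)) ` {0..1})"
 using C1_pathD[OF npath_C1] by (intro compact_continuous_image) auto
 then obtain B where "B > 0" and B: "\<forall>x\<in>(%t. vector_derivative g (at t)) ` {0..1}. cmod x <= B"
 using compact_imp_bounded bounded_pos by meson
 have "cmod (contour_integral g f) <= B * M"
 if f: "continuous_on (path_image g) f" and M: "\<forall>s\<in>path_image g. cmod (f s) <= M" for f M
 proof -
 have "M \<ge> 0" using M norm_ge_zero order_trans pathstart_in_path_image by blast
 have i: "(%t. f (g t) * vector_derivative g (at t)) integrable_on cbox 0 1"
 using npath_integrable[OF npath.npath_C1[OF npath_C1] f] by (simp add: contour_integrable_on)
 have "cmod (integral (cbox 0 1) (%t. f (g t) * vector_derivative g (at t))) <= integral (cbox 0 (1::real)) (%_. M * B)"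
 using B \<open>M \<ge> 0\<close> M
 by (intro integral_norm_bound_integral i) (auto simp: norm_mult path_image_def intro!: mult_mono)
 then show ?thesis by (simp add: contour_integral_integral mult.commute)
 qed
 with \<open>B > 0\<close> show ?case by blast
 next
 case (npath_join g h)
 then obtain B C where B: "B > 0" "!!f M. continuous_on (path_image g) f ==> (\<forall>s\<in>path_image g. cmod (f s) <= M) ==>
 cmod (contour_integral g f) <= B * M" and C: "C > 0" "!!f M. continuous_on (path_image h) f ==> (\<forall>s\<in>path_image h. cmod (f s) <= M) ==>
 cmod (contour_integral h f) <= C * M" by metis
 have "cmod (contour_integral (g +++ h) f) <= (B + C) * M"
 if f: "continuous_on (path_image (g +++ h)) f" and M: "\<forall>s\<in>path_image (g +++ h). cmod (f s) <= M" for f M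
 proof -
 have "cmod (contour_integral (g +++ h) f) <= cmod (contour_integral g f) + cmod (contour_integral h f)"
 by (simp only: CI_join[OF npath_join(1-3) f] norm_triangle_ineq)
 also have "\<dots> <= B * M + C * M"
 using f M npath_join(3) by (intro add_mono B(2) C(2)) (auto simp: path_image_join intro: continuous_on_subset[OF f])
 finally show ?thesis by (simp add: algebra_simps)
 qed
 then show ?case using B(1) C(1) by (intro exI[of _ "B + C"]) auto
 qed
 then show ?thesis using that by blast
qed

lemma npath_linepath [simp]: "npath (linepath a b)"
 by (rule npath_C1) (auto simp: C1_differentiable_on_eq)

lemma npath_part_circlepath [simp]: "npath (part_circlepath z r s t)"
 by (rule npath_C1)
 (auto simp: C1_differentiable_on_eq differentiable_part_circlepath vector_derivative_part_circlepath
 intro!: continuous_intros)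

lemma npath_circlepath [simp]: "npath (circlepath z r)"
 by (simp add: circlepath_def)

text \<open>No integrability is assumed: for nonzero c both integrands are integrable or neither is,
  and in the second case both sides have the default value 0. Constants can thus be moved through
  iterated integrals freely (\<open>iter_cmult\<close>).\<close>

lemma CI_cmult: "contour_integral g (%s. c * f s) = c * contour_integral g f"
proof (cases "c = 0 \<or> f contour_integrable_on g")
 case True
 then show ?thesis by (auto simp: contour_integral_lmul)
next
 case False
 then have "\<not> (%s. c * f s) contour_integrable_on g"
 using contour_integrable_lmul[of "%s. c * f s" g "inverse c"] by (auto simp: mult.assoc[symmetric])
 with False show ?thesis by (simp add: not_integrable_contour_integral)
qed

lemma npath_affine: "npath g ==> npath (%t. a + b * g t)"
proof (induction rule: npath.induct)
 case (npath_C1 g)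
 have "(%t. a + b * g t) C1_differentiable_on {0..1}"
 using npath_C1
 by (intro C1_differentiable_on_add C1_differentiable_on_mult C1_differentiable_on_const)
 then show ?case by (rule npath.npath_C1)
next
 case (npath_join g h)
 have "(%t. a + b * (g +++ h) t) = (%t. a + b * g t) +++ (%t. a + b * h t)"
 by (auto simp: joinpaths_def)
 with npath_join show ?case by (auto intro!: npath.npath_join simp: pathfinish_def pathstart_def)
qed

lemma path_image_affine: "path_image (%t. a + b * g t) = (%s. a + b * s) ` path_image g"
 by (auto simp: path_image_def)

lemma CI_affine:
 assumes "npath g" "continuous_on ((%s. a + b * s) ` path_image g) f"
 shows "contour_integral (%t. a + b * g t) f = b * contour_integral g (%s. f (a + b * s))"
 using assms
proof (induction rule: npath.induct)
 case (npath_C1 g)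
 have *: "vector_derivative (%t. a + b * g t) (at t) = b * vector_derivative g (at t)" if "t \<in> {0..1}" for t
 proof (rule vector_derivative_at)
 have "(g has_vector_derivative vector_derivative g (at t)) (at t)"
 using C1_pathD[OF npath_C1(1)] that by (simp add: vector_derivative_works)
 then show "((%t. a + b * g t) has_vector_derivative b * vector_derivative g (at t)) (at t)"
 by (auto intro!: derivative_eq_intros)
 qed
 have "contour_integral (%t. a + b * g t) f = integral {0..1} (%t. b * (f (a + b * g t) * vector_derivative g (at t)))"
 unfolding contour_integral_integral by (intro integral_cong) (simp add: *)
 then show ?case by (simp add: contour_integral_integral)
next
 case (npath_join g h)
 have eq: "(%t. a + b * (g +++ h) t) = (%t. a + b * g t) +++ (%t. a + b * h t)"
 by (auto simp: joinpaths_def)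
 let ?A = "%s. a + b * s"
 note hyps = npath_join(1-3)
 have c: "continuous_on (path_image (g +++ h)) (%s. f (a + b * s))"
 by (intro continuous_on_compose2[OF npath_join.prems(1)] continuous_intros) auto
 have fs: "pathfinish (%t. a + b * g t) = pathstart (%t. a + b * h t)"
 using hyps(3) by (simp add: pathfinish_def pathstart_def)
 have f: "continuous_on (path_image ((%t. a + b * g t) +++ (%t. a + b * h t))) f"
 using npath_join.prems(1) by (simp add: path_image_affine flip: eq)
 have f': "continuous_on (?A ` path_image g) f" "continuous_on (?A ` path_image h) f"
 using hyps(3) by (auto intro!: continuous_on_subset[OF npath_join.prems(1)] simp: path_image_join)
 show ?case
 unfolding eq CI_join[OF hyps c] distrib_left
 CI_join[OF npath_affine[OF hyps(1)] npath_affine[OF hyps(2)] fs f]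
 npath_join.IH(1)[OF f'(1)] npath_join.IH(2)[OF f'(2)] ..
qed

section \<open>Complex differentiability on complex Euclidean spaces\<close>

class cvs = euclidean_space +
 fixes cmul :: "complex => 'a => 'a"
 assumes cmul_add_right: "cmul c (x + y) = cmul c x + cmul c y"
 and cmul_add_left: "cmul (c + d) x = cmul c x + cmul d x"
 and cmul_cmul: "cmul c (cmul d x) = cmul (c * d) x"
 and cmul_of_real: "cmul (of_real r) x = r *\<^sub>R x"
 and norm_cmul: "norm (cmul c x) = cmod c * norm x"

instantiation complex :: cvs
begin
definition "cmul_complex = ((*) :: complex => complex => complex)"
instance
 by standard (auto simp: cmul_complex_def algebra_simps norm_mult scaleR_conv_of_real)
end

instantiation prod :: (cvs,cvs) cvs
begin
definition "cmul_prod c = (%(x,y). (cmul c x,cmul c y))"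
instance
proof
 fix c :: complex and x :: "'a \<times> 'b"
 show "norm (cmul c x) = cmod c * norm x"
 by (cases x) (simp add: cmul_prod_def norm_prod_def norm_cmul power_mult_distrib real_sqrt_mult flip: distrib_left)
qed (auto simp: cmul_prod_def cmul_add_right cmul_add_left cmul_cmul cmul_of_real)
end

instantiation vec :: (cvs,finite) cvs
begin
definition "cmul_vec c x = (\<chi> i. cmul c (x $ i))"
instance
proof
 fix c :: complex and x :: "'a ^ 'b"
 show "norm (cmul c x) = cmod c * norm x"
 by (simp add: cmul_vec_def norm_vec_def norm_cmul L2_set_right_distrib)
qed (auto simp: cmul_vec_def vec_eq_iff cmul_add_right cmul_add_left cmul_cmul cmul_of_real)
end

lemma cmul_simps [simp]:
 "cmul c (s::complex) = c * s" "cmul c (x,y) = (cmul c x,cmul c y)" "cmul c v $ i = cmul c (v $ i)"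
 by (auto simp: cmul_complex_def cmul_prod_def cmul_vec_def)

lemma cmul_0 [simp]: "cmul 0 x = 0" "cmul c 0 = 0" and cmul_1 [simp]: "cmul 1 x = x"
 and cmul_minus_right: "cmul c (- x) = - cmul c x" and cmul_diff_right: "cmul c (x - y) = cmul c x - cmul c y"
proof -
 show "cmul 0 x = 0" "cmul 1 x = x" using cmul_of_real[of 0 x] cmul_of_real[of 1 x] by auto
 have m: "cmul c (- x) = - cmul c x" for x :: 'a
 using cmul_cmul[of c "of_real (-1)" x] cmul_cmul[of "of_real (-1)" c x] cmul_of_real[of "-1" x] cmul_of_real[of "-1" "cmul c x"]
 by simp
 then show "cmul c (- x) = - cmul c x" .
 show "cmul c (x - y) = cmul c x - cmul c y" using cmul_add_right[of c x "- y"] m by simp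
 show "cmul c 0 = 0" using cmul_add_right[of c 0 0] by simp
qed

lemma cmul_scaleR: "cmul c (r *\<^sub>R x) = r *\<^sub>R cmul c x"
 by (metis cmul_cmul cmul_of_real mult.commute)

lemma bounded_bilinear_cmul: "bounded_bilinear (cmul :: complex => 'a::cvs => 'a)"
proof
 fix r :: real and c :: complex and x :: 'a
 show "cmul (r *\<^sub>R c) x = r *\<^sub>R cmul c x"
 by (simp add: scaleR_conv_of_real cmul_cmul[symmetric] cmul_of_real)
 show "EX K. ALL c x. norm (cmul c (x::'a)) <= norm c * norm x * K"
 by (intro exI[of _ 1]) (simp add: norm_cmul)
qed (auto simp: cmul_add_right cmul_add_left cmul_scaleR)

lemmas continuous_on_cmul [continuous_intros] = bounded_bilinear.continuous_on[OF bounded_bilinear_cmul]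
lemmas has_derivative_cmul = bounded_bilinear.FDERIV[OF bounded_bilinear_cmul]

text \<open>The pointwise condition of \<open>holo_on\<close>, for any source and target in
  \<open>cvs\<close>. Parameter integrals need it on pairs of a point and an integration variable,
  and on complex numbers it is \<open>field_differentiable\<close>; one calculus covers all of
  these.\<close>

definition chol :: "('a::cvs => 'b::cvs) => 'a => bool" where
 "chol f x \<longleftrightarrow> (EX D. (f has_derivative D) (at x) & (ALL c v. D (cmul c v) = cmul c (D v)))"

lemma cscale_eq_cmul: "cscale c = cmul c"
 by (auto simp: cscale_def fun_eq_iff vec_eq_iff)

lemma holo_on_iff_chol: "holo_on f U \<longleftrightarrow> (\<forall>x\<in>U. chol f x)"
 by (simp add: holo_on_def chol_def cscale_eq_cmul)

lemma chol_imp_isCont: "chol f x ==> isCont f x"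
 by (auto simp: chol_def intro: has_derivative_continuous)

lemma chol_imp_continuous_on: "(!!x. x \<in> U ==> chol f x) ==> continuous_on U f"
 by (auto intro!: continuous_at_imp_continuous_on chol_imp_isCont)

lemma chol_compose:
 assumes "chol f (g x)" "chol g x" shows "chol (%x. f (g x)) x"
proof -
 obtain D E where D: "(f has_derivative D) (at (g x))" "ALL c v. D (cmul c v) = cmul c (D v)"
 and E: "(g has_derivative E) (at x)" "ALL c v. E (cmul c v) = cmul c (E v)"
 using assms by (auto simp: chol_def)
 have "((%x. f (g x)) has_derivative (%v. D (E v))) (at x)"
 by (rule has_derivative_compose[OF E(1) D(1)])
 with D E show ?thesis by (auto simp: chol_def)
qed

lemma chol_cong_open:
 assumes "open U" "x \<in> U" "!!y. y \<in> U ==> f y = g y" "chol f x" shows "chol g x"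
 using assms unfolding chol_def by (metis has_derivative_transform_within_open)

lemma chol_linear:
 assumes "bounded_linear L" "!!c v. L (cmul c v) = cmul c (L v)" shows "chol L x"
 using assms unfolding chol_def by (blast intro: bounded_linear_imp_has_derivative)

lemma chol_const: "chol (%x. c) x"
 unfolding chol_def by (intro exI[of _ "%_. 0"]) auto

lemma chol_id: "chol (%x. x) x"
 by (intro chol_linear) auto

lemma chol_Pair:
 assumes "chol f x" "chol g x" shows "chol (%x. (f x,g x)) x"
proof -
 obtain D E where D: "(f has_derivative D) (at x)" "ALL c v. D (cmul c v) = cmul c (D v)"
 and E: "(g has_derivative E) (at x)" "ALL c v. E (cmul c v) = cmul c (E v)"
 using assms by (auto simp: chol_def)
 from has_derivative_Pair[OF D(1) E(1)] D(2) E(2) show ?thesis by (auto simp: chol_def)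
qed

lemma chol_fst: "chol f x ==> chol (%x. fst (f x)) x"
 by (rule chol_compose[where f = fst]) (auto intro!: chol_linear bounded_linear_fst)

lemma chol_snd: "chol f x ==> chol (%x. snd (f x)) x"
 by (rule chol_compose[where f = snd]) (auto intro!: chol_linear bounded_linear_snd)

lemma chol_add:
 assumes "chol f x" "chol g x" shows "chol (%x. f x + g x) x"
proof -
 have "chol (%p::'b\<times>'b. fst p + snd p) (f x,g x)"
 by (intro chol_linear bounded_linear_add bounded_linear_fst bounded_linear_snd)
 (auto simp: cmul_add_right cmul_prod_def)
 from chol_compose[OF this chol_Pair[OF assms]] show ?thesis by simp
qed

lemma chol_cmul:
 assumes "chol f x" "chol g x" shows "chol (%x. cmul (f x) (g x)) x"
proof -
 obtain D E where D: "(f has_derivative D) (at x)" "ALL c v. D (cmul c v) = cmul c (D v)"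
 and E: "(g has_derivative E) (at x)" "ALL c v. E (cmul c v) = cmul c (E v)"
 using assms by (auto simp: chol_def)
 have "((%x. cmul (f x) (g x)) has_derivative (%v. cmul (f x) (E v) + cmul (D v) (g x))) (at x)"
 by (rule has_derivative_cmul[OF D(1) E(1)])
 with D(2) E(2) show ?thesis unfolding chol_def
 by (intro exI[of _ "%v. cmul (f x) (E v) + cmul (D v) (g x)"]) (auto simp: cmul_add_right cmul_cmul mult.commute)
qed

lemma chol_mult: "chol f x ==> chol g x ==> chol (%x. f x * (g x :: complex)) x"
 using chol_cmul[of f x g] by simp

lemma chol_minus: "chol f x ==> chol (%x. - f x) x"
 by (rule chol_compose[where f = uminus])
 (auto intro!: chol_linear bounded_linear_minus bounded_linear_ident simp: cmul_minus_right)

lemma chol_diff: "chol f x ==> chol g x ==> chol (%x. f x - g x) x"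
 using chol_add[of f x "%x. - g x"] chol_minus[of g x] by simp

lemma chol_sum: "(!!i. i \<in> I ==> chol (f i) x) ==> chol (%x. \<Sum>i\<in>I. f i x) x"
 by (induction I rule: infinite_finite_induct) (auto intro: chol_const chol_add)

lemma chol_power: "chol f x ==> chol (%x. f x ^ n :: complex) x"
 by (induction n) (auto intro: chol_const chol_mult)

lemma chol_prod: "(!!i. i \<in> I ==> chol (f i) x) ==> chol (%x. \<Prod>i\<in>I. f i x :: complex) x"
 by (induction I rule: infinite_finite_induct) (auto intro: chol_const chol_mult)

lemma chol_complex_iff: "chol f z \<longleftrightarrow> f field_differentiable (at (z::complex))" for f :: "complex => complex"
proof
 assume "chol f z"
 then obtain D where D: "(f has_derivative D) (at z)" "ALL c v. D (c * v) = c * D v" by (auto simp: chol_def)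
 then have "D = (*) (D 1)" by (metis mult.commute mult.right_neutral ext)
 with D(1) show "f field_differentiable (at z)"
 unfolding field_differentiable_def has_field_derivative_def by metis
next
 assume "f field_differentiable (at z)"
 then show "chol f z" unfolding chol_def field_differentiable_def has_field_derivative_def
 by (auto simp: mult.left_commute)
qed

lemma chol_field: "chol g x ==> f field_differentiable (at (g x)) ==> chol (%x. f (g x)) x" for f :: "complex => complex"
 by (rule chol_compose[where f = f]) (auto simp: chol_complex_iff)

lemma chol_exp: "chol g x ==> chol (%x. exp (g x :: complex)) x"
 by (rule chol_field[where f = exp]) (auto intro: field_differentiable_within_exp)

lemma chol_inverse: "chol g x ==> g x ~= 0 ==> chol (%x. inverse (g x :: complex)) x"
 by (rule chol_field[where f = inverse]) (auto intro: field_differentiable_inverse field_differentiable_ident)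

lemma chol_divide: "chol f x ==> chol g x ==> g x ~= 0 ==> chol (%x. f x/(g x :: complex)) x"
 by (simp add: divide_inverse chol_mult chol_inverse)

lemma chol_vec_nth: "chol f x ==> chol (%x. f x $ i) x"
 by (rule chol_compose[where f = "%v. v $ i"]) (auto intro!: chol_linear bounded_linear_vec_nth)

lemma bounded_linear_axis: "bounded_linear (axis i :: 'a::euclidean_space => 'a ^ 'n)"
 by (intro linear_conv_bounded_linear[THEN iffD1] linearI) (auto simp: axis_def vec_eq_iff)

lemma chol_axis: "chol f x ==> chol (%x. axis i (f x)) x"
 by (rule chol_compose[where f = "axis i"]) (auto intro!: chol_linear bounded_linear_axis simp: axis_def vec_eq_iff)

lemma vec_lambda_sum_axis: "(\<chi> i. f i) = (\<Sum>i\<in>UNIV. axis i (f i :: 'a::comm_monoid_add))"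
 by (auto simp: vec_eq_iff axis_def if_distrib cong: if_cong)

lemma chol_vec_lambda: "(!!i. chol (%x. f x i) x) ==> chol (%x. \<chi> i. f x i) x"
 unfolding vec_lambda_sum_axis by (intro chol_sum chol_axis)

lemma set_coord_nth [simp]: "set_coord w i s $ j = (if j = i then s else w $ j)"
 by (simp add: set_coord_def)

lemma chol_set_coord: "chol f x ==> chol g x ==> chol (%x. set_coord (f x) i (g x)) x"
 unfolding set_coord_def
proof (rule chol_vec_lambda)
 fix j assume "chol f x" "chol g x"
 then show "chol (%x. if j = i then g x else f x $ j) x" by (cases "j = i") (auto intro: chol_vec_nth)
qed

lemma chol_pairing: "chol f x ==> chol g x ==> chol (%x. pairing (f x) (g x)) x"
 unfolding pairing_def by (intro chol_sum chol_mult chol_vec_nth)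

lemmas chol_intros = chol_const chol_id chol_Pair chol_fst chol_snd chol_add chol_diff chol_minus chol_sum
 chol_cmul chol_mult chol_power chol_prod chol_exp chol_vec_nth chol_axis chol_set_coord chol_pairing

text \<open>Osgood's lemma: the directional derivatives are Cauchy integrals, hence jointly continuous in
 the point and the direction, which gives additivity in the direction and total differentiability.\<close>

lemma chol_osgood:
 fixes f :: "'a::cvs => complex"
 assumes U: "open U" and cont: "continuous_on U f"
 and gat: "!!x v. x \<in> U ==> (%s. f (x + cmul s v)) field_differentiable (at 0)"
 and x0: "x0 \<in> U"
 shows "chol f x0"
proof -
 define D where "D x v = deriv (%s. f (x + cmul s v)) 0" for x v
 have D_at: "((%s. f (x + cmul s v)) has_field_derivative D (x + cmul s v) v) (at s)"
 if "x + cmul s v \<in> U" for x v s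
 proof -
 have "((%t. f ((x + cmul s v) + cmul t v)) has_field_derivative D (x + cmul s v) v) (at 0)"
 using gat[OF that] unfolding D_def by (simp add: DERIV_deriv_iff_field_differentiable)
 then have "((%t. f (x + cmul (s + t) v)) has_field_derivative D (x + cmul s v) v) (at 0)"
 by (simp add: cmul_add_left add.assoc)
 then show ?thesis
 using DERIV_shift[of "%t. f (x + cmul t v)" "D (x + cmul s v) v" 0 s] by (simp add: add.commute)
 qed
 obtain r where r: "r > 0" "cball x0 (2 * r) <= U"
 proof -
 obtain e where "e > 0" "cball x0 e <= U" using U x0 open_contains_cball by blast
 then show ?thesis using that[of "e/2"] by simp
 qed
 have inU: "x + cmul s v \<in> U" if "x \<in> cball x0 r" "norm v <= 1" "cmod s <= r" for x v s
 proof -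
 have "norm (cmul s v) <= r * 1" unfolding norm_cmul using that r by (intro mult_mono) auto
 then have "dist x0 (x + cmul s v) <= r + r"
 using that(1) norm_triangle_ineq4[of "x0 - x" "cmul s v"] by (auto simp: dist_norm algebra_simps)
 then show ?thesis using r by auto
 qed
 have cauchy: "D x v = contour_integral (circlepath 0 r) (%s. f (x + cmul s v)/s\<^sup>2)/(2 * pi * \<i>)"
 if "x \<in> cball x0 r" "norm v <= 1" for x v
 proof -
 have hol: "(%s. f (x + cmul s v)) holomorphic_on cball 0 r"
 unfolding holomorphic_on_def field_differentiable_def
 using D_at inU[OF that] by (metis DERIV_subset dist_0_norm mem_cball subset_UNIV)
 have "((%u. f (x + cmul u v)/(u - 0)\<^sup>2) has_contour_integral 2 * pi * \<i>/fact 1 * (deriv ^^ 1) (%s. f (x + cmul s v)) 0)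
 (circlepath 0 r)"
 using Cauchy_has_contour_integral_higher_derivative_circlepath[of 0 r "%s. f (x + cmul s v)" 0 1] hol r
 holomorphic_on_imp_continuous_on[OF hol] holomorphic_on_subset[OF hol ball_subset_cball]
 by (simp add: numeral_2_eq_2)
 then show ?thesis by (simp add: contour_integral_unique D_def)
 qed
 have Dcont: "continuous_on (cball x0 r \<times> cball 0 1) (%(x,v). D x v)"
 proof -
 have "continuous_on ((cball x0 r \<times> cball 0 1) \<times> path_image (circlepath 0 r))
 (%q. f (fst (fst q) + cmul (snd q) (snd (fst q)))/(snd q)\<^sup>2)"
 using r inU by (intro continuous_intros continuous_on_compose2[OF cont]) auto
 then have "continuous_on (cball x0 r \<times> cball 0 1)
 (%p. contour_integral (circlepath 0 r) (%s. f (fst p + cmul s (snd p))/s\<^sup>2)/(2 * pi * \<i>))"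
 by (intro continuous_intros continuous_on_CI) (auto simp: case_prod_unfold)
 then show ?thesis
 by (rule continuous_on_eq) (auto simp: cauchy)
 qed
 have Dscale: "D x (cmul c v) = c * D x v" if "x \<in> U" for x v c
 proof -
 have "((%s. f (x + cmul (s * c) v)) has_field_derivative D (x + cmul (0 * c) v) v * c) (at 0)"
 using DERIV_chain2[OF D_at[of x "0 * c" v] DERIV_cmult_Id[of c 0 UNIV,unfolded mult.commute[of c]]] that by simp
 then have "deriv (%s. f (x + cmul s (cmul c v))) 0 = c * D x v"
 by (intro DERIV_imp_deriv) (simp add: cmul_cmul mult.commute)
 then show ?thesis by (simp add: D_def)
 qed
 have Dadd1: "D x0 (v + w) = D x0 v + D x0 w" if vw: "norm v <= 1/2" "norm w <= 1/2" for v w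
 proof -
 let ?B = "cball (0::complex) (r/2)"
 let ?f = "%a b. f ((x0 + cmul a v) + cmul b w)"
 have inr: "x0 + cmul a v + cmul b w \<in> cball x0 r" if "a \<in> ball 0 r" "b \<in> ball 0 r" for a b
 proof -
 have "norm (cmul a v) <= r * (1/2)" "norm (cmul b w) <= r * (1/2)"
 unfolding norm_cmul using that r vw by (intro mult_mono; simp)+
 then show ?thesis using norm_triangle_ineq[of "cmul a v" "cmul b w"]
 by (auto simp: dist_norm algebra_simps simp flip: norm_minus_cancel[of "cmul a v + cmul b w"])
 qed
 \<comment> \<open>Total differentiability in two complex parameters follows from one partial
   derivative at the centre and a continuous second one nearby. Restricting to the diagonal a = b
   gives the derivative in the direction v + w.\<close>
 have "((%(a,b). ?f a b) has_derivative (%(ta,tb). D x0 v * ta + blinfun_mult_right (D ((x0 + cmul 0 v) + cmul 0 w) w) tb))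
 (at (0,0) within ball 0 r \<times> ball 0 r)"
 proof (rule has_derivative_partialsI[where fy = "%a b. blinfun_mult_right (D ((x0 + cmul a v) + cmul b w) w)"])
 show "((%a. ?f a 0) has_derivative (%ta. D x0 v * ta)) (at 0 within ball 0 r)"
 proof -
 have "((%s. f (x0 + cmul s v)) has_field_derivative D x0 v) (at 0)" using D_at[of x0 0 v] x0 by simp
 then have "((%s. f (x0 + cmul s v)) has_derivative (*) (D x0 v)) (at 0 within ball 0 r)"
 unfolding has_field_derivative_def by (rule has_derivative_at_withinI)
 then show ?thesis by simp
 qed
 show "((%b. ?f a b) has_derivative blinfun_apply (blinfun_mult_right (D ((x0 + cmul a v) + cmul b w) w)))
 (at b within ball 0 r)" if "a \<in> ball 0 r" "b \<in> ball 0 r" for a b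
 proof -
 have "x0 + cmul a v + cmul b w \<in> U" using inr[OF that] r by auto
 from D_at[OF this] show ?thesis
 unfolding has_field_derivative_def by (simp add: has_derivative_at_withinI)
 qed
 have c: "continuous_on (ball 0 r \<times> ball 0 r) (%p. D ((x0 + cmul (fst p) v) + cmul (snd p) w) w)"
 proof -
 have "continuous_on (ball 0 r \<times> ball 0 r) (%p. ((x0 + cmul (fst p) v) + cmul (snd p) w,w))"
 "(%p. ((x0 + cmul (fst p) v) + cmul (snd p) w,w)) ` (ball 0 r \<times> ball 0 r) <= cball x0 r \<times> cball 0 1"
 using vw inr by (auto intro!: continuous_intros)
 from continuous_on_compose2[OF Dcont this] show ?thesis by simp
 qed
 have "(0,0) \<in> ball (0::complex) r \<times> ball (0::complex) r" using r by simp
 from c[unfolded continuous_on_def,rule_format,OF this]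
 show "continuous (at (0,0) within ball 0 r \<times> ball 0 r) (%(a,b). blinfun_mult_right (D ((x0 + cmul a v) + cmul b w) w))"
 unfolding case_prod_unfold continuous_within
 by (intro bounded_linear.tendsto[OF bounded_linear_blinfun_mult_right]) simp
 qed (use r in auto)
 then have "((%(a,b). ?f a b) has_derivative (%(ta,tb). D x0 v * ta + D x0 w * tb)) (at (0,0))"
 using r by (subst (asm) at_within_open) (auto intro!: open_Times)
 then have "((%s. (%(a,b). ?f a b) (s,s)) has_derivative (%s. (%(ta,tb). D x0 v * ta + D x0 w * tb) (s,s))) (at 0)"
 by (rule has_derivative_compose[rotated]) (auto intro!: derivative_eq_intros)
 moreover have "(%s. D x0 v * s + D x0 w * s) = (*) (D x0 v + D x0 w)"
 by (auto simp: distrib_right)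
 ultimately have "((%s. f (x0 + cmul s (v + w))) has_field_derivative D x0 v + D x0 w) (at 0)"
 by (simp add: has_field_derivative_def cmul_add_right add.assoc)
 then show ?thesis unfolding D_def by (metis DERIV_imp_deriv)
 qed
 have Dadd: "D x0 (v + w) = D x0 v + D x0 w" for v w
 proof -
 \<comment> \<open>Shrinks both directions to length at most 1/2; homogeneity of D undoes the
   scaling afterwards.\<close>
 define k :: real where "k = 1/(2 * (1 + norm v + norm w))"
 have k0: "k > 0" by (auto simp: k_def add_pos_nonneg)
 have "norm (cmul (of_real k) u) = k * norm u" for u :: 'a using k0 by (simp add: norm_cmul)
 moreover have "k * norm v <= 1/2" "k * norm w <= 1/2"
 by (auto simp: k_def divide_simps add_pos_nonneg add_nonneg_eq_0_iff)
 ultimately have k: "k > 0" "norm (cmul (of_real k) v) <= 1/2" "norm (cmul (of_real k) w) <= 1/2"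
 using k0 by auto
 have "of_real k * D x0 (v + w) = of_real k * (D x0 v + D x0 w)"
 using Dadd1[OF k(2,3)] by (simp add: Dscale[OF x0] cmul_add_right[symmetric] distrib_left)
 then show ?thesis using k(1) by simp
 qed
 have lin: "bounded_linear (D x0)"
 using Dscale[OF x0,of "of_real _"] Dadd
 by (intro linear_conv_bounded_linear[THEN iffD1] linearI) (auto simp: cmul_of_real scaleR_conv_of_real)
 have "(f has_derivative D x0) (at x0)"
 unfolding has_derivative_at_alt
 proof (intro conjI lin allI impI)
 fix e :: real assume e: "e > 0"
 have "uniformly_continuous_on (cball x0 r \<times> cball 0 1) (%(x,v). D x v)"
 using Dcont by (intro compact_uniformly_continuous compact_Times) auto
 then obtain d where d: "d > 0" "!!p q. p \<in> cball x0 r \<times> cball 0 1 ==> q \<in> cball x0 r \<times> cball 0 1 ==>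
 dist p q < d ==> cmod (D (fst p) (snd p) - D (fst q) (snd q)) < e"
 using e unfolding uniformly_continuous_on_def case_prod_unfold dist_norm[of "D _ _"]
 by (metis dist_commute)
 have "cmod (f y - f x0 - D x0 (y - x0)) <= e * norm (y - x0)" if y: "norm (y - x0) < min r d" for y
 proof (cases "y = x0")
 case False
 define h where "h = y - x0"
 have h: "h ~= 0" "norm h < r" "norm h < d" using y False by (auto simp: h_def)
 define k where "k = complex_of_real (norm h)"
 define u where "u = cmul (inverse k) h"
 have ku: "h = cmul k u" "norm u = 1"
 using h by (auto simp: u_def k_def cmul_cmul norm_cmul norm_inverse)
 have b: "cmod (D (x0 + cmul s h) h - D x0 h) <= e * norm h" if s: "s \<in> closed_segment 0 1" for s
 proof -
 have "cmod s <= 1" using s segment_bound1[OF s] by simp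
 then have n: "norm (cmul s h) <= norm h" by (simp add: norm_cmul mult_left_le_one_le)
 then have i: "x0 + cmul s h \<in> cball x0 r" "dist (x0 + cmul s h,u) (x0,u) < d"
 using h by (auto simp: dist_norm dist_Pair_Pair)
 then have "cmod (D (x0 + cmul s h) u - D x0 u) < e"
 using d(2)[of "(x0 + cmul s h,u)" "(x0,u)"] ku r by auto
 moreover have "D (x0 + cmul s h) h - D x0 h = k * (D (x0 + cmul s h) u - D x0 u)"
 proof -
 have "x0 + cmul s h \<in> U" using i(1) r by auto
 then show ?thesis using Dscale[of "x0 + cmul s h" k u] Dscale[OF x0,of k u]
 by (simp add: right_diff_distrib ku(1)[symmetric])
 qed
 ultimately show ?thesis using h by (simp add: norm_mult k_def mult.commute)
 qed
 \<comment> \<open>With the linear part removed, the derivative along the segment from 0 to 1 is at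
   most e times the norm of h, and the mean value inequality finishes.\<close>
 have der: "((%s. f (x0 + cmul s h) - s * D x0 h) has_field_derivative D (x0 + cmul s h) h - D x0 h)
 (at s within closed_segment 0 1)" if "s \<in> closed_segment 0 1" for s
 proof -
 have "cmod s <= 1" using segment_bound1[OF that] by simp
 then have "norm (cmul s h) <= norm h" by (simp add: norm_cmul mult_left_le_one_le)
 then have "x0 + cmul s h \<in> U" using h r by (auto simp: dist_norm)
 then show ?thesis
 by (intro DERIV_diff DERIV_subset[OF D_at] DERIV_cmult_right[of "%s. s" 1 _ _ "D x0 h",simplified]) (auto intro: DERIV_ident)
 qed
 have "norm ((f (x0 + cmul 1 h) - 1 * D x0 h) - (f (x0 + cmul 0 h) - 0 * D x0 h)) <= e * norm h * norm (1 - 0 :: complex)"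
 by (rule field_differentiable_bound[OF convex_closed_segment der b]) auto
 then show ?thesis by (simp add: h_def algebra_simps)
 qed (use linear_0[OF bounded_linear.linear[OF lin]] in auto)
 then show "\<exists>d>0. ALL y. norm (y - x0) < d --> cmod (f y - f x0 - D x0 (y - x0)) <= e * norm (y - x0)"
 using r d by (intro exI[of _ "min r d"]) auto
 qed
 then show ?thesis unfolding chol_def using Dscale[OF x0] by (auto intro!: exI[of _ "D x0"])
qed


section \<open>Holomorphic dependence of integrals and derivatives on parameters\<close>

lemma chol_slice:
 fixes f :: "'a::cvs => complex"
 assumes "chol f (x + cmul s v)" shows "(%t. f (x + cmul t v)) field_differentiable (at s)"
 using chol_compose[of f "%t. x + cmul t v" s,OF assms] by (simp add: chol_complex_iff chol_intros)

text \<open>Cauchy's formula on a circle about c0 represents f in its first argument. Exchanging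
  this circle with g makes the integral over g a Cauchy integral itself, and that can be
  differentiated under the sign.\<close>

lemma CI_has_field_derivative:
 fixes f :: "complex => complex => complex"
 assumes g: "npath g" and R: "R > 0"
 and cont: "continuous_on (cball c0 R \<times> path_image g) (%(c,s). f c s)"
 and diff: "!!c s. c \<in> ball c0 R ==> s \<in> path_image g ==> (%c. f c s) field_differentiable (at c)"
 shows "((%c. contour_integral g (f c)) has_field_derivative
 contour_integral g (%s. deriv (%c. f c s) c0)) (at c0)"
proof -
 let ?C = "circlepath c0 R" and ?I = "%c. contour_integral g (f c)"
 have sub: "sphere c0 R <= cball c0 R" by auto
 have cc: "continuous_on (cball c0 R) (%c. f c s)" if "s \<in> path_image g" for s
 by (rule continuous_on_slice(2)[OF cont that])
 have hol: "(%c. f c s) holomorphic_on ball c0 R" if "s \<in> path_image g" for s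
 using diff that by (auto simp: holomorphic_on_def field_differentiable_at_within)
 have c2: "continuous_on (sphere c0 R \<times> path_image g) (%(\<xi>,s). f \<xi> s/(\<xi> - c) ^ k)" if "c \<in> ball c0 R" for c k
 using that unfolding case_prod_unfold
 by (intro continuous_intros continuous_on_subset[OF cont[unfolded case_prod_unfold]]) auto
 have swap: "contour_integral ?C (%\<xi>. ?I \<xi>/(\<xi> - c) ^ k) = contour_integral g (%s. contour_integral ?C (%\<xi>. f \<xi> s/(\<xi> - c) ^ k))"
 if "c \<in> ball c0 R" for c k
 proof -
 have "contour_integral ?C (%\<xi>. ?I \<xi>/(\<xi> - c) ^ k) = contour_integral ?C (%\<xi>. contour_integral g (%s. f \<xi> s/(\<xi> - c) ^ k))"
 using CI_cmult[of g "inverse ((_ - c) ^ k)"] by (simp add: divide_inverse mult.commute)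
 also have "\<dots> = contour_integral g (%s. contour_integral ?C (%\<xi>. f \<xi> s/(\<xi> - c) ^ k))"
 using c2[OF that,of k] R by (intro CI_swap g) auto
 finally show ?thesis .
 qed
 have Icont: "continuous_on (cball c0 R) ?I" by (rule continuous_on_CI[OF g cont])
 have int: "((%\<xi>. ?I \<xi>/(\<xi> - c) ^ 1) has_contour_integral 2 * pi * \<i> * ?I c) ?C" if "c \<in> ball c0 R" for c
 proof -
 have "(%\<xi>. ?I \<xi>/(\<xi> - c) ^ 1) contour_integrable_on ?C"
 using that R by (intro npath_integrable continuous_intros continuous_on_subset[OF Icont]) auto
 moreover have "contour_integral ?C (%\<xi>. ?I \<xi>/(\<xi> - c) ^ 1) = contour_integral g (%s. (2 * pi * \<i>) * f c s)"
 unfolding swap[OF that]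
 using that by (intro contour_integral_eq contour_integral_unique)
 (auto intro!: Cauchy_integral_circlepath cc hol simp: dist_norm norm_minus_commute)
 ultimately show ?thesis by (metis CI_cmult has_contour_integral_integral)
 qed
 have c0: "c0 \<in> ball c0 R" using R by simp
 have d: "((%c. 2 * pi * \<i> * ?I c) has_field_derivative (of_nat 1 * contour_integral ?C (%\<xi>. ?I \<xi>/(\<xi> - c0) ^ Suc 1))) (at c0)"
 using Cauchy_next_derivative_circlepath(2)[of c0 R ?I 1 "%c. 2 * pi * \<i> * ?I c" c0] int c0 R
 continuous_on_subset[OF Icont sub] by auto
 have "contour_integral ?C (%\<xi>. ?I \<xi>/(\<xi> - c0) ^ Suc 1) =
 contour_integral g (%s. (2 * pi * \<i>) * deriv (%c. f c s) c0)"
 unfolding swap[OF c0]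
 proof (intro contour_integral_eq contour_integral_unique)
 fix s assume s: "s \<in> path_image g"
 show "((%\<xi>. f \<xi> s/(\<xi> - c0) ^ Suc 1) has_contour_integral 2 * pi * \<i> * deriv (%c. f c s) c0) ?C"
 using Cauchy_has_contour_integral_higher_derivative_circlepath[OF cc[OF s] hol[OF s] c0,of 1] by simp
 qed
 then have "contour_integral ?C (%\<xi>. ?I \<xi>/(\<xi> - c0) ^ Suc 1) = (2 * pi * \<i>) * contour_integral g (%s. deriv (%c. f c s) c0)"
 by (simp only: CI_cmult)
 from d[unfolded this] show ?thesis
 using DERIV_cdivide[of "%c. 2 * pi * \<i> * ?I c" _ c0 UNIV "2 * pi * \<i>"] by fastforce
qed

text \<open>Osgood's lemma: joint continuity of the integral is \<open>continuous_on_CI\<close>, and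
  along each complex line \<open>CI_has_field_derivative\<close> applies.\<close>

lemma chol_CI:
 fixes G :: "'a::cvs => complex => complex"
 assumes g: "npath g" and P: "open P"
 and G: "!!x s. x \<in> P ==> s \<in> path_image g ==> chol (%p. G (fst p) (snd p)) (x,s)"
 and x: "x \<in> P"
 shows "chol (%x. contour_integral g (G x)) x"
proof (rule chol_osgood[OF P _ _ x])
 have c: "continuous_on (P \<times> path_image g) (%(x,s). G x s)"
 unfolding case_prod_unfold by (rule chol_imp_continuous_on) (use G in auto)
 then show "continuous_on P (%x. contour_integral g (G x))"
 by (rule continuous_on_CI[OF g])
 fix x v :: 'a assume x: "x \<in> P"
 then obtain e where e: "e > 0" "ball x e <= P" using P openE by blast
 define R where "R = e/(2 * (1 + norm v))"
 have R: "R > 0" using e by (auto simp: R_def add_pos_nonneg intro!: divide_pos_pos)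
 have inP: "x + cmul c v \<in> P" if "c \<in> cball 0 R" for c :: complex
 proof -
 have "norm (cmul c v) <= R * (1 + norm v)" unfolding norm_cmul using that R by (intro mult_mono) auto
 also have "\<dots> < e" using e by (simp add: R_def field_simps add_pos_nonneg)
 finally show ?thesis using e by (auto simp: dist_norm)
 qed
 have "((%c. contour_integral g (G (x + cmul c v))) has_field_derivative
 contour_integral g (%s. deriv (%c. G (x + cmul c v) s) 0)) (at 0)"
 proof (rule CI_has_field_derivative[OF g R])
 have "continuous_on (cball 0 R \<times> path_image g) (%p. (x + cmul (fst p) v,snd p))"
 "(%p. (x + cmul (fst p) v,snd p)) ` (cball 0 R \<times> path_image g) <= P \<times> path_image g"
 using inP by (auto intro!: continuous_intros)
 from continuous_on_compose2[OF c this]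
 show "continuous_on (cball 0 R \<times> path_image g) (%(c,s). G (x + cmul c v) s)"
 by (simp add: case_prod_unfold)
 fix c s :: complex assume cs: "c \<in> ball 0 R" "s \<in> path_image g"
 have "chol (%p. G (fst p) (snd p)) (x + cmul c v,s)" using cs by (intro G inP) auto
 then have "chol (%c. G (fst (x + cmul c v,s)) (snd (x + cmul c v,s))) c"
 by (rule chol_compose) (intro chol_intros)
 then show "(%c. G (x + cmul c v) s) field_differentiable (at c)" by (simp add: chol_complex_iff)
 qed
 then show "(%c. contour_integral g (G (x + cmul c v))) field_differentiable (at 0)"
 by (auto simp: field_differentiable_def)
qed

text \<open>A directional derivative is a Cauchy integral over a small circle whose radius can be
  kept fixed near x, so \<open>chol_CI\<close> applies to it.\<close>

lemma chol_deriv: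
 fixes f :: "'a::cvs => complex"
 assumes U: "open U" and f: "!!x. x \<in> U ==> chol f x" and x: "x \<in> U"
 shows "chol (%x. deriv (%s. f (x + cmul s v)) 0) x"
proof -
 obtain e where e: "e > 0" "ball x e <= U" using U x openE by blast
 define R where "R = e/(4 * (1 + norm v))"
 have R: "R > 0" using e by (auto simp: R_def add_pos_nonneg intro!: divide_pos_pos)
 have inU: "y + cmul c v \<in> U" if "c \<in> cball 0 R" "y \<in> ball x (e/2)" for c y
 proof -
 have "norm (cmul c v) <= R * (1 + norm v)" unfolding norm_cmul using that R by (intro mult_mono) auto
 also have "\<dots> <= e/4" using e by (simp add: R_def field_simps add_pos_nonneg)
 finally have "dist x (y + cmul c v) < e"
 using that(2) norm_triangle_ineq4[of "x - y" "cmul c v"] e(1) by (auto simp: dist_norm algebra_simps)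
 then show ?thesis using e by auto
 qed
 have "chol (%y. contour_integral (circlepath 0 R) (%s. f (y + cmul s v)/s\<^sup>2)/(2 * pi * \<i>)) x"
 proof (rule chol_divide[OF chol_CI[where P = "ball x (e/2)"] chol_const])
 fix y s assume "y \<in> ball x (e/2)" "s \<in> path_image (circlepath 0 R)"
 then show "chol (%p. f (fst p + cmul (snd p) v)/(snd p)\<^sup>2) (y,s)"
 using R inU[of s y] f[of "y + cmul s v"]
 by (intro chol_divide chol_compose[of f "%p. fst p + cmul (snd p) v"] chol_intros) auto
 qed (use e in auto)
 then show ?thesis
 proof (rule chol_cong_open[rotated -1])
 fix y assume y: "y \<in> ball x (e/2)"
 have hol: "(%s. f (y + cmul s v)) holomorphic_on cball 0 R"
 using inU[OF _ y] f by (auto simp: holomorphic_on_def intro!: field_differentiable_at_within chol_slice)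
 show "contour_integral (circlepath 0 R) (%s. f (y + cmul s v)/s\<^sup>2)/(2 * pi * \<i>) = deriv (%s. f (y + cmul s v)) 0"
 using Cauchy_has_contour_integral_higher_derivative_circlepath[of 0 R "%s. f (y + cmul s v)" 0 1,THEN contour_integral_unique] hol R
 holomorphic_on_imp_continuous_on[OF hol] holomorphic_on_subset[OF hol ball_subset_cball]
 by (simp add: numeral_2_eq_2)
 qed (use e in auto)
qed

lemma pd1_cmul: "pd1 i f x = deriv (%s. f (x + cmul s (axis i 1,0,0))) 0"
 and pd2_cmul: "pd2 i f x = deriv (%s. f (x + cmul s (0,axis i 1,0))) 0"
 and pd_eta_cmul: "pd_eta f x = deriv (%s. f (x + cmul s (0,0,1))) 0"
proof -
 have ax: "cmul s (axis i 1) = axis i s" for s :: complex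
 by (auto simp: axis_def vec_eq_iff)
 show "pd1 i f x = deriv (%s. f (x + cmul s (axis i 1,0,0))) 0"
 "pd2 i f x = deriv (%s. f (x + cmul s (0,axis i 1,0))) 0"
 by (auto simp: pd1_def pd2_def ax split: prod.split)
 obtain z w eta where x: "x = (z,w,eta)" by (cases x)
 have "deriv (%s. f (z,w,s)) eta = deriv (%s. f (z,w,eta + s)) 0"
 using DERIV_shift[of "%s. f (z,w,s)" _ 0 eta] by (simp add: deriv_def add.commute)
 then show "pd_eta f x = deriv (%s. f (x + cmul s (0,0,1))) 0" by (simp add: pd_eta_def x)
qed

lemma holo_pd:
 assumes "open U" "holo_on f U"
 shows "holo_on (pd1 i f) U" "holo_on (pd2 i f) U" "holo_on (pd_eta f) U"
 using chol_deriv[OF assms(1),of f] assms(2)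
 unfolding holo_on_iff_chol pd1_cmul[abs_def] pd2_cmul[abs_def] pd_eta_cmul[abs_def] by blast+

lemma holo_pd_multi:
 assumes "open U" "holo_on f U"
 shows "holo_on (pd1_multi al f) U" "holo_on (pd2_multi al f) U"
proof -
 have 1: "holo_on ((pd1 i ^^ k) g) U" "holo_on ((pd2 i ^^ k) g) U" if "holo_on g U" for i k g
 using that holo_pd[OF assms(1)] by (induction k) auto
 have "holo_on (foldr (%i. pd1 i ^^ al i) L f) U" "holo_on (foldr (%i. pd2 i ^^ al i) L f) U" for L
 by (induction L) (auto intro: 1 assms)
 then show "holo_on (pd1_multi al f) U" "holo_on (pd2_multi al f) U"
 by (auto simp: pd1_multi_def pd2_multi_def)
qed

section \<open>Iterated integrals over products of paths\<close>

lemma chol_compose2: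
 assumes "chol (%p. F (fst p) (snd p)) (a,b)" "chol g x" "chol h x" "g x = a" "h x = b"
 shows "chol (%x. F (g x) (h x)) x"
 using chol_compose[of "%p. F (fst p) (snd p)" "%x. (g x,h x)" x] chol_Pair[OF assms(2,3)] assms by simp

text \<open>\<open>prod_integral\<close> with the list of coordinates and the start vector made
  explicit. Inductions over the coordinates need both, and the boundary terms below are integrals
  over all coordinates but the first.\<close>

definition iter :: "('n::finite => real => complex) => 'n list => ('n cvec => complex) => 'n cvec => complex" where
 "iter g L f = foldr (%i F w. contour_integral (g i) (%s. F (set_coord w i s))) L f"

lemma iter_Nil [simp]: "iter g [] f = f"
 and iter_Cons: "iter g (i # L) f w = contour_integral (g i) (%s. iter g L f (set_coord w i s))"
 by (simp_all add: iter_def)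

text \<open>Boxes with one set per coordinate are stable under \<open>set_coord\<close>, so
  continuity and holomorphy on a box survive each single integration.\<close>

definition cbx :: "('n::finite => complex set) => 'n cvec set" where
 "cbx B = {w. ALL i. w $ i \<in> B i}"

lemma open_cbx:
 assumes "!!i. open (B i)" shows "open (cbx B)"
proof -
 have "cbx B = (\<Inter>i\<in>UNIV. (%w. w $ i) -` B i)" by (auto simp: cbx_def)
 moreover have "open ((%w::'a cvec. w $ i) -` B i)" for i
 by (intro open_vimage assms continuous_intros)
 ultimately show ?thesis by auto
qed

lemma compact_cbx:
 assumes "!!i. compact (B i)" shows "compact (cbx B)"
proof -
 have "bounded (cbx B)"
 proof -
 have "ALL i. EX M. \<forall>s\<in>B i. cmod s <= M" using assms compact_imp_bounded by (metis bounded_iff)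
 then obtain M where M: "!!i s. s \<in> B i ==> cmod s <= M i" by metis
 have "norm w <= (\<Sum>i\<in>UNIV. M i)" if "w \<in> cbx B" for w
 unfolding norm_vec_def using that M
 by (intro order_trans[OF L2_set_le_sum] sum_mono) (auto simp: cbx_def)
 then show ?thesis by (auto simp: bounded_iff)
 qed
 moreover have "closed (cbx B)"
 proof -
 have "cbx B = (\<Inter>i\<in>UNIV. (%w. w $ i) -` B i)" by (auto simp: cbx_def)
 moreover have "closed ((%w::'a cvec. w $ i) -` B i)" for i
 by (intro closed_vimage compact_imp_closed assms continuous_intros)
 ultimately show ?thesis by auto
 qed
 ultimately show ?thesis by (simp add: compact_eq_bounded_closed)
qed

lemma set_coord_cbx: "w \<in> cbx B ==> s \<in> B i ==> set_coord w i s \<in> cbx B"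
 by (auto simp: cbx_def)

lemma iter_cong:
 assumes "!!i. i \<in> set L ==> path_image (g i) <= B i" "!!w. w \<in> cbx B ==> f w = f' w" "w \<in> cbx B"
 shows "iter g L f w = iter g L f' w"
 using assms(1,3)
proof (induction L arbitrary: w)
 case (Cons i L)
 show ?case unfolding iter_Cons
 using Cons.prems by (intro contour_integral_eq Cons.IH set_coord_cbx) auto
qed (use assms in auto)

lemma iter_start:
 "(!!i. i \<notin> set L ==> w $ i = w' $ i) ==> iter g L f w = iter g L f w'"
proof (induction L arbitrary: w w')
 case Nil
 then have "w = w'" by (simp add: vec_eq_iff)
 then show ?case by simp
next
 case (Cons i L)
 have "iter g L f (set_coord w i s) = iter g L f (set_coord w' i s)" for s
 using Cons.prems by (intro Cons.IH) auto
 then show ?case by (simp add: iter_Cons)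
qed

lemma iter_cmult: "iter g L (%w. c * f w) w = c * iter g L f w"
 by (induction L arbitrary: w) (simp_all add: iter_Cons CI_cmult)

lemma continuous_on_set_coord [continuous_intros]:
 "continuous_on S f ==> continuous_on S h ==> continuous_on S (%x. set_coord (f x) i (h x))"
 unfolding set_coord_def
proof (rule continuous_on_vec_lambda)
 fix j assume "continuous_on S f" "continuous_on S h"
 then show "continuous_on S (%x. if j = i then h x else f x $ j)"
 by (cases "j = i") (auto intro: continuous_intros)
qed

lemma continuous_on_iter_param:
 fixes f :: "'a::topological_space => 'n::finite cvec => complex"
 assumes "!!i. i \<in> set L ==> npath (g i)" "!!i. i \<in> set L ==> path_image (g i) <= B i"
 and f: "continuous_on (P \<times> cbx B) (%(x,w). f x w)"
 shows "continuous_on (P \<times> cbx B) (%(x,w). iter g L (f x) w)"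
 using assms(1,2)
proof (induction L)
 case (Cons i L)
 have IH: "continuous_on (P \<times> cbx B) (%(x,w). iter g L (f x) w)"
 using Cons by simp
 have "continuous_on ((P \<times> cbx B) \<times> path_image (g i)) (%q. (fst (fst q),set_coord (snd (fst q)) i (snd q)))"
 by (intro continuous_intros)
 moreover have "(%q. (fst (fst q),set_coord (snd (fst q)) i (snd q))) ` ((P \<times> cbx B) \<times> path_image (g i)) <= P \<times> cbx B"
 using Cons.prems(2)[of i] by (auto intro!: set_coord_cbx)
 ultimately have "continuous_on ((P \<times> cbx B) \<times> path_image (g i)) (%q. iter g L (f (fst (fst q))) (set_coord (snd (fst q)) i (snd q)))"
 using continuous_on_compose2[OF IH] by (fastforce simp: case_prod_unfold)
 then have "continuous_on (P \<times> cbx B) (%p. contour_integral (g i) (%s. iter g L (f (fst p)) (set_coord (snd p) i s)))"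
 using Cons.prems by (intro continuous_on_CI) (auto simp: case_prod_unfold)
 then show ?case by (simp add: iter_Cons case_prod_unfold)
qed (use f in auto)

lemma continuous_on_iter:
 assumes "!!i. i \<in> set L ==> npath (g i)" "!!i. i \<in> set L ==> path_image (g i) <= B i"
 and f: "continuous_on (cbx B) f"
 shows "continuous_on (cbx B) (iter g L f)"
proof -
 have "continuous_on (UNIV \<times> cbx B) (%(x::real,w). f w)"
 unfolding case_prod_unfold by (intro continuous_on_compose2[OF f] continuous_intros) auto
 from continuous_on_iter_param[of L g B UNIV "%_. f",OF assms(1,2) this] show ?thesis
 using continuous_on_slice(1)[of UNIV "cbx B" "%_. iter g L f" 0] by simp
qed

text \<open>Holomorphy is carried jointly in the parameter and the start vector, because the next
  integration turns a coordinate of the start vector into its variable.\<close>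

lemma chol_iter_param:
 fixes f :: "'a::cvs => 'n::finite cvec => complex"
 assumes "!!i. i \<in> set L ==> npath (g i)" "!!i. i \<in> set L ==> path_image (g i) <= B i"
 and P: "open P" and B: "!!i. open (B i)"
 and f: "!!x w. x \<in> P ==> w \<in> cbx B ==> chol (%p. f (fst p) (snd p)) (x,w)"
 and x: "x \<in> P" "w \<in> cbx B"
 shows "chol (%p. iter g L (f (fst p)) (snd p)) (x,w)"
 using assms(1,2) x
proof (induction L arbitrary: x w)
 case (Cons i L)
 have "chol (%p. contour_integral (g i) ((%p s. iter g L (f (fst p)) (set_coord (snd p) i s)) p)) (x,w)"
 proof (rule chol_CI[where P = "P \<times> cbx B"])
 show "open (P \<times> cbx B)" by (intro open_Times P open_cbx B)
 fix p s assume p: "p \<in> P \<times> cbx B" "s \<in> path_image (g i)"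
 have "chol (%p. iter g L (f (fst p)) (snd p)) (fst p,set_coord (snd p) i s)"
 using p Cons.prems(1,2) by (intro Cons.IH set_coord_cbx) auto
 then show "chol (%q. iter g L (f (fst (fst q))) (set_coord (snd (fst q)) i (snd q))) (p,s)"
 by (rule chol_compose2) ((intro chol_intros | simp)+)
 qed (use Cons.prems in auto)
 then show ?case by (simp add: iter_Cons)
qed (use f in auto)

lemma chol_iter:
 assumes "!!i. i \<in> set L ==> npath (g i)" "!!i. i \<in> set L ==> path_image (g i) <= B i"
 and B: "!!i. open (B i)" and f: "!!w. w \<in> cbx B ==> chol f w" and w: "w \<in> cbx B"
 shows "chol (iter g L f) w"
proof -
 have "chol (%p. iter g L ((%_. f) (fst p)) (snd p)) (0::complex,w)"
 using assms by (intro chol_iter_param[where P = UNIV and B = B] chol_compose[where f = f and g = snd] chol_snd chol_id) auto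
 then show ?thesis by (rule chol_compose2[where F = "%_. iter g L f" and g = "%_. 0" and h = "%w. w"]) (auto intro: chol_intros)
qed

lemma chol_holomorphic_coord:
 assumes "!!w. w \<in> cbx B ==> chol F w" "w \<in> cbx B"
 shows "(%s. F (set_coord w i s)) holomorphic_on B i"
 unfolding holomorphic_on_def
proof
 fix s assume "s \<in> B i"
 then have "chol F (set_coord w i s)" using assms by (intro assms(1) set_coord_cbx)
 then have "chol (%s. F (set_coord w i s)) s" by (rule chol_compose) (intro chol_intros)
 then show "(%s. F (set_coord w i s)) field_differentiable at s within B i"
 by (simp add: chol_complex_iff field_differentiable_at_within)
qed

text \<open>Paths are exchanged one coordinate at a time. When the turn of coordinate i comes, the
  integrals inside are holomorphic in it on B i, so the one-variable equality applies.\<close>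

lemma iter_change_paths:
 assumes "!!i. i \<in> set L ==> npath (g i)" "!!i. i \<in> set L ==> path_image (g i) <= B i"
 and "!!i. i \<in> set L ==> npath (g' i)" "!!i. i \<in> set L ==> path_image (g' i) <= B i"
 and B: "!!i. open (B i)" and f: "!!w. w \<in> cbx B ==> chol f w" and w: "w \<in> cbx B"
 and eq: "!!i F. i \<in> set L ==> F holomorphic_on B i ==> contour_integral (g i) F = contour_integral (g' i) F"
 shows "iter g L f w = iter g' L f w"
 using assms(1-4) w eq
proof (induction L arbitrary: w)
 case (Cons i L)
 have "contour_integral (g i) (%s. iter g L f (set_coord w i s)) = contour_integral (g i) (%s. iter g' L f (set_coord w i s))"
 using Cons.prems by (intro contour_integral_eq Cons.IH set_coord_cbx) auto
 also have "\<dots> = contour_integral (g' i) (%s. iter g' L f (set_coord w i s))"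
 using Cons.prems(1-5)
 by (intro Cons.prems(6) chol_holomorphic_coord chol_iter[where B = B] B f) auto
 finally show ?case by (simp add: iter_Cons)
qed auto

lemma iter_eq_0:
 assumes "!!i. i \<in> set L ==> npath (g i)" "!!i. i \<in> set L ==> path_image (g i) <= B i"
 and B: "!!i. open (B i)" and f: "!!w. w \<in> cbx B ==> chol f w" and w: "w \<in> cbx B"
 and i: "i \<in> set L" and eq: "!!F. F holomorphic_on B i ==> contour_integral (g i) F = 0"
 shows "iter g L f w = 0"
 using assms(1,2) w i
proof (induction L arbitrary: w)
 case (Cons j L)
 show ?case
 proof (cases "j = i")
 case True
 show ?thesis unfolding iter_Cons True
 using Cons.prems True by (intro eq chol_holomorphic_coord chol_iter[where B = B] B f) auto
 next
 case False
 have "contour_integral (g j) (%s. iter g L f (set_coord w j s)) = contour_integral (g j) (%s. 0)"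
 using Cons.prems False by (intro contour_integral_eq Cons.IH set_coord_cbx) auto
 then show ?thesis by (simp add: iter_Cons)
 qed
qed auto

lemma iter_add:
 assumes "!!i. i \<in> set L ==> npath (g i)" "!!i. i \<in> set L ==> path_image (g i) <= B i"
 and "continuous_on (cbx B) f" "continuous_on (cbx B) f'" "w \<in> cbx B"
 shows "iter g L (%w. f w + f' w) w = iter g L f w + iter g L f' w"
 using assms(1,2,5)
proof (induction L arbitrary: w)
 case (Cons i L)
 have c: "continuous_on (path_image (g i)) (%s. iter g L F (set_coord w i s))" if "continuous_on (cbx B) F" for F
 using Cons.prems that
 by (intro continuous_on_compose2[OF continuous_on_iter[of L g B F]] continuous_intros) (auto intro: set_coord_cbx)
 have "contour_integral (g i) (%s. iter g L (%w. f w + f' w) (set_coord w i s)) =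
 contour_integral (g i) (%s. iter g L f (set_coord w i s) + iter g L f' (set_coord w i s))"
 using Cons.prems by (intro contour_integral_eq Cons.IH set_coord_cbx) auto
 also have "\<dots> = contour_integral (g i) (%s. iter g L f (set_coord w i s)) + contour_integral (g i) (%s. iter g L f' (set_coord w i s))"
 using Cons.prems assms(3,4) by (intro contour_integral_add npath_integrable c) auto
 finally show ?case by (simp add: iter_Cons)
qed auto

lemma iter_zero [simp]: "iter g L (%w. 0) w = 0"
 using iter_cmult[of g L 0 "%_. 0" w] by simp

lemma iter_diff:
 assumes "!!i. i \<in> set L ==> npath (g i)" "!!i. i \<in> set L ==> path_image (g i) <= B i"
 and "continuous_on (cbx B) f" "continuous_on (cbx B) f'" "w \<in> cbx B"
 shows "iter g L (%w. f w - f' w) w = iter g L f w - iter g L f' w"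
 using iter_add[of L g B f "%w. - 1 * f' w" w] iter_cmult[of g L "-1" f' w] assms
 by (simp add: continuous_on_minus)

lemma iter_sum:
 assumes "!!i. i \<in> set L ==> npath (g i)" "!!i. i \<in> set L ==> path_image (g i) <= B i"
 and "!!a. a \<in> A ==> continuous_on (cbx B) (f a)" "w \<in> cbx B"
 shows "iter g L (%w. \<Sum>a\<in>A. f a w) w = (\<Sum>a\<in>A. iter g L (f a) w)"
 using assms(3)
proof (induction A rule: infinite_finite_induct)
 case (insert a A)
 then show ?case
 using iter_add[of L g B "f a" "%w. \<Sum>a\<in>A. f a w" w] assms by (simp add: continuous_on_sum)
qed auto

lemma iter_CI_swap:
 fixes f :: "complex => 'n::finite cvec => complex"
 assumes "!!i. i \<in> set L ==> npath (g i)" "!!i. i \<in> set L ==> path_image (g i) <= B i"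
 and h: "npath h" and f: "continuous_on (path_image h \<times> cbx B) (%(s,w). f s w)" and w: "w \<in> cbx B"
 shows "contour_integral h (%s. iter g L (f s) w) = iter g L (%w. contour_integral h (%s. f s w)) w"
 using assms(1,2) w
proof (induction L arbitrary: w)
 case (Cons i L)
 have c: "continuous_on (path_image h \<times> cbx B) (%(s,w). iter g L (f s) w)"
 using Cons.prems by (intro continuous_on_iter_param f) auto
 have "continuous_on (path_image h \<times> path_image (g i)) (%q. (fst q,set_coord w i (snd q)))"
 "(%q. (fst q,set_coord w i (snd q))) ` (path_image h \<times> path_image (g i)) <= path_image h \<times> cbx B"
 using Cons.prems(2)[of i] w Cons.prems(3) by (auto intro!: continuous_intros set_coord_cbx)
 from continuous_on_compose2[OF c this]
 have "continuous_on (path_image h \<times> path_image (g i)) (%(s,s'). iter g L (f s) (set_coord w i s'))"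
 by (simp add: case_prod_unfold)
 then have "contour_integral h (%s. contour_integral (g i) (%s'. iter g L (f s) (set_coord w i s'))) =
 contour_integral (g i) (%s'. contour_integral h (%s. iter g L (f s) (set_coord w i s')))"
 using Cons.prems by (intro CI_swap h) auto
 also have "\<dots> = contour_integral (g i) (%s'. iter g L (%w. contour_integral h (%s. f s w)) (set_coord w i s'))"
 using Cons.prems by (intro contour_integral_eq Cons.IH set_coord_cbx) auto
 finally show ?case by (simp add: iter_Cons)
qed auto

lemma iter_iter_swap:
 fixes f :: "'m::finite cvec => 'n::finite cvec => complex"
 assumes "!!i. i \<in> set L ==> npath (g i)" "!!i. i \<in> set L ==> path_image (g i) <= B i"
 and "!!i. i \<in> set M ==> npath (h i)" "!!i. i \<in> set M ==> path_image (h i) <= A i"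
 and f: "continuous_on (cbx A \<times> cbx B) (%(y,w). f y w)" and y: "y \<in> cbx A" and w: "w \<in> cbx B"
 shows "iter h M (%y. iter g L (f y) w) y = iter g L (%w. iter h M (%y. f y w) y) w"
 using assms(3,4) y
proof (induction M arbitrary: y)
 case (Cons i M)
 have f': "continuous_on (cbx B \<times> cbx A) (%(w,y). f y w)" by (rule continuous_on_swap_args[OF f])
 have c: "continuous_on (cbx B \<times> cbx A) (%(w,y). iter h M (%y. f y w) y)"
 using Cons.prems by (intro continuous_on_iter_param[OF _ _ f']) auto
 have "continuous_on (path_image (h i) \<times> cbx B) (%q. (snd q,set_coord y i (fst q)))"
 "(%q. (snd q,set_coord y i (fst q))) ` (path_image (h i) \<times> cbx B) <= cbx B \<times> cbx A"
 using Cons.prems(2)[of i] Cons.prems(3) by (auto intro!: continuous_intros set_coord_cbx)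
 from continuous_on_compose2[OF c this]
 have c2: "continuous_on (path_image (h i) \<times> cbx B) (%(s,w). iter h M (%y. f y w) (set_coord y i s))"
 by (simp add: case_prod_unfold)
 have "contour_integral (h i) (%s. iter h M (%y. iter g L (f y) w) (set_coord y i s)) =
 contour_integral (h i) (%s. iter g L (%w. iter h M (%y. f y w) (set_coord y i s)) w)"
 using Cons.prems by (intro contour_integral_eq Cons.IH set_coord_cbx) auto
 also have "\<dots> = iter g L (%w. contour_integral (h i) (%s. iter h M (%y. f y w) (set_coord y i s))) w"
 using Cons.prems by (intro iter_CI_swap[OF assms(1,2) _ c2 w]) auto
 finally show ?case by (simp add: iter_Cons)
qed auto

text \<open>C is a product of constants of the paths and independent of integrand and box; one C
  thus serves for all values of z, zeta and eta.\<close>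

lemma iter_bound:
 assumes "!!i. i \<in> set L ==> npath (g i)"
 obtains C where "C > 0" "!!f B M w. (!!i. i \<in> set L ==> path_image (g i) <= B i) ==> continuous_on (cbx B) f ==>
 (!!w. w \<in> cbx B ==> cmod (f w) <= M) ==> w \<in> cbx B ==> cmod (iter g L f w) <= C * M"
proof -
 have "\<exists>C>0. ALL f B M w. (\<forall>i\<in>set L. path_image (g i) <= B i) --> continuous_on (cbx B) f -->
 (\<forall>w\<in>cbx B. cmod (f w) <= M) --> w \<in> cbx B --> cmod (iter g L f w) <= C * M"
 using assms
 proof (induction L)
 case Nil then show ?case by (auto intro!: exI[of _ 1])
 next
 case (Cons i L)
 then obtain C where C: "C > 0" "!!f B M w. (\<forall>i\<in>set L. path_image (g i) <= B i) ==> continuous_on (cbx B) f ==>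
 (\<forall>w\<in>cbx B. cmod (f w) <= M) ==> w \<in> cbx B ==> cmod (iter g L f w) <= C * M" by (metis list.set_intros(2))
 obtain D where D: "D > 0" "!!f M. continuous_on (path_image (g i)) f ==> (!!s. s \<in> path_image (g i) ==> cmod (f s) <= M) ==>
 cmod (contour_integral (g i) f) <= D * M" using CI_bound[of "g i"] Cons.prems by auto
 have "cmod (iter g (i # L) f w) <= (D * C) * M"
 if h: "\<forall>i\<in>set (i # L). path_image (g i) <= B i" "continuous_on (cbx B) f" "\<forall>w\<in>cbx B. cmod (f w) <= M" "w \<in> cbx B" for f B M w
 proof -
 have "continuous_on (path_image (g i)) (%s. iter g L f (set_coord w i s))"
 using Cons.prems h
 by (intro continuous_on_compose2[OF continuous_on_iter[of L g B f]] continuous_intros) (auto intro: set_coord_cbx)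
 then have "cmod (iter g (i # L) f w) <= D * (C * M)"
 unfolding iter_Cons using h by (intro D(2) C(2)[of B]) (auto intro: set_coord_cbx)
 then show ?thesis by (simp add: mult.assoc)
 qed
 then show ?case using C(1) D(1) by (intro exI[of _ "D * C"]) auto
 qed
 then show ?thesis using that by metis
qed

text \<open>The M-test makes the series converge uniformly on the box, and \<open>iter_bound\<close>
  carries uniform closeness through the integrals.\<close>

lemma iter_has_sum:
 fixes f :: "'a => 'n::finite cvec => complex"
 assumes g: "!!i. i \<in> set L ==> npath (g i)" "!!i. i \<in> set L ==> path_image (g i) <= B i"
 and c: "!!a. continuous_on (cbx B) (f a)" and b: "!!a w. w \<in> cbx B ==> cmod (f a w) <= M a"
 and M: "M summable_on UNIV" and S: "!!w. w \<in> cbx B ==> ((%a. f a w) has_sum S w) UNIV"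
 and w: "w \<in> cbx B"
 shows "((%a. iter g L (f a) w) has_sum iter g L S w) UNIV"
proof -
 have ul: "uniform_limit (cbx B) (%X w. \<Sum>a\<in>X. f a w) S (finite_subsets_at_top UNIV)"
 by (rule Weierstrass_m_test_general'[OF b S M])
 have cS: "continuous_on (cbx B) S"
 by (rule uniform_limit_theorem[OF _ ul]) (auto intro!: always_eventually continuous_on_sum c)
 obtain C where C: "C > 0" "!!f B M w. (!!i. i \<in> set L ==> path_image (g i) <= B i) ==> continuous_on (cbx B) f ==>
 (!!w. w \<in> cbx B ==> cmod (f w) <= M) ==> w \<in> cbx B ==> cmod (iter g L f w) <= C * M"
 using iter_bound[of L g,OF g(1)] by blast
 show ?thesis unfolding has_sum_def
 proof (rule tendstoI)
 fix e :: real assume e: "e > 0"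
 have "e/(2 * C) > 0" using e C by simp
 from uniform_limitD[OF ul this]
 show "\<forall>\<^sub>F X in finite_subsets_at_top UNIV. dist (\<Sum>a\<in>X. iter g L (f a) w) (iter g L S w) < e"
 proof eventually_elim
 case (elim X)
 have cX: "continuous_on (cbx B) (%w. \<Sum>a\<in>X. f a w)" by (intro continuous_on_sum c)
 have "cmod (iter g L (%w. (\<Sum>a\<in>X. f a w) - S w) w) <= C * (e/(2 * C))"
 using elim by (intro C(2)[of B] g continuous_intros cX cS w) (auto simp: dist_norm less_imp_le)
 moreover have "iter g L (%w. (\<Sum>a\<in>X. f a w) - S w) w = (\<Sum>a\<in>X. iter g L (f a) w) - iter g L S w"
 using iter_diff[OF g cX cS w] iter_sum[of L g B X f w] g c w by simp
 ultimately show ?case using C(1) e by (simp add: dist_norm)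
 qed
 qed
qed

definition aff :: "'n::finite cvec => 'n cvec => 'n cvec => 'n cvec" where
 "aff a b w = (\<chi> i. a $ i + b $ i * w $ i)"

lemma aff_nth [simp]: "aff a b w $ i = a $ i + b $ i * w $ i"
 by (simp add: aff_def)

lemma chol_aff: "chol f x ==> chol h x ==> chol k x ==> chol (%x. aff (f x) (h x) (k x)) x"
 unfolding aff_def by (intro chol_vec_lambda chol_intros)

lemma continuous_on_aff [continuous_intros]:
 "continuous_on S f ==> continuous_on S h ==> continuous_on S k ==> continuous_on S (%x. aff (f x) (h x) (k x))"
 unfolding aff_def by (intro continuous_intros)

lemma iter_aff:
 fixes a b w :: "'n::finite cvec"
 assumes "!!i. i \<in> set L ==> npath (g i)"
 and "!!i. i \<in> set L ==> (%s. a $ i + b $ i * s) ` path_image (g i) <= B i"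
 and f: "continuous_on (cbx B) f" and w: "aff a b w \<in> cbx B"
 shows "iter (%i t. a $ i + b $ i * g i t) L f (aff a b w) =
 prod_list (map (($) b) L) * iter g L (%w. f (aff a b w)) w"
 using assms(1,2) w
proof (induction L arbitrary: w)
 case (Cons i L)
 have sc: "set_coord (aff a b w) i (a $ i + b $ i * s) = aff a b (set_coord w i s)" for s
 by (auto simp: vec_eq_iff)
 have c: "continuous_on ((%s. a $ i + b $ i * s) ` path_image (g i))
 (%s. iter (%i t. a $ i + b $ i * g i t) L f (set_coord (aff a b w) i s))"
 using Cons.prems
 by (intro continuous_on_compose2[OF continuous_on_iter[of L _ B f]] continuous_intros f npath_affine)
 (auto intro!: set_coord_cbx simp: path_image_affine)
 have "iter (%i t. a $ i + b $ i * g i t) (i # L) f (aff a b w) =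
 b $ i * contour_integral (g i) (%s. iter (%i t. a $ i + b $ i * g i t) L f (aff a b (set_coord w i s)))"
 unfolding iter_Cons using CI_affine[OF _ c] Cons.prems by (simp add: sc)
 also have "contour_integral (g i) (%s. iter (%i t. a $ i + b $ i * g i t) L f (aff a b (set_coord w i s))) =
 contour_integral (g i) (%s. prod_list (map (($) b) L) * iter g L (%w. f (aff a b w)) (set_coord w i s))"
 using Cons.prems by (intro contour_integral_eq Cons.IH) (auto simp: sc[symmetric] intro!: set_coord_cbx)
 finally show ?case by (simp add: iter_Cons CI_cmult)
qed auto

lemma iter_has_field_derivative:
 fixes f :: "complex => 'n::finite cvec => complex"
 assumes "!!i. i \<in> set L ==> npath (g i)" "!!i. i \<in> set L ==> path_image (g i) <= B i"
 and P: "open P" and B: "!!i. open (B i)"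
 and f: "!!c w. c \<in> P ==> w \<in> cbx B ==> chol (%p. f (fst p) (snd p)) (c,w)"
 and c: "c \<in> P" and w: "w \<in> cbx B"
 shows "((%c. iter g L (f c) w) has_field_derivative iter g L (%w. deriv (%c. f c w) c) w) (at c)"
 using assms(1,2) w
proof (induction L arbitrary: w)
 case Nil
 have "chol (%c. f c w) c"
 by (rule chol_compose2[where g = "%c. c" and h = "%_. w",OF f]) (use Nil c in \<open>auto intro: chol_intros\<close>)
 then show ?case by (simp add: chol_complex_iff DERIV_deriv_iff_field_differentiable)
next
 case (Cons i L)
 obtain R where R: "R > 0" "cball c R <= P" using P c open_contains_cball by blast
 have ch: "chol (%p. iter g L (f (fst p)) (snd p)) (c',w')" if "c' \<in> P" "w' \<in> cbx B" for c' w'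
 using Cons.prems that by (intro chol_iter_param[OF _ _ P B f]) auto
 have cont: "continuous_on (P \<times> cbx B) (%(c,w). iter g L (f c) w)"
 unfolding case_prod_unfold using ch by (intro chol_imp_continuous_on) auto
 have "continuous_on (cball c R \<times> path_image (g i)) (%q. (fst q,set_coord w i (snd q)))"
 "(%q. (fst q,set_coord w i (snd q))) ` (cball c R \<times> path_image (g i)) <= P \<times> cbx B"
 using Cons.prems(2)[of i] Cons.prems(3) R by (auto intro!: continuous_intros set_coord_cbx)
 from continuous_on_compose2[OF cont this]
 have cont2: "continuous_on (cball c R \<times> path_image (g i)) (%(c,s). iter g L (f c) (set_coord w i s))"
 by (simp add: case_prod_unfold)
 have "((%c. contour_integral (g i) (%s. iter g L (f c) (set_coord w i s))) has_field_derivative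
 contour_integral (g i) (%s. deriv (%c. iter g L (f c) (set_coord w i s)) c)) (at c)"
 proof (rule CI_has_field_derivative[OF _ R(1) cont2])
 fix c' s assume "c' \<in> ball c R" "s \<in> path_image (g i)"
 then have "chol (%p. iter g L (f (fst p)) (snd p)) (c',set_coord w i s)"
 using R Cons.prems by (intro ch set_coord_cbx) auto
 then have "chol (%c. iter g L (f c) (set_coord w i s)) c'"
 by (rule chol_compose2[where F = "%c. iter g L (f c)"]) (auto intro: chol_intros)
 then show "(%c. iter g L (f c) (set_coord w i s)) field_differentiable at c'"
 by (simp add: chol_complex_iff)
 qed (use Cons.prems in auto)
 moreover have "contour_integral (g i) (%s. deriv (%c. iter g L (f c) (set_coord w i s)) c) =
 contour_integral (g i) (%s. iter g L (%w. deriv (%c. f c w) c) (set_coord w i s))"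
 using Cons.prems by (intro contour_integral_eq DERIV_imp_deriv Cons.IH set_coord_cbx) auto
 ultimately show ?case by (simp add: iter_Cons)
qed

section \<open>Cauchy's formula and Taylor series on polydiscs\<close>

definition PD :: "'n::finite => ('n cvec => complex) => 'n cvec => complex" where
 "PD i H v = deriv (%s. H (set_coord v i s)) (v $ i)"

definition PDm :: "('n::finite => nat) => 'n list => ('n cvec => complex) => 'n cvec => complex" where
 "PDm al L H = foldr (%i. PD i ^^ al i) L H"

lemma PDm_simps: "PDm al [] H = H" "PDm al (i # L) H = (PD i ^^ al i) (PDm al L H)"
 by (simp_all add: PDm_def)

lemma set_coord_twice [simp]: "set_coord (set_coord v i s) i t = set_coord v i t"
 by (simp add: vec_eq_iff)

lemma set_coord_same [simp]: "set_coord v i (v $ i) = v"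
 by (simp add: vec_eq_iff)

lemma deriv_shift_0: "deriv (%s. f (a + s)) 0 = deriv f (a :: complex)"
 using DERIV_shift[of f _ 0 a] by (simp add: deriv_def add.commute)

lemma add_axis: "v + axis i s = set_coord v i (v $ i + s)"
 by (simp add: vec_eq_iff axis_def)

lemma PD_axis: "PD i H v = deriv (%s. H (v + axis i s)) 0"
 by (simp add: PD_def add_axis deriv_shift_0[of "%s. H (set_coord v i s)"])

text \<open>Brings the one-variable theory of higher derivatives to bear on iterated partial
  derivatives.\<close>

lemma PD_pow: "(PD i ^^ k) H v = (deriv ^^ k) (%s. H (set_coord v i s)) (v $ i)"
proof (induction k arbitrary: v)
 case (Suc k)
 have "(PD i ^^ k) H (set_coord v i s) = (deriv ^^ k) (%s. H (set_coord v i s)) s" for s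
 using Suc[of "set_coord v i s"] by simp
 then have "PD i ((PD i ^^ k) H) v = (deriv ^^ Suc k) (%s. H (set_coord v i s)) (v $ i)"
 by (simp add: PD_def[of i "(PD i ^^ k) H"])
 then show ?case by simp
qed simp

lemma pd1_multi_eq_PDm: "pd1_multi al f (z,w,eta) = PDm al (sorted_list_of_set UNIV) (%v. f (v,w,eta)) z"
proof -
 have 1: "(pd1 i ^^ k) g (z,w,eta) = (PD i ^^ k) (%v. g (v,w,eta)) z" for i k g z
 by (induction k arbitrary: z) (simp_all add: pd1_def PD_axis)
 have "foldr (%i. pd1 i ^^ al i) L f (z,w,eta) = PDm al L (%v. f (v,w,eta)) z" for L z
 by (induction L arbitrary: z) (simp_all add: PDm_simps 1)
 then show ?thesis by (simp add: pd1_multi_def)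
qed

lemma pd2_multi_eq_PDm: "pd2_multi al f (z,w,eta) = PDm al (sorted_list_of_set UNIV) (%v. f (z,v,eta)) w"
proof -
 have 1: "(pd2 i ^^ k) g (z,w,eta) = (PD i ^^ k) (%v. g (z,v,eta)) w" for i k g w
 by (induction k arbitrary: w) (simp_all add: pd2_def PD_axis)
 have "foldr (%i. pd2 i ^^ al i) L f (z,w,eta) = PDm al L (%v. f (z,v,eta)) w" for L w
 by (induction L arbitrary: w) (simp_all add: PDm_simps 1)
 then show ?thesis by (simp add: pd2_multi_def)
qed

lemma chol_PDm:
 assumes U: "open U" and H: "!!v. v \<in> U ==> chol H v"
 shows "v \<in> U ==> chol (PDm al L H) v"
proof -
 have ax: "axis i s = cmul s (axis i 1)" for s :: complex and i
 by (auto simp: axis_def vec_eq_iff)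
 have 1: "\<forall>v\<in>U. chol (PD i G) v" if "\<forall>v\<in>U. chol G v" for i G
 using chol_deriv[OF U,of G _ "axis i 1"] that by (simp add: PD_axis[abs_def] ax[symmetric])
 have 2: "\<forall>v\<in>U. chol ((PD i ^^ k) G) v" if "\<forall>v\<in>U. chol G v" for i k G
 using that 1 by (induction k) auto
 have "\<forall>v\<in>U. chol (PDm al L H) v"
 by (induction L) (use H 2 in \<open>auto simp: PDm_simps\<close>)
 then show "v \<in> U ==> chol (PDm al L H) v" by blast
qed

text \<open>Iterates the one-variable formula for higher derivatives. The point v may lie anywhere
  in the open polydisc about c, so that \<open>PDm_taylor\<close> can use the same circles for the
  value at c + w and for the derivatives at c.\<close>

lemma PDm_cauchy:
 fixes c v :: "'n::finite cvec"
 assumes L: "distinct L" and R: "R > 0" and B: "!!i. open (B i)" and H: "!!w. w \<in> cbx B ==> chol H w"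
 and cB: "!!i. i \<in> set L ==> cball (c $ i) R <= B i"
 and v: "v \<in> cbx B" "!!i. i \<in> set L ==> v $ i \<in> ball (c $ i) R"
 shows "PDm al L H v = (\<Prod>i\<in>set L. fact (al i)/(2 * pi * \<i>)) *
 iter (%i. circlepath (c $ i) R) L (%w. H w/(\<Prod>i\<in>set L. (w $ i - v $ i) ^ Suc (al i))) v"
 using L cB v
proof (induction L arbitrary: v)
 case Nil
 then show ?case by (simp add: PDm_simps)
next
 case (Cons i L)
 let ?g = "%i. circlepath (c $ i) R" and ?K = "\<Prod>i\<in>set L. fact (al i)/(2 * pi * \<i>)"
 let ?P = "%w. \<Prod>i\<in>set L. (w $ i - v $ i) ^ Suc (al i)"
 have i: "i \<notin> set L" using Cons.prems by simp
 have hol: "(%s. PDm al L H (set_coord v i s)) holomorphic_on B i"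
 by (rule chol_holomorphic_coord[OF chol_PDm[OF open_cbx[OF B] H] Cons.prems(3)])
 have hol': "(%s. PDm al L H (set_coord v i s)) holomorphic_on cball (c $ i) R"
 using Cons.prems by (intro holomorphic_on_subset[OF hol]) auto
 have "((%s. PDm al L H (set_coord v i s)/(s - v $ i) ^ Suc (al i)) has_contour_integral
 2 * pi * \<i>/fact (al i) * PDm al (i # L) H v) (?g i)"
 unfolding PDm_simps PD_pow
 using hol' holomorphic_on_subset[OF hol' ball_subset_cball] Cons.prems
 by (intro Cauchy_has_contour_integral_higher_derivative_circlepath holomorphic_on_imp_continuous_on) auto
 then have "PDm al (i # L) H v = fact (al i)/(2 * pi * \<i>) *
 contour_integral (?g i) (%s. PDm al L H (set_coord v i s)/(s - v $ i) ^ Suc (al i))"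
 by (simp add: contour_integral_unique)
 also have "contour_integral (?g i) (%s. PDm al L H (set_coord v i s)/(s - v $ i) ^ Suc (al i)) =
 contour_integral (?g i) (%s. ?K * iter ?g L (%w. H w/((w $ i - v $ i) ^ Suc (al i) * ?P w)) (set_coord v i s))"
 proof (rule contour_integral_eq)
 fix s assume s: "s \<in> path_image (?g i)"
 have sB: "s \<in> B i" using s Cons.prems(2)[of i] R by auto
 let ?v = "set_coord v i s"
 have "PDm al L H ?v = ?K * iter ?g L (%w. H w/(\<Prod>j\<in>set L. (w $ j - ?v $ j) ^ Suc (al j))) ?v"
 using Cons.prems i sB by (intro Cons.IH set_coord_cbx) auto
 also have "(%w. H w/(\<Prod>j\<in>set L. (w $ j - ?v $ j) ^ Suc (al j))) = (%w. H w/?P w)"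
 using i by (intro ext arg_cong2[of _ _ _ _ "(/)"] prod.cong) auto
 finally have e: "PDm al L H ?v = ?K * iter ?g L (%w. H w/?P w) ?v" .
 have "PDm al L H ?v/(s - v $ i) ^ Suc (al i) =
 ?K * (inverse ((s - v $ i) ^ Suc (al i)) * iter ?g L (%w. H w/?P w) ?v)"
 unfolding e divide_inverse[of "_ * _"] by (simp only: mult.assoc mult.commute[of "inverse _"])
 also have "inverse ((s - v $ i) ^ Suc (al i)) * iter ?g L (%w. H w/?P w) ?v =
 iter ?g L (%w. inverse ((s - v $ i) ^ Suc (al i)) * (H w/?P w)) ?v"
 by (rule iter_cmult[symmetric])
 also have "iter ?g L (%w. inverse ((s - v $ i) ^ Suc (al i)) * (H w/?P w)) ?v =
 iter ?g L (%w. H w/((w $ i - v $ i) ^ Suc (al i) * ?P w)) ?v"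
 \<comment> \<open>The integrations over L never touch coordinate i, so the box may pin it to s;
   this identifies the constant s - v_i with the kernel factor under the integral.\<close>
 proof (rule iter_cong[where B = "%j. if j = i then {s} else UNIV"])
 fix w assume "w \<in> cbx (%j. if j = i then {s} else UNIV)"
 then have "w $ i = s" by (force simp: cbx_def dest: spec[of _ i])
 then show "inverse ((s - v $ i) ^ Suc (al i)) * (H w/?P w) = H w/((w $ i - v $ i) ^ Suc (al i) * ?P w)"
 by (simp only: divide_inverse inverse_mult_distrib mult_ac)
 qed (use i in \<open>auto simp: cbx_def\<close>)
 finally show "PDm al L H ?v/(s - v $ i) ^ Suc (al i) =
 ?K * iter ?g L (%w. H w/((w $ i - v $ i) ^ Suc (al i) * ?P w)) ?v" .
 qed
 also have "\<dots> = ?K * iter ?g (i # L) (%w. H w/((w $ i - v $ i) ^ Suc (al i) * ?P w)) v"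
 by (simp only: CI_cmult iter_Cons)
 finally show ?case using i by (simp add: mult.assoc)
qed

text \<open>Cauchy's inequality in one coordinate after the other. Coordinates outside L stay free
  in the polydisc, since in the induction step the outer coordinate runs over its circle while the
  inner derivatives are already estimated.\<close>

lemma PDm_estimate:
 fixes c v :: "'n::finite cvec"
 assumes L: "distinct L" and R: "R > 0" and B: "!!i. open (B i)" and H: "!!w. w \<in> cbx B ==> chol H w"
 and cB: "!!i. cball (c $ i) R <= B i"
 and M: "!!w. (!!i. cmod (w $ i - c $ i) <= R) ==> cmod (H w) <= M"
 and v: "!!i. i \<in> set L ==> v $ i = c $ i" "!!i. cmod (v $ i - c $ i) <= R"
 shows "cmod (PDm al L H v) <= (\<Prod>i\<in>set L. fact (al i)/R ^ al i) * M"
 using L v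
proof (induction L arbitrary: v)
 case Nil
 then show ?case by (simp add: PDm_simps M)
next
 case (Cons i L)
 have vB: "v \<in> cbx B" using cB Cons.prems(3) by (force simp: cbx_def dist_norm norm_minus_commute)
 have hol: "(%s. PDm al L H (set_coord v i s)) holomorphic_on B i"
 by (rule chol_holomorphic_coord[OF chol_PDm[OF open_cbx[OF B] H] vB])
 have hol': "(%s. PDm al L H (set_coord v i s)) holomorphic_on cball (c $ i) R"
 using cB by (intro holomorphic_on_subset[OF hol]) auto
 have "cmod ((deriv ^^ al i) (%s. PDm al L H (set_coord v i s)) (c $ i)) \<le>
 fact (al i) * ((\<Prod>i\<in>set L. fact (al i)/R ^ al i) * M)/R ^ al i"
 proof (rule Cauchy_inequality)
 fix s assume "norm (c $ i - s) = R"
 then show "cmod (PDm al L H (set_coord v i s)) <= (\<Prod>i\<in>set L. fact (al i)/R ^ al i) * M"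
 using Cons.prems by (intro Cons.IH) (auto simp: norm_minus_commute)
 qed (use R hol' holomorphic_on_subset[OF hol' ball_subset_cball] in \<open>auto intro: holomorphic_on_imp_continuous_on\<close>)
 then show ?case using Cons.prems by (simp add: PDm_simps PD_pow mult_ac)
qed

text \<open>A finite set of multi-indices fits into a box, and a sum over a box factors into sums in
  one index.\<close>

lemma abs_summable_prod_UNIV:
 fixes g :: "'n::finite => nat => complex"
 assumes "!!i. summable (%k. norm (g i k))"
 shows "(%al. norm (\<Prod>i\<in>UNIV. g i (al i))) summable_on UNIV"
proof (rule nonneg_bdd_above_summable_on)
 let ?S = "\<Prod>i\<in>UNIV. suminf (%k. norm (g i k))"
 have "sum (%al. norm (\<Prod>i\<in>UNIV. g i (al i))) F <= ?S" if F: "finite F" for F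
 proof -
 define N where "N = Suc (Max ((%(al,i). al i) ` (F \<times> UNIV)))"
 have N: "al i < N" if "al \<in> F" for al i
 unfolding N_def less_Suc_eq_le using F that by (intro Max_ge) auto
 have "sum (%al. norm (\<Prod>i\<in>UNIV. g i (al i))) F <= sum (%al. norm (\<Prod>i\<in>UNIV. g i (al i))) (PiE UNIV (%_. {..<N}))"
 using N by (intro sum_mono2 finite_PiE) (auto simp: PiE_def)
 also have "\<dots> = (\<Prod>i\<in>UNIV. \<Sum>k<N. norm (g i k))"
 by (simp add: prod_sum_PiE prod_norm)
 also have "\<dots> <= ?S"
 by (intro prod_mono) (auto intro!: sum_nonneg sum_le_suminf assms)
 finally show ?thesis .
 qed
 then show "bdd_above (sum (%al. norm (\<Prod>i\<in>UNIV. g i (al i))) ` {F. F <= UNIV & finite F})"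
 by (intro bdd_aboveI2) auto
qed auto

lemma has_sum_prod_UNIV:
 fixes g :: "'n::finite => nat => complex"
 assumes "!!i. summable (%k. norm (g i k))"
 shows "((%al. \<Prod>i\<in>UNIV. g i (al i)) has_sum (\<Prod>i\<in>UNIV. suminf (g i))) UNIV"
proof -
 have a: "(%k. norm (g i k)) summable_on UNIV" for i
 using norm_summable_imp_summable_on[of "%k. norm (g i k)"] assms by simp
 have "infsum (%al. \<Prod>i\<in>UNIV. g i (al i)) (PiE UNIV (%_. UNIV)) = (\<Prod>i\<in>UNIV. infsum (g i) UNIV)"
 by (rule infsum_prod_PiE_abs) (auto intro: a)
 also have "\<dots> = (\<Prod>i\<in>UNIV. suminf (g i))"
 by (intro prod.cong refl infsumI norm_summable_imp_has_sum[OF assms summable_sums[OF summable_norm_cancel[OF assms]]])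
 finally show ?thesis
 using Infinite_Sum.abs_summable_summable[OF abs_summable_prod_UNIV[OF assms]] by (simp add: has_sum_iff)
qed

lemma geometric_prod_summable:
 fixes t :: "'n::finite => real"
 assumes "!!i. 0 <= t i" "!!i. t i < 1"
 shows "(%al. \<Prod>i\<in>UNIV. t i ^ al i) summable_on UNIV"
proof -
 have "(%al. norm (\<Prod>i\<in>UNIV. complex_of_real (t i) ^ al i)) summable_on UNIV"
 using assms by (intro abs_summable_prod_UNIV) (auto simp: norm_power intro!: summable_geometric)
 then show ?thesis using assms by (simp add: prod_norm[symmetric] norm_power)
qed

text \<open>The product of the Cauchy kernels at c + w is expanded into geometric series in w_i /
  (u_i - c_i). They converge uniformly on the torus, and integration term by term turns each term
  into a derivative at c by \<open>PDm_cauchy\<close>.\<close>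

lemma PDm_taylor:
 fixes c w :: "'n::finite cvec"
 assumes L: "distinct L" "set L = UNIV" and R: "R > 0" and B: "!!i. open (B i)" and H: "!!w. w \<in> cbx B ==> chol H w"
 and cB: "!!i. cball (c $ i) R <= B i" and w: "!!i. cmod (w $ i) < R"
 shows "((%al. (\<Prod>i\<in>UNIV. w $ i ^ al i/fact (al i)) * PDm al L H c) has_sum H (c + w)) UNIV"
proof -
 let ?g = "%i. circlepath (c $ i) R"
 let ?S = "%i. sphere (c $ i) R"
 \<comment> \<open>Start vectors are overwritten, but \<open>iter_has_sum\<close> asks for one
   inside the box of spheres; any point of the torus will do.\<close>
 define w0 where "w0 = (\<chi> i. c $ i + of_real R)"
 have w0: "w0 \<in> cbx ?S" using R by (auto simp: w0_def cbx_def dist_norm)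
 have SB: "u \<in> cbx B" if "u \<in> cbx ?S" for u using that cB by (force simp: cbx_def)
 have cH: "continuous_on (cbx ?S) H" using SB H by (intro chol_imp_continuous_on) auto
 have "compact (cbx ?S)" by (intro compact_cbx) auto
 then have "bounded (H ` cbx ?S)" by (intro compact_imp_bounded compact_continuous_image cH)
 then obtain M where M: "!!u. u \<in> cbx ?S ==> cmod (H u) <= M" by (auto simp: bounded_iff)
 have M0: "M \<ge> 0" using M[OF w0] norm_ge_zero order_trans by blast
 \<comment> \<open>H times the term of index al in the product of the geometric series for 1 / (u_i
   - c_i - w_i).\<close>
 define f where "f al u = H u * (\<Prod>i\<in>UNIV. (w $ i/(u $ i - c $ i)) ^ al i * inverse (u $ i - c $ i))" for al u
 have n: "cmod (u $ i - c $ i) = R" if "u \<in> cbx ?S" for u i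
 using that by (auto simp: cbx_def dist_norm norm_minus_commute)
 have n0: "u $ i - c $ i ~= 0" if "u \<in> cbx ?S" for u i using n[OF that,of i] R by auto
 have hs: "((%al. iter ?g L (f al) w0) has_sum iter ?g L (%u. H u/(\<Prod>i\<in>UNIV. (u $ i - (c + w) $ i) ^ Suc 0)) w0) UNIV"
 proof (rule iter_has_sum[where B = ?S and M = "%al. (M * (\<Prod>i\<in>(UNIV::'n set). inverse R)) * (\<Prod>i\<in>UNIV. (cmod (w $ i)/R) ^ al i)"])
 show "continuous_on (cbx ?S) (f al)" for al
 unfolding f_def using n0 by (intro continuous_intros cH) auto
 show "(%al. (M * (\<Prod>i\<in>(UNIV::'n set). inverse R)) * (\<Prod>i\<in>UNIV. (cmod (w $ i)/R) ^ al i)) summable_on UNIV"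
 using w R by (intro summable_on_cmult_right geometric_prod_summable) auto
 fix u assume u: "u \<in> cbx ?S"
 show "cmod (f al u) <= (M * (\<Prod>i\<in>(UNIV::'n set). inverse R)) * (\<Prod>i\<in>UNIV. (cmod (w $ i)/R) ^ al i)" for al
 proof -
 have "cmod (f al u) = cmod (H u) * (\<Prod>i\<in>UNIV. (cmod (w $ i)/R) ^ al i * inverse R)"
 using R by (simp add: f_def norm_mult prod_norm[symmetric] norm_power norm_divide norm_inverse n[OF u])
 also have "\<dots> <= M * (\<Prod>i\<in>UNIV. (cmod (w $ i)/R) ^ al i * inverse R)"
 using R by (intro mult_right_mono M u prod_nonneg) auto
 finally show ?thesis by (simp add: prod.distrib mult_ac)
 qed
 have q: "cmod (w $ i/(u $ i - c $ i)) < 1" for i using w[of i] R by (simp add: norm_divide n[OF u])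
 have "((%al. \<Prod>i\<in>UNIV. (w $ i/(u $ i - c $ i)) ^ al i * inverse (u $ i - c $ i)) has_sum
 (\<Prod>i\<in>UNIV. suminf (%k. (w $ i/(u $ i - c $ i)) ^ k * inverse (u $ i - c $ i)))) UNIV"
 using q by (intro has_sum_prod_UNIV) (auto simp: norm_mult norm_power intro!: summable_mult2 summable_geometric)
 also have "(\<Prod>i\<in>UNIV. suminf (%k. (w $ i/(u $ i - c $ i)) ^ k * inverse (u $ i - c $ i))) =
 (\<Prod>i\<in>UNIV. inverse (u $ i - (c + w) $ i))"
 proof (rule prod.cong)
 fix i
 have "suminf (%k. (w $ i/(u $ i - c $ i)) ^ k * inverse (u $ i - c $ i)) =
 1/(1 - w $ i/(u $ i - c $ i)) * inverse (u $ i - c $ i)"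
 using suminf_geometric[OF q[of i]] summable_geometric[OF q[of i]] by (simp add: suminf_mult2[symmetric])
 also have "\<dots> = inverse (u $ i - (c + w) $ i)"
 using n0[OF u,of i] q[of i] by (simp add: divide_simps) (auto simp: algebra_simps)
 finally show "suminf (%k. (w $ i/(u $ i - c $ i)) ^ k * inverse (u $ i - c $ i)) = inverse (u $ i - (c + w) $ i)" .
 qed auto
 finally show "((%al. f al u) has_sum H u/(\<Prod>i\<in>UNIV. (u $ i - (c + w) $ i) ^ Suc 0)) UNIV"
 unfolding f_def by (simp add: divide_inverse prod_inversef[symmetric] o_def has_sum_cmult_right)
 qed (use R w0 in auto)
 have cBx: "v \<in> cbx B" if "!!i. cmod (v $ i - c $ i) < R" for v
 using that cB by (force simp: cbx_def dist_norm norm_minus_commute less_imp_le)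
 let ?K = "\<Prod>i\<in>(UNIV::'n set). 1/(2 * pi * \<i>)"
 have H1: "H (c + w) = ?K * iter ?g L (%u. H u/(\<Prod>i\<in>UNIV. (u $ i - (c + w) $ i) ^ Suc 0)) w0"
 proof -
 have "PDm (%_. 0) L H (c + w) = (\<Prod>i\<in>set L. fact 0/(2 * pi * \<i>)) *
 iter ?g L (%u. H u/(\<Prod>i\<in>set L. (u $ i - (c + w) $ i) ^ Suc 0)) (c + w)"
 using w cB cBx[of "c + w"]
 by (intro PDm_cauchy[where B = B] L(1) R B H) (auto simp: dist_norm)
 moreover have "PDm (%_. 0) M H = H" for M by (induction M) (simp_all add: PDm_simps)
 ultimately show ?thesis using iter_start[of L "c + w" w0 ?g] L by simp
 qed
 have H2: "(\<Prod>i\<in>UNIV. w $ i ^ al i/fact (al i)) * PDm al L H c = ?K * iter ?g L (f al) w0" for al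
 proof -
 have "PDm al L H c = (\<Prod>i\<in>set L. fact (al i)/(2 * pi * \<i>)) *
 iter ?g L (%u. H u/(\<Prod>i\<in>set L. (u $ i - c $ i) ^ Suc (al i))) c"
 using R cB cBx[of c]
 by (intro PDm_cauchy[where B = B] L(1) B H) (auto simp: dist_norm)
 also have "iter ?g L (%u. H u/(\<Prod>i\<in>set L. (u $ i - c $ i) ^ Suc (al i))) c =
 iter ?g L (%u. H u/(\<Prod>i\<in>UNIV. (u $ i - c $ i) ^ Suc (al i))) w0"
 using iter_start[of L c w0 ?g] L by simp
 finally have "(\<Prod>i\<in>UNIV. w $ i ^ al i/fact (al i)) * PDm al L H c =
 ((\<Prod>i\<in>UNIV. w $ i ^ al i/fact (al i)) * (\<Prod>i\<in>UNIV. fact (al i)/(2 * pi * \<i>))) *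
 iter ?g L (%u. H u/(\<Prod>i\<in>UNIV. (u $ i - c $ i) ^ Suc (al i))) w0"
 using L by simp
 also have "(\<Prod>i\<in>UNIV. w $ i ^ al i/fact (al i)) * (\<Prod>i\<in>UNIV. fact (al i)/(2 * pi * \<i>)) =
 ?K * (\<Prod>i\<in>UNIV. w $ i ^ al i)"
 unfolding prod.distrib[symmetric] by (intro prod.cong) auto
 also have "?K * (\<Prod>i\<in>UNIV. w $ i ^ al i) * iter ?g L (%u. H u/(\<Prod>i\<in>UNIV. (u $ i - c $ i) ^ Suc (al i))) w0 =
 ?K * iter ?g L (%u. (\<Prod>i\<in>UNIV. w $ i ^ al i) * (H u/(\<Prod>i\<in>UNIV. (u $ i - c $ i) ^ Suc (al i)))) w0"
 by (simp only: iter_cmult mult.assoc)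
 also have "(%u. (\<Prod>i\<in>UNIV. w $ i ^ al i) * (H u/(\<Prod>i\<in>UNIV. (u $ i - c $ i) ^ Suc (al i)))) = f al"
 by (simp add: fun_eq_iff f_def divide_inverse power_mult_distrib prod.distrib prod_inversef[symmetric] o_def mult_ac power_inverse)
 finally show ?thesis .
 qed
 show ?thesis unfolding H1 H2 by (rule has_sum_cmult_right[OF hs])
qed

section \<open>Sectors as unions of two half planes\<close>

definition lf :: "real => complex => real" where
 "lf th s = Re (s * cis th)"

lemma lf_simps [simp]:
 "lf th (s + t) = lf th s + lf th t" "lf th (s - t) = lf th s - lf th t" "lf th (- s) = - lf th s" "lf th 0 = 0"
 "lf th (of_real r * s) = r * lf th s" "lf th (r *\<^sub>R s) = r * lf th s" "lf th (of_real r) = r * cos th"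
 "lf th (rcis r x) = r * cos (x + th)" "lf 0 s = Re s"
 by (simp_all add: lf_def algebra_simps cos_add)

lemma continuous_on_lf [continuous_intros]: "continuous_on A f ==> continuous_on A (%x. lf th (f x))"
 unfolding lf_def by (intro continuous_intros)

text \<open>The sector of \<open>V_hat\<close> in the first variable (\<open>Sect_Arg2pi\<close>),
  written with two linear functionals. Membership then follows from one strict inequality and
  survives adding vectors on which both functionals are <= 0.\<close>

definition Sect :: "real => complex set" where
 "Sect th = {s. lf th s < 0 \<or> lf (- th) s < 0}"

lemma cos_neg: "pi/2 < x ==> x < 3 * pi/2 ==> cos x < 0"
 using cos_gt_zero_pi[of "x - pi"] by (simp add: cos_diff)

lemma Sect_Arg2pi:
 assumes "0 < th" "th < pi/2"
 shows "s \<in> Sect th \<longleftrightarrow> pi/2 - th < Arg2pi s & Arg2pi s < 3 * pi/2 + th"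
proof (cases "s = 0")
 case True
 then show ?thesis using assms by (auto simp: Sect_def Arg2pi_def)
next
 case False
 define A where "A = Arg2pi s"
 have A: "0 <= A" "A < 2 * pi" using Arg2pi[of s] by (auto simp: A_def)
 have "s = rcis (cmod s) A"
 using cos_Arg2pi[of s] sin_Arg2pi[of s] by (intro complex_eqI) (simp_all add: A_def)
 then have c: "lf x s = cmod s * cos (A + x)" for x
 by (metis lf_simps(8))
 have "s \<in> Sect th \<longleftrightarrow> cos (A + th) < 0 \<or> cos (A - th) < 0"
 using False by (simp add: Sect_def c mult_less_0_iff)
 also have "\<dots> \<longleftrightarrow> pi/2 - th < A & A < 3 * pi/2 + th"
 proof
 assume r: "pi/2 - th < A & A < 3 * pi/2 + th"
 show "cos (A + th) < 0 \<or> cos (A - th) < 0"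
 proof (cases "A < 3 * pi/2 - th")
 case True
 then show ?thesis using r by (intro disjI1 cos_neg) auto
 next
 case False
 then show ?thesis using r assms by (intro disjI2 cos_neg) auto
 qed
 next
 assume n: "cos (A + th) < 0 \<or> cos (A - th) < 0"
 show "pi/2 - th < A & A < 3 * pi/2 + th"
 proof (rule ccontr)
 assume "\<not> (pi/2 - th < A & A < 3 * pi/2 + th)"
 then consider "A <= pi/2 - th" | "A \<ge> 3 * pi/2 + th" by linarith
 then show False
 proof cases
 case 1
 then show ?thesis using n A assms cos_ge_zero[of "A + th"] cos_ge_zero[of "A - th"] by auto
 next
 case 2
 have "cos (A + th) = cos (A + th - 2 * pi)" "cos (A - th) = cos (A - th - 2 * pi)"
 by (simp_all add: cos_diff)
 then show ?thesis
 using 2 n A assms cos_ge_zero[of "A + th - 2 * pi"] cos_ge_zero[of "A - th - 2 * pi"] by auto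
 qed
 qed
 qed
 finally show ?thesis by (simp add: A_def)
qed

text \<open>Multiplied by sin (2 th) > 0, the functionals at th' and -th' are combinations of those
  at th and -th with the nonnegative coefficients p and q. If neither of the latter is negative,
  neither of the former is.\<close>

lemma Sect_mono:
 assumes "0 <= th'" "th' <= th" "0 < th" "th < pi/2"
 shows "Sect th' <= Sect th"
proof
 fix s assume s: "s \<in> Sect th'"
 define p q where "p = sin (th + th')" and "q = sin (th - th')"
 have pq: "p \<ge> 0" "q \<ge> 0" "sin (2 * th) > 0"
 using assms by (auto simp: p_def q_def intro!: sin_ge_zero sin_gt_zero)
 have e: "sin (2 * th) * lf th' s = p * lf th s + q * lf (- th) s"
 "sin (2 * th) * lf (- th') s = q * lf th s + p * lf (- th) s"
 unfolding sin_double p_def q_def lf_def by (simp_all add: sin_add sin_diff algebra_simps)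
 show "s \<in> Sect th"
 proof (rule ccontr)
 assume "s \<notin> Sect th"
 then have n: "lf th s \<ge> 0" "lf (- th) s \<ge> 0" unfolding Sect_def mem_Collect_eq by linarith+
 have "sin (2 * th) * lf th' s \<ge> 0" "sin (2 * th) * lf (- th') s \<ge> 0"
 unfolding e using n pq by auto
 then show False using s pq(3) unfolding Sect_def mem_Collect_eq by (auto simp: zero_le_mult_iff)
 qed
qed

lemma Sect_add:
 assumes "s \<in> Sect th" "lf th u <= 0" "lf (- th) u <= 0"
 shows "s + u \<in> Sect th"
 using assms by (auto simp: Sect_def)

lemma Sect_cis:
 assumes "\<bar>x\<bar> < pi/2 + th" "0 < th" "th < pi/2" "r > 0"
 shows "- rcis r x \<in> Sect th"
proof -
 have "cos (x + th) > 0 \<or> cos (x - th) > 0"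
 proof (cases "x < pi/2 - th")
 case True
 then show ?thesis using assms by (intro disjI1 cos_gt_zero_pi) auto
 next
 case False
 then show ?thesis using assms by (intro disjI2 cos_gt_zero_pi) auto
 qed
 then show ?thesis using assms(4) by (auto simp: Sect_def)
qed

lemma open_Sect: "open (Sect th)"
 unfolding Sect_def Collect_disj_eq
 by (intro open_Un open_Collect_less continuous_intros)

text \<open>On the negative real axis both functionals are negative. A point of the sector makes one
  of them negative, and that one stays negative along the whole segment from a. The sector itself is
  not convex, so starlikeness is what gives primitives here.\<close>

lemma starlike_Sect:
 assumes C: "convex C" and a: "a \<in> C" "m * a + v = - of_real \<tau>" "\<tau> > 0" and th: "0 < th" "th < pi/2"
 shows "starlike {s \<in> C. m * s + v \<in> Sect th}"
proof -
 have aS: "lf th (m * a + v) < 0" "lf (- th) (m * a + v) < 0"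
 unfolding a(2) using a th cos_gt_zero_pi[of th] by auto
 have "closed_segment a x <= {s \<in> C. m * s + v \<in> Sect th}" if x: "x \<in> C" "m * x + v \<in> Sect th" for x
 proof
 fix y assume y: "y \<in> closed_segment a x"
 then have yC: "y \<in> C" using C a x closed_segment_subset by blast
 obtain u where u: "0 <= u" "u <= 1" "y = (1 - u) *\<^sub>R a + u *\<^sub>R x" using y by (auto simp: closed_segment_def)
 have Ry: "lf w (m * y + v) = (1 - u) * lf w (m * a + v) + u * lf w (m * x + v)" for w
 proof -
 have "m * y + v = of_real (1 - u) * (m * a + v) + of_real u * (m * x + v)"
 by (simp add: u(3) scaleR_conv_of_real algebra_simps)
 then show ?thesis by (simp only: lf_simps)
 qed
 have neg: "(1 - u) * p + u * q < 0" if "p < 0" "q < 0" for p q :: real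
 proof (cases "u = 0")
 case False
 then have "u * q < 0" using u(1) that(2) by (simp add: mult_pos_neg)
 moreover have "(1 - u) * p <= 0" using u(2) that(1) by (simp add: mult_nonneg_nonpos)
 ultimately show ?thesis by simp
 qed (use that in simp)
 show "y \<in> {s \<in> C. m * s + v \<in> Sect th}"
 using yC x(2) aS neg unfolding Sect_def mem_Collect_eq Ry by blast
 qed
 moreover have "a \<in> {s \<in> C. m * s + v \<in> Sect th}"
 using a(1) aS unfolding Sect_def by blast
 ultimately show ?thesis unfolding starlike_def by blast
qed

lemma starlike_primitive:
 assumes "open S" "starlike S" "f holomorphic_on S"
 obtains F where "!!p. valid_path p ==> path_image p <= S ==>
 (f has_contour_integral F (pathfinish p) - F (pathstart p)) p"
proof -
 obtain F where F: "!!x. x \<in> S ==> (F has_field_derivative f x) (at x)"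
 using holomorphic_starlike_primitive[of S f "{}"] assms
 by (auto simp: holomorphic_on_imp_continuous_on holomorphic_on_imp_differentiable_at)
 show ?thesis
 by (rule that[of F],rule contour_integral_primitive[of S]) (auto intro: F has_field_derivative_at_within)
qed

subsection \<open>The integration paths\<close>

text \<open>The first path gamma_1 for z = 0 and eta = 1; \<open>gamma_path_idx1\<close> recovers
  the general case by an affine map.\<close>

definition gam :: "real => real => real => real => complex" where
 "gam \<rho> th ep = linepath (beta0 \<rho> th) (of_real ep * beta0 \<rho> th) +++
 part_circlepath 0 (ep * \<rho>/2) (- ((pi + th)/2)) ((pi + th)/2) +++
 linepath (of_real ep * beta1 \<rho> th) (beta1 \<rho> th)"

lemma beta_rcis: "beta0 \<rho> th = rcis (\<rho>/2) (- ((pi + th)/2))" "beta1 \<rho> th = rcis (\<rho>/2) ((pi + th)/2)"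
 by (simp_all add: beta0_def beta1_def rcis_def cis_conv_exp)

lemma gamma_path_idx1: "gamma_path z eta \<rho> th ep idx1 = (%t. z $ idx1 + eta * gam \<rho> th ep t)"
proof -
 have "arc_path (z $ idx1) eta \<rho> th ep t = z $ idx1 + eta * part_circlepath 0 (ep * \<rho>/2) (- ((pi + th)/2)) ((pi + th)/2) t" for t
 proof -
 have "(pi + th) * (2 * t - 1)/2 = linepath (- ((pi + th)/2)) ((pi + th)/2) t"
 by (simp add: linepath_def field_simps)
 then show ?thesis unfolding arc_path_def part_circlepath_def by simp
 qed
 then show ?thesis
 by (auto simp: gamma_path_def gam_def fun_eq_iff joinpaths_def linepath_def scaleR_conv_of_real algebra_simps)
qed

lemma gam_ends:
 "pathfinish (linepath (beta0 \<rho> th) (of_real ep * beta0 \<rho> th)) =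
 pathstart (part_circlepath 0 (ep * \<rho>/2) (- ((pi + th)/2)) ((pi + th)/2))"
 "pathfinish (part_circlepath 0 (ep * \<rho>/2) (- ((pi + th)/2)) ((pi + th)/2)) =
 pathstart (linepath (of_real ep * beta1 \<rho> th) (beta1 \<rho> th))"
 by (simp_all add: beta_rcis rcis_def cis_conv_exp mult_ac)

lemma npath_gam [simp]: "npath (gam \<rho> th ep)"
 unfolding gam_def using gam_ends by (intro npath_join) auto

lemma gam_startfinish [simp]: "pathstart (gam \<rho> th ep) = beta0 \<rho> th" "pathfinish (gam \<rho> th ep) = beta1 \<rho> th"
 by (simp_all add: gam_def)

lemma arc_image:
 assumes "0 < th" "u \<in> path_image (part_circlepath 0 r (- ((pi + th)/2)) ((pi + th)/2))"
 obtains x where "\<bar>x\<bar> <= (pi + th)/2" "u = rcis r x"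
proof -
 have "0 < (pi + th)/2" using assms by (simp add: add_pos_pos)
 then have "- ((pi + th)/2) <= (pi + th)/2" by linarith
 with assms(2) obtain x where x: "x \<in> {- ((pi + th)/2)..(pi + th)/2}" "u = of_real r * cis x"
 by (auto simp: path_image_part_circlepath cis_conv_exp)
 have "\<bar>x\<bar> <= (pi + th)/2" using x(1) unfolding atLeastAtMost_iff abs_le_iff by linarith
 then show ?thesis using x(2) by (intro that[of x]) (simp_all add: rcis_def)
qed

lemma gam_image:
 assumes "0 < ep" "ep <= 1" "0 < th" "0 < \<rho>" and u: "u \<in> path_image (gam \<rho> th ep)"
 obtains (ray0) t where "ep <= t" "t <= 1" "u = of_real t * beta0 \<rho> th"
 | (arc) x where "\<bar>x\<bar> <= (pi + th)/2" "u = rcis (ep * \<rho>/2) x"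
 | (ray1) t where "ep <= t" "t <= 1" "u = of_real t * beta1 \<rho> th"
proof -
 have seg: "EX t. ep <= t & t <= 1 & u = of_real t * b" if u: "u \<in> closed_segment b (of_real ep * b)" for b
 proof -
 obtain x where x: "0 <= x" "x <= 1" "u = (1 - x) *\<^sub>R b + x *\<^sub>R (of_real ep * b)"
 using u by (auto simp: closed_segment_def)
 have "x * (1 - ep) <= 1 * (1 - ep)" "0 <= x * (1 - ep)" using x assms by (simp_all add: mult_left_le_one_le)
 then show ?thesis
 by (intro exI[of _ "1 - x * (1 - ep)"]) (auto simp: x(3) scaleR_conv_of_real algebra_simps)
 qed
 consider "u \<in> closed_segment (beta0 \<rho> th) (of_real ep * beta0 \<rho> th)"
 | "u \<in> path_image (part_circlepath 0 (ep * \<rho>/2) (- ((pi + th)/2)) ((pi + th)/2))"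
 | "u \<in> closed_segment (beta1 \<rho> th) (of_real ep * beta1 \<rho> th)"
 using u gam_ends unfolding gam_def by (auto simp: path_image_join closed_segment_commute)
 then show ?thesis
 proof cases
 case 1 then show ?thesis using seg that(1) by blast
 next
 case 2 then show ?thesis using arc_image[OF assms(3)] that(2) by metis
 next
 case 3 then show ?thesis using seg that(3) by blast
 qed
qed

lemma gam_image_rcis:
 assumes "0 < ep" "ep <= 1" "0 < th" "0 < \<rho>" "u \<in> path_image (gam \<rho> th ep)"
 obtains r x where "0 < r" "r <= \<rho>/2" "\<bar>x\<bar> <= (pi + th)/2" "u = rcis r x"
proof (rule gam_image[OF assms])
 fix t assume "ep <= t" "t <= 1" "u = of_real t * beta0 \<rho> th"
 then show ?thesis using assms
 by (intro that[of "t * (\<rho>/2)" "- ((pi + th)/2)"]) (auto simp: beta_rcis rcis_def)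
next
 fix x assume "\<bar>x\<bar> <= (pi + th)/2" "u = rcis (ep * \<rho>/2) x"
 then show ?thesis using assms
 by (intro that[of "ep * \<rho>/2" x]) auto
next
 fix t assume "ep <= t" "t <= 1" "u = of_real t * beta1 \<rho> th"
 then show ?thesis using assms
 by (intro that[of "t * (\<rho>/2)" "(pi + th)/2"]) (auto simp: beta_rcis rcis_def)
qed

lemma Sect_minus_rcis:
 assumes "\<bar>x\<bar> <= (pi + th)/2" "\<bar>Arg eta\<bar> < th/2" "0 < th" "th < pi/2" "r > 0" "eta ~= 0"
 shows "- (eta * rcis r x) \<in> Sect th"
proof -
 have "eta * rcis r x = rcis (cmod eta * r) (Arg eta + x)"
 using rcis_cmod_Arg[of eta] rcis_mult[of "cmod eta" "Arg eta" r x] by simp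
 then show ?thesis using assms by (simp only:,intro Sect_cis) auto
qed

text \<open>Only the part of the path near a depends on epsilon. It runs in a starlike subset S of
  D, where f has a primitive, while the outer parts of the rays are common to both paths.\<close>

lemma gam_eps_le:
 assumes D: "open D" and f: "f holomorphic_on D" and eta: "eta ~= 0" "\<bar>Arg eta\<bar> < th/2"
 and th: "0 < th" "th < pi/2" and \<rho>: "0 < \<rho>" and R: "R > 0"
 and AD: "!!s. cmod (s - a) < R ==> a - s \<in> Sect th ==> s \<in> D"
 and ray: "!!t. 0 < t ==> t <= 1 ==> a + eta * (of_real t * beta0 \<rho> th) \<in> D"
 "!!t. 0 < t ==> t <= 1 ==> a + eta * (of_real t * beta1 \<rho> th) \<in> D"
 and ep: "0 < ep" "ep <= ep'" "ep' <= 1" "ep' * \<rho> * cmod eta < 2 * R"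
 shows "contour_integral (%t. a + eta * gam \<rho> th ep t) f = contour_integral (%t. a + eta * gam \<rho> th ep' t) f"
proof -
 let ?A = "%s. a + eta * s"
 let ?arc = "%e. part_circlepath 0 (e * \<rho>/2) (- ((pi + th)/2)) ((pi + th)/2)"
 let ?b0 = "%e. ?A (of_real e * beta0 \<rho> th)" and ?b1 = "%e. ?A (of_real e * beta1 \<rho> th)"
 define S where "S = {s \<in> ball a R. (- 1) * s + a \<in> Sect th}"
 have SD: "S <= D" using AD by (auto simp: S_def dist_norm norm_minus_commute)
 have "S = ball a R Int (%s. (- 1) * s + a) -` Sect th" by (auto simp: S_def)
 moreover have "open ((%s. (- 1) * s + a) -` Sect th)"
 by (intro open_vimage open_Sect continuous_intros)
 ultimately have "open S" by auto
 \<comment> \<open>The centre a + R/2 is a point at which a - s is a negative real number.\<close>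
 moreover have "starlike S" unfolding S_def
 by (rule starlike_Sect[where a = "a + of_real (R/2)" and \<tau> = "R/2"]) (use R th in \<open>auto simp: dist_norm\<close>)
 ultimately obtain F where F: "!!p. valid_path p ==> path_image p <= S ==>
 (f has_contour_integral F (pathfinish p) - F (pathstart p)) p"
 using starlike_primitive[of S f] holomorphic_on_subset[OF f SD] by metis
 have cont: "continuous_on D f" using f by (rule holomorphic_on_imp_continuous_on)
 have inS: "?A (rcis r x) \<in> S" if "\<bar>x\<bar> <= (pi + th)/2" "0 < r" "r <= ep' * \<rho>/2" for r x
 proof -
 have "cmod (eta * rcis r x) = cmod eta * r" using that by (simp add: norm_mult)
 also have "\<dots> <= cmod eta * (ep' * \<rho>/2)" using that by (intro mult_left_mono) auto
 also have "\<dots> < R" using ep by (simp add: mult_ac)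
 finally show ?thesis using Sect_minus_rcis[OF that(1) eta(2) th that(2) eta(1)] by (simp add: S_def dist_norm)
 qed
 have arcS: "path_image (%t. ?A (?arc e t)) <= S" if e: "0 < e" "e <= ep'" for e
 proof -
 have im: "path_image (?arc e) <= {rcis (e * \<rho>/2) x | x. \<bar>x\<bar> <= (pi + th)/2}"
 using arc_image[OF th(1)] by blast
 have "e * \<rho>/2 <= ep' * \<rho>/2" "0 < e * \<rho>/2" using e \<rho> by auto
 then show ?thesis unfolding path_image_affine using im inS by blast
 qed
 have rayS: "?b0 e \<in> S" "?b1 e \<in> S" if e: "0 < e" "e <= ep'" for e
 proof -
 have "0 < e * \<rho>/2" "e * \<rho>/2 <= ep' * \<rho>/2" using e \<rho> by auto
 moreover have "of_real e * beta0 \<rho> th = rcis (e * \<rho>/2) (- ((pi + th)/2))" "of_real e * beta1 \<rho> th = rcis (e * \<rho>/2) ((pi + th)/2)"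
 by (simp_all add: beta_rcis rcis_def)
 ultimately show "?b0 e \<in> S" "?b1 e \<in> S" using inS th by (auto simp: abs_le_iff)
 qed
 have segI: "EX t. e <= t & t <= e' & y = ?A (of_real t * b)"
 if y: "y \<in> closed_segment (?A (of_real e * b)) (?A (of_real e' * b))" and e: "e <= e'" for e e' y b
 proof -
 obtain x where x: "0 <= x" "x <= 1" "y = (1 - x) *\<^sub>R ?A (of_real e * b) + x *\<^sub>R ?A (of_real e' * b)"
 using y unfolding closed_segment_def by blast
 have "x * (e' - e) <= 1 * (e' - e)" "0 <= x * (e' - e)" using x e by (simp_all add: mult_left_le_one_le)
 then show ?thesis
 by (intro exI[of _ "e + x * (e' - e)"]) (auto simp: x(3) scaleR_conv_of_real algebra_simps)
 qed
 have segS: "closed_segment (?b0 ep) (?b0 ep') <= S" "closed_segment (?b1 ep) (?b1 ep') <= S"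
 proof -
 show "closed_segment (?b0 ep) (?b0 ep') <= S"
 proof
 fix y assume "y \<in> closed_segment (?b0 ep) (?b0 ep')"
 from segI[OF this ep(2)] obtain t where "ep <= t" "t <= ep'" "y = ?b0 t" by blast
 then show "y \<in> S" using rayS(1)[of t] ep(1) by simp
 qed
 show "closed_segment (?b1 ep) (?b1 ep') <= S"
 proof
 fix y assume "y \<in> closed_segment (?b1 ep) (?b1 ep')"
 from segI[OF this ep(2)] obtain t where "ep <= t" "t <= ep'" "y = ?b1 t" by blast
 then show "y \<in> S" using rayS(2)[of t] ep(1) by simp
 qed
 qed
 have segD: "closed_segment (?b0 e) (?b0 1) <= D" "closed_segment (?b1 e) (?b1 1) <= D" if e: "0 < e" "e <= 1" for e
 proof -
 show "closed_segment (?b0 e) (?b0 1) <= D"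
 proof
 fix y assume "y \<in> closed_segment (?b0 e) (?b0 1)"
 from segI[OF this e(2)] obtain t where "e <= t" "t <= 1" "y = ?b0 t" by blast
 then show "y \<in> D" using ray(1)[of t] e(1) by simp
 qed
 show "closed_segment (?b1 e) (?b1 1) <= D"
 proof
 fix y assume "y \<in> closed_segment (?b1 e) (?b1 1)"
 from segI[OF this e(2)] obtain t where "e <= t" "t <= 1" "y = ?b1 t" by blast
 then show "y \<in> D" using ray(2)[of t] e(1) by simp
 qed
 qed
 have mid: "?b0 ep' \<in> closed_segment (?b0 1) (?b0 ep)" "?b1 ep' \<in> closed_segment (?b1 ep) (?b1 1)"
 proof -
 define x where "x = (if ep = 1 then 0 else (1 - ep')/(1 - ep))"
 have x: "0 <= x" "x <= 1" "1 - x * (1 - ep) = ep'" using ep by (auto simp: x_def divide_le_eq)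
 have "?A (of_real ep' * b) = (1 - x) *\<^sub>R ?A (of_real 1 * b) + x *\<^sub>R ?A (of_real ep * b)" for b
 unfolding x(3)[symmetric] by (simp add: scaleR_conv_of_real algebra_simps)
 then have m: "?A (of_real ep' * b) \<in> closed_segment (?A (of_real 1 * b)) (?A (of_real ep * b))" for b
 unfolding closed_segment_def using x by blast
 show "?b0 ep' \<in> closed_segment (?b0 1) (?b0 ep)" "?b1 ep' \<in> closed_segment (?b1 ep) (?b1 1)"
 using m by (simp_all add: closed_segment_commute)
 qed
 have split: "contour_integral (%t. ?A (gam \<rho> th e t)) f = contour_integral (linepath (?b0 1) (?b0 e)) f +
 (contour_integral (%t. ?A (?arc e t)) f + contour_integral (linepath (?b1 e) (?b1 1)) f)"
 if e: "0 < e" "e <= ep'" for e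
 proof -
 have eq: "(%t. ?A (gam \<rho> th e t)) = linepath (?b0 1) (?b0 e) +++ (%t. ?A (?arc e t)) +++ linepath (?b1 e) (?b1 1)"
 by (auto simp: gam_def joinpaths_def linepath_def scaleR_conv_of_real algebra_simps)
 have ends: "pathfinish (linepath (?b0 1) (?b0 e)) = pathstart (%t. ?A (?arc e t))"
 "pathfinish (%t. ?A (?arc e t)) = pathstart (linepath (?b1 e) (?b1 1))"
 using gam_ends(1)[of \<rho> th e] gam_ends(2)[of e \<rho> th] by (simp_all add: pathfinish_def pathstart_def linepath_def)
 have "closed_segment (?b0 1) (?b0 e) <= D" "closed_segment (?b1 e) (?b1 1) <= D"
 using segD[of e] e ep unfolding closed_segment_commute[of "?b0 1"] by simp_all
 then have im: "path_image (linepath (?b0 1) (?b0 e)) <= D" "path_image (%t. ?A (?arc e t)) <= D"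
 "path_image (linepath (?b1 e) (?b1 1)) <= D"
 using arcS[OF e] SD by auto
 then have c2: "continuous_on (path_image ((%t. ?A (?arc e t)) +++ linepath (?b1 e) (?b1 1))) f"
 using ends(2) by (intro continuous_on_subset[OF cont]) (simp add: path_image_join)
 have c1: "continuous_on (path_image (linepath (?b0 1) (?b0 e) +++ (%t. ?A (?arc e t)) +++ linepath (?b1 e) (?b1 1))) f"
 using ends im by (intro continuous_on_subset[OF cont]) (simp add: path_image_join)
 show ?thesis unfolding eq
 using CI_join[OF npath_linepath npath_join[OF npath_affine[OF npath_part_circlepath] npath_linepath ends(2)] _ c1]
 CI_join[OF npath_affine[OF npath_part_circlepath] npath_linepath ends(2) c2] ends(1) by simp
 qed
 have s0: "contour_integral (linepath (?b0 1) (?b0 ep)) f =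
 contour_integral (linepath (?b0 1) (?b0 ep')) f + contour_integral (linepath (?b0 ep') (?b0 ep)) f"
 using segD[of ep] ep mid by (intro contour_integral_split_linepath continuous_on_subset[OF cont]) (simp_all add: closed_segment_commute)
 have s1: "contour_integral (linepath (?b1 ep) (?b1 1)) f =
 contour_integral (linepath (?b1 ep) (?b1 ep')) f + contour_integral (linepath (?b1 ep') (?b1 1)) f"
 using segD[of ep] ep mid by (intro contour_integral_split_linepath continuous_on_subset[OF cont]) simp_all
 have arcF: "contour_integral (%t. ?A (?arc e t)) f = F (?b1 e) - F (?b0 e)" if e: "0 < e" "e <= ep'" for e
 using contour_integral_unique[OF F[OF npath_valid[OF npath_affine[OF npath_part_circlepath]] arcS[OF e]]]
 gam_ends(1)[of \<rho> th e] gam_ends(2)[of e \<rho> th] by (simp add: pathfinish_def pathstart_def linepath_def)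
 have l0: "contour_integral (linepath (?b0 ep') (?b0 ep)) f = F (?b0 ep) - F (?b0 ep')"
 using contour_integral_unique[OF F[of "linepath (?b0 ep') (?b0 ep)"]] segS by (simp add: closed_segment_commute)
 have l1: "contour_integral (linepath (?b1 ep) (?b1 ep')) f = F (?b1 ep') - F (?b1 ep)"
 using contour_integral_unique[OF F[of "linepath (?b1 ep) (?b1 ep')"]] segS by simp
 show ?thesis
 using split[of ep] split[of ep'] s0 s1 l0 l1 arcF[of ep] arcF[of ep'] ep by simp
qed

text \<open>Both loops wind once around a inside the annulus with radii m and M; a simultaneous
  rotation and dilation is a homotopy between them.\<close>

lemma circle_scale:
 assumes D: "open D" and f: "f holomorphic_on D"
 and AD: "!!s. m < cmod (s - a) ==> cmod (s - a) < M ==> s \<in> D"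
 and R: "0 < R" "m < R" "R < M" and c: "0 < c" "b ~= 0" "m < cmod b * c" "cmod b * c < M"
 shows "contour_integral (circlepath a R) f = contour_integral (%t. a + b * circlepath 0 c t) f"
proof (rule Cauchy_theorem_homotopic_loops[OF _ D f])
 \<comment> \<open>The homotopy interpolates linearly between ln R and this logarithm of the complex
   radius b c, so the modulus always lies between R and |b| c.\<close>
 define q where "q = Ln (b * of_real c)"
 have q: "exp q = b * of_real c" using c by (simp add: q_def)
 have Rq: "exp (Re q) = cmod b * c" using c by (simp add: norm_exp_eq_Re[symmetric] q norm_mult)
 let ?h = "%(\<tau>,t). a + exp (of_real (1 - \<tau>) * of_real (ln R) + of_real \<tau> * q) * exp (2 * of_real pi * \<i> * of_real t)"
 have mod: "m < cmod (?h (\<tau>,t) - a) & cmod (?h (\<tau>,t) - a) < M" if "\<tau> \<in> {0..1}" for \<tau> t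
 proof -
 let ?y = "(1 - \<tau>) * ln R + \<tau> * Re q"
 have "cmod (?h (\<tau>,t) - a) = exp ?y" by (simp add: norm_mult norm_exp_eq_Re)
 moreover have "min (ln R) (Re q) <= ?y" "?y <= max (ln R) (Re q)"
 proof -
 have "(1 - \<tau>) * min (ln R) (Re q) + \<tau> * min (ln R) (Re q) <= ?y"
 using that by (intro add_mono mult_left_mono) auto
 then show "min (ln R) (Re q) <= ?y" by (simp add: algebra_simps)
 have "?y <= (1 - \<tau>) * max (ln R) (Re q) + \<tau> * max (ln R) (Re q)"
 using that by (intro add_mono mult_left_mono) auto
 then show "?y <= max (ln R) (Re q)" by (simp add: algebra_simps)
 qed
 moreover have "exp (min (ln R) (Re q)) = min R (cmod b * c)" "exp (max (ln R) (Re q)) = max R (cmod b * c)"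
 using R Rq by (auto simp: min_def max_def not_le) (smt (verit) exp_ln exp_le_cancel_iff)+
 ultimately have "min R (cmod b * c) <= cmod (?h (\<tau>,t) - a)" "cmod (?h (\<tau>,t) - a) <= max R (cmod b * c)"
 by (metis exp_le_cancel_iff)+
 then show ?thesis using R c by linarith
 qed
 show "homotopic_loops D (circlepath a R) (%t. a + b * circlepath 0 c t)"
 unfolding homotopic_loops
 proof (intro exI[of _ ?h] conjI ballI)
 show "continuous_on ({0..1} \<times> {0..1}) ?h" unfolding case_prod_unfold by (intro continuous_intros)
 show "?h \<in> {0..1} \<times> {0..1} \<rightarrow> D" using mod AD by (auto simp del: of_real_diff)
 show "?h (0,x) = circlepath a R x" for x using R by (simp add: circlepath exp_of_real)
 show "?h (1,x) = a + b * circlepath 0 c x" for x by (simp add: circlepath q)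
 show "pathfinish (?h \<circ> Pair t) = pathstart (?h \<circ> Pair t)" for t
 by (simp add: pathfinish_def pathstart_def)
 qed
 show "valid_path (%t. a + b * circlepath 0 c t)" by (intro npath_valid npath_affine npath_circlepath)
qed auto

lemma circle_eq_0:
 assumes "f holomorphic_on ball a M" "cmod b * c < M" "0 < c"
 shows "contour_integral (%t. a + b * circlepath 0 c t) f = 0"
proof -
 have "path_image (%t. a + b * circlepath 0 c t) <= ball a M"
 using assms unfolding path_image_affine by (auto simp: dist_norm norm_mult)
 then have "(f has_contour_integral 0) (%t. a + b * circlepath 0 c t)"
 using npath_valid[OF npath_affine[OF npath_circlepath[of 0 c],of a b]]
 by (intro Cauchy_theorem_disc_simple[OF assms(1)]) (auto simp: pathfinish_def pathstart_def circlepath)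
 then show ?thesis by (rule contour_integral_unique)
qed

subsection \<open>The domains\<close>

lemma maxnorm_le_iff: "maxnorm z <= c \<longleftrightarrow> (ALL i. cmod (z $ i) <= c)"
 and maxnorm_less_iff: "maxnorm z < c \<longleftrightarrow> (ALL i. cmod (z $ i) < c)"
 unfolding maxnorm_def by (auto simp: Max_le_iff Max_less_iff)

lemma sectorD:
 assumes "eta \<in> sector r th"
 shows "eta ~= 0" "cmod eta < r" "\<bar>Arg eta\<bar> < th/4" "cmod eta > 0"
 using assms by (auto simp: sector_def)

lemma sector_mono: "r <= r' ==> th <= th' ==> sector r th <= sector r' th'"
 by (auto simp: sector_def)

lemma sector_scale: "eta \<in> sector r th ==> 0 < t ==> t <= 1 ==> of_real t * eta \<in> sector r th"
 by (auto simp: sector_def norm_mult mult_le_one intro: le_less_trans[OF mult_left_le_one_le])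

text \<open>The bound on th means |Arg| < pi on the sector, which thus avoids the ray where
  \<open>Arg\<close> jumps.\<close>

lemma open_sector:
 assumes "th < 4 * pi" shows "open (sector r th)"
proof -
 let ?U = "- \<real>\<^sub>\<le>\<^sub>0 :: complex set"
 have "open ?U" by auto
 moreover have "continuous_on ?U Arg" by (intro continuous_at_imp_continuous_on ballI continuous_at_Arg) auto
 ultimately have "open (?U Int Arg -` {- (th/4)<..<th/4})"
 using continuous_open_preimage[of ?U Arg] by auto
 moreover have "sector r th = ball 0 r Int (?U Int Arg -` {- (th/4)<..<th/4})"
 proof -
 have "eta \<in> ?U" if "eta ~= 0" "\<bar>Arg eta\<bar> < th/4" for eta
 using that assms Arg_eq_pi[of eta] by (auto simp: complex_nonpos_Reals_iff complex_eq_iff)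
 then show ?thesis by (auto simp: sector_def abs_less_iff)
 qed
 ultimately show ?thesis by auto
qed

lemma V_multi_iff:
 assumes "admissible k"
 shows "(z,w,eta) \<in> V_multi k al \<longleftrightarrow> maxnorm z < rad' k & eta \<in> sector (rad k) (theta k) &
 cmod (z $ idx1 - w $ idx1) < rho k * cmod eta & (ALL i. i ~= idx1 --> cmod (z $ i - w $ i) < rad' k) &
 (idx1 \<in> al --> z $ idx1 - w $ idx1 \<in> Sect (theta k)) &
 (\<forall>i\<in>al. i ~= idx1 --> cmod eta < rho k * cmod (z $ i - w $ i))"
proof -
 have th: "0 < theta k" "theta k < pi/2" using assms by (auto simp: admissible_def)
 define A where "A \<longleftrightarrow> maxnorm z < rad' k & eta \<in> sector (rad k) (theta k) &
 cmod (z $ idx1 - w $ idx1) < rho k * cmod eta & (ALL i. i ~= idx1 --> cmod (z $ i - w $ i) < rad' k)"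
 have U: "(z,w,eta) \<in> U_hat k \<longleftrightarrow> A" by (simp add: U_hat_def A_def)
 have V: "(z,w,eta) \<in> V_hat k i \<longleftrightarrow> A & (if i = idx1 then z $ idx1 - w $ idx1 \<in> Sect (theta k)
 else cmod eta < rho k * cmod (z $ i - w $ i))" for i
 by (simp add: V_hat_def U Sect_Arg2pi[OF th])
 have "(z,w,eta) \<in> V_multi k al \<longleftrightarrow> A & (idx1 \<in> al --> z $ idx1 - w $ idx1 \<in> Sect (theta k)) &
 (\<forall>i\<in>al. i ~= idx1 --> cmod eta < rho k * cmod (z $ i - w $ i))"
 unfolding V_multi_def Int_iff INT_iff U V by (auto split: if_splits)
 then show ?thesis unfolding A_def by blast
qed

lemma open_V_multi:
 assumes "admissible k"
 shows "open (V_multi k al :: 'a::{finite,linorder} triple set)"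
proof -
 have th: "theta k < 4 * pi" using assms by (auto simp: admissible_def)
 have eq: "V_multi k al = {p :: 'a triple. (\<forall>i\<in>UNIV. cmod (fst p $ i) < rad' k) & snd (snd p) \<in> sector (rad k) (theta k) &
 cmod (fst p $ idx1 - fst (snd p) $ idx1) < rho k * cmod (snd (snd p)) &
 (\<forall>i\<in>- {idx1}. cmod (fst p $ i - fst (snd p) $ i) < rad' k) &
 (\<forall>i\<in>al Int {idx1}. fst p $ i - fst (snd p) $ i \<in> Sect (theta k)) &
 (\<forall>i\<in>al - {idx1}. cmod (snd (snd p)) < rho k * cmod (fst p $ i - fst (snd p) $ i))}" (is "_ = ?R")
 proof (rule set_eqI)
 fix p :: "'a triple"
 obtain z w eta where p: "p = (z,w,eta)" by (cases p)
 show "p \<in> V_multi k al \<longleftrightarrow> p \<in> ?R"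
 unfolding p V_multi_iff[OF assms] maxnorm_less_iff by auto
 qed
 have op1: "open ((%p::'a triple. snd (snd p)) -` sector (rad k) (theta k))"
 by (intro open_vimage open_sector th continuous_intros)
 have op2: "open ((%p::'a triple. fst p $ i - fst (snd p) $ i) -` Sect (theta k))" for i
 by (intro open_vimage open_Sect continuous_intros)
 have opb: "open {p :: 'a triple. \<forall>i\<in>A. P i p}" if "!!i. open {p. P i p}" for A :: "'a set" and P
 proof -
 have "{p. \<forall>i\<in>A. P i p} = (\<Inter>i\<in>A. {p. P i p})" by auto
 then show ?thesis using that by auto
 qed
 show ?thesis unfolding eq
 by (intro open_Collect_conj opb op1[unfolded vimage_def] op2[unfolded vimage_def] open_Collect_less continuous_intros)
qed

section \<open>Rescaled contours and holomorphy of the symbol\<close>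

abbreviation L0 :: "'n::{finite,linorder} list" where
 "L0 \<equiv> sorted_list_of_set UNIV"

definition Lr :: "'n::{finite,linorder} list" where
 "Lr = sorted_list_of_set (UNIV - {idx1})"

text \<open>Makes the integral over the first coordinate the outermost one, so that differentiating
  its moving path leaves integrals over \<open>Lr\<close> as boundary terms.\<close>

lemma L0_Cons: "(L0 :: 'n::{finite,linorder} list) = idx1 # Lr"
 unfolding Lr_def idx1_def using sorted_list_of_set_nonempty[of "UNIV :: 'n set"] by simp

lemma set_Lr [simp]: "set Lr = UNIV - {idx1}" and distinct_Lr [simp]: "distinct Lr"
 by (simp_all add: Lr_def)

lemma prod_integral_iter: "prod_integral g f = iter g L0 f 0"
 by (simp add: prod_integral_def iter_def)

text \<open>The contour for u where w = z + eta u. The radius 2/rho lies inside the annulus 1/rho <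
  |u_i| < 3/rho on which integrands will be known to be holomorphic.\<close>

definition G :: "kappa => real => 'n::{finite,linorder} => real => complex" where
 "G k ep i = (if i = idx1 then gam (rho k) (theta k) ep else circlepath 0 (2/rho k))"

lemma npath_G [simp]: "npath (G k ep i)"
 by (simp add: G_def)

lemma admissibleD:
 assumes "admissible k"
 shows "0 < rad k" "0 < rad' k" "0 < rho k" "rho k < 1" "0 < theta k" "theta k < pi/2" "rad k < rho k * rad' k"
 using assms by (auto simp: admissible_def)

lemma small_valueI:
 assumes "eventually (%ep. F ep = c) (at_right 0)"
 shows "small_value F = c"
 unfolding small_value_def
proof (rule the_equality)
 show "eventually (%ep. F ep = c) (at_right 0)" by (rule assms)
 fix c' assume "eventually (%ep. F ep = c') (at_right 0)"
 with assms have "eventually (%ep::real. c' = c) (at_right 0)" by eventually_elim simp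
 then show "c' = c" by simp
qed

text \<open>A start vector lying on the contour for every epsilon at once, for the arguments that
  need one in a box. Its first entry is the starting point of \<open>gam\<close>, which does not
  depend on epsilon.\<close>

definition u1 :: "kappa => 'n::{finite,linorder} cvec" where
 "u1 k = (\<chi> i. if i = idx1 then beta0 (rho k) (theta k) else of_real (2/rho k))"

lemma u1_G: "u1 k $ i \<in> path_image (G k ep i)"
proof (cases "i = idx1")
 case True
 then show ?thesis using pathstart_in_path_image[of "gam (rho k) (theta k) ep"] by (simp add: u1_def G_def)
next
 case False
 have "pathstart (circlepath 0 (2/rho k)) = of_real (2/rho k)" by (simp add: pathstart_def circlepath)
 then show ?thesis using pathstart_in_path_image[of "circlepath 0 (2/rho k)"] False by (simp add: u1_def G_def)
qed

text \<open>By Cauchy's theorem in each variable, the integral over \<open>\<gamma>(a, \<eta>)\<close> is an integral over the fixed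
 contour \<open>G\<close>, rescaled by \<open>b\<close>; only the first coordinate of \<open>b\<close> has to be \<open>\<eta>\<close>.\<close>

lemma small_value_prod_gamma:
 fixes f :: "'n::{finite,linorder} cvec => complex"
 assumes k: "admissible k" and eta: "eta ~= 0" "\<bar>Arg eta\<bar> < theta k/2"
 and B: "!!i. open (B i)" and f: "!!w. w \<in> cbx B ==> chol f w"
 and circ: "!!i s. i ~= idx1 ==> cmod eta/rho k < cmod (s - a $ i) ==> cmod (s - a $ i) < 3 * cmod eta/rho k ==> s \<in> B i"
 and R: "R > 0" and AD: "!!s. cmod (s - a $ idx1) < R ==> a $ idx1 - s \<in> Sect (theta k) ==> s \<in> B idx1"
 and ray: "!!t. 0 < t ==> t <= 1 ==> a $ idx1 + eta * (of_real t * beta0 (rho k) (theta k)) \<in> B idx1"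
 "!!t. 0 < t ==> t <= 1 ==> a $ idx1 + eta * (of_real t * beta1 (rho k) (theta k)) \<in> B idx1"
 and b: "b $ idx1 = eta" "!!i. i ~= idx1 ==> cmod eta/2 < cmod (b $ i) & cmod (b $ i) < 3 * cmod eta/2"
 and ep': "0 < ep'" "ep' <= 1" "ep' * rho k * cmod eta < 2 * R"
 shows "small_value (%ep. prod_integral (gamma_path a eta (rho k) (theta k) ep) f) =
 (\<Prod>i\<in>UNIV. b $ i) * iter (G k ep') L0 (%u. f (aff a b u)) u0"
proof (rule small_valueI)
 note kD = admissibleD[OF k]
 let ?\<rho> = "rho k" and ?th = "theta k"
 have gamB: "a $ idx1 + eta * u \<in> B idx1" if e: "0 < ep" "ep <= ep'" and u: "u \<in> path_image (gam ?\<rho> ?th ep)" for ep u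
 proof (rule gam_image[OF e(1) _ kD(5) kD(3) u])
 show "ep <= 1" using e ep' by simp
 fix t assume "ep <= t" "t <= 1" "u = of_real t * beta0 ?\<rho> ?th"
 then show ?thesis using ray(1)[of t] e by simp
 next
 fix t assume "ep <= t" "t <= 1" "u = of_real t * beta1 ?\<rho> ?th"
 then show ?thesis using ray(2)[of t] e by simp
 next
 fix x assume x: "\<bar>x\<bar> <= (pi + ?th)/2" and u: "u = rcis (ep * ?\<rho>/2) x"
 have "cmod (eta * u) = ep * ?\<rho> * cmod eta/2" using e kD by (simp add: u norm_mult)
 also have "\<dots> <= ep' * ?\<rho> * cmod eta/2" using e kD by (simp add: mult_right_mono)
 also have "\<dots> < R" using ep'(3) by simp
 finally have "cmod (eta * u) < R" .
 moreover have "- (eta * u) \<in> Sect ?th"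
 unfolding u using x eta kD e by (intro Sect_minus_rcis) auto
 ultimately show ?thesis by (intro AD) auto
 qed
 have Gsub: "(%s. a $ i + b $ i * s) ` path_image (G k ep' i) <= B i" for i
 proof (cases "i = idx1")
 case True
 then show ?thesis using gamB[OF ep'(1)] b by (auto simp: G_def)
 next
 case False
 have "a $ i + b $ i * s \<in> B i" if "cmod s = 2/?\<rho>" for s
 proof (rule circ[OF False])
 have "cmod (b $ i) * (2/?\<rho>) > cmod eta/2 * (2/?\<rho>)" "cmod (b $ i) * (2/?\<rho>) < 3 * cmod eta/2 * (2/?\<rho>)"
 using b(2)[OF False] kD by (simp_all add: divide_strict_right_mono)
 then show "cmod eta/?\<rho> < cmod (a $ i + b $ i * s - a $ i)" "cmod (a $ i + b $ i * s - a $ i) < 3 * cmod eta/?\<rho>"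
 using that by (auto simp: norm_mult)
 qed
 then show ?thesis using False kD by (auto simp: G_def)
 qed
 have affB: "aff a b (u1 k) \<in> cbx B"
 using Gsub u1_G[of k _ ep'] by (auto simp: cbx_def image_subset_iff)
 have npa: "npath (%t. a $ i + b $ i * G k ep' i t)" for i by (intro npath_affine npath_G)
 have cf: "continuous_on (cbx B) f" by (rule chol_imp_continuous_on[OF f])
 have "iter (%i t. a $ i + b $ i * G k ep' i t) L0 f (aff a b (u1 k)) =
 prod_list (map (($) b) L0) * iter (G k ep') L0 (%u. f (aff a b u)) (u1 k)"
 by (rule iter_aff[OF npath_G Gsub cf affB])
 also have "prod_list (map (($) b) L0) = (\<Prod>i\<in>UNIV. b $ i)"
 using prod.distinct_set_conv_list[of "L0 :: 'n list" "($) b"] by simp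
 also have "iter (G k ep') L0 (%u. f (aff a b u)) (u1 k) = iter (G k ep') L0 (%u. f (aff a b u)) u0"
 by (rule iter_start) simp
 finally have I1: "iter (%i t. a $ i + b $ i * G k ep' i t) L0 f (aff a b (u1 k)) =
 (\<Prod>i\<in>UNIV. b $ i) * iter (G k ep') L0 (%u. f (aff a b u)) u0" .
 \<comment> \<open>For these epsilon the radius |eta|/rho + epsilon stays below 2 |eta|/rho, inside
   the annulus of \<open>circ\<close>, so the circles can be scaled to those of
   \<open>G\<close>.\<close>
 have "prod_integral (gamma_path a eta ?\<rho> ?th ep) f = (\<Prod>i\<in>UNIV. b $ i) * iter (G k ep') L0 (%u. f (aff a b u)) u0"
 if e: "0 < ep" "ep < min ep' (cmod eta/?\<rho>)" for ep
 proof -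
 have gsub: "path_image (gamma_path a eta ?\<rho> ?th ep i) <= B i" and np: "npath (gamma_path a eta ?\<rho> ?th ep i)" for i
 proof -
 show "path_image (gamma_path a eta ?\<rho> ?th ep i) <= B i"
 proof (cases "i = idx1")
 case True
 then show ?thesis using gamB[of ep] e by (auto simp: gamma_path_idx1 path_image_affine)
 next
 case False
 have "s \<in> B i" if "cmod (s - a $ i) = cmod eta/?\<rho> + ep" for s
 using that e eta kD by (intro circ[OF False]) auto
 moreover have "cmod eta/?\<rho> + ep > 0" using e eta kD by (simp add: add_pos_pos)
 ultimately show ?thesis using False by (auto simp: gamma_path_def dist_norm norm_minus_commute)
 qed
 show "npath (gamma_path a eta ?\<rho> ?th ep i)"
 proof (cases "i = idx1")
 case True then show ?thesis by (simp add: gamma_path_idx1 npath_affine)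
 next
 case False then show ?thesis by (simp add: gamma_path_def)
 qed
 qed
 have "prod_integral (gamma_path a eta ?\<rho> ?th ep) f = iter (gamma_path a eta ?\<rho> ?th ep) L0 f (aff a b (u1 k))"
 unfolding prod_integral_iter by (rule iter_start) simp
 also have "\<dots> = iter (%i t. a $ i + b $ i * G k ep' i t) L0 f (aff a b (u1 k))"
 proof (rule iter_change_paths[where B = B,OF np gsub npa _ B f affB])
 show "path_image (%t. a $ i + b $ i * G k ep' i t) <= B i" for i
 using Gsub by (simp add: path_image_affine)
 fix i F assume F: "F holomorphic_on B i"
 show "contour_integral (gamma_path a eta ?\<rho> ?th ep i) F = contour_integral (%t. a $ i + b $ i * G k ep' i t) F"
 proof (cases "i = idx1")
 case True
 have "contour_integral (%t. a $ idx1 + eta * gam ?\<rho> ?th ep t) F = contour_integral (%t. a $ idx1 + eta * gam ?\<rho> ?th ep' t) F"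
 using e ep' F True by (intro gam_eps_le[OF B[of idx1] _ eta kD(5,6,3) R AD ray]) auto
 then show ?thesis using True b by (simp add: G_def gamma_path_idx1)
 next
 case False
 have "contour_integral (circlepath (a $ i) (cmod eta/?\<rho> + ep)) F = contour_integral (%t. a $ i + b $ i * circlepath 0 (2/?\<rho>) t) F"
 proof (rule circle_scale[OF B F,where m = "cmod eta/?\<rho>" and M = "3 * cmod eta/?\<rho>"])
 show "s \<in> B i" if "cmod eta/?\<rho> < cmod (s - a $ i)" "cmod (s - a $ i) < 3 * cmod eta/?\<rho>" for s
 using circ[OF False that] .
 show "0 < cmod eta/?\<rho> + ep" using e kD by (simp add: add_nonneg_pos)
 have "0 < cmod eta/?\<rho>" using eta(1) kD by simp
 then show "cmod eta/?\<rho> + ep < 3 * cmod eta/?\<rho>" using e by (simp only: times_divide_eq_right[symmetric])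
 show "b $ i ~= 0" using b(2)[OF False] by auto
 have "cmod (b $ i) * (2/?\<rho>) > cmod eta/2 * (2/?\<rho>)" "cmod (b $ i) * (2/?\<rho>) < 3 * cmod eta/2 * (2/?\<rho>)"
 using b(2)[OF False] kD by (simp_all add: divide_strict_right_mono)
 then show "cmod eta/?\<rho> < cmod (b $ i) * (2/?\<rho>)" "cmod (b $ i) * (2/?\<rho>) < 3 * cmod eta/?\<rho>" by auto
 qed (use e kD in auto)
 then show ?thesis using False by (simp add: G_def gamma_path_def)
 qed
 qed
 finally show ?thesis using I1 by simp
 qed
 moreover have "eventually (%ep. ep \<in> {0<..<min ep' (cmod eta/?\<rho>)}) (at_right 0)"
 using ep' eta kD by (intro eventually_at_right_real) auto
 ultimately show "eventually (%ep. prod_integral (gamma_path a eta ?\<rho> ?th ep) f =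
 (\<Prod>i\<in>UNIV. b $ i) * iter (G k ep') L0 (%u. f (aff a b u)) u0) (at_right 0)"
 by (rule eventually_mono[rotated]) auto
qed

lemma aff_cmul: "aff a (\<chi> i. eta) u = a + cmul eta u"
 by (simp add: vec_eq_iff)

text \<open>The domain of the rescaled variable \<open>u\<close>, where the condition for \<open>i \<notin> \<alpha>\<close> is dropped.\<close>

definition ubox :: "kappa => 'n::{finite,linorder} set => 'n => complex set" where
 "ubox k al i = (if i = idx1 then {u. cmod u < rho k & (i \<in> al --> - u \<in> Sect (3 * theta k/4))}
 else {u. cmod u < 3/rho k & (i \<in> al --> 1/rho k < cmod u)})"

lemma open_ubox: "open (ubox k al i)"
proof -
 have "open (uminus -` Sect (3 * theta k/4))" by (intro open_vimage open_Sect continuous_intros)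
 then have "open {u. - u \<in> Sect (3 * theta k/4)}" by (simp add: vimage_def)
 then show ?thesis unfolding ubox_def
 by (cases "i = idx1"; cases "i \<in> al") (auto intro!: open_Collect_conj open_Collect_less continuous_intros)
qed

lemma Sect_lfI:
 assumes "\<bar>th'\<bar> <= th" "0 < th" "th < pi/2" "lf th' s < 0"
 shows "s \<in> Sect th"
proof -
 have "s \<in> Sect \<bar>th'\<bar>" using assms by (auto simp: Sect_def abs_if)
 then show ?thesis using Sect_mono[of "\<bar>th'\<bar>" th] assms by auto
qed

lemma lf_mult: "lf th (eta * s) = cmod eta * lf (th + Arg eta) s"
proof -
 have eq: "eta * s * cis th = of_real (cmod eta) * (s * cis (th + Arg eta))"
 using rcis_cmod_Arg[of eta] by (simp add: rcis_def cis_mult[symmetric] mult_ac)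
 show ?thesis unfolding lf_def eq by simp
qed

text \<open>Multiplication by eta turns both functionals by Arg eta. Since |Arg eta| < theta/4 in
  the sector of eta, the aperture 3 theta/4 in \<open>ubox\<close> becomes at most theta.\<close>

lemma Sect_mult:
 assumes "s \<in> Sect th'" "eta ~= 0" "0 <= th'" "th' + \<bar>Arg eta\<bar> <= th" "0 < th" "th < pi/2"
 shows "eta * s \<in> Sect th"
proof -
 have "lf th' s < 0 \<or> lf (- th') s < 0" using assms by (simp add: Sect_def)
 then have "lf (th' - Arg eta) (eta * s) < 0 \<or> lf (- th' - Arg eta) (eta * s) < 0"
 using assms(2) by (simp add: lf_mult mult_less_0_iff)
 then show ?thesis
 proof
 assume "lf (th' - Arg eta) (eta * s) < 0"
 then show ?thesis using assms by (intro Sect_lfI[of "th' - Arg eta"]) auto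
 next
 assume "lf (- th' - Arg eta) (eta * s) < 0"
 then show ?thesis using assms by (intro Sect_lfI[of "- th' - Arg eta"]) auto
 qed
qed

lemma G_ubox:
 assumes k: "admissible k" and ep: "0 < ep" "ep <= 1"
 shows "path_image (G k ep i) <= ubox k al i"
proof
 note kD = admissibleD[OF k]
 fix u assume u: "u \<in> path_image (G k ep i)"
 show "u \<in> ubox k al i"
 proof (cases "i = idx1")
 case True
 with u have "u \<in> path_image (gam (rho k) (theta k) ep)" by (simp add: G_def)
 then obtain r x where rx: "0 < r" "r <= rho k/2" "\<bar>x\<bar> <= (pi + theta k)/2" "u = rcis r x"
 using gam_image_rcis[OF ep kD(5,3)] by metis
 have "- u \<in> Sect (3 * theta k/4)" unfolding rx(4) using rx kD by (intro Sect_cis) auto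
 then show ?thesis using True rx kD by (simp add: ubox_def)
 next
 case False
 then show ?thesis using u kD by (auto simp: G_def ubox_def divide_simps)
 qed
qed

lemma u1_ubox: "admissible k ==> u1 k \<in> cbx (ubox k al)"
 using G_ubox[of k 1] u1_G[of k _ 1] by (fastforce simp: cbx_def)

text \<open>A domain for the symbol; the last condition keeps all |eta u_i| with |u_i| < 3/rho below
  the radius rad'.\<close>

definition sdom :: "kappa => 'n::{finite,linorder} triple set" where
 "sdom k = {(z,zeta,eta). maxnorm z < rad' k & eta \<in> sector (rad k) (theta k) & 3 * cmod eta < rho k * rad' k}"

lemma open_sdom:
 assumes "admissible k" shows "open (sdom k :: 'n::{finite,linorder} triple set)"
proof -
 have "(sdom k :: 'n triple set) = (\<Inter>i\<in>UNIV. {x. cmod (fst x $ i) < rad' k}) Int ((%x. snd (snd x)) -` sector (rad k) (theta k)) \<inter>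
 {x. 3 * cmod (snd (snd x)) < rho k * rad' k}"
 by (auto simp: sdom_def maxnorm_less_iff)
 moreover have "open ((%x::'n triple. snd (snd x)) -` sector (rad k) (theta k))"
 using admissibleD[OF assms] by (intro open_vimage open_sector continuous_intros) auto
 ultimately show ?thesis by (auto intro!: open_Int open_INT open_Collect_less continuous_intros)
qed

lemma ubox_V_multi:
 assumes k: "admissible k" and x: "(z,zeta,eta) \<in> sdom k" and u: "u \<in> cbx (ubox k al)"
 shows "(z,z + cmul eta u,eta) \<in> V_multi k al"
proof -
 note kD = admissibleD[OF k]
 have eta: "maxnorm z < rad' k" "eta \<in> sector (rad k) (theta k)" "3 * cmod eta < rho k * rad' k"
 using x by (auto simp: sdom_def)
 note etaD = sectorD[OF eta(2)]
 have u': "u $ i \<in> ubox k al i" for i using u by (simp add: cbx_def)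
 have "cmod (eta * u $ idx1) < rho k * cmod eta"
 using u'[of idx1] etaD by (simp add: ubox_def norm_mult mult.commute)
 moreover have "cmod (eta * u $ i) < rad' k" if "i ~= idx1" for i
 proof -
 have "cmod (eta * u $ i) < cmod eta * (3/rho k)"
 unfolding norm_mult using u'[of i] that etaD by (intro mult_strict_left_mono) (auto simp: ubox_def)
 also have "\<dots> < rad' k" using eta(3) kD by (simp add: field_simps)
 finally show ?thesis .
 qed
 moreover have "- (eta * u $ idx1) \<in> Sect (theta k)" if "idx1 \<in> al"
 using Sect_mult[of "- u $ idx1" "3 * theta k/4" eta "theta k"] u'[of idx1] that etaD kD by (simp add: ubox_def)
 moreover have "cmod eta < rho k * cmod (eta * u $ i)" if "i \<in> al" "i ~= idx1" for i
 using u'[of i] that etaD kD by (simp add: ubox_def norm_mult field_simps)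
 ultimately show ?thesis using eta by (simp add: V_multi_iff[OF k])
qed

text \<open>Only the first entry of b is prescribed. With all entries equal to eta this becomes
  \<open>symbol_map_scaled\<close>; with the others frozen at a fixed value, only the first path
  moves when eta is differentiated.\<close>

lemma symbol_map_eq:
 fixes psi :: "'n::{finite,linorder} triple => complex"
 assumes k: "admissible k" and psi: "holo_on psi (V_multi k UNIV)" and x: "(z,zeta,eta) \<in> sdom k"
 and b: "b $ idx1 = eta" "!!i. i ~= idx1 ==> cmod eta/2 < cmod (b $ i) & cmod (b $ i) < 3 * cmod eta/2"
 and ep: "0 < ep" "ep <= 1"
 shows "symbol_map k psi (z,zeta,eta) = (\<Prod>i\<in>UNIV. b $ i) *
 iter (G k ep) L0 (%u. psi (z,z + aff 0 b u,eta) * exp (pairing (aff 0 b u) zeta)) u0"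
proof -
 note kD = admissibleD[OF k]
 have eta: "maxnorm z < rad' k" "eta \<in> sector (rad k) (theta k)" "3 * cmod eta < rho k * rad' k"
 using x by (auto simp: sdom_def)
 note etaD = sectorD[OF eta(2)]
 define B where "B i = (if i = (idx1 :: 'n) then {s. cmod s < rho k * cmod eta & - s \<in> Sect (theta k)}
 else {s. cmod eta < rho k * cmod s & cmod s < rad' k})" for i
 have oS: "open {s. - s \<in> Sect (theta k)}"
 using open_vimage[OF open_Sect[of "theta k"],of uminus] by (simp add: vimage_def continuous_on_minus)
 have oB: "open (B i)" for i
 unfolding B_def by (cases "i = idx1") (auto intro!: open_Collect_conj open_Collect_less continuous_intros oS)
 have ch: "chol (%w. psi (z,z + w,eta) * exp (pairing w zeta)) w" if w: "w \<in> cbx B" for w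
 proof -
 have wi: "w $ i \<in> B i" for i using w by (simp add: cbx_def)
 have "cmod (w $ idx1) < rho k * cmod eta" "- (w $ idx1) \<in> Sect (theta k)"
 using wi[of idx1] by (auto simp: B_def)
 moreover have "cmod eta < rho k * cmod (w $ i) & cmod (w $ i) < rad' k" if "i ~= idx1" for i
 using wi[of i] that by (simp add: B_def)
 ultimately have "(z,z + w,eta) \<in> V_multi k UNIV" using eta by (simp add: V_multi_iff[OF k])
 then have "chol psi (z,z + w,eta)" using psi by (auto simp: holo_on_iff_chol)
 then show ?thesis by (intro chol_mult chol_exp chol_compose[of psi "%w. (z,z + w,eta)"] chol_intros)
 qed
 have scaled: "eta * (of_real t * beta0 (rho k) (theta k)) \<in> B idx1 & eta * (of_real t * beta1 (rho k) (theta k)) \<in> B idx1"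
 if t: "0 < t" "t <= 1" for t
 proof -
 have e: "of_real t * beta0 (rho k) (theta k) = rcis (t * (rho k/2)) (- ((pi + theta k)/2))"
 "of_real t * beta1 (rho k) (theta k) = rcis (t * (rho k/2)) ((pi + theta k)/2)"
 by (simp_all add: beta_rcis rcis_def)
 have "t * (rho k/2) < rho k" using t kD by (smt (verit) mult_left_le_one_le field_sum_of_halves)
 then have "cmod (eta * rcis (t * (rho k/2)) x) < rho k * cmod eta" for x
 using t kD etaD by (simp add: norm_mult)
 moreover have "- (eta * rcis (t * (rho k/2)) x) \<in> Sect (theta k)" if "\<bar>x\<bar> <= (pi + theta k)/2" for x
 using that t kD etaD by (intro Sect_minus_rcis) auto
 ultimately show ?thesis unfolding e B_def using kD by auto
 qed
 show ?thesis unfolding symbol_map_def prod.case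
 proof (rule small_value_prod_gamma[where a = 0 and B = B and R = "rho k * cmod eta",OF k etaD(1) _ oB ch])
 show "\<bar>Arg eta\<bar> < theta k/2" using etaD kD by simp
 show "s \<in> B i" if "i ~= idx1" "cmod eta/rho k < cmod (s - (0::'n cvec) $ i)" "cmod (s - (0::'n cvec) $ i) < 3 * cmod eta/rho k" for i s
 proof -
 have "3 * cmod eta/rho k < rad' k" using eta(3) kD by (simp add: field_simps)
 then have "cmod s < rad' k" using that by simp
 moreover have "cmod eta < rho k * cmod s" using that kD by (simp add: field_simps)
 ultimately show ?thesis using that(1) by (simp add: B_def)
 qed
 show "s \<in> B idx1" if "cmod (s - (0::'n cvec) $ idx1) < rho k * cmod eta" "(0::'n cvec) $ idx1 - s \<in> Sect (theta k)" for s
 using that by (simp add: B_def)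
 show "ep * rho k * cmod eta < 2 * (rho k * cmod eta)" using ep kD etaD by simp
 qed (use ep kD etaD b scaled in auto)
qed

lemma symbol_map_scaled:
 fixes psi :: "'n::{finite,linorder} triple => complex"
 assumes k: "admissible k" and psi: "holo_on psi (V_multi k UNIV)" and x: "(z,zeta,eta) \<in> sdom k" and ep: "0 < ep" "ep <= 1"
 shows "symbol_map k psi (z,zeta,eta) = eta ^ CARD('n) *
 iter (G k ep) L0 (%u. psi (z,z + cmul eta u,eta) * exp (pairing (cmul eta u) zeta)) u0"
proof -
 have "eta ~= 0" using x by (auto simp: sdom_def sector_def)
 then show ?thesis
 using symbol_map_eq[OF k psi x,of "\<chi> i. eta" ep u0] ep by (simp add: aff_cmul)
qed

lemma chol_integrand:
 assumes k: "admissible k" and h: "holo_on h (V_multi k al)" and x: "(z,zeta,eta) \<in> sdom k" and u: "u \<in> cbx (ubox k al)"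
 shows "chol (%p. (%x u. h (fst x,fst x + cmul (snd (snd x)) u,snd (snd x)) * exp (pairing (cmul (snd (snd x)) u) (fst (snd x)))) (fst p) (snd p))
 ((z,zeta,eta),u)"
proof -
 have "chol h (z,z + cmul eta u,eta)" using ubox_V_multi[OF k x u] h by (auto simp: holo_on_iff_chol)
 then have "chol (%p. h (fst (fst p),fst (fst p) + cmul (snd (snd (fst p))) (snd p),snd (snd (fst p)))) ((z,zeta,eta),u)"
 by (intro chol_compose[of h "%p. (fst (fst p),fst (fst p) + cmul (snd (snd (fst p))) (snd p),snd (snd (fst p)))"] chol_intros) simp
 then show ?thesis by (intro chol_mult chol_exp chol_intros)
qed

lemma holo_symbol_map:
 assumes k: "admissible k" and psi: "holo_on psi (V_multi k UNIV)"
 shows "holo_on (symbol_map k psi) (sdom k :: 'n::{finite,linorder} triple set)"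
 unfolding holo_on_iff_chol
proof
 fix x :: "'n triple" assume x: "x \<in> sdom k"
 let ?f = "%x u. psi (fst x,fst x + cmul (snd (snd x)) u,snd (snd x)) * exp (pairing (cmul (snd (snd x)) u) (fst (snd x)))"
 have "chol (%p. iter (G k 1) L0 (?f (fst p)) (snd p)) (x,u1 k)"
 proof (rule chol_iter_param[where P = "sdom k" and B = "ubox k UNIV",OF _ _ open_sdom[OF k] open_ubox])
 fix x' :: "'n triple" and w :: "'n cvec" assume "x' \<in> sdom k" "w \<in> cbx (ubox k UNIV)"
 then show "chol (%p. ?f (fst p) (snd p)) (x',w)"
 using chol_integrand[OF k psi,of "fst x'" "fst (snd x')" "snd (snd x')" w] by simp
 qed (use G_ubox[OF k,of 1] u1_ubox[OF k] x in simp_all)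
 then have "chol (%x. iter (G k 1) L0 (?f x) (u1 k)) x"
 by (rule chol_compose2[where F = "%x. iter (G k 1) L0 (?f x)" and g = "%x. x" and h = "%_. u1 k"]) (auto intro: chol_intros)
 then have "chol (%x. snd (snd x) ^ CARD('n) * iter (G k 1) L0 (?f x) (u1 k)) x"
 by (intro chol_mult chol_intros)
 then show "chol (symbol_map k psi) x"
 by (rule chol_cong_open[OF open_sdom[OF k] x,rotated])
 (auto simp: symbol_map_scaled[OF k psi,of _ _ _ 1 "u1 k"])
qed

section \<open>The derivative of the symbol in eta\<close>

lemma iter_set_coord:
 "i \<notin> set L ==> iter g L (%u. K (set_coord u i t)) w = iter g L K (set_coord w i t)"
proof (induction L arbitrary: w)
 case (Cons j L)
 then have "set_coord (set_coord w j s) i t = set_coord (set_coord w i t) j s" for s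
 by (auto simp: vec_eq_iff)
 with Cons show ?case by (simp add: iter_Cons)
qed simp

text \<open>By the chain rule, d/dc (c H(c, c u)) = d/du (u H(c, c u)) + c (D_1 H)(c, c u), where
  D_1 is the derivative in the first slot. The middle term integrates to the difference of its
  values at the two ends of the path.\<close>

lemma deriv_scaled_integral:
 fixes H :: "complex => complex => complex"
 assumes g: "npath g" and P: "open P" "c0 \<in> P" and D: "open D" and gD: "!!c u. c \<in> P ==> u \<in> path_image g ==> c * u \<in> D"
 and H: "!!c s. c \<in> P ==> s \<in> D ==> chol (%p. H (fst p) (snd p)) (c,s)"
 shows "((%c. c * contour_integral g (%u. H c (c * u))) has_field_derivative
 pathfinish g * H c0 (c0 * pathfinish g) - pathstart g * H c0 (c0 * pathstart g) +
 c0 * contour_integral g (%u. deriv (%c. H c (c0 * u)) c0)) (at c0)"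
proof -
 let ?f = "%c u. c * H c (c * u)"
 obtain R where R: "R > 0" "cball c0 R <= P" using P open_contains_cball by blast
 have chf: "chol (%p. ?f (fst p) (snd p)) (c,u)" if "c \<in> P" "u \<in> path_image g" for c u
 using H[OF that(1) gD[OF that]]
 by (intro chol_mult chol_compose2[where F = H and g = fst and h = "%p. fst p * snd p"] chol_intros) auto
 have d1: "((%c. contour_integral g (?f c)) has_field_derivative contour_integral g (%u. deriv (%c. ?f c u) c0)) (at c0)"
 proof (rule CI_has_field_derivative[OF g R(1)])
 show "continuous_on (cball c0 R \<times> path_image g) (%(c,s). ?f c s)"
 unfolding case_prod_unfold using chf R by (intro chol_imp_continuous_on) auto
 fix c u assume cu: "c \<in> ball c0 R" "u \<in> path_image g"
 have "c \<in> P" using cu R by auto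
 have "chol (%c. ?f c u) c"
 by (rule chol_compose2[where F = ?f and g = "%c. c" and h = "%_. u",OF chf[OF \<open>c \<in> P\<close> cu(2)]]) (auto intro: chol_intros)
 then show "(%c. ?f c u) field_differentiable at c" by (simp add: chol_complex_iff)
 qed
 define E where "E = (%u. c0 * u) -` D"
 have E: "open E" "path_image g <= E" unfolding E_def using D gD P by (auto intro!: open_vimage continuous_intros)
 have chK: "chol (%u. u * H c0 (c0 * u)) u" if "u \<in> E" for u
 using H[of c0 "c0 * u"] that P
 by (intro chol_mult chol_compose2[where F = H and g = "%_. c0" and h = "%u. c0 * u"] chol_intros) (auto simp: E_def)
 have chL: "chol (%p. deriv (%c. H c (snd p)) (fst p)) (c0,s)" if "s \<in> D" for s
 proof -
 have "chol (%p. deriv (%c. H (fst (p + cmul c (1,0))) (snd (p + cmul c (1,0)))) 0) (c0,s)"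
 using P that H by (intro chol_deriv[of "P \<times> D" "%p. H (fst p) (snd p)"] open_Times D) auto
 then show ?thesis by (simp add: deriv_shift_0[of "%c. H c (snd _)"])
 qed
 \<comment> \<open>The chain rule identity; p and q are the two partial derivatives of H at (c0, c0
   u).\<close>
 have split: "deriv (%c. ?f c u) c0 = deriv (%u. u * H c0 (c0 * u)) u + c0 * deriv (%c. H c (c0 * u)) c0"
 if u: "u \<in> E" for u
 proof -
 obtain DH where DH: "((%p. H (fst p) (snd p)) has_derivative DH) (at (c0,c0 * u))" "!!c v. DH (cmul c v) = c * DH v"
 using H[of c0 "c0 * u"] u P by (auto simp: chol_def E_def)
 define p q where "p = DH (1,0)" and "q = DH (0,1)"
 have pq: "DH (a,b) = a * p + b * q" for a b
 proof -
 have "DH (a,b) = DH (cmul a (1,0) + cmul b (0,1))" by simp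
 also have "\<dots> = a * p + b * q"
 using linear_add[OF has_derivative_linear[OF DH(1)]] by (simp only: DH(2) p_def q_def)
 finally show ?thesis .
 qed
 have chain: "((%t. H (a t) (b t)) has_field_derivative a' * p + b' * q) (at x)"
 if "(a has_field_derivative a') (at x)" "(b has_field_derivative b') (at x)" "a x = c0" "b x = c0 * u" for a b a' b' x
 proof -
 have ab: "((%t. (a t,b t)) has_derivative (%t. (a' * t,b' * t))) (at x)"
 using that by (intro has_derivative_Pair) (auto simp: has_field_derivative_def)
 have "((%t. H (fst (a t,b t)) (snd (a t,b t))) has_derivative (%t. DH (a' * t,b' * t))) (at x)"
 using DH(1) that by (intro has_derivative_compose[OF ab,where g = "%p. H (fst p) (snd p)"]) simp
 moreover have "(%t. DH (a' * t,b' * t)) = (*) (a' * p + b' * q)"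
 by (auto simp: pq algebra_simps)
 ultimately show ?thesis by (simp add: has_field_derivative_def)
 qed
 have "((%c. H c (c0 * u)) has_field_derivative 1 * p + 0 * q) (at c0)"
 by (rule chain) (auto intro!: derivative_eq_intros)
 then have 1: "deriv (%c. H c (c0 * u)) c0 = p" by (simp add: DERIV_imp_deriv)
 have "((%c. H c (c * u)) has_field_derivative 1 * p + u * q) (at c0)"
 by (rule chain) (auto intro!: derivative_eq_intros)
 then have "((%c. c * H c (c * u)) has_field_derivative c0 * (1 * p + u * q) + 1 * H c0 (c0 * u)) (at c0)"
 by (auto intro!: derivative_eq_intros)
 then have 2: "deriv (%c. ?f c u) c0 = c0 * (p + u * q) + H c0 (c0 * u)" by (simp add: DERIV_imp_deriv)
 have "((%u. H c0 (c0 * u)) has_field_derivative 0 * p + c0 * q) (at u)"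
 by (rule chain) (auto intro!: derivative_eq_intros)
 then have "((%u. u * H c0 (c0 * u)) has_field_derivative u * (0 * p + c0 * q) + 1 * H c0 (c0 * u)) (at u)"
 by (auto intro!: derivative_eq_intros)
 then have 3: "deriv (%u. u * H c0 (c0 * u)) u = u * (c0 * q) + H c0 (c0 * u)" by (simp add: DERIV_imp_deriv)
 show ?thesis unfolding 1 2 3 by (simp add: algebra_simps)
 qed
 let ?K = "%u. u * H c0 (c0 * u)" and ?M = "%u. deriv (%c. H c (c0 * u)) c0"
 have Kd: "(?K has_field_derivative deriv ?K u) (at u)" if "u \<in> E" for u
 using chK[OF that] by (simp add: chol_complex_iff DERIV_deriv_iff_field_differentiable)
 have prim: "(deriv ?K has_contour_integral ?K (pathfinish g) - ?K (pathstart g)) g"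
 by (rule contour_integral_primitive[of E]) (use Kd E npath_valid[OF g] in \<open>auto intro: has_field_derivative_at_within\<close>)
 have cK: "continuous_on (path_image g) (deriv ?K)"
 proof -
 have "?K holomorphic_on E" using chK by (auto simp: holomorphic_on_def chol_complex_iff intro: field_differentiable_at_within)
 then have "deriv ?K holomorphic_on E" using E by (intro holomorphic_deriv)
 then show ?thesis using E holomorphic_on_imp_continuous_on continuous_on_subset by blast
 qed
 have cM: "continuous_on (path_image g) ?M"
 proof (rule chol_imp_continuous_on)
 fix u assume "u \<in> path_image g"
 then have "c0 * u \<in> D" using gD P by auto
 from chL[OF this] show "chol ?M u"
 by (rule chol_compose2[where F = "%c s. deriv (%c. H c s) c" and g = "%_. c0" and h = "%u. c0 * u"]) (auto intro: chol_intros)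
 qed
 have "contour_integral g (%u. deriv (%c. ?f c u) c0) = contour_integral g (%u. deriv ?K u + c0 * ?M u)"
 using split E by (intro contour_integral_eq) auto
 also have "\<dots> = contour_integral g (deriv ?K) + contour_integral g (%u. c0 * ?M u)"
 using prim by (intro contour_integral_add npath_integrable[OF g] continuous_intros cM cK)
 also have "\<dots> = (?K (pathfinish g) - ?K (pathstart g)) + c0 * contour_integral g ?M"
 using contour_integral_unique[OF prim] by (simp add: CI_cmult)
 finally have "contour_integral g (%u. deriv (%c. ?f c u) c0) = (?K (pathfinish g) - ?K (pathstart g)) + c0 * contour_integral g ?M" .
 with d1 show ?thesis by (simp add: CI_cmult)
qed

definition bv :: "complex => complex => 'n::{finite,linorder} cvec" where
 "bv c c' = (\<chi> i. if i = idx1 then c else c')"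

lemma bv_nth [simp]: "bv c c' $ i = (if i = idx1 then c else c')"
 by (simp add: bv_def)

lemma bv_same: "aff a (bv c c) u = a + cmul c u"
 by (simp add: vec_eq_iff)

lemma prod_bv: "(\<Prod>i\<in>UNIV. bv c c' $ (i :: 'n::{finite,linorder})) = c * c' ^ (CARD('n) - 1)"
 by (simp add: prod.remove[of UNIV "idx1 :: 'n"])

text \<open>For an integral over \<open>Lr\<close> the first coordinate is a parameter, so scaling
  it in the integrand or in the start vector amounts to the same.\<close>

lemma iter_Lr_rescale:
 fixes K :: "'n::{finite,linorder} cvec => complex"
 shows "iter g Lr (%u. K (aff a (bv 1 c') u)) (set_coord v idx1 (c * s)) = iter g Lr (%u. K (aff a (bv c c') u)) (set_coord v idx1 s)"
proof -
 have "iter g Lr (%u. K (aff a (bv 1 c') u)) (set_coord v idx1 (c * s)) =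
 iter g Lr (%u. K (aff a (bv 1 c') (set_coord u idx1 (c * s)))) (set_coord v idx1 s)"
 using iter_set_coord[of idx1 Lr g "%u. K (aff a (bv 1 c') u)" "c * s" "set_coord v idx1 s"] by simp
 also have "\<dots> = iter g Lr (%u. K (aff a (bv c c') u)) (set_coord v idx1 s)"
 proof (rule iter_cong[where B = "%j. if j = idx1 then {s} else UNIV"])
 fix u assume "u \<in> cbx (%j. if j = (idx1 :: 'n) then {s} else UNIV)"
 then have "u $ idx1 = s" by (force simp: cbx_def dest: spec[of _ idx1])
 then have "aff a (bv 1 c') (set_coord u idx1 (c * s)) = aff a (bv c c') u" by (simp add: vec_eq_iff)
 then show "K (aff a (bv 1 c') (set_coord u idx1 (c * s))) = K (aff a (bv c c') u)" by simp
 qed (auto simp: cbx_def)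
 finally show ?thesis .
qed

text \<open>The boundary terms come from integrating \<open>d(u\<^sub>1 f)\<close> along the first path, whose endpoints move
 with \<open>\<eta>\<close>.\<close>

lemma scaled_integral_has_derivative:
 fixes f :: "complex => 'n::{finite,linorder} cvec => complex" and a :: "'n cvec"
 assumes P: "open P" "eta0 \<in> P" and B: "!!i. open (B i)"
 and f: "!!eta w. eta \<in> P ==> w \<in> cbx B ==> chol (%p. f (fst p) (snd p)) (eta,w)"
 and c1: "!!eta u. eta \<in> P ==> u \<in> path_image (gam (rho k) (theta k) ep) ==> a $ idx1 + eta * u \<in> B idx1"
 and c2: "!!i u. i ~= idx1 ==> u \<in> path_image (circlepath 0 (2/rho k)) ==> a $ i + eta0 * u \<in> B i"
 shows "((%eta. (\<Prod>i\<in>(UNIV :: 'n set). bv eta eta0 $ i) * iter (G k ep) L0 (%u. f eta (aff a (bv eta eta0) u)) (u1 k)) has_field_derivative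
 eta0 ^ (CARD('n) - 1) *
 (beta1 (rho k) (theta k) * iter (G k ep) Lr (%u. f eta0 (a + cmul eta0 u)) (set_coord (u1 k) idx1 (beta1 (rho k) (theta k))) -
 beta0 (rho k) (theta k) * iter (G k ep) Lr (%u. f eta0 (a + cmul eta0 u)) (set_coord (u1 k) idx1 (beta0 (rho k) (theta k)))) +
 eta0 ^ CARD('n) * iter (G k ep) L0 (%u. deriv (%eta. f eta (a + cmul eta0 u)) eta0) (u1 k)) (at eta0)"
proof -
 let ?g = "G k ep :: 'n => _" and ?gam = "gam (rho k) (theta k) ep"
 define B' where "B' i = (%u. a $ i + bv 1 eta0 $ i * u) -` B i" for i
 have oB': "open (B' i)" for i unfolding B'_def by (intro open_vimage B continuous_intros)
 have affB: "aff a (bv 1 eta0) u \<in> cbx B" if "u \<in> cbx B'" for u using that by (auto simp: cbx_def B'_def)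
 have gB': "path_image (?g i) <= B' i" if "i ~= idx1" for i
 using c2[OF that] that by (auto simp: G_def B'_def)
 have sc: "set_coord (u1 k) idx1 s \<in> cbx B'" if "s \<in> B' idx1" for s
 using that gB' u1_G[of k _ ep] by (fastforce simp: cbx_def)
 define H where "H eta s = iter ?g Lr (%u. f eta (aff a (bv 1 eta0) u)) (set_coord (u1 k) idx1 s)" for eta s
 have fa: "chol (%p. f (fst p) (aff a (bv 1 eta0) (snd p))) (eta,u)" if "eta \<in> P" "u \<in> cbx B'" for eta u
 by (rule chol_compose2[OF f[OF that(1) affB[OF that(2)]]]) ((intro chol_aff chol_intros | simp)+)
 have Hchol: "chol (%p. H (fst p) (snd p)) (eta,s)" if "eta \<in> P" "s \<in> B' idx1" for eta s
 proof -
 have "chol (%p. iter ?g Lr (%u. f (fst p) (aff a (bv 1 eta0) u)) (snd p)) (eta,set_coord (u1 k) idx1 s)"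
 by (rule chol_iter_param[where P = P and B = B',OF _ _ P(1) oB' fa that(1) sc[OF that(2)]]) (use gB' in auto)
 then show ?thesis unfolding H_def
 by (rule chol_compose2[where F = "%eta. iter ?g Lr (%u. f eta (aff a (bv 1 eta0) u))"]) ((intro chol_intros | simp)+)
 qed
 have gam_D: "c * u \<in> B' idx1" if "c \<in> P" "u \<in> path_image ?gam" for c u
 using c1[OF that] by (simp add: B'_def)
 have d: "((%c. c * contour_integral ?gam (%u. H c (c * u))) has_field_derivative
 pathfinish ?gam * H eta0 (eta0 * pathfinish ?gam) - pathstart ?gam * H eta0 (eta0 * pathstart ?gam) +
 eta0 * contour_integral ?gam (%u. deriv (%c. H c (eta0 * u)) eta0)) (at eta0)"
 by (rule deriv_scaled_integral[OF npath_gam P oB'[of idx1] gam_D Hchol])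
 have J: "(\<Prod>i\<in>(UNIV :: 'n set). bv eta eta0 $ i) * iter ?g L0 (%u. f eta (aff a (bv eta eta0) u)) (u1 k) =
 eta0 ^ (CARD('n) - 1) * (eta * contour_integral ?gam (%u. H eta (eta * u)))" for eta
 unfolding prod_bv H_def iter_Lr_rescale L0_Cons iter_Cons by (simp add: G_def)
 have E: "H eta0 (eta0 * s) = iter ?g Lr (%u. f eta0 (a + cmul eta0 u)) (set_coord (u1 k) idx1 s)" for s
 unfolding H_def iter_Lr_rescale bv_same ..
 have "contour_integral ?gam (%u. deriv (%c. H c (eta0 * u)) eta0) =
 contour_integral ?gam (%s. iter ?g Lr (%u. deriv (%eta. f eta (a + cmul eta0 u)) eta0) (set_coord (u1 k) idx1 s))"
 proof (rule contour_integral_eq)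
 fix s assume s: "s \<in> path_image ?gam"
 have "((%c. H c (eta0 * s)) has_field_derivative
 iter ?g Lr (%u. deriv (%c. f c (aff a (bv 1 eta0) u)) eta0) (set_coord (u1 k) idx1 (eta0 * s))) (at eta0)"
 unfolding H_def
 by (rule iter_has_field_derivative[where P = P and B = B',OF _ _ P(1) oB' fa P(2) sc[OF gam_D[OF P(2) s]]]) (use gB' in auto)
 then show "deriv (%c. H c (eta0 * s)) eta0 =
 iter ?g Lr (%u. deriv (%eta. f eta (a + cmul eta0 u)) eta0) (set_coord (u1 k) idx1 s)"
 using iter_Lr_rescale[of ?g "%w. deriv (%c. f c w) eta0" a eta0 "u1 k" eta0 s]
 by (simp add: DERIV_imp_deriv bv_same)
 qed
 also have "\<dots> = iter ?g L0 (%u. deriv (%eta. f eta (a + cmul eta0 u)) eta0) (u1 k)"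
 unfolding L0_Cons iter_Cons by (simp add: G_def)
 finally have I: "contour_integral ?gam (%u. deriv (%c. H c (eta0 * u)) eta0) =
 iter ?g L0 (%u. deriv (%eta. f eta (a + cmul eta0 u)) eta0) (u1 k)" .
 have pw: "eta0 ^ CARD('n) = eta0 ^ (CARD('n) - 1) * eta0"
 using power_minus_mult[of "CARD('n)" eta0] by simp
 note d' = d[unfolded I gam_startfinish E]
 show ?thesis unfolding J pw
 by (rule DERIV_cong[OF DERIV_cmult[OF d',of "eta0 ^ (CARD('n) - 1)"]]) (simp add: algebra_simps)
qed

lemma sum_card_complement:
 "(\<Sum>al | card al = CARD('n::finite) - 1. F al) = (\<Sum>i\<in>(UNIV :: 'n set). F (UNIV - {i}))"
proof -
 have "{al :: 'n set. card al = CARD('n) - 1} = (%i. UNIV - {i}) ` UNIV"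
 proof
 show "{al :: 'n set. card al = CARD('n) - 1} <= (%i. UNIV - {i}) ` UNIV"
 proof
 fix al :: "'n set" assume "al \<in> {al. card al = CARD('n) - 1}"
 then have "card (UNIV - al) = 1" using card_Diff_subset[of al UNIV] card_gt_0_iff[of "UNIV :: 'n set"] by simp
 then obtain i where "UNIV - al = {i}" by (auto simp: card_1_singleton_iff)
 then have "al = UNIV - {i}" by auto
 then show "al \<in> (%i. UNIV - {i}) ` UNIV" by auto
 qed
 qed auto
 moreover have "inj_on (%i. UNIV - {i}) (UNIV :: 'n set)" by (auto simp: inj_on_def)
 ultimately show ?thesis by (simp add: sum.reindex)
qed

lemma card_complement: "card (UNIV - {i}) = CARD('n) - 1" for i :: "'n::finite"
 by simp

text \<open>\<open>G\<close> with the first path pulled straight, for integrands that extend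
  holomorphically in the first variable.\<close>

definition Gseg :: "kappa => 'n::{finite,linorder} => real => complex" where
 "Gseg k i = (if i = idx1 then linepath (beta0 (rho k) (theta k)) (beta1 (rho k) (theta k)) else circlepath 0 (2/rho k))"

lemma npath_Gseg [simp]: "npath (Gseg k i)"
 by (simp add: Gseg_def)

text \<open>Of a sum of forms that extend in one variable each, only the part which extends in the first
 variable contributes, and there the path can be replaced by the segment between its endpoints.\<close>

lemma integral_null_forms:
 fixes e :: "'n::{finite,linorder} cvec => complex"
 assumes k: "admissible k" and x: "(z,zeta,eta) \<in> sdom k" and ep: "0 < ep" "ep <= 1"
 and h: "!!i. holo_on (h (UNIV - {i})) (V_multi k (UNIV - {i}))"
 and S: "open S" "starlike S" "S <= ball 0 (rho k)" "path_image (gam (rho k) (theta k) ep) <= S"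
 "closed_segment (beta0 (rho k) (theta k)) (beta1 (rho k) (theta k)) <= S"
 and e: "!!u. u $ idx1 \<in> S ==> (!!i. i ~= idx1 ==> cmod (u $ i) < 3/rho k) ==> chol e u"
 shows "iter (G k ep) L0 (%u. (\<Sum>al | card al = CARD('n) - 1. h al (z,z + cmul eta u,eta)) * e u) (u1 k) =
 iter (Gseg k) L0 (%u. h (UNIV - {idx1}) (z,z + cmul eta u,eta) * e u) (u1 k)"
proof -
 note kD = admissibleD[OF k]
 define f where "f i u = h (UNIV - {i}) (z,z + cmul eta u,eta) * e u" for i u
 define Bx where "Bx i j = (if j = (idx1::'n) then S Int ubox k (UNIV - {i}) j else ubox k (UNIV - {i}) j)" for i j
 have oB: "open (Bx i j)" for i j using S(1) by (auto simp: Bx_def open_ubox)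
 have fch: "chol (f i) u" if u: "u \<in> cbx (Bx i)" for i u
 proof -
 have u': "u $ j \<in> Bx i j" for j using u by (simp add: cbx_def)
 have "u $ j \<in> ubox k (UNIV - {i}) j" for j using u'[of j] by (auto simp: Bx_def split: if_splits)
 then have "u \<in> cbx (ubox k (UNIV - {i}))" by (simp add: cbx_def)
 from ubox_V_multi[OF k x this] have "chol (h (UNIV - {i})) (z,z + cmul eta u,eta)" using h by (auto simp: holo_on_iff_chol)
 moreover have "chol e u"
 proof (rule e)
 show "u $ idx1 \<in> S" using u'[of idx1] by (simp add: Bx_def)
 show "cmod (u $ j) < 3/rho k" if "j ~= idx1" for j using u'[of j] that by (simp add: Bx_def ubox_def)
 qed
 ultimately show ?thesis unfolding f_def
 by (intro chol_mult chol_compose[of "h (UNIV - {i})" "%u. (z,z + cmul eta u,eta)"] chol_intros)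
 qed
 have G_B: "path_image (G k ep j) <= Bx i j" for i j
 using G_ubox[OF k ep,of j "UNIV - {i}"] S(4) by (cases "j = idx1") (simp_all add: Bx_def G_def)
 have u1B: "u1 k \<in> cbx (Bx i)" for i using u1_G[of k _ ep] G_B by (fastforce simp: cbx_def)
 define B where "B j = (if j = (idx1::'n) then S Int ubox k UNIV j else ubox k UNIV j)" for j
 have BBx: "cbx B <= cbx (Bx i)" for i by (auto simp: cbx_def B_def Bx_def ubox_def split: if_splits)
 have GB: "path_image (G k ep j) <= B j" for j
 using G_ubox[OF k ep,of j UNIV] S(4) by (cases "j = idx1") (simp_all add: B_def G_def)
 have u1B': "u1 k \<in> cbx B" using u1_G[of k _ ep] GB by (fastforce simp: cbx_def)
 have cB: "continuous_on (cbx B) (f i)" for i using fch BBx by (intro chol_imp_continuous_on) auto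
 have z: "iter (G k ep) L0 (f i) (u1 k) = 0" if i: "i ~= idx1" for i
 proof (rule iter_eq_0[where B = "Bx i" and i = i,OF npath_G G_B oB fch u1B])
 fix F assume F: "F holomorphic_on Bx i i"
 have "Bx i i = ball 0 (3/rho k)" using i by (auto simp: Bx_def ubox_def)
 then show "contour_integral (G k ep i) F = 0"
 using circle_eq_0[of F 0 "3/rho k" 1 "2/rho k"] F i kD by (simp add: G_def divide_strict_right_mono)
 qed auto
 have seg: "iter (G k ep) L0 (f idx1) (u1 k) = iter (Gseg k) L0 (f idx1) (u1 k)"
 proof (rule iter_change_paths[where B = "Bx idx1",OF npath_G G_B npath_Gseg _ oB fch u1B])
 have S': "Bx idx1 idx1 = S" using S(3) by (auto simp: Bx_def ubox_def)
 show "path_image (Gseg k i) <= Bx idx1 i" for i :: 'n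
 using G_B[of i idx1] S(5) S' by (cases "i = idx1") (auto simp: Gseg_def G_def)
 fix i :: 'n and F assume F: "F holomorphic_on Bx idx1 i"
 show "contour_integral (G k ep i) F = contour_integral (Gseg k i) F"
 proof (cases "i = idx1")
 case True
 then obtain F' where F': "!!p. valid_path p ==> path_image p <= S ==> (F has_contour_integral F' (pathfinish p) - F' (pathstart p)) p"
 using starlike_primitive[OF S(1,2),of F] F S' by metis
 show ?thesis using True S
 contour_integral_unique[OF F'[of "gam (rho k) (theta k) ep"]] contour_integral_unique[OF F'[of "linepath (beta0 (rho k) (theta k)) (beta1 (rho k) (theta k))"]]
 by (simp add: G_def Gseg_def npath_valid)
 qed (simp add: G_def Gseg_def)
 qed
 have "iter (G k ep) L0 (%u. (\<Sum>al | card al = CARD('n) - 1. h al (z,z + cmul eta u,eta)) * e u) (u1 k) =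
 iter (G k ep) L0 (%u. \<Sum>i\<in>UNIV. f i u) (u1 k)"
 by (simp only: sum_card_complement f_def sum_distrib_right)
 also have "\<dots> = (\<Sum>i\<in>UNIV. iter (G k ep) L0 (f i) (u1 k))"
 by (rule iter_sum[where B = B,OF npath_G GB cB u1B'])
 also have "\<dots> = iter (G k ep) L0 (f idx1) (u1 k)"
 using z by (simp add: sum.remove[of UNIV "idx1 :: 'n"])
 finally show ?thesis using seg by (simp add: f_def[abs_def])
qed

lemma ER_D:
 assumes "psi \<in> ER k"
 obtains h where "holo_on psi (V_multi k UNIV)" "!!i. holo_on (h (UNIV - {i})) (V_multi k (UNIV - {i}))"
 "!!x. x \<in> V_multi k UNIV ==> pd_eta psi x = (\<Sum>al | card al = CARD('n::{finite,linorder}) - 1. h (al :: 'n set) x)"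
proof -
 obtain h where h: "\<forall>al :: 'n set. card al = CARD('n) - 1 --> holo_on (h al) (V_multi k al)"
 "\<forall>x\<in>V_multi k UNIV. pd_eta psi x = (\<Sum>al | card al = CARD('n) - 1. h al x)"
 using assms unfolding ER_def null_forms_def by blast
 show ?thesis
 using h assms by (intro that[of h]) (simp_all only: card_complement ER_def mem_Collect_eq)
qed

lemma beta_bound:
 assumes k: "admissible k" shows "cmod (beta0 (rho k) (theta k)) = rho k/2" "cmod (beta1 (rho k) (theta k)) = rho k/2"
 using admissibleD[OF k] by (simp_all add: beta_rcis)

lemma segment_ball:
 assumes k: "admissible k" shows "closed_segment (beta0 (rho k) (theta k)) (beta1 (rho k) (theta k)) <= ball 0 (rho k)"
 using admissibleD[OF k] beta_bound[OF k]
 by (intro closed_segment_subset convex_ball) auto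

lemma gam_ball:
 assumes k: "admissible k" and ep: "0 < ep" "ep <= 1"
 shows "path_image (gam (rho k) (theta k) ep) <= ball 0 (rho k)"
 using G_ubox[OF k ep,of idx1 "{}"] by (auto simp: G_def ubox_def)

text \<open>\<open>scaled_integral_has_derivative\<close> splits off the boundary terms, and
  \<open>integral_null_forms\<close> evaluates the integral of the eta-derivative of psi with the
  exponential as its holomorphic factor e.\<close>

lemma pd_eta_symbol_map:
 fixes psi :: "'n::{finite,linorder} triple => complex"
 assumes k: "admissible k" and psi: "holo_on psi (V_multi k UNIV)"
 and h: "!!i. holo_on (h (UNIV - {i})) (V_multi k (UNIV - {i}))"
 and psih: "!!x. x \<in> V_multi k UNIV ==> pd_eta psi x = (\<Sum>al | card al = CARD('n) - 1. h al x)"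
 and x: "(z,zeta,eta) \<in> sdom k"
 shows "pd_eta (symbol_map k psi) (z,zeta,eta) = eta ^ (CARD('n) - 1) *
 (beta1 (rho k) (theta k) * iter (G k 1) Lr (%u. psi (z,z + cmul eta u,eta) * exp (pairing (cmul eta u) zeta))
 (set_coord (u1 k) idx1 (beta1 (rho k) (theta k))) -
 beta0 (rho k) (theta k) * iter (G k 1) Lr (%u. psi (z,z + cmul eta u,eta) * exp (pairing (cmul eta u) zeta))
 (set_coord (u1 k) idx1 (beta0 (rho k) (theta k)))) +
 eta ^ CARD('n) * iter (Gseg k) L0 (%u. h (UNIV - {idx1}) (z,z + cmul eta u,eta) * exp (pairing (cmul eta u) zeta)) (u1 k)"
proof -
 note kD = admissibleD[OF k]
 have eta: "maxnorm z < rad' k" "eta \<in> sector (rad k) (theta k)" "3 * cmod eta < rho k * rad' k"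
 using x by (auto simp: sdom_def)
 note etaD = sectorD[OF eta(2)]
 define P where "P = ball eta (cmod eta/5) Int sector (rad k) (theta k) Int {eta. 3 * cmod eta < rho k * rad' k}"
 have P: "open P" "eta \<in> P" unfolding P_def using eta etaD kD
 by (auto intro!: open_Int open_sector open_Collect_less continuous_intros)
 have PD: "4/5 * cmod eta < cmod c" "cmod c < 6/5 * cmod eta" if "c \<in> P" for c
 using that norm_triangle_ineq2[of eta c] norm_triangle_ineq2[of c eta] by (auto simp: P_def dist_norm norm_minus_commute)
 \<comment> \<open>All c in P satisfy 4/5 < |c|/|eta| < 6/5, and the constants make one box
   admissible for all of them.\<close>
 define B where "B i = (if i = (idx1 :: 'n) then {s. cmod s < rho k * (4/5 * cmod eta) & - s \<in> Sect (theta k)}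
 else {s. 6/5 * cmod eta < rho k * cmod s & rho k * cmod s < 3 * cmod eta})" for i
 have oS: "open {s. - s \<in> Sect (theta k)}"
 using open_vimage[OF open_Sect[of "theta k"],of uminus] by (simp add: vimage_def continuous_on_minus)
 have oB: "open (B i)" for i
 unfolding B_def by (cases "i = idx1") (auto intro!: open_Collect_conj open_Collect_less continuous_intros oS)
 have V: "(z,z + w,c) \<in> V_multi k UNIV" if c: "c \<in> P" and w: "w \<in> cbx B" for c w
 proof -
 have wi: "w $ i \<in> B i" for i using w by (simp add: cbx_def)
 have "rho k * (4/5 * cmod eta) < rho k * cmod c" using PD[OF c] kD by (intro mult_strict_left_mono) auto
 then have "cmod (w $ idx1) < rho k * cmod c" "- (w $ idx1) \<in> Sect (theta k)"
 using wi[of idx1] by (auto simp: B_def)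
 moreover have "cmod c < rho k * cmod (w $ i) & cmod (w $ i) < rad' k" if "i ~= idx1" for i
 proof -
 have *: "6/5 * cmod eta < rho k * cmod (w $ i)" "rho k * cmod (w $ i) < 3 * cmod eta" using wi[of i] that by (auto simp: B_def)
 then have "rho k * cmod (w $ i) < rho k * rad' k" using eta(3) by linarith
 then show ?thesis using * PD[OF c] kD by simp
 qed
 ultimately show ?thesis using c eta by (simp add: V_multi_iff[OF k] P_def)
 qed
 let ?f = "%c w. psi (z,z + w,c) * exp (pairing w zeta)"
 have f: "chol (%p. ?f (fst p) (snd p)) (c,w)" if "c \<in> P" "w \<in> cbx B" for c w
 proof -
 have "chol psi (z,z + w,c)" using V[OF that] psi by (auto simp: holo_on_iff_chol)
 then show ?thesis
 by (intro chol_mult chol_exp chol_compose[of psi "%p. (z,z + snd p,fst p)"] chol_intros) auto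
 qed
 have g1: "(0 :: 'n cvec) $ idx1 + c * u \<in> B idx1" if c: "c \<in> P" and u: "u \<in> path_image (gam (rho k) (theta k) 1)" for c u
 proof -
 obtain r x where rx: "0 < r" "r <= rho k/2" "\<bar>x\<bar> <= (pi + theta k)/2" "u = rcis r x"
 using gam_image_rcis[OF _ _ kD(5,3) u] by auto
 have cS: "c \<in> sector (rad k) (theta k)" using c by (simp add: P_def)
 have "cmod (c * u) = cmod c * r" using rx by (simp add: norm_mult)
 also have "\<dots> <= (6/5 * cmod eta) * (rho k/2)" using PD[OF c] rx by (intro mult_mono) auto
 also have "\<dots> < rho k * (4/5 * cmod eta)" using etaD kD by simp
 finally show ?thesis using sectorD[OF cS] rx kD by (auto simp: B_def intro!: Sect_minus_rcis)
 qed
 have g2: "(0 :: 'n cvec) $ i + eta * u \<in> B i" if "i ~= idx1" "u \<in> path_image (circlepath 0 (2/rho k))" for i u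
 using that kD etaD by (auto simp: B_def norm_mult)
 note der = scaled_integral_has_derivative[where f = ?f and a = 0 and B = B and ep = 1 and k = k,OF P oB f g1 g2]
 have "pd_eta (symbol_map k psi) (z,zeta,eta) = deriv (%c. symbol_map k psi (z,zeta,c)) eta"
 by (simp add: pd_eta_def)
 \<comment> \<open>Near eta the symbol at c may be computed with the circles frozen at eta, by the
   freedom in b in \<open>symbol_map_eq\<close>.\<close>
 also have "\<dots> = deriv (%c. (\<Prod>i\<in>(UNIV :: 'n set). bv c eta $ i) * iter (G k 1) L0 (%u. ?f c (aff 0 (bv c eta) u)) (u1 k)) eta"
 proof (rule deriv_cong_ev)
 have "eventually (%c. c \<in> P) (nhds eta)" using P by (rule eventually_nhds_in_open)
 then show "eventually (%c. symbol_map k psi (z,zeta,c) =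
 (\<Prod>i\<in>(UNIV :: 'n set). bv c eta $ i) * iter (G k 1) L0 (%u. ?f c (aff 0 (bv c eta) u)) (u1 k)) (nhds eta)"
 proof eventually_elim
 case (elim c)
 show ?case
 using PD[OF elim] eta elim by (intro symbol_map_eq[OF k psi]) (auto simp: sdom_def P_def)
 qed
 qed auto
 finally have e1: "pd_eta (symbol_map k psi) (z,zeta,eta) = deriv (%c. (\<Prod>i\<in>(UNIV :: 'n set). bv c eta $ i) *
 iter (G k 1) L0 (%u. ?f c (aff 0 (bv c eta) u)) (u1 k)) eta" .
 have "iter (G k 1) L0 (%u. deriv (%c. ?f c (0 + cmul eta u)) eta) (u1 k) =
 iter (G k 1) L0 (%u. (\<Sum>al | card al = CARD('n) - 1. h al (z,z + cmul eta u,eta)) * exp (pairing (cmul eta u) zeta)) (u1 k)"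
 proof (rule iter_cong[where B = "ubox k UNIV"])
 fix u :: "'n cvec" assume u: "u \<in> cbx (ubox k UNIV)"
 note Vu = ubox_V_multi[OF k x u]
 have "chol psi (z,z + cmul eta u,eta)" using Vu psi by (auto simp: holo_on_iff_chol)
 then have "chol (%c. psi (z,z + cmul eta u,c)) eta"
 by (rule chol_compose[where f = psi and g = "%c. (z,z + cmul eta u,c)"]) (intro chol_intros)
 then have "deriv (%c. psi (z,z + cmul eta u,c) * exp (pairing (cmul eta u) zeta)) eta =
 pd_eta psi (z,z + cmul eta u,eta) * exp (pairing (cmul eta u) zeta)"
 by (subst deriv_cmult_right) (auto simp: chol_complex_iff pd_eta_def)
 then show "deriv (%c. ?f c (0 + cmul eta u)) eta =
 (\<Sum>al | card al = CARD('n) - 1. h al (z,z + cmul eta u,eta)) * exp (pairing (cmul eta u) zeta)"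
 using psih[OF Vu] by simp
 qed (use G_ubox[OF k,of 1] u1_ubox[OF k] in simp_all)
 also have "\<dots> = iter (Gseg k) L0 (%u. h (UNIV - {idx1}) (z,z + cmul eta u,eta) * exp (pairing (cmul eta u) zeta)) (u1 k)"
 using kD segment_ball[OF k] gam_ball[OF k,of 1]
 by (intro integral_null_forms[where S = "ball 0 (rho k)",OF k x _ _ h])
 (auto intro!: convex_imp_starlike chol_exp chol_intros)
 finally have e2: "iter (G k 1) L0 (%u. deriv (%c. ?f c (0 + cmul eta u)) eta) (u1 k) =
 iter (Gseg k) L0 (%u. h (UNIV - {idx1}) (z,z + cmul eta u,eta) * exp (pairing (cmul eta u) zeta)) (u1 k)" .
 show ?thesis using e1 DERIV_imp_deriv[OF der] unfolding e2 by simp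
qed

section \<open>Cones of covectors\<close>

definition cone_dev :: "'n::{finite,linorder} cvec => 'n => complex" where
 "cone_dev zeta i = zeta $ i - (if i = idx1 then of_real (Re (zeta $ idx1)) else 0)"

text \<open>Closed conic neighbourhoods of the direction (1,0,...,0). The deviation is measured
  against Re zeta_1 because it is Re zeta_1 that multiplies the negative Re (eta u_1) in the
  exponent.\<close>

definition Cone :: "real => 'n::{finite,linorder} cvec set" where
 "Cone b = {zeta. ALL i. cmod (cone_dev zeta i) <= b * Re (zeta $ idx1)}"

lemma cone_split: "zeta $ i = (if i = idx1 then of_real (Re (zeta $ idx1)) else 0) + cone_dev zeta i"
 by (simp add: cone_dev_def)

lemma maxnorm_nth: "cmod (z $ i) <= maxnorm z"
 using maxnorm_le_iff[of z "maxnorm z"] by simp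

lemma maxnorm_nonneg: "0 <= maxnorm z"
 using maxnorm_nth[of z undefined] norm_ge_zero order_trans by blast

lemma maxnorm_scale: "maxnorm (eta *s zeta) = cmod eta * maxnorm zeta"
proof (cases "eta = 0")
 case False
 show ?thesis
 proof (rule antisym)
 show "maxnorm (eta *s zeta) <= cmod eta * maxnorm zeta"
 unfolding maxnorm_le_iff by (auto simp: norm_mult intro!: mult_left_mono maxnorm_nth)
 have "maxnorm zeta <= maxnorm (eta *s zeta)/cmod eta"
 unfolding maxnorm_le_iff
 proof
 fix i show "cmod (zeta $ i) <= maxnorm (eta *s zeta)/cmod eta"
 using maxnorm_nth[of "eta *s zeta" i] False by (simp add: norm_mult field_simps)
 qed
 then show "cmod eta * maxnorm zeta <= maxnorm (eta *s zeta)" using False by (simp add: field_simps)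
 qed
next
 case True
 then have "maxnorm (eta *s zeta) <= 0" by (simp add: maxnorm_le_iff)
 then show ?thesis using maxnorm_nonneg[of "eta *s zeta"] True by simp
qed

lemma maxnorm_pos: "zeta ~= 0 ==> 0 < maxnorm zeta"
 using maxnorm_nth[of zeta] by (force simp: vec_eq_iff intro: less_le_trans[OF _ maxnorm_nth])

lemma ConeD:
 assumes "zeta \<in> Cone b" "0 < b" "b <= 1"
 shows "0 <= Re (zeta $ idx1)" "Re (zeta $ idx1) <= maxnorm zeta" "maxnorm zeta <= 2 * Re (zeta $ idx1)"
proof -
 let ?X = "Re (zeta $ idx1)"
 have d: "cmod (cone_dev zeta i) <= b * ?X" for i using assms by (simp add: Cone_def)
 have "0 <= b * ?X" using d norm_ge_zero order_trans by blast
 then show X: "0 <= ?X" using assms by (simp add: zero_le_mult_iff)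
 show "?X <= maxnorm zeta" using maxnorm_nth[of zeta idx1] complex_Re_le_cmod order_trans by blast
 show "maxnorm zeta <= 2 * ?X"
 unfolding maxnorm_le_iff
 proof
 fix i
 have "cmod (zeta $ i) <= cmod (if i = idx1 then of_real ?X else 0) + cmod (cone_dev zeta i)"
 using norm_triangle_ineq[of "if i = idx1 then of_real ?X else 0" "cone_dev zeta i"] cone_split[of zeta i] by simp
 also have "\<dots> <= ?X + 1 * ?X" using X d[of i] assms mult_right_mono[of b 1 ?X] by (intro add_mono) auto
 finally show "cmod (zeta $ i) <= 2 * ?X" by simp
 qed
qed

lemma Cone_mono: "b <= b' ==> 0 < b ==> b <= 1 ==> Cone b <= Cone b'"
proof
 fix zeta :: "'a cvec" assume b: "b <= b'" "0 < b" "b <= 1" and z: "zeta \<in> Cone b"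
 then have "b * Re (zeta $ idx1) <= b' * Re (zeta $ idx1)" using ConeD(1)[OF z b(2,3)] by (simp add: mult_right_mono)
 then show "zeta \<in> Cone b'" using z by (auto simp: Cone_def intro: order_trans)
qed

text \<open>Replacing zeta by (Re zeta_1, 0, ..., 0) leaves Re s_1 times Re zeta_1; each of the n
  deviations costs at most b M Re zeta_1.\<close>

lemma Re_pairing_cone:
 fixes s zeta :: "'n::{finite,linorder} cvec"
 assumes "zeta \<in> Cone b" "0 < b" "b <= 1" "Re (s $ idx1) <= - m" "!!i. cmod (s $ i) <= M"
 shows "Re (pairing s zeta) <= (- m + real CARD('n) * b * M) * Re (zeta $ idx1)"
proof -
 let ?X = "Re (zeta $ idx1)"
 have X: "0 <= ?X" by (rule ConeD[OF assms(1-3)])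
 have "pairing s zeta = (\<Sum>i\<in>UNIV. s $ i * (if i = idx1 then of_real ?X else 0)) + (\<Sum>i\<in>UNIV. s $ i * cone_dev zeta i)"
 unfolding pairing_def by (subst cone_split) (simp add: distrib_left sum.distrib)
 also have "(\<Sum>i\<in>UNIV. s $ i * (if i = idx1 then of_real ?X else 0)) = s $ idx1 * of_real ?X"
 by (simp add: if_distrib cong: if_cong)
 finally have "Re (pairing s zeta) = Re (s $ idx1) * ?X + Re (\<Sum>i\<in>UNIV. s $ i * cone_dev zeta i)" by simp
 also have "Re (\<Sum>i\<in>UNIV. s $ i * cone_dev zeta i) <= (\<Sum>i\<in>(UNIV::'n set). M * (b * ?X))"
 proof (rule order_trans[OF complex_Re_le_cmod sum_norm_le])
 have "0 <= M" using assms(5) norm_ge_zero order_trans by blast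
 then show "cmod (s $ i * cone_dev zeta i) <= M * (b * ?X)" for i
 using assms unfolding norm_mult Cone_def by (intro mult_mono) auto
 qed
 also have "Re (s $ idx1) * ?X <= - m * ?X" using assms(4) X by (rule mult_right_mono)
 finally show ?thesis by (simp add: algebra_simps)
qed

lemma cmod_pairing_le:
 fixes s zeta :: "'n::finite cvec"
 assumes "!!i. cmod (s $ i) <= M"
 shows "cmod (pairing s zeta) <= real CARD('n) * M * maxnorm zeta"
proof -
 have "0 <= M" using assms norm_ge_zero order_trans by blast
 then have "cmod (pairing s zeta) <= (\<Sum>i\<in>(UNIV::'n set). M * maxnorm zeta)"
 unfolding pairing_def using assms
 by (intro sum_norm_le) (auto simp: norm_mult intro!: mult_mono maxnorm_nth)
 then show ?thesis by simp
qed

section \<open>Bounds on explicit regions, and germs\<close>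

definition Rg :: "real => real => complex set => 'n::{finite,linorder} triple set" where
 "Rg a b S = {(z,zeta,eta). maxnorm z <= a & zeta \<in> Cone b & zeta ~= 0 & eta \<in> S}"

text \<open>Lets all estimates be made on the explicit regions \<open>Rg\<close>; germs in the sense
  of \<open>frakN\<close>, \<open>frakS\<close> and \<open>frakN_cl\<close> are obtained afterwards
  with d = 1.\<close>

lemma sym_dom_Rg:
 assumes a: "0 < a" and b: "0 < b" "b <= 1"
 obtains \<Omega> \<rho> where "conic_nbhd (z0star :: 'n::{finite,linorder} cvec \<times> 'n cvec) \<Omega>" "0 < \<rho>" "\<rho> < 1"
 "!!Z. sym_dom_times \<Omega> \<rho> 1 Z <= Rg a b Z"
proof -
 define \<Omega> where "\<Omega> = {(z :: 'n cvec,zeta). (ALL i. cmod (z $ i) < a/2) & (ALL i. cmod (cone_dev zeta i) < b/4 * Re ((zeta :: 'n cvec) $ (idx1 :: 'n)))}"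
 \<comment> \<open>As |zeta| <= 2 Re zeta_1 in the cone, thickening moves each zeta_i by at most
   (b/8) Re zeta_1, which the passage from aperture b/4 to b absorbs.\<close>
 define \<rho> where "\<rho> = min (a/2) (b/16)"
 have \<rho>: "0 < \<rho>" "\<rho> < 1" "\<rho> <= a/2" "\<rho> <= b/16" using a b by (auto simp: \<rho>_def)
 have cd: "continuous_on UNIV (%x. cone_dev (snd x) i)" for i :: 'n
 unfolding cone_dev_def by (cases "i = idx1") (auto intro!: continuous_intros)
 have "\<Omega> = (\<Inter>i\<in>UNIV. {x. cmod (fst x $ i) < a/2}) Int (\<Inter>i\<in>UNIV. {x. cmod (cone_dev (snd x) i) < b/4 * Re (snd x $ idx1)})"
 by (auto simp: \<Omega>_def)
 then have "open \<Omega>"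
 by (auto intro!: open_Int open_INT open_Collect_less continuous_intros cd)
 moreover have "z0star \<in> \<Omega>" using a b by (auto simp: z0star_def \<Omega>_def cone_dev_def axis_def)
 moreover have "(z,c *\<^sub>R zeta) \<in> \<Omega>" if "c > 0" "(z,zeta) \<in> \<Omega>" for z zeta and c :: real
 proof -
 have "cone_dev (c *\<^sub>R zeta) i = c *\<^sub>R cone_dev zeta i" for i by (simp add: cone_dev_def complex_eq_iff algebra_simps)
 then show ?thesis using that by (simp add: \<Omega>_def)
 qed
 \<comment> \<open>Scaled to Re zeta_1 = 1, the covectors of \<Omega> have entries within b/4 of
   those of (1,0,...,0).\<close>
 moreover define K where "K = (cbx (%_. cball 0 a) :: 'n cvec set) \<times> cbx (%i. cball (if i = (idx1::'n) then 1 else 0) (b/4))"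
 have "compact K" unfolding K_def by (intro compact_Times compact_cbx) auto
 moreover have "zeta ~= 0" if "(z,zeta) \<in> K" for z :: "'n cvec" and zeta
 proof
 assume "zeta = 0"
 have "ALL i. zeta $ i \<in> cball (if i = (idx1::'n) then 1 else 0) (b/4)"
 using that unfolding K_def cbx_def by blast
 from spec[OF this,of idx1] have "zeta $ idx1 \<in> cball 1 (b/4)" by simp
 then show False using b \<open>zeta = 0\<close> by simp
 qed
 moreover have "\<Omega> <= {(z,c *\<^sub>R zeta) | z zeta c. (z,zeta) \<in> K & c > 0}"
 proof
 fix x assume x: "x \<in> \<Omega>"
 obtain z zeta where zx: "x = (z,zeta)" by (cases x)
 let ?X = "Re (zeta $ idx1)"
 have d: "cmod (z $ i) < a/2" "cmod (cone_dev zeta i) < b/4 * ?X" for i using x by (auto simp: zx \<Omega>_def)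
 have "0 < b/4 * ?X" using d(2) norm_ge_zero le_less_trans by blast
 then have X: "?X > 0" using b by (simp add: zero_less_mult_iff)
 have "(1/?X) *\<^sub>R zeta \<in> cbx (%i. cball (if i = idx1 then 1 else 0) (b/4))"
 proof -
 have "dist (if i = idx1 then 1 else 0) (((1/?X) *\<^sub>R zeta) $ i) <= b/4" for i
 proof -
 have "((1/?X) *\<^sub>R zeta) $ i - (if i = idx1 then 1 else 0) = (1/?X) *\<^sub>R cone_dev zeta i"
 using X by (auto simp: cone_dev_def complex_eq_iff)
 then have "cmod (((1/?X) *\<^sub>R zeta) $ i - (if i = idx1 then 1 else 0)) = cmod (cone_dev zeta i)/?X"
 using X by (simp only: norm_scaleR) simp
 then have "dist (if i = idx1 then 1 else 0) (((1/?X) *\<^sub>R zeta) $ i) = cmod (cone_dev zeta i)/?X"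
 by (metis dist_commute dist_norm)
 also have "\<dots> <= b/4" using d(2)[of i] X by (simp add: divide_le_eq)
 finally show ?thesis .
 qed
 then show ?thesis by (simp add: cbx_def)
 qed
 moreover have "z \<in> cbx (%_. cball 0 a)"
 unfolding cbx_def using d(1) a by (auto simp: less_imp_le intro: order.trans[OF less_imp_le[OF d(1)]])
 moreover have "zeta = ?X *\<^sub>R ((1/?X) *\<^sub>R zeta)" using X by simp
 ultimately show "x \<in> {(z,c *\<^sub>R zeta) | z zeta c. (z,zeta) \<in> K & c > 0}"
 using X unfolding zx K_def by blast
 qed
 ultimately have nb: "conic_nbhd (z0star :: 'n cvec \<times> 'n cvec) \<Omega>"
 unfolding conic_nbhd_def by blast
 have thick: "thicken \<Omega> \<rho> <= {(z,zeta). (ALL i. cmod (z $ i) <= a) & zeta \<in> Cone b}"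
 unfolding thicken_def
 proof (rule closure_minimal)
 have "{(z :: 'n cvec,zeta :: 'n cvec). (ALL i. cmod (z $ i) <= a) & zeta \<in> Cone b} =
 (\<Inter>i\<in>UNIV. {x. cmod (fst x $ i) <= a}) Int (\<Inter>i\<in>UNIV. {x. cmod (cone_dev (snd x) i) <= b * Re (snd x $ idx1)})"
 by (auto simp: Cone_def)
 then show "closed {(z :: 'n cvec,zeta :: 'n cvec). (ALL i. cmod (z $ i) <= a) & zeta \<in> Cone b}"
 by (auto intro!: closed_Int closed_INT closed_Collect_le continuous_intros cd)
 have "(ALL i. cmod ((z + z') $ i) <= a) & zeta + zeta' \<in> Cone b"
 if x: "(z,zeta) \<in> \<Omega>" and x': "maxnorm z' <= \<rho>" "maxnorm zeta' <= \<rho> * maxnorm zeta" for z z' zeta zeta' :: "'n cvec"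
 proof
 let ?X = "Re (zeta $ idx1)"
 have d: "cmod (z $ i) < a/2" "cmod (cone_dev zeta i) < b/4 * ?X" for i using x by (auto simp: \<Omega>_def)
 show "ALL i. cmod ((z + z') $ i) <= a"
 proof
 fix i
 have "cmod ((z + z') $ i) <= a/2 + \<rho>"
 using d(1)[of i] maxnorm_nth[of z' i] x' norm_triangle_ineq[of "z $ i" "z' $ i"] by simp
 then show "cmod ((z + z') $ i) <= a" using \<rho> by linarith
 qed
 have "0 < b/4 * ?X" using d(2) norm_ge_zero le_less_trans by blast
 then have X: "?X > 0" using b by (simp add: zero_less_mult_iff)
 have "zeta \<in> Cone (b/4)" using d(2) by (auto simp: Cone_def less_imp_le)
 then have "maxnorm zeta <= 2 * ?X" using ConeD(3)[of zeta "b/4"] b by simp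
 then have "\<rho> * maxnorm zeta <= b/16 * (2 * ?X)" using \<rho> maxnorm_nonneg[of zeta] by (intro mult_mono) auto
 then have z': "cmod (zeta' $ i) <= b/8 * ?X" for i using maxnorm_nth[of zeta' i] x'(2) by simp
 have re': "\<bar>Re (zeta' $ idx1)\<bar> <= b/8 * ?X" using z'[of idx1] abs_Re_le_cmod[of "zeta' $ idx1"] by linarith
 have X': "Re ((zeta + zeta') $ idx1) \<ge> ?X - b/8 * ?X" using re' unfolding vector_add_component plus_complex.sel by linarith
 show "zeta + zeta' \<in> Cone b"
 unfolding Cone_def mem_Collect_eq
 proof
 fix i
 have "cone_dev (zeta + zeta') i = cone_dev zeta i + cone_dev zeta' i" by (simp add: cone_dev_def)
 then have "cmod (cone_dev (zeta + zeta') i) <= cmod (cone_dev zeta i) + cmod (cone_dev zeta' i)"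
 by (simp add: norm_triangle_ineq)
 also have "cmod (cone_dev zeta' i) <= 2 * (b/8 * ?X)"
 proof -
 have 1: "cmod (cone_dev zeta' i) <= cmod (zeta' $ i) + cmod (if i = idx1 then of_real (Re (zeta' $ idx1)) else 0)"
 unfolding cone_dev_def by (rule norm_triangle_ineq4)
 have "0 <= b/8 * ?X" using X b by simp
 then have 2: "cmod (if i = idx1 then complex_of_real (Re (zeta' $ idx1)) else 0) <= b/8 * ?X"
 using re' by (cases "i = idx1") simp_all
 show ?thesis using 1 2 z'[of i] by linarith
 qed
 finally have "cmod (cone_dev (zeta + zeta') i) <= b/2 * ?X" using d(2)[of i] by linarith
 also have "\<dots> <= b * (?X - b/8 * ?X)"
 proof -
 have "b * b * ?X <= b * 1 * ?X" using b X by (intro mult_right_mono mult_left_mono) auto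
 moreover have "b * (?X - b/8 * ?X) = b * ?X - (b * b * ?X)/8" by (simp add: algebra_simps)
 moreover have "0 < b * ?X" using b X by simp
 ultimately show ?thesis by simp
 qed
 also have "\<dots> <= b * Re ((zeta + zeta') $ idx1)" using X' b by (intro mult_left_mono) auto
 finally show "cmod (cone_dev (zeta + zeta') i) <= b * Re ((zeta + zeta') $ idx1)" .
 qed
 qed
 then show "(\<Union>(z,zeta)\<in>\<Omega>. {(z + z',zeta + zeta') | z' zeta'. maxnorm z' <= \<rho> & maxnorm zeta' <= \<rho> * maxnorm zeta}) \<subseteq>
 {(z,zeta). (ALL i. cmod (z $ i) <= a) & zeta \<in> Cone b}" by fast
 qed
 have "sym_dom_times \<Omega> \<rho> 1 Z <= Rg a b Z" for Z
 proof
 fix x assume x: "x \<in> sym_dom_times \<Omega> \<rho> 1 Z"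
 obtain z zeta eta where zx: "x = (z,zeta,eta)" by (cases x)
 have m: "(z,zeta) \<in> thicken \<Omega> \<rho>" "1 - \<rho> <= maxnorm zeta" "eta \<in> Z" using x by (auto simp: zx sym_dom_times_def sym_dom_def)
 have "maxnorm z <= a" "zeta \<in> Cone b" using thick m(1) unfolding maxnorm_le_iff by auto
 moreover have "maxnorm (0 :: 'n cvec) <= 0" unfolding maxnorm_le_iff by simp
 then have "zeta ~= 0" using m(2) \<rho>(2) by auto
 ultimately show "x \<in> Rg a b Z" using m(3) by (simp add: zx Rg_def)
 qed
 then show ?thesis using that nb \<rho> by blast
qed

text \<open>The condition of \<open>frakN\<close> with region and rate explicit, so that several
  bounds can be combined; \<open>SB\<close> is the growth condition of \<open>frakS\<close> in the
  same form. Compact Z replaces relatively compact Z.\<close>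

definition NB :: "real => real => complex set => real => ('n::{finite,linorder} triple => complex) => bool" where
 "NB a b S dl P \<longleftrightarrow> (EX W. open W & Rg a b S <= W & holo_on P W) &
 (ALL Z. compact Z --> Z <= S --> (EX C. ALL z zeta eta. (z,zeta,eta) \<in> Rg a b Z -->
 cmod (P (z,zeta,eta)) <= C * exp (- dl * (cmod eta * maxnorm zeta))))"

definition SB :: "real => real => complex set => ('n::{finite,linorder} triple => complex) => bool" where
 "SB a b S P \<longleftrightarrow> (EX W. open W & Rg a b S <= W & holo_on P W) &
 (ALL Z h. compact Z --> Z <= S --> h > 0 --> (EX C. ALL z zeta eta. (z,zeta,eta) \<in> Rg a b Z -->
 cmod (P (z,zeta,eta)) <= C * exp (h * maxnorm zeta)))"

lemma Rg_mono: "a <= a' ==> b <= b' ==> 0 < b ==> b <= 1 ==> S <= S' ==> Rg a b S <= Rg a' b' S'"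
 using Cone_mono[of b b'] unfolding Rg_def by auto

lemma NB_D:
 assumes "NB a b S dl P"
 shows "EX W. open W & Rg a b S <= W & holo_on P W"
 "compact Z ==> Z <= S ==> EX C. ALL z zeta eta. (z,zeta,eta) \<in> Rg a b Z -->
 cmod (P (z,zeta,eta)) <= C * exp (- dl * (cmod eta * maxnorm zeta))"
 using assms by (simp_all add: NB_def)

lemma SB_D:
 assumes "SB a b S P"
 shows "EX W. open W & Rg a b S <= W & holo_on P W"
 "compact Z ==> Z <= S ==> h > 0 ==> EX C. ALL z zeta eta. (z,zeta,eta) \<in> Rg a b Z -->
 cmod (P (z,zeta,eta)) <= C * exp (h * maxnorm zeta)"
 using assms by (simp_all add: SB_def)

lemma holo_near_sym_dom:
 assumes "sym_dom_times \<Omega> \<rho> 1 S <= Rg a b S" "EX W. open W & Rg a b S <= W & holo_on P W"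
 shows "holo_near P (sym_dom_times \<Omega> \<rho> 1 S)"
proof -
 obtain W where "open W" "Rg a b S <= W" "holo_on P W" using assms(2) by (elim exE conjE)
 then show ?thesis unfolding holo_near_def using assms(1) by (intro exI[of _ W] conjI) (simp_all add: order.trans)
qed

text \<open>A relatively compact Z is replaced by its closure, which is compact and still inside
  S.\<close>

lemma sym_dom_bound:
 assumes sub: "!!Z. sym_dom_times \<Omega> \<rho> 1 Z <= Rg a b Z" and Z: "rel_compact Z S"
 and bd: "!!Z. compact Z ==> Z <= S ==> EX C. ALL z zeta eta. (z,zeta,eta) \<in> Rg a b Z --> Q C (z,zeta,eta)"
 shows "EX C. \<forall>x\<in>sym_dom_times \<Omega> \<rho> 1 Z. Q C x"
proof -
 have "compact (closure Z)" "closure Z <= S" using Z by (simp_all add: rel_compact_def)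
 from bd[OF this] obtain C where C: "ALL z zeta eta. (z,zeta,eta) \<in> Rg a b (closure Z) --> Q C (z,zeta,eta)" ..
 show ?thesis
 proof (intro exI[of _ C] ballI)
 fix x assume x: "x \<in> sym_dom_times \<Omega> \<rho> 1 Z"
 obtain z zeta eta where zx: "x = (z,zeta,eta)" by (cases x)
 have "eta \<in> closure Z" using x closure_subset[of Z] by (auto simp: zx sym_dom_times_def)
 then have "x \<in> Rg a b (closure Z)" using x sub[of Z] by (auto simp: zx Rg_def)
 then show "Q C x" using C by (simp add: zx)
 qed
qed

lemma frakN_I:
 assumes sub: "!!Z. sym_dom_times \<Omega> \<rho> 1 Z <= Rg a b Z" and \<rho>: "0 < \<rho>" "\<rho> < 1" and P: "NB a b S dl P" "dl > 0"
 shows "P \<in> frakN \<Omega> S"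
proof -
 have "holo_near P (sym_dom_times \<Omega> \<rho> 1 S)"
 by (rule holo_near_sym_dom[OF sub NB_D(1)[OF P(1)]])
 moreover have bd: "EX C. \<forall>x \<in> sym_dom_times \<Omega> \<rho> 1 Z. (%C (z,zeta,eta). cmod (P (z,zeta,eta)) <= C * exp (- dl * maxnorm (eta *s zeta))) C x"
 if "rel_compact Z S" for Z
 by (rule sym_dom_bound[OF sub that]) (use NB_D(2)[OF P(1)] in \<open>simp add: maxnorm_scale\<close>)
 moreover have "\<exists>dl>0. ALL Z. rel_compact Z S --> (EX C. \<forall>(z,zeta,eta) \<in> sym_dom_times \<Omega> \<rho> 1 Z.
 cmod (P (z,zeta,eta)) <= C * exp (- dl * maxnorm (eta *s zeta)))"
 by (rule exI[of _ dl],intro conjI allI impI P(2)) (rule bd)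
 ultimately have "\<exists>\<rho>\<in>{0<..<1}. holo_near P (sym_dom_times \<Omega> \<rho> 1 S) & (\<exists>dl>0. ALL Z. rel_compact Z S --> (EX C. \<forall>(z,zeta,eta) \<in> sym_dom_times \<Omega> \<rho> 1 Z.
 cmod (P (z,zeta,eta)) <= C * exp (- dl * maxnorm (eta *s zeta))))"
 using \<rho> by (intro bexI[of _ \<rho>] conjI) simp_all
 then show ?thesis unfolding frakN_def mem_Collect_eq by (intro exI[of _ 1] conjI) simp_all
qed

lemma NB_germ:
 fixes P :: "'n::{finite,linorder} triple => complex"
 assumes "NB a b (sector r th) dl P" "0 < dl" "0 < a" "0 < b" "b <= 1" "0 < r" "r < 1/2" "0 < th" "th < 1/2"
 shows "P \<in> germs z0star frakN"
proof -
 obtain \<Omega> \<rho> where "conic_nbhd (z0star :: 'n cvec \<times> 'n cvec) \<Omega>" "0 < \<rho>" "\<rho> < 1" "!!Z. sym_dom_times \<Omega> \<rho> 1 Z <= Rg a b Z"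
 by (rule sym_dom_Rg[OF assms(3-5)],rule that)
 then have "conic_nbhd z0star \<Omega>" "P \<in> frakN \<Omega> (sector r th)" using frakN_I[of \<Omega> \<rho> a b "sector r th" dl P] assms(1,2) by blast+
 then show ?thesis unfolding germs_def mem_Collect_eq using assms(6-9)
 by (intro exI[of _ \<Omega>] conjI bexI[of _ r] bexI[of _ th]) simp_all
qed

lemma SB_germ:
 fixes P :: "'n::{finite,linorder} triple => complex"
 assumes "SB a b (sector r th) P" "NB a b (sector r th) dl (pd_eta P)" "0 < dl" "0 < a" "0 < b" "b <= 1" "0 < r" "r < 1/2" "0 < th" "th < 1/2"
 shows "P \<in> germs z0star frakS"
proof -
 obtain \<Omega> \<rho> where \<Omega>: "conic_nbhd (z0star :: 'n cvec \<times> 'n cvec) \<Omega>" "0 < \<rho>" "\<rho> < 1" and sub: "!!Z. sym_dom_times \<Omega> \<rho> 1 Z <= Rg a b Z"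
 by (rule sym_dom_Rg[OF assms(4-6)],rule that)
 let ?S = "sector r th"
 have pdN: "pd_eta P \<in> frakN \<Omega> ?S" by (rule frakN_I[OF sub \<Omega>(2,3) assms(2,3)])
 have hn: "holo_near P (sym_dom_times \<Omega> \<rho> 1 ?S)"
 by (rule holo_near_sym_dom[OF sub SB_D(1)[OF assms(1)]])
 have bd: "EX C. \<forall>x \<in> sym_dom_times \<Omega> \<rho> 1 Z. (%C (z,zeta,eta). cmod (P (z,zeta,eta)) <= C * exp (h * maxnorm zeta)) C x"
 if "rel_compact Z ?S" "h > 0" for Z h
 by (rule sym_dom_bound[OF sub that(1)]) (use SB_D(2)[OF assms(1) _ _ that(2)] in simp)
 have "\<exists>\<rho>\<in>{0<..<1}. holo_near P (sym_dom_times \<Omega> \<rho> 1 ?S) & (\<forall>h>0. ALL Z. rel_compact Z ?S --> (EX C. \<forall>(z,zeta,eta) \<in> sym_dom_times \<Omega> \<rho> 1 Z.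
 cmod (P (z,zeta,eta)) <= C * exp (h * maxnorm zeta)))"
 by (rule bexI[of _ \<rho>],intro conjI hn allI impI,rule bd) (use \<Omega>(2,3) in simp_all)
 then have "P \<in> frakS \<Omega> ?S" unfolding frakS_def mem_Collect_eq using pdN
 by (intro conjI exI[of _ 1]) simp_all
 then show ?thesis unfolding germs_def mem_Collect_eq using assms(7-10) \<Omega>(1)
 by (intro exI[of _ \<Omega>] conjI bexI[of _ r] bexI[of _ th]) simp_all
qed

subsection \<open>Estimates for the symbol mapping\<close>

definition Sk :: "kappa => complex set" where
 "Sk k = {eta \<in> sector (rad k) (theta k). 3 * cmod eta < rho k * rad' k}"

lemma sdom_Sk: "(z,zeta,eta) \<in> sdom k \<longleftrightarrow> maxnorm z < rad' k & eta \<in> Sk k"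
 by (auto simp: sdom_def Sk_def)

lemma Sk_scale:
 assumes "eta \<in> Sk k" "0 < t" "t <= 1" shows "of_real t * eta \<in> Sk k"
proof -
 have "t * cmod eta <= cmod eta" using assms by (simp add: mult_left_le_one_le)
 then have "3 * cmod (of_real t * eta) < rho k * rad' k" using assms by (simp add: Sk_def norm_mult)
 then show ?thesis using assms sector_scale[of eta "rad k" "theta k" t] by (simp add: Sk_def)
qed

definition mk :: "kappa => real" where
 "mk k = rho k/2 * sin (theta k/4)"

lemma mk_pos: "admissible k ==> mk k > 0"
 using admissibleD[of k] by (auto simp: mk_def intro!: mult_pos_pos sin_gt_zero)

text \<open>The ends have arguments -(pi + theta)/2 and (pi + theta)/2. Multiplication by eta turns
  them by less than theta/4, so the cosines stay <= - sin (theta/4), whence the rate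
  \<open>mk\<close>; the bound is linear in u and passes to the segment.\<close>

lemma Re_beta_le:
 assumes k: "admissible k" and eta: "\<bar>Arg eta\<bar> < theta k/4"
 and u: "u \<in> closed_segment (beta0 (rho k) (theta k)) (beta1 (rho k) (theta k))"
 shows "Re (eta * u) <= - mk k * cmod eta"
proof -
 note kD = admissibleD[OF k]
 have sn: "sin (theta k/4) <= sin (theta k/2 + t)" if "\<bar>t\<bar> < theta k/4" for t
 using that kD by (intro sin_monotone_2pi_le) auto
 have cosm: "cos (- ((pi + theta k)/2) + Arg eta) = - sin (theta k/2 + - Arg eta)"
 "cos ((pi + theta k)/2 + Arg eta) = - sin (theta k/2 + Arg eta)"
 unfolding add_divide_distrib by (simp_all add: cos_add sin_add cos_diff sin_diff)
 have b: "Re (eta * beta0 (rho k) (theta k)) <= - mk k * cmod eta" "Re (eta * beta1 (rho k) (theta k)) <= - mk k * cmod eta"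
 proof -
 have e: "Re (eta * s) = cmod eta * lf (Arg eta) s" for s using lf_mult[of 0 eta s] by simp
 have r2: "0 <= rho k/2" using kD by simp
 have l: "lf (Arg eta) (beta0 (rho k) (theta k)) <= - mk k" "lf (Arg eta) (beta1 (rho k) (theta k)) <= - mk k"
 unfolding beta_rcis lf_simps cosm mk_def mult_minus_right
 using mult_left_mono[OF sn[of "- Arg eta"] r2] mult_left_mono[OF sn[of "Arg eta"] r2] eta by simp_all
 show "Re (eta * beta0 (rho k) (theta k)) <= - mk k * cmod eta" "Re (eta * beta1 (rho k) (theta k)) <= - mk k * cmod eta"
 unfolding e using mult_left_mono[OF l(1) norm_ge_zero[of eta]] mult_left_mono[OF l(2) norm_ge_zero[of eta]]
 by (simp_all only: mult.commute)
 qed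
 obtain t where t: "0 <= t" "t <= 1" "u = (1 - t) *\<^sub>R beta0 (rho k) (theta k) + t *\<^sub>R beta1 (rho k) (theta k)"
 using u unfolding closed_segment_def by blast
 have "eta * u = of_real (1 - t) * (eta * beta0 (rho k) (theta k)) + of_real t * (eta * beta1 (rho k) (theta k))"
 by (simp add: t(3) scaleR_conv_of_real algebra_simps)
 then have "Re (eta * u) = (1 - t) * Re (eta * beta0 (rho k) (theta k)) + t * Re (eta * beta1 (rho k) (theta k))"
 by (metis Re_complex_of_real lf_simps(1,5,9))
 also have "\<dots> <= (1 - t) * (- mk k * cmod eta) + t * (- mk k * cmod eta)"
 using t b by (intro add_mono mult_left_mono) auto
 finally show ?thesis by (simp add: algebra_simps)
qed

lemma compact_bound_V:
 fixes h :: "'n::{finite,linorder} triple => complex"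
 assumes k: "admissible k" and h: "holo_on h (V_multi k al)" and A: "!!i. compact (A i)" "!!i. A i <= ubox k al i"
 and a: "a < rad' k" and Z: "compact Z" "Z <= Sk k"
 obtains C where "C > 0" "!!z eta u. maxnorm z <= a ==> eta \<in> Z ==> u \<in> cbx A ==> cmod (h (z,z + cmul eta u,eta)) <= C"
proof -
 let ?K = "cbx (%_. cball 0 a) \<times> Z \<times> cbx A"
 let ?F = "%p. (fst p,fst p + cmul (fst (snd p)) (snd (snd p)),fst (snd p))"
 have K: "compact ?K" using A Z by (intro compact_Times compact_cbx) auto
 have ch: "continuous_on (V_multi k al) h" using h by (intro chol_imp_continuous_on) (auto simp: holo_on_iff_chol)
 have "?F ` ?K <= V_multi k al"
 proof
 fix y assume "y \<in> ?F ` ?K"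
 then obtain z :: "'n cvec" and eta u where y: "y = (z,z + cmul eta u,eta)" "ALL i. cmod (z $ i) <= a" "eta \<in> Z" "u \<in> cbx A"
 by (auto simp: cbx_def)
 have "maxnorm z < rad' k" using y(2) a unfolding maxnorm_less_iff by (auto intro: le_less_trans)
 then have "(z,0,eta) \<in> sdom k" using y(3) Z by (auto simp: sdom_Sk)
 moreover have "u \<in> cbx (ubox k al)" using y(4) A by (auto simp: cbx_def)
 ultimately show "y \<in> V_multi k al" unfolding y(1) by (rule ubox_V_multi[OF k])
 qed
 then have "continuous_on ?K (%p. h (?F p))"
 by (intro continuous_on_compose2[OF ch] continuous_intros)
 from compact_continuous_image[OF this K] obtain C where "C > 0" "\<forall>y\<in>(%p. h (?F p)) ` ?K. cmod y <= C"
 using compact_imp_bounded bounded_pos by meson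
 then show ?thesis by (intro that[of C]) (auto simp: cbx_def maxnorm_le_iff)
qed

lemma cmul_nth_bound:
 assumes k: "admissible k" and u: "u \<in> cbx (ubox k al)"
 shows "cmod (cmul eta u $ i) <= 3/rho k * cmod eta"
proof -
 note kD = admissibleD[OF k]
 have ui: "u $ i \<in> ubox k al i" using u by (simp add: cbx_def)
 have "rho k <= 3/rho k" using kD mult_le_one[of "rho k" "rho k"] by (simp add: field_simps)
 then have "cmod (u $ i) <= 3/rho k" using ui by (auto simp: ubox_def split: if_splits)
 then have "cmod (u $ i) * cmod eta <= 3/rho k * cmod eta" by (intro mult_right_mono) auto
 then show ?thesis by (simp add: norm_mult mult.commute)
qed

text \<open>An aperture for which the deviations of zeta cost at most half of the rate
  \<open>mk\<close> when |s_i| <= (6/rho) |eta|; see \<open>bk_bounds\<close>.\<close>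

definition bk :: "kappa => real => real" where
 "bk k n = min 1 (mk k * rho k/(12 * n))"

lemma bk_bounds:
 assumes "admissible k" "n > 0"
 shows "0 < bk k n" "bk k n <= 1" "n * bk k n * (6/rho k) <= mk k/2"
proof -
 have p: "mk k > 0" "rho k > 0" using mk_pos[OF assms(1)] admissibleD[OF assms(1)] by auto
 then show "0 < bk k n" "bk k n <= 1" using assms by (auto simp: bk_def)
 have "n * bk k n * (6/rho k) <= n * (mk k * rho k/(12 * n)) * (6/rho k)"
 using assms p by (intro mult_right_mono mult_left_mono) (auto simp: bk_def)
 also have "\<dots> = mk k/2" using assms p by simp
 finally show "n * bk k n * (6/rho k) <= mk k/2" .
qed

lemma exp_decay:
 fixes s zeta :: "'n::{finite,linorder} cvec"
 assumes k: "admissible k" and zeta: "zeta \<in> Cone (bk k (real CARD('n)))" and s: "Re (s $ idx1) <= - mk k * cmod eta"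
 "!!i. cmod (s $ i) <= 6/rho k * cmod eta"
 shows "cmod (exp (pairing s zeta)) <= exp (- (mk k/4) * (cmod eta * maxnorm zeta))"
proof -
 let ?b = "bk k (real CARD('n))"
 have b: "0 < ?b" "?b <= 1" "real CARD('n) * ?b * (6/rho k) <= mk k/2" using bk_bounds[OF k,of "real CARD('n)"] by auto
 note D = ConeD[OF zeta b(1,2)]
 have "Re (pairing s zeta) <= (- (mk k * cmod eta) + real CARD('n) * ?b * (6/rho k * cmod eta)) * Re (zeta $ idx1)"
 using s by (intro Re_pairing_cone[OF zeta b(1,2)]) auto
 also have "\<dots> <= (- (mk k/2) * cmod eta) * Re (zeta $ idx1)"
 proof (rule mult_right_mono[OF _ D(1)])
 have "real CARD('n) * ?b * (6/rho k) * cmod eta <= mk k/2 * cmod eta" using b(3) by (intro mult_right_mono) auto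
 moreover have "real CARD('n) * ?b * (6/rho k * cmod eta) = real CARD('n) * ?b * (6/rho k) * cmod eta" by simp
 moreover have "mk k * cmod eta = mk k/2 * cmod eta + mk k/2 * cmod eta" by simp
 ultimately show "- (mk k * cmod eta) + real CARD('n) * ?b * (6/rho k * cmod eta) <= - (mk k/2) * cmod eta" by linarith
 qed
 \<comment> \<open>The half that is left is halved again by |zeta| <= 2 Re zeta_1.\<close>
 also have "\<dots> <= - (mk k/4) * (cmod eta * maxnorm zeta)"
 proof -
 have "mk k/4 * cmod eta * maxnorm zeta <= mk k/4 * cmod eta * (2 * Re (zeta $ idx1))"
 using D mk_pos[OF k] by (intro mult_left_mono) auto
 then show ?thesis by (simp add: mult_ac)
 qed
 finally show ?thesis by (simp add: norm_exp_eq_Re)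
qed

lemma iter_path_cong: "(!!i. i \<in> set L ==> g i = g' i) ==> iter g L f w = iter g' L f w"
 by (induction L arbitrary: w) (simp_all add: iter_Cons)

lemma integrand_continuous:
 assumes k: "admissible k" and h: "holo_on h (V_multi k al)" and x: "(z,zeta,eta) \<in> sdom k" and A: "!!i. A i <= ubox k al i"
 shows "continuous_on (cbx A) (%u. h (z,z + cmul eta u,eta) * exp (pairing (cmul eta u) zeta))"
 "continuous_on (cbx A) (%u. h (z,z + cmul eta u,eta))"
proof -
 have sub: "u \<in> cbx (ubox k al)" if "u \<in> cbx A" for u using that A by (auto simp: cbx_def)
 have 1: "chol (%u. h (z,z + cmul eta u,eta)) u" if "u \<in> cbx A" for u
 proof -
 have "chol h (z,z + cmul eta u,eta)" using ubox_V_multi[OF k x sub[OF that]] h by (simp add: holo_on_iff_chol)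
 then show ?thesis by (intro chol_compose[of h "%u. (z,z + cmul eta u,eta)"] chol_intros)
 qed
 then show "continuous_on (cbx A) (%u. h (z,z + cmul eta u,eta))" by (rule chol_imp_continuous_on)
 show "continuous_on (cbx A) (%u. h (z,z + cmul eta u,eta) * exp (pairing (cmul eta u) zeta))"
 by (rule chol_imp_continuous_on) (intro chol_mult 1 chol_exp chol_intros)
qed

text \<open>With the first coordinate confined to the segment the exponential decays uniformly, and
  h is bounded by compactness. With L = \<open>Lr\<close> and the first coordinate fixed at an end
  this treats the boundary terms, with L = \<open>L0\<close> the segment integral.\<close>

lemma decay_integral:
 fixes h :: "'n::{finite,linorder} triple => complex"
 assumes k: "admissible k" and h: "holo_on h (V_multi k al)" and A: "!!i. compact (A i)" "!!i. A i <= ubox k al i"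
 and seg: "A idx1 <= closed_segment (beta0 (rho k) (theta k)) (beta1 (rho k) (theta k))"
 and g: "!!i. i \<in> set L ==> npath (g i)" "!!i. i \<in> set L ==> path_image (g i) <= A i" and v: "v \<in> cbx A"
 and a: "a < rad' k" and Z: "compact Z" "Z <= Sk k"
 obtains C where "C > 0" "!!z zeta eta. maxnorm z <= a ==> zeta \<in> Cone (bk k (real CARD('n))) ==> eta \<in> Z ==>
 cmod (iter g L (%u. h (z,z + cmul eta u,eta) * exp (pairing (cmul eta u) zeta)) v) <= C * exp (- (mk k/4) * (cmod eta * maxnorm zeta))"
proof -
 obtain C1 where C1: "C1 > 0" "!!z eta u. maxnorm z <= a ==> eta \<in> Z ==> u \<in> cbx A ==> cmod (h (z,z + cmul eta u,eta)) <= C1"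
 using compact_bound_V[OF k h A a Z] by metis
 obtain C2 where C2: "C2 > 0" "!!f B M w. (!!i. i \<in> set L ==> path_image (g i) <= B i) ==> continuous_on (cbx B) f ==>
 (!!w. w \<in> cbx B ==> cmod (f w) <= M) ==> w \<in> cbx B ==> cmod (iter g L f w) <= C2 * M"
 using iter_bound[of L g,OF g(1)] by blast
 show ?thesis
 proof (rule that[of "C2 * C1"])
 fix z :: "'n cvec" and zeta :: "'n cvec" and eta
 assume x: "maxnorm z <= a" "zeta \<in> Cone (bk k (real CARD('n)))" "eta \<in> Z"
 have eta: "eta \<in> Sk k" using x(3) Z by auto
 have sd: "(z,zeta,eta) \<in> sdom k" using x(1) a eta by (simp add: sdom_Sk)
 have Arg: "\<bar>Arg eta\<bar> < theta k/4" using eta by (simp add: Sk_def sector_def)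
 have "cmod (iter g L (%u. h (z,z + cmul eta u,eta) * exp (pairing (cmul eta u) zeta)) v) \<le>
 C2 * (C1 * exp (- (mk k/4) * (cmod eta * maxnorm zeta)))"
 proof (rule C2(2)[OF g(2) integrand_continuous(1)[OF k h sd A(2)] _ v])
 fix u assume u: "u \<in> cbx A"
 then have ub: "u \<in> cbx (ubox k al)" using A(2) by (auto simp: cbx_def)
 have "u $ idx1 \<in> closed_segment (beta0 (rho k) (theta k)) (beta1 (rho k) (theta k))" using u seg by (auto simp: cbx_def)
 then have "Re (cmul eta u $ idx1) <= - mk k * cmod eta" using Re_beta_le[OF k Arg] by simp
 moreover have "cmod (cmul eta u $ i) <= 6/rho k * cmod eta" for i
 proof -
 have "3/rho k * cmod eta <= 6/rho k * cmod eta" using admissibleD[OF k] by (intro mult_right_mono divide_right_mono) auto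
 then show ?thesis using cmul_nth_bound[OF k ub,of eta i] by linarith
 qed
 ultimately have "cmod (exp (pairing (cmul eta u) zeta)) <= exp (- (mk k/4) * (cmod eta * maxnorm zeta))"
 by (rule exp_decay[OF k x(2)])
 then show "cmod (h (z,z + cmul eta u,eta) * exp (pairing (cmul eta u) zeta)) <= C1 * exp (- (mk k/4) * (cmod eta * maxnorm zeta))"
 unfolding norm_mult using C1(1) C1(2)[OF x(1,3) u] by (intro mult_mono) auto
 qed auto
 then show "cmod (iter g L (%u. h (z,z + cmul eta u,eta) * exp (pairing (cmul eta u) zeta)) v) <= C2 * C1 * exp (- (mk k/4) * (cmod eta * maxnorm zeta))"
 by (simp add: mult.assoc)
 qed (use C1 C2 in auto)
qed

lemma beta_gam: "beta0 \<rho> th \<in> path_image (gam \<rho> th ep)" "beta1 \<rho> th \<in> path_image (gam \<rho> th ep)"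
 using pathstart_in_path_image[of "gam \<rho> th ep"] pathfinish_in_path_image[of "gam \<rho> th ep"] by simp_all

text \<open>In all three terms of \<open>pd_eta_symbol_map\<close> the first coordinate lies on the
  segment from beta0 to beta1, so \<open>decay_integral\<close> applies to each.\<close>

lemma pd_eta_symbol_decay:
 fixes psi :: "'n::{finite,linorder} triple => complex"
 assumes k: "admissible k" and psi: "psi \<in> ER k" and a: "a < rad' k" and Z: "compact Z" "Z <= Sk k"
 shows "EX C. ALL z zeta eta. maxnorm z <= a --> zeta \<in> Cone (bk k (real CARD('n))) --> eta \<in> Z -->
 cmod (pd_eta (symbol_map k psi) (z,zeta,eta)) <= C * exp (- (mk k/4) * (cmod eta * maxnorm zeta))"
proof -
 obtain h where h0: "holo_on psi (V_multi k UNIV)" and h: "!!i. holo_on (h (UNIV - {i})) (V_multi k (UNIV - {i}))"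
 and psih: "!!x. x \<in> V_multi k UNIV ==> pd_eta psi x = (\<Sum>al | card al = CARD('n) - 1. h al x)"
 using ER_D[OF psi] by metis
 let ?seg = "closed_segment (beta0 (rho k) (theta k)) (beta1 (rho k) (theta k))"
 let ?b0 = "beta0 (rho k) (theta k)" and ?b1 = "beta1 (rho k) (theta k)"
 define A where "A b i = (if i = (idx1::'n) then {b} else path_image (circlepath 0 (2/rho k)))" for b i
 define As where "As i = path_image (Gseg k (i::'n))" for i
 have b\<gamma>: "?b0 \<in> ubox k UNIV (idx1::'n)" "?b1 \<in> ubox k UNIV (idx1::'n)"
 using G_ubox[OF k,of 1 "idx1::'n" UNIV] beta_gam[of "rho k" "theta k" 1] by (auto simp: G_def)
 have circ: "path_image (circlepath 0 (2/rho k)) <= ubox k al i" if "i ~= idx1" for i :: 'n and al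
 using G_ubox[OF k,of 1 i al] that by (simp add: G_def)
 have A: "compact (A b i)" for b i by (simp add: A_def path_image_compact)
 have Ab: "A ?b0 i <= ubox k UNIV i" "A ?b1 i <= ubox k UNIV i" for i using b\<gamma> circ by (auto simp: A_def)
 have As: "compact (As i)" "As i <= ubox k (UNIV - {idx1}) i" for i
 using circ segment_ball[OF k] by (auto simp: As_def Gseg_def ubox_def path_image_compact)
 have GA: "path_image (G k 1 i) <= A b i" if "i \<in> set Lr" for i b using that by (simp add: A_def G_def)
 have u1A: "set_coord (u1 k) idx1 b \<in> cbx (A b)" for b
 unfolding cbx_def mem_Collect_eq
 proof
 fix i show "set_coord (u1 k) idx1 b $ i \<in> A b i"
 using u1_G[of k i 1] by (cases "i = idx1") (auto simp: A_def G_def set_coord_def)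
 qed
 have u1As: "u1 k \<in> cbx As"
 unfolding cbx_def mem_Collect_eq
 proof
 fix i show "u1 k $ i \<in> As i"
 using u1_G[of k i 1] by (cases "i = idx1") (auto simp: As_def Gseg_def u1_def G_def)
 qed
 have sA: "A ?b0 idx1 <= ?seg" "A ?b1 idx1 <= ?seg" "As idx1 <= ?seg" by (auto simp: A_def As_def Gseg_def)
 have GS: "path_image (Gseg k i) <= As i" for i by (simp add: As_def)
 have npG: "npath (G k 1 i)" for i :: 'n by simp
 obtain C0 where C0: "C0 > 0" "!!z zeta eta. maxnorm z <= a ==> zeta \<in> Cone (bk k (real CARD('n))) ==> eta \<in> Z ==>
 cmod (iter (G k 1) Lr (%u. psi (z,z + cmul eta u,eta) * exp (pairing (cmul eta u) zeta)) (set_coord (u1 k) idx1 ?b0)) <= C0 * exp (- (mk k/4) * (cmod eta * maxnorm zeta))"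
 by (rule decay_integral[where L = Lr,OF k h0 A[of "?b0"] Ab(1) sA(1) npG GA[of _ "?b0"] u1A[of "?b0"] a Z],assumption,rule that)
 obtain C1 where C1: "C1 > 0" "!!z zeta eta. maxnorm z <= a ==> zeta \<in> Cone (bk k (real CARD('n))) ==> eta \<in> Z ==>
 cmod (iter (G k 1) Lr (%u. psi (z,z + cmul eta u,eta) * exp (pairing (cmul eta u) zeta)) (set_coord (u1 k) idx1 ?b1)) <= C1 * exp (- (mk k/4) * (cmod eta * maxnorm zeta))"
 by (rule decay_integral[where L = Lr,OF k h0 A[of "?b1"] Ab(2) sA(2) npG GA[of _ "?b1"] u1A[of "?b1"] a Z],assumption,rule that)
 obtain C2 where C2: "C2 > 0" "!!z zeta eta. maxnorm z <= a ==> zeta \<in> Cone (bk k (real CARD('n))) ==> eta \<in> Z ==>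
 cmod (iter (Gseg k) L0 (%u. h (UNIV - {idx1}) (z,z + cmul eta u,eta) * exp (pairing (cmul eta u) zeta)) (u1 k)) <= C2 * exp (- (mk k/4) * (cmod eta * maxnorm zeta))"
 by (rule decay_integral[OF k h[of idx1] As sA(3) npath_Gseg GS u1As a Z,where L = L0],rule that)
 define R where "R = max 1 (rad k)"
 have "cmod (pd_eta (symbol_map k psi) (z,zeta,eta)) <= (R ^ CARD('n) * (C1 + C0 + C2)) * exp (- (mk k/4) * (cmod eta * maxnorm zeta))"
 if x: "maxnorm z <= a" "zeta \<in> Cone (bk k (real CARD('n)))" "eta \<in> Z" for z zeta :: "'n cvec" and eta
 proof -
 have eta: "eta \<in> Sk k" using x(3) Z by auto
 have sd: "(z,zeta,eta) \<in> sdom k" using x(1) a eta by (simp add: sdom_Sk)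
 have etaR: "cmod eta <= R" "1 <= R" using eta by (auto simp: R_def Sk_def sector_def)
 have p1: "cmod eta ^ (CARD('n) - 1) <= R ^ CARD('n)"
 by (rule order_trans[OF power_mono[OF etaR(1)] power_increasing]) (use etaR in auto)
 have p2: "cmod eta ^ CARD('n) <= R ^ CARD('n)" using etaR by (intro power_mono) auto
 have r: "rho k/2 <= 1" using admissibleD[OF k] by simp
 let ?X = "exp (- (mk k/4) * (cmod eta * maxnorm zeta))"
 let ?E = "%b. iter (G k 1) Lr (%u. psi (z,z + cmul eta u,eta) * exp (pairing (cmul eta u) zeta)) (set_coord (u1 k) idx1 b)"
 let ?I = "iter (Gseg k) L0 (%u. h (UNIV - {idx1}) (z,z + cmul eta u,eta) * exp (pairing (cmul eta u) zeta)) (u1 k)"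
 have e1: "cmod (?b1 * ?E ?b1) <= 1 * (C1 * ?X)" unfolding norm_mult beta_bound[OF k]
 using C1(2)[OF x] r by (intro mult_mono) auto
 have e0: "cmod (?b0 * ?E ?b0) <= 1 * (C0 * ?X)" unfolding norm_mult beta_bound[OF k]
 using C0(2)[OF x] r by (intro mult_mono) auto
 have "cmod (eta ^ (CARD('n) - 1) * (?b1 * ?E ?b1 - ?b0 * ?E ?b0)) <= R ^ CARD('n) * (C1 * ?X + C0 * ?X)"
 unfolding norm_mult norm_power using p1 e1 e0 norm_triangle_ineq4[of "?b1 * ?E ?b1" "?b0 * ?E ?b0"] etaR
 by (intro mult_mono) auto
 moreover have "cmod (eta ^ CARD('n) * ?I) <= R ^ CARD('n) * (C2 * ?X)"
 unfolding norm_mult norm_power using p2 C2(2)[OF x] etaR by (intro mult_mono) auto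
 ultimately have "cmod (eta ^ (CARD('n) - 1) * (?b1 * ?E ?b1 - ?b0 * ?E ?b0) + eta ^ CARD('n) * ?I) \<le>
 R ^ CARD('n) * (C1 * ?X + C0 * ?X) + R ^ CARD('n) * (C2 * ?X)"
 by (intro order_trans[OF norm_triangle_ineq add_mono])
 moreover have "pd_eta (symbol_map k psi) (z,zeta,eta) = eta ^ (CARD('n) - 1) * (?b1 * ?E ?b1 - ?b0 * ?E ?b0) + eta ^ CARD('n) * ?I"
 by (rule pd_eta_symbol_map[OF k h0 h _ sd]) (rule psih)
 ultimately have "cmod (pd_eta (symbol_map k psi) (z,zeta,eta)) <= R ^ CARD('n) * (C1 * ?X + C0 * ?X) + R ^ CARD('n) * (C2 * ?X)" by (simp only:)
 also have "\<dots> = R ^ CARD('n) * (C1 + C0 + C2) * ?X" by (simp only: ring_distribs mult.assoc)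
 finally show ?thesis .
 qed
 then show ?thesis by blast
qed

section \<open>Derivatives of the symbol in zeta, and its growth\<close>

lemma PDm_exp:
 fixes v :: "'n::finite cvec"
 assumes "distinct L"
 shows "PDm al L (%zeta. exp (pairing v zeta)) = (%zeta. (\<Prod>i\<in>set L. v $ i ^ al i) * exp (pairing v zeta))"
proof -
 have sc: "pairing v (set_coord zeta i s) = pairing v zeta + v $ i * (s - zeta $ i)" for zeta i s
 proof -
 have "pairing v (set_coord zeta i s) - pairing v zeta = (\<Sum>j\<in>UNIV. if j = i then v $ i * (s - zeta $ i) else 0)"
 unfolding pairing_def sum_subtractf[symmetric] by (intro sum.cong) (auto simp: algebra_simps)
 then show ?thesis by (simp add: algebra_simps)
 qed
 have 1: "PD i (%zeta. c * exp (pairing v zeta)) = (%zeta. (v $ i * c) * exp (pairing v zeta))" for i c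
 proof
 fix zeta
 have "((%s. c * exp (pairing v zeta + v $ i * (s - zeta $ i))) has_field_derivative (v $ i * c) * exp (pairing v zeta)) (at (zeta $ i))"
 by (auto intro!: derivative_eq_intros)
 then show "PD i (%zeta. c * exp (pairing v zeta)) zeta = (v $ i * c) * exp (pairing v zeta)"
 unfolding PD_def sc by (rule DERIV_imp_deriv)
 qed
 have 2: "(PD i ^^ m) (%zeta. c * exp (pairing v zeta)) = (%zeta. (v $ i ^ m * c) * exp (pairing v zeta))" for i c m
 proof (induction m)
 case (Suc m)
 show ?case unfolding funpow.simps o_apply Suc.IH 1 by (simp only: power_Suc mult.assoc)
 qed simp
 have "PDm al L (%zeta. 1 * exp (pairing v zeta)) = (%zeta. (\<Prod>i\<in>set L. v $ i ^ al i) * exp (pairing v zeta))"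
 using assms
 proof (induction L)
 case (Cons i L)
 show ?case unfolding PDm_simps Cons.IH[OF distinct_tl[OF Cons.prems,simplified]] 2 using Cons.prems by simp
 qed (simp add: PDm_simps)
 then show ?thesis by simp
qed

text \<open>The derivative is written by Cauchy's formula on a polydisc about zeta. After Fubini the
  same formula is read backwards for the exponential alone, whose derivatives bring down the powers
  of eta u.\<close>

lemma pd2_multi_symbol_map:
 fixes psi :: "'n::{finite,linorder} triple => complex"
 assumes k: "admissible k" and psi: "holo_on psi (V_multi k UNIV)" and x: "(z,zeta,eta) \<in> sdom k"
 shows "pd2_multi al (symbol_map k psi) (z,zeta,eta) = eta ^ CARD('n) *
 iter (G k 1) L0 (%u. (\<Prod>i\<in>UNIV. (eta * u $ i) ^ al i) * (psi (z,z + cmul eta u,eta) * exp (pairing (cmul eta u) zeta))) (u1 k)"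
proof -
 let ?H = "%v. symbol_map k psi (z,v,eta)" and ?K = "%u. psi (z,z + cmul eta u,eta)" and ?E = "%u v. exp (pairing (cmul eta u) v)"
 let ?c = "%i. circlepath (zeta $ i) 1" and ?S = "%i. sphere (zeta $ i) 1"
 let ?D = "%w. \<Prod>i\<in>(UNIV::'n set). (w $ i - zeta $ i) ^ Suc (al i)"
 let ?P = "\<Prod>i\<in>(UNIV::'n set). fact (al i)/(2 * pi * \<i>)"
 define w0 where "w0 = (\<chi> i. zeta $ i + 1)"
 have w0: "w0 \<in> cbx ?S" by (auto simp: w0_def cbx_def dist_norm)
 have xv: "(z,v,eta) \<in> sdom k" for v using x by (simp add: sdom_Sk)
 have HE: "?H v = eta ^ CARD('n) * iter (G k 1) L0 (%u. ?K u * ?E u v) (u1 k)" for v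
 by (rule symbol_map_scaled[OF k psi xv]) auto
 have cauchy: "PDm al L0 F zeta = ?P * iter ?c L0 (%w. F w/?D w) w0" if F: "!!v. chol F v" for F :: "'n cvec => complex"
 proof -
 have "PDm al L0 F zeta = (\<Prod>i\<in>set L0. fact (al i)/(2 * pi * \<i>)) * iter ?c L0 (%w. F w/(\<Prod>i\<in>set L0. (w $ i - zeta $ i) ^ Suc (al i))) zeta"
 by (rule PDm_cauchy[where B = "%_. UNIV"]) (auto simp: F cbx_def)
 moreover have "iter ?c L0 (%w. F w/?D w) zeta = iter ?c L0 (%w. F w/?D w) w0" by (rule iter_start) simp
 ultimately show ?thesis by simp
 qed
 have Hchol: "chol ?H v" for v
 proof -
 have "chol (symbol_map k psi) (z,v,eta)" using holo_symbol_map[OF k psi] xv by (simp add: holo_on_iff_chol)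
 then show ?thesis by (intro chol_compose[of "symbol_map k psi" "%v. (z,v,eta)"] chol_intros)
 qed
 have Echol: "chol (?E u) v" for u v by (intro chol_exp chol_pairing chol_const chol_id)
 have D0: "?D w ~= 0" if "w \<in> cbx ?S" for w
 proof -
 have "cmod (w $ i - zeta $ i) = 1" for i using that by (auto simp: cbx_def dist_norm norm_minus_commute)
 then have "w $ i - zeta $ i ~= 0" for i by (metis norm_zero zero_neq_one)
 then show ?thesis by simp
 qed
 have cont: "continuous_on (cbx ?S \<times> cbx (ubox k UNIV)) (%(w,u). inverse (?D w) * (?K u * ?E u w))"
 proof -
 have cK: "continuous_on (cbx (ubox k UNIV)) ?K" by (rule integrand_continuous(2)[OF k psi x]) auto
 have cE: "continuous_on UNIV (%p. exp (pairing (cmul eta (snd p)) (fst p)))"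
 by (rule chol_imp_continuous_on) (intro chol_exp chol_intros)
 have "continuous_on (cbx ?S \<times> cbx (ubox k UNIV)) (%p. inverse (?D (fst p)) * (?K (snd p) * ?E (snd p) (fst p)))"
 using D0 by (intro continuous_intros continuous_on_compose2[OF cK] continuous_on_subset[OF cE]) auto
 then show ?thesis by (simp add: case_prod_unfold)
 qed
 have "pd2_multi al (symbol_map k psi) (z,zeta,eta) = ?P * iter ?c L0 (%w. ?H w/?D w) w0"
 unfolding pd2_multi_eq_PDm by (rule cauchy[OF Hchol])
 also have "(%w. ?H w/?D w) = (%w. eta ^ CARD('n) * iter (G k 1) L0 (%u. inverse (?D w) * (?K u * ?E u w)) (u1 k))"
 proof
 fix w
 show "?H w/?D w = eta ^ CARD('n) * iter (G k 1) L0 (%u. inverse (?D w) * (?K u * ?E u w)) (u1 k)"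
 unfolding HE iter_cmult[of "G k 1" L0 "inverse (?D w)" "%u. ?K u * ?E u w" "u1 k"] divide_inverse by (simp only: mult_ac)
 qed
 also have "iter ?c L0 \<dots> w0 = eta ^ CARD('n) * iter ?c L0 (%w. iter (G k 1) L0 (%u. inverse (?D w) * (?K u * ?E u w)) (u1 k)) w0"
 by (rule iter_cmult)
 also have "iter ?c L0 (%w. iter (G k 1) L0 (%u. inverse (?D w) * (?K u * ?E u w)) (u1 k)) w0 =
 iter (G k 1) L0 (%u. iter ?c L0 (%w. inverse (?D w) * (?K u * ?E u w)) w0) (u1 k)"
 by (rule iter_iter_swap[OF npath_G G_ubox[OF k] npath_circlepath _ cont w0 u1_ubox[OF k]]) auto
 also have "?P * (eta ^ CARD('n) * \<dots>) = eta ^ CARD('n) * iter (G k 1) L0 (%u. ?P * iter ?c L0 (%w. inverse (?D w) * (?K u * ?E u w)) w0) (u1 k)"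
 unfolding iter_cmult[of "G k 1" L0 "?P"] by (simp only: mult.left_commute)
 also have "(%u. ?P * iter ?c L0 (%w. inverse (?D w) * (?K u * ?E u w)) w0) =
 (%u. (\<Prod>i\<in>UNIV. (eta * u $ i) ^ al i) * (?K u * ?E u zeta))"
 proof
 fix u
 have "(%w. inverse (?D w) * (?K u * ?E u w)) = (%w. ?K u * (?E u w/?D w))"
 by (simp only: divide_inverse mult_ac)
 then have "?P * iter ?c L0 (%w. inverse (?D w) * (?K u * ?E u w)) w0 = ?K u * (?P * iter ?c L0 (%w. ?E u w/?D w) w0)"
 using iter_cmult[of ?c L0 "?K u" "%w. ?E u w/?D w" w0] by (simp only: mult.left_commute)
 also have "\<dots> = ?K u * PDm al L0 (?E u) zeta" by (simp only: cauchy[OF Echol])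
 also have "PDm al L0 (?E u) zeta = (\<Prod>i\<in>UNIV. (eta * u $ i) ^ al i) * ?E u zeta"
 using PDm_exp[of L0 al "cmul eta u"] by simp
 finally show "?P * iter ?c L0 (%w. inverse (?D w) * (?K u * ?E u w)) w0 = (\<Prod>i\<in>UNIV. (eta * u $ i) ^ al i) * (?K u * ?E u zeta)"
 by (simp only: mult.left_commute)
 qed
 finally show ?thesis .
qed

text \<open>Uniform in the multi-index and free of factorials; the price is an exponential whose
  rate is proportional to |eta|. Both the growth estimate and the estimate of the composition series
  rest on this.\<close>

lemma pd2_multi_symbol_crude:
 fixes psi :: "'n::{finite,linorder} triple => complex"
 assumes k: "admissible k" and psi: "holo_on psi (V_multi k UNIV)" and a: "a < rad' k" and Z: "compact Z" "Z <= Sk k"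
 shows "\<exists>C>0. ALL al z zeta eta. maxnorm z <= a --> eta \<in> Z --> cmod (pd2_multi al (symbol_map k psi) (z,zeta,eta)) \<le>
 C * (\<Prod>i\<in>UNIV. (3/rho k * cmod eta) ^ al i) * exp (real CARD('n) * (3/rho k * cmod eta) * maxnorm zeta)"
proof -
 let ?A = "%i::'n. path_image (G k 1 i)"
 have A: "compact (?A i)" "?A i <= ubox k UNIV i" for i using G_ubox[OF k,of 1 i UNIV] by (auto simp: path_image_compact)
 obtain C1 where C1: "C1 > 0" "!!z eta u. maxnorm z <= a ==> eta \<in> Z ==> u \<in> cbx ?A ==> cmod (psi (z,z + cmul eta u,eta)) <= C1"
 using compact_bound_V[OF k psi A a Z] by metis
 obtain C2 where C2: "C2 > 0" "!!f B M w. (!!i. i \<in> set L0 ==> path_image (G k 1 (i::'n)) <= B i) ==> continuous_on (cbx B) f ==>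
 (!!w. w \<in> cbx B ==> cmod (f w) <= M) ==> w \<in> cbx B ==> cmod (iter (G k 1) L0 f w) <= C2 * M"
 using iter_bound[of L0 "G k 1 :: 'n => _",OF npath_G] by blast
 define R where "R = max 1 (rad k)"
 have "cmod (pd2_multi al (symbol_map k psi) (z,zeta,eta)) \<le>
 (R ^ CARD('n) * C2 * C1) * (\<Prod>i\<in>UNIV. (3/rho k * cmod eta) ^ al i) * exp (real CARD('n) * (3/rho k * cmod eta) * maxnorm zeta)"
 if x: "maxnorm z <= a" "eta \<in> Z" for al and z zeta :: "'n cvec" and eta
 proof -
 let ?X = "(\<Prod>i\<in>(UNIV::'n set). (3/rho k * cmod eta) ^ al i)" and ?Y = "exp (real CARD('n) * (3/rho k * cmod eta) * maxnorm zeta)"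
 have eta: "eta \<in> Sk k" using x(2) Z by auto
 have sd: "(z,zeta,eta) \<in> sdom k" using x(1) a eta by (simp add: sdom_Sk)
 have etaR: "cmod eta <= R" "1 <= R" using eta by (auto simp: R_def Sk_def sector_def)
 have X0: "0 <= ?X" using admissibleD[OF k] by (intro prod_nonneg) auto
 have "cmod (iter (G k 1) L0 (%u. (\<Prod>i\<in>UNIV. (eta * u $ i) ^ al i) * (psi (z,z + cmul eta u,eta) * exp (pairing (cmul eta u) zeta))) (u1 k)) <= C2 * (?X * (C1 * ?Y))"
 proof (rule C2(2)[of ?A])
 show "continuous_on (cbx ?A) (%u. (\<Prod>i\<in>UNIV. (eta * u $ i) ^ al i) * (psi (z,z + cmul eta u,eta) * exp (pairing (cmul eta u) zeta)))"
 by (intro continuous_on_mult[OF _ integrand_continuous(1)[OF k psi sd A(2)]] continuous_intros)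
 show "u1 k \<in> cbx ?A" using u1_G[of k _ 1] by (auto simp: cbx_def)
 fix u assume u: "u \<in> cbx ?A"
 then have ub: "u \<in> cbx (ubox k UNIV)" using A(2) by (auto simp: cbx_def)
 have ui: "cmod (eta * u $ i) <= 3/rho k * cmod eta" for i using cmul_nth_bound[OF k ub,of eta i] by simp
 have "cmod (\<Prod>i\<in>UNIV. (eta * u $ i) ^ al i) <= ?X"
 unfolding prod_norm[symmetric] norm_power using ui by (intro prod_mono conjI power_mono) auto
 moreover have "cmod (exp (pairing (cmul eta u) zeta)) <= ?Y"
 proof -
 have "Re (pairing (cmul eta u) zeta) <= real CARD('n) * (3/rho k * cmod eta) * maxnorm zeta"
 by (rule order_trans[OF complex_Re_le_cmod cmod_pairing_le]) (use ui in simp)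
 then show ?thesis by (simp add: norm_exp_eq_Re)
 qed
 ultimately show "cmod ((\<Prod>i\<in>UNIV. (eta * u $ i) ^ al i) * (psi (z,z + cmul eta u,eta) * exp (pairing (cmul eta u) zeta))) <= ?X * (C1 * ?Y)"
 unfolding norm_mult using C1(1) C1(2)[OF x u] X0 by (intro mult_mono) auto
 qed auto
 moreover have "cmod eta ^ CARD('n) <= R ^ CARD('n)" using etaR by (intro power_mono) auto
 ultimately have "cmod (pd2_multi al (symbol_map k psi) (z,zeta,eta)) <= R ^ CARD('n) * (C2 * (?X * (C1 * ?Y)))"
 unfolding pd2_multi_symbol_map[OF k psi sd] norm_mult norm_power using etaR by (intro mult_mono) auto
 then show ?thesis by (simp only: mult_ac)
 qed
 moreover have "R ^ CARD('n) * C2 * C1 > 0" using C1 C2 by (auto simp: R_def intro!: mult_pos_pos)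
 ultimately show ?thesis by (intro exI[of _ "R ^ CARD('n) * C2 * C1"]) blast
qed

lemma pd2_multi_0: "pd2_multi (%_. 0) f = f"
proof -
 have "foldr (%i. pd2 i ^^ 0) L f = f" for L by (induction L) auto
 then show ?thesis by (simp add: pd2_multi_def)
qed

text \<open>The crude bound at tau eta has a rate proportional to tau and so at most h for small
  tau. Between tau eta and eta the symbol changes by a bounded amount only, because its
  eta-derivative is bounded there.\<close>

lemma symbol_subexp:
 fixes psi :: "'n::{finite,linorder} triple => complex"
 assumes k: "admissible k" and psi: "psi \<in> ER k" and a: "a < rad' k" and Z: "compact Z" "Z <= Sk k" and h: "h > 0"
 shows "EX C. ALL z zeta eta. maxnorm z <= a --> zeta \<in> Cone (bk k (real CARD('n))) --> eta \<in> Z -->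
 cmod (symbol_map k psi (z,zeta,eta)) <= C * exp (h * maxnorm zeta)"
proof -
 have h0: "holo_on psi (V_multi k UNIV)" using psi by (simp add: ER_def)
 let ?c = "real CARD('n) * (3/rho k)"
 have c: "?c > 0" using admissibleD[OF k] by simp
 \<comment> \<open>Makes the crude rate at \<tau> eta, at most ?c \<tau> rad k, no larger than
   h.\<close>
 define \<tau> where "\<tau> = min 1 (h/(?c * rad k))"
 have \<tau>: "0 < \<tau>" "\<tau> <= 1" using h c admissibleD[OF k] by (auto simp: \<tau>_def)
 \<comment> \<open>Contains the segments from \<tau> eta to eta for eta in Z, and is again
   compact.\<close>
 define Z' where "Z' = (%p. of_real (fst p) * snd p) ` ({\<tau>..1} \<times> Z)"
 have Z': "compact Z'" unfolding Z'_def using Z by (intro compact_continuous_image compact_Times continuous_intros) auto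
 have Z'S: "Z' <= Sk k" using Sk_scale \<tau> Z unfolding Z'_def by force
 obtain C1 where C1: "!!z zeta eta. maxnorm z <= a ==> zeta \<in> Cone (bk k (real CARD('n))) ==> eta \<in> Z' ==>
 cmod (pd_eta (symbol_map k psi) (z,zeta,eta)) <= C1 * exp (- (mk k/4) * (cmod eta * maxnorm zeta))"
 using pd_eta_symbol_decay[OF k psi a Z' Z'S] by blast
 obtain C2 where C2: "C2 > 0" "!!al z zeta eta. maxnorm z <= a ==> eta \<in> Z' ==> cmod (pd2_multi al (symbol_map k psi) (z,zeta,eta)) \<le>
 C2 * (\<Prod>i\<in>UNIV. (3/rho k * cmod eta) ^ al i) * exp (real CARD('n) * (3/rho k * cmod eta) * maxnorm zeta)"
 using pd2_multi_symbol_crude[OF k h0 a Z' Z'S] by blast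
 have "cmod (symbol_map k psi (z,zeta,eta)) <= (C2 + \<bar>C1\<bar> * rad k) * exp (h * maxnorm zeta)"
 if x: "maxnorm z <= a" "zeta \<in> Cone (bk k (real CARD('n)))" "eta \<in> Z" for z zeta :: "'n cvec" and eta
 proof -
 have eta: "eta \<in> Sk k" using x(3) Z by auto
 have etar: "cmod eta <= rad k" using eta by (auto simp: Sk_def sector_def)
 have in_Z': "of_real t * eta \<in> Z'" if "\<tau> <= t" "t <= 1" for t
 unfolding Z'_def using that x(3) by (intro image_eqI[of _ _ "(t,eta)"]) auto
 let ?f = "%s. symbol_map k psi (z,zeta,s)"
 have seg: "s \<in> Z'" if ss: "s \<in> closed_segment (of_real \<tau> * eta) eta" for s
 proof -
 obtain t where t: "0 <= t" "t <= 1" "s = (1 - t) *\<^sub>R (of_real \<tau> * eta) + t *\<^sub>R eta" using ss unfolding closed_segment_def by blast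
 have "s = of_real (\<tau> + t * (1 - \<tau>)) * eta" by (simp add: t(3) scaleR_conv_of_real algebra_simps)
 moreover have "0 <= t * (1 - \<tau>)" "t * (1 - \<tau>) <= 1 - \<tau>" using t \<tau> by (auto intro: mult_left_le_one_le)
 ultimately show ?thesis using in_Z'[of "\<tau> + t * (1 - \<tau>)"] by simp
 qed
 have d: "(?f has_field_derivative pd_eta (symbol_map k psi) (z,zeta,s)) (at s within closed_segment (of_real \<tau> * eta) eta)"
 if "s \<in> closed_segment (of_real \<tau> * eta) eta" for s
 proof -
 have "(z,zeta,s) \<in> sdom k" using seg[OF that] Z'S x(1) a by (auto simp: sdom_Sk)
 then have "chol (symbol_map k psi) (z,zeta,s)" using holo_symbol_map[OF k h0] by (simp add: holo_on_iff_chol)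
 then have "chol ?f s" by (rule chol_compose[where f = "symbol_map k psi" and g = "%s. (z,zeta,s)"]) (intro chol_intros)
 then have "(?f has_field_derivative deriv ?f s) (at s)" by (simp add: chol_complex_iff DERIV_deriv_iff_field_differentiable)
 then show ?thesis by (simp add: pd_eta_def has_field_derivative_at_within)
 qed
 have b: "cmod (pd_eta (symbol_map k psi) (z,zeta,s)) <= \<bar>C1\<bar>" if "s \<in> closed_segment (of_real \<tau> * eta) eta" for s
 proof -
 have "exp (- (mk k/4) * (cmod s * maxnorm zeta)) <= 1" using mk_pos[OF k] maxnorm_nonneg[of zeta] by simp
 then have "C1 * exp (- (mk k/4) * (cmod s * maxnorm zeta)) <= \<bar>C1\<bar> * 1" by (intro mult_mono) auto
 then show ?thesis using C1[OF x(1,2) seg[OF that]] by linarith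
 qed
 have "cmod (?f eta - ?f (of_real \<tau> * eta)) <= \<bar>C1\<bar> * cmod (eta - of_real \<tau> * eta)"
 by (rule field_differentiable_bound[OF convex_closed_segment d b]) auto
 also have "cmod (eta - of_real \<tau> * eta) <= 1 * cmod eta"
 proof -
 have "eta - of_real \<tau> * eta = of_real (1 - \<tau>) * eta" by (simp add: algebra_simps)
 then show ?thesis using \<tau> by (simp only: norm_mult norm_of_real) (intro mult_right_mono; simp)
 qed
 finally have 1: "cmod (?f eta - ?f (of_real \<tau> * eta)) <= \<bar>C1\<bar> * rad k"
 using etar mult_left_mono[of "cmod eta" "rad k" "\<bar>C1\<bar>"] by (simp add: mult_left_mono order_trans)
 have "cmod (?f (of_real \<tau> * eta)) <= C2 * exp (real CARD('n) * (3/rho k * cmod (of_real \<tau> * eta)) * maxnorm zeta)"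
 using C2(2)[OF x(1) in_Z'[of \<tau>],of "%_. 0" zeta] \<tau> by (simp add: pd2_multi_0)
 also have "real CARD('n) * (3/rho k * cmod (of_real \<tau> * eta)) * maxnorm zeta <= h * maxnorm zeta"
 proof (rule mult_right_mono[OF _ maxnorm_nonneg])
 have "real CARD('n) * (3/rho k * cmod (of_real \<tau> * eta)) = ?c * (\<tau> * cmod eta)" using \<tau> by (simp add: norm_mult)
 also have "\<dots> <= ?c * ((h/(?c * rad k)) * rad k)"
 using c etar \<tau> h admissibleD[OF k] by (intro mult_left_mono mult_mono) (auto simp: \<tau>_def)
 also have "\<dots> = h" using c admissibleD[OF k] by simp
 finally show "real CARD('n) * (3/rho k * cmod (of_real \<tau> * eta)) <= h" .
 qed
 finally have 2: "cmod (?f (of_real \<tau> * eta)) <= C2 * exp (h * maxnorm zeta)" using C2(1) by simp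
 have "1 <= exp (h * maxnorm zeta)" using h maxnorm_nonneg[of zeta] by simp
 then have "\<bar>C1\<bar> * rad k * 1 <= \<bar>C1\<bar> * rad k * exp (h * maxnorm zeta)" using admissibleD[OF k] by (intro mult_left_mono) auto
 then show ?thesis using 1 2 norm_triangle_sub[of "?f eta" "?f (of_real \<tau> * eta)"] by (simp add: algebra_simps)
 qed
 then show ?thesis by blast
qed

lemma Rg_sdom: "a < rad' k ==> S <= Sk k ==> Rg a b S <= sdom k"
 by (auto simp: Rg_def sdom_Sk)

lemma symbol_NB_SB:
 fixes psi :: "'n::{finite,linorder} triple => complex"
 assumes k: "admissible k" and psi: "psi \<in> ER k" and a: "a < rad' k" and S: "S <= Sk k" and b: "0 < b" "b <= bk k (real CARD('n))"
 shows "SB a b S (symbol_map k psi)" "NB a b S (mk k/4) (pd_eta (symbol_map k psi))"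
proof -
 have h0: "holo_on psi (V_multi k UNIV)" using psi by (simp add: ER_def)
 have b1: "b <= 1" using b bk_bounds[OF k,of "real CARD('n)"] by simp
 have cone: "zeta \<in> Cone (bk k (real CARD('n)))" if "zeta \<in> Cone b" for zeta :: "'n cvec" using Cone_mono[OF b(2,1) b1] that by auto
 show "SB a b S (symbol_map k psi)" unfolding SB_def
 proof (intro conjI allI impI)
 show "EX W. open W & Rg a b S <= W & holo_on (symbol_map k psi) W"
 by (intro exI[of _ "sdom k"] conjI open_sdom[OF k] Rg_sdom a S holo_symbol_map[OF k h0])
 fix Z h assume Z: "compact Z" "Z <= S" and h: "h > (0::real)"
 show "EX C. ALL z zeta eta. (z,zeta,eta) \<in> Rg a b Z --> cmod (symbol_map k psi (z,zeta,eta)) <= C * exp (h * maxnorm zeta)"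
 using symbol_subexp[OF k psi a Z(1) _ h] Z(2) S cone unfolding Rg_def by blast
 qed
 show "NB a b S (mk k/4) (pd_eta (symbol_map k psi))" unfolding NB_def
 proof (intro conjI allI impI)
 show "EX W. open W & Rg a b S <= W & holo_on (pd_eta (symbol_map k psi)) W"
 by (intro exI[of _ "sdom k"] conjI open_sdom[OF k] Rg_sdom a S holo_pd(3) holo_symbol_map[OF k h0])
 fix Z assume Z: "compact Z" "Z <= S"
 show "EX C. ALL z zeta eta. (z,zeta,eta) \<in> Rg a b Z --> cmod (pd_eta (symbol_map k psi) (z,zeta,eta)) <= C * exp (- (mk k/4) * (cmod eta * maxnorm zeta))"
 using pd_eta_symbol_decay[OF k psi a Z(1)] Z(2) S cone unfolding Rg_def by blast
 qed
qed

section \<open>The product of operators\<close>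

lemma V_multi_antimono: "\<beta> <= al ==> V_multi k al <= V_multi k \<beta>"
 by (auto simp: V_multi_def)

lemma lf_beta_neg:
 assumes k: "admissible k" and \<omega>: "\<bar>\<omega>\<bar> < theta k/2"
 shows "lf \<omega> (beta0 (rho k) (theta k)) < 0" "lf \<omega> (beta1 (rho k) (theta k)) < 0"
proof -
 note kD = admissibleD[OF k]
 have w: "\<omega> < theta k/2" "- \<omega> < theta k/2" using \<omega> unfolding abs_less_iff by auto
 have 1: "cos ((pi + theta k)/2 - \<omega>) < 0" by (rule cos_neg) (use w kD(5,6) in \<open>simp_all add: field_simps\<close>)
 have 2: "cos ((pi + theta k)/2 + \<omega>) < 0" by (rule cos_neg) (use w kD(5,6) in \<open>simp_all add: field_simps\<close>)
 have "- ((pi + theta k)/2) + \<omega> = - ((pi + theta k)/2 - \<omega>)" by simp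
 then have "cos (- ((pi + theta k)/2) + \<omega>) < 0" using 1 by (simp only: cos_minus)
 then show "lf \<omega> (beta0 (rho k) (theta k)) < 0" unfolding beta_rcis lf_simps using kD(3) by (intro mult_pos_neg) auto
 show "lf \<omega> (beta1 (rho k) (theta k)) < 0" unfolding beta_rcis lf_simps using kD(3) 2 by (intro mult_pos_neg) auto
qed

lemma open_Sect_shift: "open {s. c - s \<in> Sect th}" "open {s. s - c \<in> Sect th}"
 unfolding Sect_def mem_Collect_eq by (intro open_Collect_disj open_Collect_less continuous_intros)+

lemma V_left:
 fixes z y :: "'n::{finite,linorder} cvec"
 assumes k: "admissible k" and "maxnorm z < rad' k" "eta \<in> Sk k" "cmod (y $ idx1) < rho k * cmod eta" "- y $ idx1 \<in> Sect (theta k)"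
 "!!i. i ~= idx1 ==> cmod eta < rho k * cmod (y $ i)" "!!i. i ~= idx1 ==> cmod (y $ i) < 3/rho k * cmod eta"
 shows "(z,z + y,eta) \<in> V_multi k UNIV"
proof -
 have "3/rho k * cmod eta < rad' k" using assms(3) admissibleD[OF k] by (simp add: Sk_def field_simps)
 then have "cmod (y $ i) < rad' k" if "i ~= idx1" for i using assms(7)[OF that] by linarith
 then show ?thesis unfolding V_multi_iff[OF k] using assms by (simp add: Sk_def)
qed

text \<open>The product over the fixed contour. How small epsilon must be depends on the point, so
  it remains a parameter. \<open>edge\<close> and \<open>segm\<close> are the two terms of the
  eta-derivative of the product that come from the moving ends and from the null form of the left
  factor.\<close>

definition mub :: "kappa => real => ('n::{finite,linorder} triple => complex) => ('n triple => complex) => 'n triple => complex" where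
 "mub k ep F1 F2 = (%(z,w,eta). eta ^ CARD('n) *
 iter (G k ep) L0 (%u. F1 (z,z + cmul eta u,eta) * F2 (z + cmul eta u,w,eta)) (u1 k))"

definition edge :: "kappa => ('n::{finite,linorder} triple => complex) => ('n triple => complex) => 'n triple => complex" where
 "edge k F1 F2 = (%(z,w,eta). eta ^ (CARD('n) - 1) *
 (beta1 (rho k) (theta k) * iter (G k 1) Lr (%u. F1 (z,z + cmul eta u,eta) * F2 (z + cmul eta u,w,eta)) (set_coord (u1 k) idx1 (beta1 (rho k) (theta k))) -
 beta0 (rho k) (theta k) * iter (G k 1) Lr (%u. F1 (z,z + cmul eta u,eta) * F2 (z + cmul eta u,w,eta)) (set_coord (u1 k) idx1 (beta0 (rho k) (theta k)))))"

definition segm :: "kappa => ('n::{finite,linorder} triple => complex) => ('n triple => complex) => 'n triple => complex" where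
 "segm k F1 F2 = (%(z,w,eta). eta ^ CARD('n) *
 iter (Gseg k) L0 (%u. F1 (z,z + cmul eta u,eta) * F2 (z + cmul eta u,w,eta)) (u1 k))"

text \<open>Operators over k have a product over l. \<open>rho_mk\<close> lets the drop of Re (eta
  u_1) along the segment outweigh z_1 - w_1, \<open>rho_le\<close> keeps w_i away from the disc
  around z_i + eta u_i, \<open>theta_le\<close> leaves room for the rotation by eta, and
  \<open>rad'_le\<close> keeps all points in the larger polydiscs.\<close>

locale kappa_pair =
 fixes k l :: kappa
 assumes k: "admissible k" and l: "admissible l"
 and rad_le: "rad l <= rad k" and rad'_le: "rad' l <= rad' k/4" and rho_le: "rho l <= rho k/6"
 and rho_mk: "rho l <= mk k/2" and theta_le: "theta l <= theta k/8"
begin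

lemma eta_bounds:
 assumes "eta \<in> sector (rad l) (theta l)"
 shows "eta ~= 0" "0 < cmod eta" "\<bar>Arg eta\<bar> < theta l/4" "\<bar>Arg eta\<bar> < theta k/32" "eta \<in> Sk k" "cmod eta < rho l * rad' l"
 "24 * cmod eta < rho k * rad' k"
proof -
 note kD = admissibleD[OF k] and lD = admissibleD[OF l]
 show 0: "eta ~= 0" "\<bar>Arg eta\<bar> < theta l/4" and 1: "0 < cmod eta" using sectorD[OF assms] by auto
 show 2: "\<bar>Arg eta\<bar> < theta k/32" using 0 theta_le by linarith
 show 3: "cmod eta < rho l * rad' l" using sectorD(2)[OF assms] lD(7) by linarith
 have "rho l * rad' l <= (rho k/6) * (rad' k/4)" using rho_le rad'_le lD kD by (intro mult_mono) auto
 then show 4: "24 * cmod eta < rho k * rad' k" using 3 by simp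
 have "eta \<in> sector (rad k) (theta k)" using sector_mono[OF rad_le,of "theta l" "theta k"] theta_le kD assms by auto
 moreover have "3 * cmod eta < rho k * rad' k" using 4 1 by linarith
 ultimately show "eta \<in> Sk k" by (simp add: Sk_def)
qed

lemma V_D:
 assumes "(z,w,eta) \<in> V_multi l al"
 shows "maxnorm z < rad' l" "eta \<in> sector (rad l) (theta l)" "cmod (z $ idx1 - w $ idx1) < rho l * cmod eta"
 "!!i. i ~= idx1 ==> cmod (z $ i - w $ i) < rad' l" "idx1 \<in> al ==> z $ idx1 - w $ idx1 \<in> Sect (theta l)"
 "!!i. i \<in> al ==> i ~= idx1 ==> cmod eta < rho l * cmod (z $ i - w $ i)" "maxnorm z < rad' k" "eta \<in> Sk k" "(z,zeta,eta) \<in> sdom k"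
proof -
 show 1: "maxnorm z < rad' l" "eta \<in> sector (rad l) (theta l)" "cmod (z $ idx1 - w $ idx1) < rho l * cmod eta"
 "!!i. i ~= idx1 ==> cmod (z $ i - w $ i) < rad' l" "idx1 \<in> al ==> z $ idx1 - w $ idx1 \<in> Sect (theta l)"
 "!!i. i \<in> al ==> i ~= idx1 ==> cmod eta < rho l * cmod (z $ i - w $ i)"
 using assms unfolding V_multi_iff[OF l] by auto
 show "maxnorm z < rad' k" "eta \<in> Sk k" "(z,zeta,eta) \<in> sdom k"
 using 1(1) eta_bounds(5)[OF 1(2)] rad'_le admissibleD[OF k] by (auto simp: sdom_Sk)
qed

text \<open>For i >= 2 in \<beta>, |z_i - w_i| exceeds 6 |eta|/rho k whereas |y_i| < 3 |eta|/rho k,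
  so the condition at i survives the shift. The sector condition in the first coordinate is supplied
  as a hypothesis; thus \<beta> may contain \<open>idx1\<close> even if al does not.\<close>

lemma V_shift:
 fixes z w y :: "'n::{finite,linorder} cvec"
 assumes x: "(z,w,eta) \<in> V_multi l al" and \<beta>: "\<beta> <= insert idx1 al"
 and y1: "cmod (y $ idx1) < 3/4 * rho k * cmod eta" and yi: "!!i. i ~= idx1 ==> cmod (y $ i) < 3/rho k * cmod eta"
 and s: "idx1 \<in> \<beta> ==> z $ idx1 - w $ idx1 + y $ idx1 \<in> Sect (theta k)"
 shows "(z + y,w,eta) \<in> V_multi k \<beta>"
proof -
 note kD = admissibleD[OF k] and lD = admissibleD[OF l] and X = V_D[OF x]
 note e = eta_bounds[OF X(2)]
 have yi': "rho k * cmod (y $ i) < 3 * cmod eta" if "i ~= idx1" for i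
 using yi[OF that] kD by (simp add: field_simps)
 have y3: "cmod (y $ i) < rad' k/8" for i
 proof (cases "i = idx1")
 case True
 have "3/4 * rho k * cmod eta <= 3/4 * 1 * cmod eta" using kD by (intro mult_right_mono mult_left_mono) auto
 moreover have "rho k * rad' k <= 1 * rad' k" using kD by (intro mult_right_mono) auto
 ultimately show ?thesis unfolding True using y1 e(7,2) by linarith
 next
 case False
 have "rho k * cmod (y $ i) < rho k * (rad' k/8)" using yi'[OF False] e(7) by simp
 then show ?thesis using kD by (simp only: mult_less_cancel_left_pos)
 qed
 have a: "maxnorm (z + y) < rad' k" unfolding maxnorm_less_iff
 proof
 fix i
 have "cmod (z $ i) < rad' l" using X(1) by (simp add: maxnorm_less_iff)
 then show "cmod ((z + y) $ i) < rad' k" using y3[of i] rad'_le kD norm_triangle_ineq[of "z $ i" "y $ i"] by simp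
 qed
 have b: "cmod ((z + y) $ idx1 - w $ idx1) < rho k * cmod eta"
 proof -
 have "rho l * cmod eta <= rho k/6 * cmod eta" using rho_le e by (intro mult_right_mono) auto
 moreover have "0 < rho k * cmod eta" using kD e by simp
 moreover have "(z + y) $ idx1 - w $ idx1 = (z $ idx1 - w $ idx1) + y $ idx1" by simp
 ultimately show ?thesis using X(3) y1 norm_triangle_ineq[of "z $ idx1 - w $ idx1" "y $ idx1"]
 by (simp only: mult.assoc times_divide_eq_left,linarith?)
 qed
 have c: "cmod ((z + y) $ i - w $ i) < rad' k" if "i ~= idx1" for i
 proof -
 have eq: "(z + y) $ i - w $ i = (z $ i - w $ i) + y $ i" by simp
 show ?thesis unfolding eq using X(4)[OF that] y3[of i] rad'_le kD(2) norm_triangle_ineq[of "z $ i - w $ i" "y $ i"] by linarith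
 qed
 have d: "cmod eta < rho k * cmod ((z + y) $ i - w $ i)" if "i \<in> \<beta>" "i ~= idx1" for i
 proof -
 have "rho l * cmod (z $ i - w $ i) <= rho k/6 * cmod (z $ i - w $ i)" using rho_le by (intro mult_right_mono) auto
 then have 1: "6 * cmod eta < rho k * cmod (z $ i - w $ i)" using X(6)[of i] that \<beta> by auto
 have "cmod (z $ i - w $ i) - cmod (y $ i) <= cmod ((z + y) $ i - w $ i)"
 using norm_diff_ineq[of "z $ i - w $ i" "y $ i"] by (simp add: algebra_simps)
 then have "rho k * (cmod (z $ i - w $ i) - cmod (y $ i)) <= rho k * cmod ((z + y) $ i - w $ i)" using kD by (intro mult_left_mono) auto
 then show ?thesis using 1 yi'[OF that(2)] e(2) by (simp only: right_diff_distrib,linarith?)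
 qed
 have "idx1 \<in> \<beta> ==> (z + y) $ idx1 - w $ idx1 \<in> Sect (theta k)" using s by (simp add: algebra_simps)
 then show ?thesis unfolding V_multi_iff[OF k] using a b c d X(8) by (simp add: Sk_def)
qed

text \<open>After rotation by eta, the functionals of angle at most theta l are still <= 0 on both
  rays, so moving along them does not leave the sector.\<close>

lemma ray_Sect:
 assumes eta: "\<bar>Arg eta\<bar> < theta l/4" and v: "v \<in> Sect (theta l)" and t: "0 <= t"
 shows "v + eta * (of_real t * beta0 (rho k) (theta k)) \<in> Sect (theta k)" "v + eta * (of_real t * beta1 (rho k) (theta k)) \<in> Sect (theta k)"
proof -
 note kD = admissibleD[OF k] and lD = admissibleD[OF l]
 have gen: "v + eta * (of_real t * b) \<in> Sect (theta k)" if b: "!!\<omega>. \<bar>\<omega>\<bar> < theta k/2 ==> lf \<omega> b < 0" for b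
 proof -
 have "lf \<omega> (eta * (of_real t * b)) <= 0" if "\<bar>\<omega>\<bar> <= theta l" for \<omega>
 proof -
 have "\<bar>\<omega> + Arg eta\<bar> < theta k/2" using that eta theta_le lD(5) by linarith
 then have "lf (\<omega> + Arg eta) b <= 0" using b by fastforce
 then show ?thesis unfolding lf_mult lf_simps using t by (intro mult_nonneg_nonpos) (auto simp: mult_nonneg_nonpos)
 qed
 then have "v + eta * (of_real t * b) \<in> Sect (theta l)" using lD by (intro Sect_add[OF v]) auto
 moreover have "Sect (theta l) <= Sect (theta k)" using kD lD theta_le by (intro Sect_mono) auto
 ultimately show ?thesis by blast
 qed
 show "v + eta * (of_real t * beta0 (rho k) (theta k)) \<in> Sect (theta k)" "v + eta * (of_real t * beta1 (rho k) (theta k)) \<in> Sect (theta k)"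
 using gen lf_beta_neg[OF k] by auto
qed

lemma gam_Sect:
 assumes eta: "\<bar>Arg eta\<bar> < theta l/4" and v: "v \<in> Sect (theta l)" and R: "ball v R <= Sect (theta k)"
 and ep: "0 < ep" "ep <= 1" "ep * rho k * cmod eta < 2 * R" and u: "u \<in> path_image (gam (rho k) (theta k) ep)"
 shows "v + eta * u \<in> Sect (theta k)"
proof -
 note kD = admissibleD[OF k]
 from ep(1,2) kD(5,3) u show ?thesis
 proof (cases rule: gam_image)
 case (ray0 t)
 then show ?thesis using ray_Sect(1)[OF eta v,of t] ep by simp
 next
 case (arc x)
 have "cmod (eta * u) = cmod eta * (ep * rho k/2)" using arc(2) ep kD by (simp add: norm_mult)
 also have "\<dots> < R" using ep(3) by (simp add: mult_ac)
 finally have "v + eta * u \<in> ball v R" by (simp add: dist_norm)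
 then show ?thesis using R by blast
 next
 case (ray1 t)
 then show ?thesis using ray_Sect(2)[OF eta v,of t] ep by simp
 qed
qed

text \<open>Re (eta u) <= - mk k |eta|, while |z_1 - w_1| < rho l |eta| <= mk k |eta| / 2, so the
  real part of the sum is negative. No sector condition on z_1 - w_1 enters, and this is what
  extends \<open>edge\<close> and \<open>segm\<close> across the first variable.\<close>

lemma seg_Sect:
 assumes x: "(z,w,eta) \<in> V_multi l al" and u: "u \<in> closed_segment (beta0 (rho k) (theta k)) (beta1 (rho k) (theta k))"
 shows "z $ idx1 - w $ idx1 + eta * u \<in> Sect (theta k)"
proof -
 note kD = admissibleD[OF k] and X = V_D[OF x]
 note e = eta_bounds[OF X(2)]
 have "Re (eta * u) <= - mk k * cmod eta" using Re_beta_le[OF k _ u,of eta] e(4) by auto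
 moreover have "Re (z $ idx1 - w $ idx1) < rho l * cmod eta" using X(3) complex_Re_le_cmod[of "z $ idx1 - w $ idx1"] by linarith
 moreover have "rho l * cmod eta <= mk k/2 * cmod eta" using rho_mk by (intro mult_right_mono) auto
 moreover have "0 < mk k * cmod eta" using mk_pos[OF k] e by simp
 ultimately have "lf 0 (z $ idx1 - w $ idx1 + eta * u) < 0" unfolding lf_simps by simp
 then show ?thesis using kD by (intro Sect_lfI[of 0]) auto
qed

text \<open>The arc of the first path has radius ep rho k |eta| / 2. It must stay closer to z_1 than
  R, the room that z_1 - w_1 has in the sector, for the second factor to be defined on it; the rays
  need no such bound by \<open>ray_Sect\<close>.\<close>

lemma mu_eq:
 fixes F1 F2 :: "'n::{finite,linorder} triple => complex"
 assumes F1: "holo_on F1 (V_multi k UNIV)" and F2: "holo_on F2 (V_multi k al)" and x: "(z,w,eta) \<in> V_multi l al"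
 and R: "R > 0" "idx1 \<in> al ==> ball (z $ idx1 - w $ idx1) R <= Sect (theta k)" "R <= 3/4 * rho k * cmod eta"
 and ep: "0 < ep" "ep <= 1" "ep * rho k * cmod eta < 2 * R"
 and b: "b $ idx1 = eta" "!!i. i ~= idx1 ==> cmod eta/2 < cmod (b $ i) & cmod (b $ i) < 3 * cmod eta/2"
 shows "mu_prod k F1 F2 (z,w,eta) = (\<Prod>i\<in>UNIV. b $ i) * iter (G k ep) L0 (%u. F1 (z,aff z b u,eta) * F2 (aff z b u,w,eta)) (u1 k)"
proof -
 note kD = admissibleD[OF k] and lD = admissibleD[OF l] and X = V_D[OF x]
 note e = eta_bounds[OF X(2)]
 define B where "B i = (if i = (idx1::'n) then {s. cmod (s - z $ i) < 3/4 * rho k * cmod eta} Int {s. z $ i - s \<in> Sect (theta k)} Int {s. i \<in> al --> s - w $ i \<in> Sect (theta k)}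
 else {s. cmod eta/rho k < cmod (s - z $ i)} Int {s. cmod (s - z $ i) < 3 * cmod eta/rho k})" for i
 have oB: "open (B i)" for i
 proof -
 have "open {s. i \<in> al --> s - w $ i \<in> Sect (theta k)}" by (cases "i \<in> al") (auto simp: open_Sect_shift)
 then show ?thesis unfolding B_def by (auto intro!: open_Int open_Sect_shift open_Collect_less continuous_intros)
 qed
 have ch: "chol (%w'. F1 (z,w',eta) * F2 (w',w,eta)) w'" if w': "w' \<in> cbx B" for w'
 proof -
 have B1: "cmod (w' $ idx1 - z $ idx1) < 3/4 * rho k * cmod eta" "z $ idx1 - w' $ idx1 \<in> Sect (theta k)" "idx1 \<in> al ==> w' $ idx1 - w $ idx1 \<in> Sect (theta k)"
 using w' unfolding cbx_def by (auto simp: B_def dest!: spec[of _ idx1])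
 have Bi: "cmod eta/rho k < cmod (w' $ i - z $ i)" "cmod (w' $ i - z $ i) < 3 * cmod eta/rho k" if "i ~= idx1" for i
 using w' that unfolding cbx_def by (auto simp: B_def dest!: spec[of _ i])
 have p: "0 < rho k * cmod eta" using kD e by simp
 have "(z,z + (w' - z),eta) \<in> V_multi k UNIV"
 using X(7,8) B1 Bi kD p by (intro V_left[OF k]) (auto simp: field_simps intro: order.strict_trans)
 then have 1: "chol F1 (z,w',eta)" using F1 by (simp add: holo_on_iff_chol)
 have "(z + (w' - z),w,eta) \<in> V_multi k al"
 using B1 Bi by (intro V_shift[OF x]) auto
 then have 2: "chol F2 (w',w,eta)" using F2 by (simp add: holo_on_iff_chol)
 show ?thesis
 by (intro chol_mult chol_compose[of F1 "%w'. (z,w',eta)"] chol_compose[of F2 "%w'. (w',w,eta)"] 1 2 chol_intros)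
 qed
 have etaA: "\<bar>Arg eta\<bar> < theta k/2" using e(4) kD by linarith
 have rayB: "z $ idx1 + eta * (of_real t * bb) \<in> B idx1" if t: "0 < t" "t <= 1" and bb: "cmod bb = rho k/2" "bb = rcis (rho k/2) y" "\<bar>y\<bar> <= (pi + theta k)/2"
 "idx1 \<in> al ==> (z $ idx1 - w $ idx1) + eta * (of_real t * bb) \<in> Sect (theta k)" for t bb y
 proof -
 have "cmod (eta * (of_real t * bb)) = t * (cmod eta * (rho k/2))" using t bb by (simp add: norm_mult)
 also have "\<dots> <= 1 * (cmod eta * (rho k/2))" using t kD by (intro mult_right_mono) auto
 also have "\<dots> < 3/4 * rho k * cmod eta" using kD e by simp
 finally have 1: "cmod (eta * (of_real t * bb)) < 3/4 * rho k * cmod eta" .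
 have "of_real t * bb = rcis (t * (rho k/2)) y" by (simp add: bb(2) rcis_def)
 then have 2: "- (eta * (of_real t * bb)) \<in> Sect (theta k)" using Sect_minus_rcis[OF bb(3) etaA,of "t * (rho k/2)"] t kD e by simp
 have eq: "z $ idx1 + eta * (of_real t * bb) - w $ idx1 = z $ idx1 - w $ idx1 + eta * (of_real t * bb)" by simp
 have 3: "z $ idx1 + eta * (of_real t * bb) - w $ idx1 \<in> Sect (theta k)" if "idx1 \<in> al" unfolding eq by (rule bb(4)[OF that])
 then show ?thesis using 1 2 by (simp add: B_def)
 qed
 have "small_value (%ep. prod_integral (gamma_path z eta (rho k) (theta k) ep) (%w'. F1 (z,w',eta) * F2 (w',w,eta))) =
 (\<Prod>i\<in>UNIV. b $ i) * iter (G k ep) L0 (%u. F1 (z,aff z b u,eta) * F2 (aff z b u,w,eta)) (u1 k)"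
 proof (rule small_value_prod_gamma[OF k e(1) etaA oB ch _ R(1) _ _ _ b ep])
 fix i :: 'n and s assume "i ~= idx1" "cmod eta/rho k < cmod (s - z $ i)" "cmod (s - z $ i) < 3 * cmod eta/rho k"
 then show "s \<in> B i" by (simp add: B_def)
 next
 fix s assume s: "cmod (s - z $ idx1) < R" "z $ idx1 - s \<in> Sect (theta k)"
 have "s - w $ idx1 \<in> ball (z $ idx1 - w $ idx1) R" using s(1) by (simp add: dist_norm norm_minus_commute)
 then have "idx1 \<in> al --> s - w $ idx1 \<in> Sect (theta k)" using R(2) by blast
 moreover have "cmod (s - z $ idx1) < 3/4 * rho k * cmod eta" using s(1) R(3) by linarith
 ultimately show "s \<in> B idx1" using s(2) by (simp add: B_def)
 next
 fix t :: real assume t: "0 < t" "t <= 1"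
 show "z $ idx1 + eta * (of_real t * beta0 (rho k) (theta k)) \<in> B idx1"
 using kD by (intro rayB[OF t _ beta_rcis(1)] ray_Sect(1)[OF e(3) X(5)]) (use t in \<open>auto simp: beta_bound[OF k]\<close>)
 show "z $ idx1 + eta * (of_real t * beta1 (rho k) (theta k)) \<in> B idx1"
 using kD by (intro rayB[OF t _ beta_rcis(2)] ray_Sect(2)[OF e(3) X(5)]) (use t in \<open>auto simp: beta_bound[OF k]\<close>)
 qed
 then show ?thesis by (simp add: mu_prod_def)
qed

lemma mu_eq_mub:
 fixes F1 F2 :: "'n::{finite,linorder} triple => complex"
 assumes F1: "holo_on F1 (V_multi k UNIV)" and F2: "holo_on F2 (V_multi k al)" and x: "(z,w,eta) \<in> V_multi l al"
 and R: "R > 0" "idx1 \<in> al ==> ball (z $ idx1 - w $ idx1) R <= Sect (theta k)" "R <= 3/4 * rho k * cmod eta"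
 and ep: "0 < ep" "ep <= 1" "ep * rho k * cmod eta < 2 * R"
 shows "mu_prod k F1 F2 (z,w,eta) = mub k ep F1 F2 (z,w,eta)"
proof -
 have "0 < cmod eta" by (rule eta_bounds(2)[OF V_D(2)[OF x]])
 then show ?thesis
 using mu_eq[OF F1 F2 x R ep,of "\<chi> i. eta"] unfolding aff_cmul by (simp add: mub_def)
qed

lemma ex_R:
 assumes x: "(z,w,eta) \<in> V_multi l al"
 obtains R where "R > 0" "idx1 \<in> al ==> ball (z $ idx1 - w $ idx1) R <= Sect (theta k)" "R <= 3/4 * rho k * cmod eta"
proof -
 note kD = admissibleD[OF k] and lD = admissibleD[OF l] and X = V_D[OF x]
 note e = eta_bounds[OF X(2)]
 have p: "0 < 3/4 * rho k * cmod eta" using kD e by simp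
 have "\<exists>r>0. idx1 \<in> al --> ball (z $ idx1 - w $ idx1) r <= Sect (theta k)"
 proof (cases "idx1 \<in> al")
 case True
 have "Sect (theta l) <= Sect (theta k)" using kD lD theta_le by (intro Sect_mono) auto
 then have "z $ idx1 - w $ idx1 \<in> Sect (theta k)" using X(5)[OF True] by blast
 then show ?thesis using open_Sect[of "theta k"] open_contains_ball by metis
 qed (auto intro: exI[of _ 1])
 then obtain r where r: "r > 0" "idx1 \<in> al ==> ball (z $ idx1 - w $ idx1) r <= Sect (theta k)" by blast
 show thesis
 by (rule that[of "min r (3/4 * rho k * cmod eta)"]) (use r p subset_ball[of "min r (3/4 * rho k * cmod eta)" r] in force)+
qed

text \<open>One epsilon for all eta near eta0. Halving R leaves the other half for the motion of z_1
  - w_1.\<close>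

lemma eps_choice:
 assumes "R > 0" "R <= 3/4 * rho k * cmod eta0" "0 < cmod eta0" "cmod (eta - eta0) < cmod eta0/6"
 and ep: "ep = min 1 (R/(2 * rho k * cmod eta0))"
 shows "0 < ep" "ep <= 1" "ep * rho k * cmod eta < 2 * (R/2)" "R/2 <= 3/4 * rho k * cmod eta"
 "5/6 * cmod eta0 < cmod eta" "cmod eta < 7/6 * cmod eta0"
proof -
 note kD = admissibleD[OF k]
 have p: "0 < rho k * cmod eta0" using kD assms by simp
 have "0 < R/(2 * rho k * cmod eta0)" using kD assms by (intro divide_pos_pos mult_pos_pos) auto
 then show 1: "0 < ep" "ep <= 1" unfolding ep by simp_all
 have "cmod eta <= cmod eta0 + cmod (eta - eta0)" using norm_triangle_ineq[of eta0 "eta - eta0"] by simp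
 then show 2: "cmod eta < 7/6 * cmod eta0" using assms(4) by linarith
 have "cmod eta0 <= cmod eta + cmod (eta - eta0)" using norm_triangle_ineq[of eta "eta0 - eta"] by (simp add: norm_minus_commute)
 then show 3: "5/6 * cmod eta0 < cmod eta" using assms(4) by linarith
 have "rho k * cmod eta <= rho k * (7/6 * cmod eta0)" using 2 kD by (intro mult_left_mono) auto
 then have "ep * (rho k * cmod eta) <= (R/(2 * rho k * cmod eta0)) * (rho k * (7/6 * cmod eta0))"
 using 1 kD assms by (intro mult_mono) auto
 also have "\<dots> = 7/12 * R" using assms(3) kD by (simp add: field_simps)
 finally show "ep * rho k * cmod eta < 2 * (R/2)" using assms(1) by (simp only: mult.assoc,linarith?)
 have "rho k * (5/6 * cmod eta0) <= rho k * cmod eta" using 3 kD by (intro mult_left_mono) auto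
 then show "R/2 <= 3/4 * rho k * cmod eta" using assms(2) p by (simp add: algebra_simps)
qed

text \<open>At the base point the second factor is evaluated on a compact part of the open sector,
  hence with a margin d. Nearby points and a slightly larger open box of contours stay within this
  margin, and there \<open>chol_iter_param\<close> applies.\<close>

lemma chol_box:
 fixes F1 F2 :: "'n::{finite,linorder} triple => complex"
 assumes F1: "holo_on F1 (V_multi k al1)" and F2: "holo_on F2 (V_multi k al2)" and x: "(z0,w0,eta0) \<in> V_multi l al" and al2: "al2 <= insert idx1 al"
 and A: "!!i. compact (A i)" "!!i. A i <= ubox k al1 i" "A idx1 <= ball 0 (3/4 * rho k)"
 and S: "!!u. idx1 \<in> al2 ==> u \<in> A idx1 ==> z0 $ idx1 - w0 $ idx1 + eta0 * u \<in> Sect (theta k)"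
 and g: "!!i. i \<in> set L ==> npath (g i)" "!!i. i \<in> set L ==> path_image (g i) <= A i" and v: "v \<in> cbx A"
 shows "chol (%(z,w,eta). iter g L (%u. F1 (z,z + cmul eta u,eta) * F2 (z + cmul eta u,w,eta)) v) (z0,w0,eta0)"
proof -
 note kD = admissibleD[OF k] and lD = admissibleD[OF l]
 let ?v0 = "z0 $ idx1 - w0 $ idx1"
 have "\<exists>d>0. idx1 \<in> al2 --> (\<forall>u\<in>A idx1. ball (?v0 + eta0 * u) d <= Sect (theta k))"
 proof (cases "idx1 \<in> al2")
 case True
 have "compact ((%u. ?v0 + eta0 * u) ` A idx1)" by (intro compact_continuous_image continuous_intros A)
 moreover have "(%u. ?v0 + eta0 * u) ` A idx1 <= Sect (theta k)" using S[OF True] by blast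
 ultimately obtain d where "d > 0" "(\<Union>s\<in>(%u. ?v0 + eta0 * u) ` A idx1. ball s d) <= Sect (theta k)"
 using compact_subset_open_imp_ball_epsilon_subset[OF _ open_Sect] by metis
 then show ?thesis by blast
 qed (auto intro: exI[of _ 1])
 then obtain d where d: "d > 0" "!!u. idx1 \<in> al2 ==> u \<in> A idx1 ==> ball (?v0 + eta0 * u) d <= Sect (theta k)" by blast
 \<comment> \<open>The margin is spent in thirds: on z_1 - w_1, on eta, and on u_1, whose
   displacement d' is multiplied by |eta| <= 1 + |eta0|.\<close>
 define d' where "d' = d/(3 * (1 + cmod eta0))"
 have d': "d' > 0" "(1 + cmod eta0) * d' = d/3"
 proof -
 have "1 + cmod eta0 > 0" using norm_ge_zero[of eta0] by linarith
 then show "d' > 0" "(1 + cmod eta0) * d' = d/3" using d by (auto simp: d'_def field_simps)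
 qed
 define Bu where "Bu i = (if i = (idx1::'n) then ubox k al1 i Int ball 0 (3/4 * rho k) Int (\<Union>u'\<in>A i. ball u' d') else ubox k al1 i)" for i
 have oBu: "open (Bu i)" for i by (auto simp: Bu_def open_ubox intro!: open_Int open_UN)
 have ABu: "A i <= Bu i" for i using A(2,3) d'(1) by (auto simp: Bu_def)
 define P where "P = V_multi l al Int {x. cmod (fst x $ idx1 - fst (snd x) $ idx1 - ?v0) < d/3} Int {x. cmod (snd (snd x) - eta0) < min 1 (d/3)}"
 have oP: "open P" unfolding P_def
 by (intro open_Int open_V_multi[OF l] open_Collect_less continuous_intros)
 have xP: "(z0,w0,eta0) \<in> P" using x d by (simp add: P_def)
 define f where "f x u = F1 (fst x,fst x + cmul (snd (snd x)) u,snd (snd x)) * F2 (fst x + cmul (snd (snd x)) u,fst (snd x),snd (snd x))" for x :: "'n triple" and u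
 have f: "chol (%p. f (fst p) (snd p)) (x,u)" if xx: "x \<in> P" and u: "u \<in> cbx Bu" for x u
 proof -
 obtain z w eta where [simp]: "x = (z,w,eta)" by (cases x)
 have x': "(z,w,eta) \<in> V_multi l al" and c: "cmod (z $ idx1 - w $ idx1 - ?v0) < d/3" "cmod (eta - eta0) < 1" "cmod (eta - eta0) < d/3"
 using xx by (auto simp: P_def)
 note X = V_D[OF x']
 note e = eta_bounds[OF X(2)]
 have uB: "u \<in> cbx (ubox k al1)" using u by (auto simp: cbx_def Bu_def split: if_splits)
 have u1: "u $ idx1 \<in> Bu idx1" using u by (simp add: cbx_def)
 have ui: "cmod (u $ i) < 3/rho k" if "i ~= idx1" for i using uB that by (auto simp: cbx_def ubox_def dest: spec[of _ i])
 have 1: "(z,z + cmul eta u,eta) \<in> V_multi k al1" by (rule ubox_V_multi[OF k X(9) uB])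
 have 2: "(z + cmul eta u,w,eta) \<in> V_multi k al2"
 proof (rule V_shift[OF x' al2])
 show "cmod (cmul eta u $ idx1) < 3/4 * rho k * cmod eta" using u1 e(2) by (simp add: Bu_def norm_mult)
 show "cmod (cmul eta u $ i) < 3/rho k * cmod eta" if "i ~= idx1" for i
 using mult_strict_left_mono[OF ui[OF that] e(2)] by (simp only: cmul_simps norm_mult mult.commute[of "cmod eta"])
 assume i: "idx1 \<in> al2"
 obtain u' where u': "u' \<in> A idx1" "cmod (u $ idx1 - u') < d'" using u1 by (auto simp: Bu_def dist_norm norm_minus_commute)
 have "u' \<in> ball 0 (3/4 * rho k)" using u'(1) A(3) by blast
 then have "cmod u' <= 1" using kD by simp
 then have q1: "cmod ((eta - eta0) * u') <= cmod (eta - eta0) * 1" unfolding norm_mult by (intro mult_left_mono) auto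
 have "cmod eta <= 1 + cmod eta0" using c(2) norm_triangle_ineq[of "eta - eta0" eta0] by simp
 then have q2: "cmod (eta * (u $ idx1 - u')) <= (1 + cmod eta0) * d'" unfolding norm_mult using u'(2) by (intro mult_mono) auto
 have "z $ idx1 - w $ idx1 + eta * u $ idx1 - (?v0 + eta0 * u') = (z $ idx1 - w $ idx1 - ?v0) + eta * (u $ idx1 - u') + (eta - eta0) * u'"
 by (simp add: algebra_simps)
 then have "cmod (z $ idx1 - w $ idx1 + eta * u $ idx1 - (?v0 + eta0 * u')) <= cmod (z $ idx1 - w $ idx1 - ?v0) + cmod (eta * (u $ idx1 - u')) + cmod ((eta - eta0) * u')"
 using norm_triangle_ineq[of "(z $ idx1 - w $ idx1 - ?v0) + eta * (u $ idx1 - u')" "(eta - eta0) * u'"]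
 norm_triangle_ineq[of "z $ idx1 - w $ idx1 - ?v0" "eta * (u $ idx1 - u')"] by (simp only:,linarith?)
 also have "\<dots> < d" using q1 q2 c d'(2) by linarith
 finally have "z $ idx1 - w $ idx1 + eta * u $ idx1 \<in> ball (?v0 + eta0 * u') d" by (simp add: dist_norm norm_minus_commute)
 then show "z $ idx1 - w $ idx1 + cmul eta u $ idx1 \<in> Sect (theta k)" using d(2)[OF i u'(1)] by auto
 qed
 have "chol F1 (z,z + cmul eta u,eta)" "chol F2 (z + cmul eta u,w,eta)" using F1 F2 1 2 by (simp_all add: holo_on_iff_chol)
 then show ?thesis unfolding f_def
 by (intro chol_mult chol_compose[of F1 "%p. (fst (fst p),fst (fst p) + cmul (snd (snd (fst p))) (snd p),snd (snd (fst p)))"]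
 chol_compose[of F2 "%p. (fst (fst p) + cmul (snd (snd (fst p))) (snd p),fst (snd (fst p)),snd (snd (fst p)))"] chol_intros) simp_all
 qed
 have gB: "path_image (g i) <= Bu i" if "i \<in> set L" for i using g(2)[OF that] ABu by blast
 have vB: "v \<in> cbx Bu" using v ABu by (auto simp: cbx_def)
 have "chol (%p. iter g L (f (fst p)) (snd p)) ((z0,w0,eta0),v)"
 by (rule chol_iter_param[OF g(1) gB oP oBu f xP vB])
 then have "chol (%x. iter g L (f x) v) (z0,w0,eta0)"
 by (rule chol_compose2[where F = "%x v. iter g L (f x) v" and h = "%_. v"]) (intro chol_intros | simp)+
 moreover have "(%x. iter g L (f x) v) = (%(z,w,eta). iter g L (%u. F1 (z,z + cmul eta u,eta) * F2 (z + cmul eta u,w,eta)) v)"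
 by (auto simp: f_def[abs_def] fun_eq_iff)
 ultimately show ?thesis by simp
qed

lemma chol_power_mult:
 assumes "chol (%(z,w,eta). F z w eta :: complex) x0"
 shows "chol (%(z :: 'n::finite cvec,w :: 'n cvec,eta :: complex). eta ^ m * F z w eta) x0"
proof -
 have "chol (%x. snd (snd x) ^ m * (%(z,w,eta). F z w eta) x) x0"
 by (intro chol_mult chol_power assms chol_intros)
 moreover have "(%x. snd (snd x) ^ m * (%(z,w,eta). F z w eta) x) = (%(z,w,eta). eta ^ m * F z w eta)" by auto
 ultimately show ?thesis by simp
qed

lemma circ_ubox: "i ~= idx1 ==> path_image (circlepath 0 (2/rho k)) <= ubox k al i" for i :: "'n::{finite,linorder}"
 using G_ubox[OF k,of 1 i al] by (simp add: G_def)

text \<open>By \<open>eps_choice\<close> the product agrees with \<open>mub\<close> for one fixed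
  epsilon on a whole neighbourhood, where \<open>chol_box\<close> applies.\<close>

lemma holo_mu:
 fixes F1 F2 :: "'n::{finite,linorder} triple => complex"
 assumes F1: "holo_on F1 (V_multi k UNIV)" and F2: "holo_on F2 (V_multi k al)"
 shows "holo_on (mu_prod k F1 F2) (V_multi l al)"
 unfolding holo_on_iff_chol
proof
 fix x0 :: "'n triple" assume "x0 \<in> V_multi l al"
 obtain z0 w0 eta0 where [simp]: "x0 = (z0,w0,eta0)" by (cases x0)
 with \<open>x0 \<in> _\<close> have x: "(z0,w0,eta0) \<in> V_multi l al" by simp
 note kD = admissibleD[OF k] and X = V_D[OF x]
 note e = eta_bounds[OF X(2)]
 obtain R where R: "R > 0" "idx1 \<in> al ==> ball (z0 $ idx1 - w0 $ idx1) R <= Sect (theta k)" "R <= 3/4 * rho k * cmod eta0"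
 by (rule ex_R[OF x],rule that)
 define ep where "ep = min 1 (R/(2 * rho k * cmod eta0))"
 note ec = eps_choice[OF R(1,3) e(2) _ ep_def]
 have ec0: "0 < ep" "ep <= 1" "ep * rho k * cmod eta0 < 2 * (R/2)" using ec[of eta0] e by auto
 define N where "N = V_multi l al Int {x. cmod (fst x $ idx1 - fst (snd x) $ idx1 - (z0 $ idx1 - w0 $ idx1)) < R/2} Int {x. cmod (snd (snd x) - eta0) < cmod eta0/6}"
 have oN: "open N" unfolding N_def by (intro open_Int open_V_multi[OF l] open_Collect_less continuous_intros)
 have xN: "x0 \<in> N" using x R e by (simp add: N_def)
 have eq: "mub k ep F1 F2 y = mu_prod k F1 F2 y" if "y \<in> N" for y
 proof -
 obtain z w eta where [simp]: "y = (z,w,eta)" by (cases y)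
 have y: "(z,w,eta) \<in> V_multi l al" "cmod (z $ idx1 - w $ idx1 - (z0 $ idx1 - w0 $ idx1)) < R/2" "cmod (eta - eta0) < cmod eta0/6"
 using that by (auto simp: N_def)
 have "ball (z $ idx1 - w $ idx1) (R/2) <= ball (z0 $ idx1 - w0 $ idx1) R"
 using y(2) by (simp add: ball_subset_ball_iff dist_norm)
 then have "idx1 \<in> al ==> ball (z $ idx1 - w $ idx1) (R/2) <= Sect (theta k)" using R(2) by blast
 then show ?thesis using mu_eq_mub[OF F1 F2 y(1),of "R/2" ep] ec[OF y(3)] R(1) by simp
 qed
 have "chol (mub k ep F1 F2) (z0,w0,eta0)" unfolding mub_def
 proof (rule chol_power_mult,rule chol_box[OF F1 F2 x subset_insertI,where A = "%i. path_image (G k ep i)"])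
 show "path_image (G k ep i) <= ubox k UNIV i" for i :: 'n using G_ubox[OF k ec0(1,2)] .
 show "path_image (G k ep (idx1::'n)) <= ball 0 (3/4 * rho k)"
 proof
 fix u assume "u \<in> path_image (G k ep (idx1::'n))"
 then have "u \<in> path_image (gam (rho k) (theta k) ep)" by (simp add: G_def)
 then obtain r y where "0 < r" "r <= rho k/2" "\<bar>y\<bar> <= (pi + theta k)/2" "u = rcis r y"
 using gam_image_rcis[OF ec0(1,2) kD(5,3)] by metis
 then show "u \<in> ball 0 (3/4 * rho k)" using kD by simp
 qed
 show "z0 $ idx1 - w0 $ idx1 + eta0 * u \<in> Sect (theta k)" if "idx1 \<in> al" "u \<in> path_image (G k ep (idx1::'n))" for u
 using that ec0 R(2) subset_ball[of "R/2" R "z0 $ idx1 - w0 $ idx1"] R(1)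
 by (intro gam_Sect[OF e(3) X(5),of "R/2" ep]) (auto simp: G_def)
 show "u1 k \<in> cbx (%i. path_image (G k ep i))" by (simp add: cbx_def u1_G)
 qed (auto simp: path_image_compact)
 then show "chol (mu_prod k F1 F2) x0" by (intro chol_cong_open[OF oN xN eq]) simp_all
qed

lemma holo_edge:
 fixes F1 F2 :: "'n::{finite,linorder} triple => complex"
 assumes F1: "holo_on F1 (V_multi k UNIV)" and F2: "holo_on F2 (V_multi k UNIV)"
 shows "holo_on (edge k F1 F2) (V_multi l (UNIV - {idx1}))"
 unfolding holo_on_iff_chol
proof
 fix x0 :: "'n triple" assume "x0 \<in> V_multi l (UNIV - {idx1})"
 obtain z0 w0 eta0 where [simp]: "x0 = (z0,w0,eta0)" by (cases x0)
 with \<open>x0 \<in> _\<close> have x: "(z0,w0,eta0) \<in> V_multi l (UNIV - {idx1})" by simp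
 note kD = admissibleD[OF k]
 let ?b0 = "beta0 (rho k) (theta k)" and ?b1 = "beta1 (rho k) (theta k)"
 define E where "E b = (%(z,w,eta). iter (G k 1) Lr (%u. F1 (z,z + cmul eta u,eta) * F2 (z + cmul eta u,w,eta)) (set_coord (u1 k) idx1 b))" for b
 have E: "chol (E b) (z0,w0,eta0)" if b: "b \<in> ubox k UNIV (idx1::'n)" "cmod b = rho k/2" "b \<in> closed_segment ?b0 ?b1" for b
 unfolding E_def
 proof (rule chol_box[OF F1 F2 x _,where A = "%i. if i = idx1 then {b} else path_image (circlepath 0 (2/rho k))"])
 show "(if i = idx1 then {b} else path_image (circlepath 0 (2/rho k))) <= ubox k UNIV i" for i :: 'n
 using b circ_ubox by auto
 show "z0 $ idx1 - w0 $ idx1 + eta0 * u \<in> Sect (theta k)" if "u \<in> (if (idx1::'n) = idx1 then {b} else path_image (circlepath 0 (2/rho k)))" for u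
 using seg_Sect[OF x b(3)] that by simp
 show "set_coord (u1 k) idx1 b \<in> cbx (%i. if i = idx1 then {b} else path_image (circlepath 0 (2/rho k)))"
 unfolding cbx_def mem_Collect_eq
 proof
 fix i show "set_coord (u1 k) idx1 b $ i \<in> (if i = idx1 then {b} else path_image (circlepath 0 (2/rho k)))"
 using u1_G[of k i 1] by (cases "i = idx1") (auto simp: G_def)
 qed
 qed (use b kD in \<open>auto simp: path_image_compact G_def\<close>)
 have bu: "?b0 \<in> ubox k UNIV (idx1::'n)" "?b1 \<in> ubox k UNIV (idx1::'n)"
 using G_ubox[OF k,of 1 "idx1::'n" UNIV] beta_gam[of "rho k" "theta k" 1] by (auto simp: G_def)
 have "chol (%x. snd (snd x) ^ (CARD('n) - 1) * (?b1 * E ?b1 x - ?b0 * E ?b0 x)) (z0,w0,eta0)"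
 by (intro chol_mult chol_diff chol_power E bu beta_bound[OF k] ends_in_segment chol_intros)
 moreover have "(%x. snd (snd x) ^ (CARD('n) - 1) * (?b1 * E ?b1 x - ?b0 * E ?b0 x)) = edge k F1 F2"
 by (auto simp: E_def edge_def)
 ultimately show "chol (edge k F1 F2) x0" by simp
qed

lemma holo_segm:
 fixes F1 F2 :: "'n::{finite,linorder} triple => complex"
 assumes F1: "holo_on F1 (V_multi k (UNIV - {idx1}))" and F2: "holo_on F2 (V_multi k UNIV)"
 shows "holo_on (segm k F1 F2) (V_multi l (UNIV - {idx1}))"
 unfolding holo_on_iff_chol
proof
 fix x0 :: "'n triple" assume "x0 \<in> V_multi l (UNIV - {idx1})"
 obtain z0 w0 eta0 where [simp]: "x0 = (z0,w0,eta0)" by (cases x0)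
 with \<open>x0 \<in> _\<close> have x: "(z0,w0,eta0) \<in> V_multi l (UNIV - {idx1})" by simp
 note kD = admissibleD[OF k]
 let ?b0 = "beta0 (rho k) (theta k)" and ?b1 = "beta1 (rho k) (theta k)"
 have sb: "closed_segment ?b0 ?b1 <= ball 0 (3/4 * rho k)"
 by (rule closed_segment_subset) (use kD in \<open>auto simp: beta_bound[OF k]\<close>)
 have "chol (segm k F1 F2) (z0,w0,eta0)" unfolding segm_def
 proof (rule chol_power_mult,rule chol_box[OF F1 F2 x _,where A = "%i. path_image (Gseg k i)"])
 show "path_image (Gseg k i) <= ubox k (UNIV - {idx1}) i" for i :: 'n
 proof (cases "i = idx1")
 case True
 then show ?thesis using segment_ball[OF k] by (auto simp: Gseg_def ubox_def)
 next
 case False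
 then show ?thesis using circ_ubox[OF False] by (simp only: Gseg_def False if_False)
 qed
 show "path_image (Gseg k (idx1::'n)) <= ball 0 (3/4 * rho k)" using sb by (simp add: Gseg_def)
 show "z0 $ idx1 - w0 $ idx1 + eta0 * u \<in> Sect (theta k)" if "u \<in> path_image (Gseg k (idx1::'n))" for u
 using seg_Sect[OF x,of u] that by (simp add: Gseg_def)
 show "(u1 k :: 'n cvec) \<in> cbx (%i. path_image (Gseg k i))" unfolding cbx_def mem_Collect_eq
 proof
 fix i :: 'n show "u1 k $ i \<in> path_image (Gseg k i)"
 using u1_G[of k i 1] by (cases "i = idx1") (auto simp: Gseg_def u1_def G_def)
 qed
 qed (auto simp: path_image_compact)
 then show "chol (segm k F1 F2) x0" by simp
qed

text \<open>The moving ends give \<open>edge\<close>. Under the integral the product rule leaves two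
  terms: against the derivative of psi, the factor phi takes the part that the exponential had in
  \<open>integral_null_forms\<close>; in the other term each null summand of phi simply stays inside
  the product.\<close>

lemma pd_eta_mu:
 fixes psi phi :: "'n::{finite,linorder} triple => complex"
 assumes psi: "holo_on psi (V_multi k UNIV)" and h: "!!i. holo_on (h (UNIV - {i})) (V_multi k (UNIV - {i}))"
 and psih: "!!x. x \<in> V_multi k UNIV ==> pd_eta psi x = (\<Sum>al | card al = CARD('n) - 1. h al x)"
 and phi: "holo_on phi (V_multi k UNIV)" and h': "!!i. holo_on (h' (UNIV - {i})) (V_multi k (UNIV - {i}))"
 and phih: "!!x. x \<in> V_multi k UNIV ==> pd_eta phi x = (\<Sum>al | card al = CARD('n) - 1. h' al x)"
 and x: "(z,w,eta) \<in> V_multi l UNIV"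
 shows "pd_eta (mu_prod k psi phi) (z,w,eta) = edge k psi phi (z,w,eta) + segm k (h (UNIV - {idx1})) phi (z,w,eta) +
 (\<Sum>i\<in>UNIV. mu_prod k psi (h' (UNIV - {i})) (z,w,eta))"
proof -
 note kD = admissibleD[OF k] and lD = admissibleD[OF l] and X = V_D[OF x]
 note e = eta_bounds[OF X(2)]
 let ?b0 = "beta0 (rho k) (theta k)" and ?b1 = "beta1 (rho k) (theta k)"
 let ?v = "z $ idx1 - w $ idx1"
 obtain R where R: "R > 0" "idx1 \<in> (UNIV::'n set) ==> ball ?v R <= Sect (theta k)" "R <= 3/4 * rho k * cmod eta"
 by (rule ex_R[OF x],rule that)
 define ep where "ep = min 1 (R/(2 * rho k * cmod eta))"
 note ec = eps_choice[OF R(1,3) e(2) _ ep_def]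
 have ec0: "0 < ep" "ep <= 1" "ep * rho k * cmod eta < 2 * (R/2)" "R/2 <= 3/4 * rho k * cmod eta" using ec[of eta] e by auto
 have bR: "ball ?v (R/2) <= Sect (theta k)" using R subset_ball[of "R/2" R ?v] by auto
 have etaA: "\<bar>Arg eta'\<bar> < theta k/2" if "\<bar>Arg eta'\<bar> < theta l/4" for eta' using that theta_le kD by linarith
 have gamS: "cmod u <= rho k/2" "- (eta' * u) \<in> Sect (theta k)" "?v + eta' * u \<in> Sect (theta k)"
 if u: "u \<in> path_image (gam (rho k) (theta k) ep)" and y: "(z,w,eta') \<in> V_multi l UNIV" "cmod (eta' - eta) < cmod eta/6" for u eta'
 proof -
 note e' = eta_bounds[OF V_D(2)[OF y(1)]]
 obtain r y where r: "0 < r" "r <= rho k/2" "\<bar>y\<bar> <= (pi + theta k)/2" "u = rcis r y"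
 using gam_image_rcis[OF ec0(1,2) kD(5,3) u] by metis
 show "cmod u <= rho k/2" using r by simp
 show "- (eta' * u) \<in> Sect (theta k)" using Sect_minus_rcis[OF r(3) etaA[OF e'(3)] kD(5,6) r(1) e'(1)] r(4) by simp
 show "?v + eta' * u \<in> Sect (theta k)"
 using gam_Sect[OF e'(3) X(5) bR ec0(1,2) _ u] ec[OF y(2)] by simp
 qed
 define P where "P = ball eta (cmod eta/6) Int (%eta'. (z,w,eta')) -` V_multi l UNIV"
 have oP: "open P" unfolding P_def by (intro open_Int open_ball open_vimage open_V_multi[OF l] continuous_intros)
 have etaP: "eta \<in> P" using x e by (simp add: P_def)
 have PD: "(z,w,eta') \<in> V_multi l UNIV" "cmod (eta' - eta) < cmod eta/6" if "eta' \<in> P" for eta'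
 using that by (auto simp: P_def dist_norm norm_minus_commute)
 \<comment> \<open>All eta' in P satisfy 5/6 < |eta'|/|eta| < 7/6; the constants 3/5, 7/6 and 5/2
   give one box for all of them.\<close>
 define B where "B i = (if i = (idx1::'n) then {s. cmod (s - z $ i) < 3/5 * (rho k * cmod eta)} Int {s. z $ i - s \<in> Sect (theta k)} Int {s. s - w $ i \<in> Sect (theta k)}
 else {s. 7/6 * cmod eta < rho k * cmod (s - z $ i)} Int {s. rho k * cmod (s - z $ i) < 5/2 * cmod eta})" for i
 have oB: "open (B i)" for i
 unfolding B_def by (auto intro!: open_Int open_Sect_shift open_Collect_less continuous_intros)
 define f where "f eta' y = psi (z,y,eta') * phi (y,w,eta')" for eta' y
 have chf: "chol (%p. f (fst p) (snd p)) (eta',y)" if eta': "eta' \<in> P" and y: "y \<in> cbx B" for eta' y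
 proof -
 note p = PD[OF eta'] and c = ec[OF PD(2)[OF eta']]
 note X' = V_D[OF p(1)]
 have B1: "cmod (y $ idx1 - z $ idx1) < 3/5 * (rho k * cmod eta)" "z $ idx1 - y $ idx1 \<in> Sect (theta k)" "y $ idx1 - w $ idx1 \<in> Sect (theta k)"
 using y unfolding cbx_def by (auto simp: B_def dest!: spec[of _ idx1])
 have Bi: "7/6 * cmod eta < rho k * cmod (y $ i - z $ i)" "rho k * cmod (y $ i - z $ i) < 5/2 * cmod eta" if "i ~= idx1" for i
 using y that unfolding cbx_def by (auto simp: B_def dest!: spec[of _ i])
 have "rho k * (5/6 * cmod eta) < rho k * cmod eta'" using c(5) kD by (intro mult_strict_left_mono) auto
 then have q: "5/6 * (rho k * cmod eta) < rho k * cmod eta'" by (simp only: mult.left_commute)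
 have q0: "0 < rho k * cmod eta" using kD e by simp
 have y1: "cmod ((y - z) $ idx1) < 3/4 * rho k * cmod eta'" using B1(1) q q0 by (simp only: mult.assoc vector_minus_component,linarith?)
 have y1': "cmod ((y - z) $ idx1) < rho k * cmod eta'" using y1 q q0 by (simp only: mult.assoc,linarith?)
 have yi: "cmod ((y - z) $ i) < 3/rho k * cmod eta'" if "i ~= idx1" for i
 using Bi(2)[OF that] c(5) kD by (simp add: field_simps)
 have yi': "cmod eta' < rho k * cmod ((y - z) $ i)" if "i ~= idx1" for i
 using order.strict_trans[OF c(6) Bi(1)[OF that]] by simp
 have "(z,z + (y - z),eta') \<in> V_multi k UNIV"
 by (rule V_left[OF k X'(7,8) y1' _ yi' yi]) (use B1(2) in auto)
 then have 1: "chol psi (z,y,eta')" using psi by (simp add: holo_on_iff_chol)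
 have "(z + (y - z),w,eta') \<in> V_multi k UNIV" using B1(3) y1 yi by (intro V_shift[OF p(1)]) auto
 then have 2: "chol phi (y,w,eta')" using phi by (simp add: holo_on_iff_chol)
 show ?thesis unfolding f_def
 by (intro chol_mult chol_compose[of psi "%p. (z,snd p,fst p)"] chol_compose[of phi "%p. (snd p,w,fst p)"] chol_intros) (simp_all add: 1 2)
 qed
 have c1: "z $ idx1 + eta' * u \<in> B idx1" if eta': "eta' \<in> P" and u: "u \<in> path_image (gam (rho k) (theta k) ep)" for eta' u
 proof -
 note g = gamS[OF u PD[OF eta']] and c = ec[OF PD(2)[OF eta']]
 have "cmod (eta' * u) <= (7/6 * cmod eta) * (rho k/2)" unfolding norm_mult using g(1) c(6) by (intro mult_mono) auto
 also have "\<dots> < 3/5 * (rho k * cmod eta)" using kD e by simp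
 finally have 1: "cmod (eta' * u) < 3/5 * (rho k * cmod eta)" .
 have eq: "z $ idx1 + eta' * u - w $ idx1 = ?v + eta' * u" by simp
 have "z $ idx1 + eta' * u - w $ idx1 \<in> Sect (theta k)" unfolding eq by (rule g(3))
 then show ?thesis using g(2) 1 by (simp add: B_def)
 qed
 have c2: "z $ i + eta * u \<in> B i" if i: "i ~= idx1" and u: "u \<in> path_image (circlepath 0 (2/rho k))" for i u
 proof -
 have "cmod u = 2/rho k" using u kD by simp
 then have "rho k * cmod (eta * u) = 2 * cmod eta" using kD by (simp add: norm_mult)
 then show ?thesis using i e by (simp add: B_def)
 qed
 note der = scaled_integral_has_derivative[where B = B and f = f and k = k and ep = ep,OF oP etaP oB chf c1 c2]
 have eq: "(\<Prod>i\<in>(UNIV::'n set). bv eta' eta $ i) * iter (G k ep) L0 (%u. f eta' (aff z (bv eta' eta) u)) (u1 k) = mu_prod k psi phi (z,w,eta')" if eta': "eta' \<in> P" for eta'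
 unfolding f_def
 using ec[OF PD(2)[OF eta']] R(1) bR e(2)
 by (intro mu_eq[OF psi phi PD(1)[OF eta'],where R = "R/2",symmetric]) auto
 have "((%eta'. mu_prod k psi phi (z,w,eta')) has_field_derivative
 eta ^ (CARD('n) - 1) *
 (?b1 * iter (G k ep) Lr (%u. f eta (z + cmul eta u)) (set_coord (u1 k) idx1 ?b1) -
 ?b0 * iter (G k ep) Lr (%u. f eta (z + cmul eta u)) (set_coord (u1 k) idx1 ?b0)) +
 eta ^ CARD('n) * iter (G k ep) L0 (%u. deriv (%eta'. f eta' (z + cmul eta u)) eta) (u1 k)) (at eta)"
 by (rule has_field_derivative_transform_within_open[OF der oP etaP eq])
 then have pd: "pd_eta (mu_prod k psi phi) (z,w,eta) = eta ^ (CARD('n) - 1) *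
 (?b1 * iter (G k ep) Lr (%u. f eta (z + cmul eta u)) (set_coord (u1 k) idx1 ?b1) -
 ?b0 * iter (G k ep) Lr (%u. f eta (z + cmul eta u)) (set_coord (u1 k) idx1 ?b0)) +
 eta ^ CARD('n) * iter (G k ep) L0 (%u. deriv (%eta'. f eta' (z + cmul eta u)) eta) (u1 k)"
 unfolding pd_eta_def by (simp only: prod.case) (rule DERIV_imp_deriv)
 have "iter (G k ep) Lr K y = iter (G k 1) Lr K y" for K and y :: "'n cvec"
 by (rule iter_path_cong) (simp add: G_def)
 then have pd: "pd_eta (mu_prod k psi phi) (z,w,eta) = edge k psi phi (z,w,eta) +
 eta ^ CARD('n) * iter (G k ep) L0 (%u. deriv (%eta'. f eta' (z + cmul eta u)) eta) (u1 k)"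
 using pd by (simp add: edge_def f_def)
 let ?A = "%i::'n. path_image (G k ep i)"
 let ?e = "%u. phi (z + cmul eta u,w,eta)" and ?g = "%u. psi (z,z + cmul eta u,eta)"
 \<comment> \<open>The values of u_1 for which phi (z + eta u, w, eta) is still defined.\<close>
 define S where "S = {s \<in> ball 0 (3/4 * rho k). eta * s + ?v \<in> Sect (theta k)}"
 have V2: "(z + cmul eta u,w,eta) \<in> V_multi k UNIV" if "u $ idx1 \<in> S" "!!i. i ~= idx1 ==> cmod (u $ i) < 3/rho k" for u :: "'n cvec"
 proof (rule V_shift[OF x])
 show "cmod (cmul eta u $ idx1) < 3/4 * rho k * cmod eta" using that(1) e(2) by (simp add: S_def norm_mult)
 show "cmod (cmul eta u $ i) < 3/rho k * cmod eta" if "i ~= idx1" for i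
 using mult_strict_left_mono[OF \<open>!!i. i ~= idx1 ==> cmod (u $ i) < 3/rho k\<close>[OF that] e(2)] by (simp only: cmul_simps norm_mult mult.commute[of "cmod eta"])
 show "z $ idx1 - w $ idx1 + cmul eta u $ idx1 \<in> Sect (theta k)" using that(1) by (simp add: S_def add.commute)
 qed auto
 have AS: "u $ idx1 \<in> S" "!!i. i ~= idx1 ==> cmod (u $ i) < 3/rho k" "(z,z + cmul eta u,eta) \<in> V_multi k UNIV" if u: "u \<in> cbx ?A" for u :: "'n cvec"
 proof -
 have "u $ idx1 \<in> path_image (gam (rho k) (theta k) ep)" using u by (auto simp: cbx_def G_def dest: spec[of _ idx1])
 then show "u $ idx1 \<in> S" using gamS[of "u $ idx1" eta] x e kD by (simp add: S_def add.commute)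
 have ub: "u \<in> cbx (ubox k UNIV)" using u G_ubox[OF k ec0(1,2)] by (auto simp: cbx_def)
 then show "cmod (u $ i) < 3/rho k" if "i ~= idx1" for i using that by (auto simp: cbx_def ubox_def dest: spec[of _ i])
 show "(z,z + cmul eta u,eta) \<in> V_multi k UNIV" by (rule ubox_V_multi[OF k X(9) ub])
 qed
 have V2': "(z + cmul eta u,w,eta) \<in> V_multi k UNIV" if "u \<in> cbx ?A" for u using V2[OF AS(1,2)[OF that]] .
 have che: "chol (%u. F (z + cmul eta u,w,eta)) u" if "chol F (z + cmul eta u,w,eta)" for F :: "'n triple => complex" and u
 using that by (intro chol_compose[of F "%u. (z + cmul eta u,w,eta)"] chol_intros)
 have chg: "chol (%u. F (z,z + cmul eta u,eta)) u" if "chol F (z,z + cmul eta u,eta)" for F :: "'n triple => complex" and u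
 using that by (intro chol_compose[of F "%u. (z,z + cmul eta u,eta)"] chol_intros)
 have cont1: "continuous_on (cbx ?A) (%u. F (z,z + cmul eta u,eta))" if "holo_on F (V_multi k UNIV)" for F :: "'n triple => complex"
 using that AS(3) by (intro chol_imp_continuous_on chg) (auto simp: holo_on_iff_chol)
 have cont2: "continuous_on (cbx ?A) (%u. F (z + cmul eta u,w,eta))" if "holo_on F (V_multi k al)" for F :: "'n triple => complex" and al
 using that V2' V_multi_antimono[of al UNIV k] by (intro chol_imp_continuous_on che) (auto simp: holo_on_iff_chol)
 have phih': "pd_eta phi y = (\<Sum>i\<in>UNIV. h' (UNIV - {i}) y)" if "y \<in> V_multi k UNIV" for y
 using phih[OF that] by (simp only: sum_card_complement)
 have u1A: "u1 k \<in> cbx ?A" by (simp add: cbx_def u1_G)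
 have d: "deriv (%eta'. f eta' (z + cmul eta u)) eta = pd_eta psi (z,z + cmul eta u,eta) * ?e u + ?g u * pd_eta phi (z + cmul eta u,w,eta)" if u: "u \<in> cbx ?A" for u
 proof -
 have 1: "chol psi (z,z + cmul eta u,eta)" "chol phi (z + cmul eta u,w,eta)" using psi phi AS(3)[OF u] V2'[OF u] by (simp_all add: holo_on_iff_chol)
 have "chol (%s. psi (z,z + cmul eta u,s)) eta" "chol (%s. phi (z + cmul eta u,w,s)) eta"
 by (intro chol_compose[of psi "%s. (z,z + cmul eta u,s)"] chol_compose[of phi "%s. (z + cmul eta u,w,s)"] 1 chol_intros)+
 then show ?thesis unfolding f_def pd_eta_def chol_complex_iff by (simp add: algebra_simps)
 qed
 have hp: "holo_on (pd_eta psi) (V_multi k UNIV)" "holo_on (pd_eta phi) (V_multi k UNIV)"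
 by (intro holo_pd(3) open_V_multi[OF k] psi phi)+
 have "iter (G k ep) L0 (%u. deriv (%eta'. f eta' (z + cmul eta u)) eta) (u1 k) =
 iter (G k ep) L0 (%u. pd_eta psi (z,z + cmul eta u,eta) * ?e u + ?g u * pd_eta phi (z + cmul eta u,w,eta)) (u1 k)"
 by (rule iter_cong[where B = ?A]) (use d u1A in auto)
 also have "\<dots> = iter (G k ep) L0 (%u. pd_eta psi (z,z + cmul eta u,eta) * ?e u) (u1 k) + iter (G k ep) L0 (%u. ?g u * pd_eta phi (z + cmul eta u,w,eta)) (u1 k)"
 by (rule iter_add[where B = ?A]) (use u1A in \<open>auto intro!: continuous_intros cont1 cont2 hp psi phi\<close>)
 also have "iter (G k ep) L0 (%u. pd_eta psi (z,z + cmul eta u,eta) * ?e u) (u1 k) =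
 iter (G k ep) L0 (%u. (\<Sum>al | card al = CARD('n) - 1. h al (z,z + cmul eta u,eta)) * ?e u) (u1 k)"
 by (rule iter_cong[where B = ?A]) (use psih AS(3) u1A in auto)
 also have "\<dots> = iter (Gseg k) L0 (%u. h (UNIV - {idx1}) (z,z + cmul eta u,eta) * ?e u) (u1 k)"
 proof (rule integral_null_forms[OF k X(9) ec0(1,2) h,where S = S])
 have "S = ball 0 (3/4 * rho k) Int (%s. eta * s + ?v) -` Sect (theta k)" by (auto simp: S_def)
 then show "open S" by (simp only:) (intro open_Int open_ball open_vimage open_Sect continuous_intros)
 show "starlike S" unfolding S_def
 \<comment> \<open>At this centre eta s + z_1 - w_1 equals - rho l |eta|; the centre lies in the
   ball because rho l <= rho k / 6.\<close>
 proof (rule starlike_Sect[where a = "(- of_real (rho l * cmod eta) - ?v)/eta" and \<tau> = "rho l * cmod eta"])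
 have "cmod (- of_real (rho l * cmod eta) - ?v) <= cmod (- of_real (rho l * cmod eta) :: complex) + cmod ?v" by (rule norm_triangle_ineq4)
 also have "cmod (- of_real (rho l * cmod eta) :: complex) = rho l * cmod eta" using lD by (simp add: norm_mult)
 finally have "cmod (- of_real (rho l * cmod eta) - ?v) < 2 * (rho l * cmod eta)" using X(3) by linarith
 also have "\<dots> <= 3/4 * rho k * cmod eta" using rho_le kD e(2) by (simp flip: mult.assoc)
 finally show "(- of_real (rho l * cmod eta) - ?v)/eta \<in> ball 0 (3/4 * rho k)" using e by (simp add: norm_divide divide_simps)
 qed (use kD lD e in \<open>auto\<close>)
 show "S <= ball 0 (rho k)" using kD by (auto simp: S_def)
 show "path_image (gam (rho k) (theta k) ep) <= S"
 using gamS[of _ eta] x e kD by (fastforce simp: S_def add.commute)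
 have "closed_segment ?b0 ?b1 <= ball 0 (3/4 * rho k)"
 by (rule closed_segment_subset) (use kD in \<open>auto simp: beta_bound[OF k]\<close>)
 then show "closed_segment ?b0 ?b1 <= S" using seg_Sect[OF x] by (auto simp: S_def add.commute)
 show "chol ?e u" if "u $ idx1 \<in> S" "!!i. i ~= idx1 ==> cmod (u $ i) < 3/rho k" for u
 using V2[OF that] phi by (intro che) (auto simp: holo_on_iff_chol)
 qed
 also have "iter (G k ep) L0 (%u. ?g u * pd_eta phi (z + cmul eta u,w,eta)) (u1 k) =
 iter (G k ep) L0 (%u. \<Sum>i\<in>UNIV. ?g u * h' (UNIV - {i}) (z + cmul eta u,w,eta)) (u1 k)"
 by (rule iter_cong[where B = ?A]) (use V2' u1A phih' in \<open>auto simp: sum_distrib_left\<close>)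
 also have "\<dots> = (\<Sum>i\<in>UNIV. iter (G k ep) L0 (%u. ?g u * h' (UNIV - {i}) (z + cmul eta u,w,eta)) (u1 k))"
 by (rule iter_sum[where B = ?A]) (use u1A in \<open>auto intro!: continuous_intros cont1 cont2[OF h'] psi\<close>)
 finally have fin: "iter (G k ep) L0 (%u. deriv (%eta'. f eta' (z + cmul eta u)) eta) (u1 k) =
 iter (Gseg k) L0 (%u. h (UNIV - {idx1}) (z,z + cmul eta u,eta) * ?e u) (u1 k) +
 (\<Sum>i\<in>UNIV. iter (G k ep) L0 (%u. ?g u * h' (UNIV - {i}) (z + cmul eta u,w,eta)) (u1 k))" .
 have m: "mu_prod k psi (h' (UNIV - {i})) (z,w,eta) = eta ^ CARD('n) * iter (G k ep) L0 (%u. ?g u * h' (UNIV - {i}) (z + cmul eta u,w,eta)) (u1 k)" for i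
 proof -
 have "(z,w,eta) \<in> V_multi l (UNIV - {i})" using x V_multi_antimono[of "UNIV - {i}" UNIV l] by auto
 from mu_eq_mub[OF psi h' this,of "R/2" ep] show ?thesis using ec0 bR R(1) by (simp add: mub_def)
 qed
 show ?thesis unfolding pd fin m by (simp add: segm_def distrib_left sum_distrib_left)
qed

theorem mu_ER:
 fixes psi phi :: "'n::{finite,linorder} triple => complex"
 assumes "psi \<in> ER k" "phi \<in> ER k"
 shows "mu_prod k psi phi \<in> ER l"
proof -
 obtain h where psi: "holo_on psi (V_multi k UNIV)" and h: "!!i. holo_on (h (UNIV - {i})) (V_multi k (UNIV - {i}))"
 and psih: "!!x. x \<in> V_multi k UNIV ==> pd_eta psi x = (\<Sum>al | card al = CARD('n) - 1. h al x)"
 using ER_D[OF assms(1)] by metis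
 obtain h' where phi: "holo_on phi (V_multi k UNIV)" and h': "!!i. holo_on (h' (UNIV - {i})) (V_multi k (UNIV - {i}))"
 and phih: "!!x. x \<in> V_multi k UNIV ==> pd_eta phi x = (\<Sum>al | card al = CARD('n) - 1. h' al x)"
 using ER_D[OF assms(2)] by metis
 \<comment> \<open>\<open>edge\<close> and \<open>segm\<close> are holomorphic without the sector
   condition and join the summand of the complement of \<open>idx1\<close>; the product with the
   i-th null summand of phi belongs to the complement of i.\<close>
 define H where "H al x = (if al = UNIV - {idx1} then edge k psi phi x + segm k (h (UNIV - {idx1})) phi x else 0) + mu_prod k psi (h' al) x" for al :: "'n set" and x
 have Hh: "holo_on (H (UNIV - {i})) (V_multi l (UNIV - {i}))" for i
 proof (cases "i = idx1")
 case True
 have "chol (%x. edge k psi phi x + segm k (h (UNIV - {idx1})) phi x + mu_prod k psi (h' (UNIV - {idx1})) x) x"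
 if "x \<in> V_multi l (UNIV - {idx1})" for x
 using holo_edge[OF psi phi] holo_segm[OF h phi] holo_mu[OF psi h'[of idx1]] that unfolding holo_on_iff_chol by (intro chol_add) auto
 then show ?thesis using True by (simp add: H_def[abs_def] holo_on_iff_chol)
 next
 case False
 then have "UNIV - {i} ~= UNIV - {idx1}" by blast
 then show ?thesis using holo_mu[OF psi h'[of i]] by (simp add: H_def[abs_def])
 qed
 have "pd_eta (mu_prod k psi phi) \<in> null_forms l" unfolding null_forms_def mem_Collect_eq
 proof (intro exI[of _ H] conjI allI impI ballI)
 fix al :: "'n set" assume "card al = CARD('n) - 1"
 then have "card (UNIV - al) = 1" using card_Diff_subset[of al UNIV] card_gt_0_iff[of "UNIV :: 'n set"] by simp
 then obtain i where "UNIV - al = {i}" by (auto simp: card_1_singleton_iff)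
 then have "al = UNIV - {i}" by auto
 then show "holo_on (H al) (V_multi l al)" using Hh by simp
 next
 fix x :: "'n triple" assume x: "x \<in> V_multi l UNIV"
 obtain z w eta where [simp]: "x = (z,w,eta)" by (cases x)
 have "(\<Sum>i\<in>UNIV. H (UNIV - {i}) x) = (\<Sum>i\<in>UNIV. (if i = idx1 then edge k psi phi x + segm k (h (UNIV - {idx1})) phi x else 0) + mu_prod k psi (h' (UNIV - {i})) x)"
 proof (intro sum.cong refl)
 fix i :: 'n
 have "UNIV - {i} = UNIV - {idx1} \<longleftrightarrow> i = idx1" by blast
 then show "H (UNIV - {i}) x = (if i = idx1 then edge k psi phi x + segm k (h (UNIV - {idx1})) phi x else 0) + mu_prod k psi (h' (UNIV - {i})) x"
 by (simp only: H_def)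
 qed
 also have "\<dots> = edge k psi phi x + segm k (h (UNIV - {idx1})) phi x + (\<Sum>i\<in>UNIV. mu_prod k psi (h' (UNIV - {i})) x)"
 by (simp add: sum.distrib)
 also have "\<dots> = pd_eta (mu_prod k psi phi) x"
 using pd_eta_mu[of psi h phi h' z w eta,OF psi h psih phi h' phih] x by simp
 finally show "pd_eta (mu_prod k psi phi) x = (\<Sum>al | card al = CARD('n) - 1. H al x)" by (simp only: sum_card_complement)
 qed
 then show ?thesis using holo_mu[OF psi phi] by (simp add: ER_def)
qed

end

section \<open>The sum of the composition series as an integral\<close>

definition hk :: "kappa => kappa" where
 "hk k = Kappa (min (rad k) (rho k * rad' k/12)) (rad' k/2) (rho k) (theta k)"

lemma hk_sel [simp]: "rad' (hk k) = rad' k/2" "rho (hk k) = rho k" "theta (hk k) = theta k" "rad (hk k) = min (rad k) (rho k * rad' k/12)"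
 by (simp_all add: hk_def)

lemma admissible_hk: "admissible k ==> admissible (hk k)"
 by (auto simp: admissible_def min_less_iff_disj mult_pos_pos)

lemma Sk_hk:
 assumes "admissible k" "eta \<in> Sk (hk k)" shows "eta \<in> Sk k" "12 * cmod eta < rho k * rad' k" "eta ~= 0"
proof -
 have "eta \<in> sector (min (rad k) (rho k * rad' k/12)) (theta k)" using assms(2) by (simp add: Sk_def)
 then have s: "eta \<in> sector (rad k) (theta k)" "cmod eta < rho k * rad' k/12" "eta ~= 0" by (auto simp: sector_def)
 then show "12 * cmod eta < rho k * rad' k" "eta ~= 0" by auto
 have "0 < rho k * rad' k" using admissibleD[OF assms(1)] by simp
 then have "3 * cmod eta < rho k * rad' k" using s(2) by linarith
 then show "eta \<in> Sk k" using s by (simp add: Sk_def)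
qed

lemma sdom_hk:
 assumes k: "admissible k" and x: "(z,zeta,eta) \<in> sdom (hk k)"
 shows "maxnorm z < rad' k/2" "eta \<in> Sk k" "12 * cmod eta < rho k * rad' k" "(z,zeta,eta) \<in> sdom k" "eta ~= 0"
proof -
 have 1: "maxnorm z < rad' k/2" "eta \<in> Sk (hk k)" using x by (auto simp: sdom_Sk)
 then show "maxnorm z < rad' k/2" "eta \<in> Sk k" "12 * cmod eta < rho k * rad' k" "eta ~= 0" using Sk_hk[OF k 1(2)] by auto
 then show "(z,zeta,eta) \<in> sdom k" using admissibleD[OF k] by (auto simp: sdom_Sk)
qed

text \<open>The room made by \<open>hk\<close>: sigma(phi) is defined on the polydisc of radius
  rad'/2 about z, and all |eta u_i| are below half of this radius, so the Taylor series at z may be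
  used at z + eta u.\<close>

lemma sdom_hk_shift:
 assumes k: "admissible k" and x: "(z,zeta,eta) \<in> sdom (hk k)" and u: "u \<in> cbx (ubox k al)"
 shows "(z + cmul eta u,zeta,eta) \<in> sdom k" "cmod (cmul eta u $ i) < rad' k/4" "3/rho k * cmod eta < rad' k/4"
proof -
 note X = sdom_hk[OF k x]
 show q: "3/rho k * cmod eta < rad' k/4" using X(3) admissibleD[OF k] by (simp add: field_simps)
 then show c: "cmod (cmul eta u $ i) < rad' k/4" for i using cmul_nth_bound[OF k u,of eta i] by linarith
 have "maxnorm (z + cmul eta u) < rad' k" unfolding maxnorm_less_iff
 proof
 fix i
 have "cmod (z $ i) < rad' k/2" using X(1) maxnorm_nth[of z i] by linarith
 then show "cmod ((z + cmul eta u) $ i) < rad' k" using c[of i] norm_triangle_ineq[of "z $ i" "cmul eta u $ i"] admissibleD(2)[OF k]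
 unfolding vector_add_component by linarith
 qed
 then show "(z + cmul eta u,zeta,eta) \<in> sdom k" using X(2) by (simp add: sdom_Sk)
qed

text \<open>The integral for sigma(psi) with sigma(phi)(z + eta u, zeta, eta) put under it.\<close>

definition Iop :: "kappa => ('n::{finite,linorder} triple => complex) => ('n triple => complex) => 'n triple => complex" where
 "Iop k psi phi = (%(z,zeta,eta). eta ^ CARD('n) * iter (G k 1) L0
 (%u. psi (z,z + cmul eta u,eta) * exp (pairing (cmul eta u) zeta) * symbol_map k phi (z + cmul eta u,zeta,eta)) (u1 k))"

lemma chol_Iop_integrand:
 fixes psi phi :: "'n::{finite,linorder} triple => complex"
 assumes k: "admissible k" and psi: "holo_on psi (V_multi k UNIV)" and phi: "holo_on phi (V_multi k UNIV)"
 and x: "(z,zeta,eta) \<in> sdom (hk k)" and u: "u \<in> cbx (ubox k UNIV)"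
 shows "chol (%p. (%x u. psi (fst x,fst x + cmul (snd (snd x)) u,snd (snd x)) * exp (pairing (cmul (snd (snd x)) u) (fst (snd x))) *
 symbol_map k phi (fst x + cmul (snd (snd x)) u,fst (snd x),snd (snd x))) (fst p) (snd p)) ((z,zeta,eta),u)"
proof -
 have "chol (symbol_map k phi) (z + cmul eta u,zeta,eta)"
 using holo_symbol_map[OF k phi] sdom_hk_shift(1)[OF k x u] by (simp add: holo_on_iff_chol)
 then have 1: "chol (%p. symbol_map k phi (fst (fst p) + cmul (snd (snd (fst p))) (snd p),fst (snd (fst p)),snd (snd (fst p)))) ((z,zeta,eta),u)"
 by (intro chol_compose[of "symbol_map k phi" "%p. (fst (fst p) + cmul (snd (snd (fst p))) (snd p),fst (snd (fst p)),snd (snd (fst p)))"] chol_intros) simp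
 show ?thesis by (rule chol_mult[OF chol_integrand[OF k psi sdom_hk(4)[OF k x] u] 1])
qed

lemma holo_Iop:
 fixes psi phi :: "'n::{finite,linorder} triple => complex"
 assumes k: "admissible k" and psi: "holo_on psi (V_multi k UNIV)" and phi: "holo_on phi (V_multi k UNIV)"
 shows "holo_on (Iop k psi phi) (sdom (hk k))"
 unfolding holo_on_iff_chol
proof
 fix x :: "'n triple" assume x: "x \<in> sdom (hk k)"
 let ?f = "%x u. psi (fst x,fst x + cmul (snd (snd x)) u,snd (snd x)) * exp (pairing (cmul (snd (snd x)) u) (fst (snd x))) *
 symbol_map k phi (fst x + cmul (snd (snd x)) u,fst (snd x),snd (snd x))"
 have f: "chol (%p. ?f (fst p) (snd p)) (x,u)" if "x \<in> sdom (hk k)" "u \<in> cbx (ubox k UNIV)" for x u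
 using that chol_Iop_integrand[OF k psi phi] by (cases x) blast
 have "chol (%p. iter (G k 1) L0 (?f (fst p)) (snd p)) (x,u1 k)"
 by (rule chol_iter_param[OF npath_G G_ubox[OF k] open_sdom[OF admissible_hk[OF k]] open_ubox f x u1_ubox[OF k]]) auto
 then have "chol (%x. iter (G k 1) L0 (?f x) (u1 k)) x"
 by (rule chol_compose2[where F = "%x v. iter (G k 1) L0 (?f x) v" and h = "%_. u1 k"]) (intro chol_intros | simp)+
 then have "chol (%x. snd (snd x) ^ CARD('n) * iter (G k 1) L0 (?f x) (u1 k)) x"
 by (intro chol_mult chol_power chol_intros)
 moreover have "(%x. snd (snd x) ^ CARD('n) * iter (G k 1) L0 (?f x) (u1 k)) = Iop k psi phi" by (auto simp: Iop_def)
 ultimately show "chol (Iop k psi phi) x" by simp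
qed

text \<open>With zeta frozen, psi (z, y, eta) times sigma(phi)(y, zeta, eta) is a holomorphic kernel
  on the domain of \<open>hk k\<close>. The integral is the symbol of this kernel, and a symbol does
  not depend on epsilon.\<close>

lemma Iop_eps:
 fixes psi phi :: "'n::{finite,linorder} triple => complex"
 assumes k: "admissible k" and psi: "holo_on psi (V_multi k UNIV)" and phi: "holo_on phi (V_multi k UNIV)"
 and x: "(z,zeta,eta) \<in> sdom (hk k)" and ep: "0 < ep" "ep <= 1"
 shows "Iop k psi phi (z,zeta,eta) = eta ^ CARD('n) * iter (G k ep) L0
 (%u. psi (z,z + cmul eta u,eta) * exp (pairing (cmul eta u) zeta) * symbol_map k phi (z + cmul eta u,zeta,eta)) (u1 k)"
proof -
 note kD = admissibleD[OF k]
 define \<Psi> where "\<Psi> = (%(z',y,eta'). psi (z',y,eta') * symbol_map k phi (y,zeta,eta'))"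
 have h: "holo_on \<Psi> (V_multi (hk k) UNIV)" unfolding holo_on_iff_chol
 proof
 fix p :: "'n triple" assume p: "p \<in> V_multi (hk k) UNIV"
 obtain z' y eta' where [simp]: "p = (z',y,eta')" by (cases p)
 have V: "maxnorm z' < rad' k/2" "eta' \<in> sector (min (rad k) (rho k * rad' k/12)) (theta k)" "cmod (z' $ idx1 - y $ idx1) < rho k * cmod eta'"
 "!!i. i ~= idx1 ==> cmod (z' $ i - y $ i) < rad' k/2" "z' $ idx1 - y $ idx1 \<in> Sect (theta k)" "!!i. i ~= idx1 ==> cmod eta' < rho k * cmod (z' $ i - y $ i)"
 using p V_multi_iff[OF admissible_hk[OF k],of z' y eta' UNIV] by auto
 have s: "eta' \<in> sector (rad k) (theta k)" "12 * cmod eta' < rho k * rad' k" using V(2) by (auto simp: sector_def)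
 have pos: "0 < rho k * rad' k" using kD by simp
 have r: "rho k * rad' k <= 1 * rad' k" "rho k * cmod eta' <= 1 * cmod eta'" using kD by (intro mult_right_mono; simp)+
 have "cmod (z' $ i - y $ i) < rad' k" if "i ~= idx1" for i using V(4)[OF that] kD(2) by linarith
 moreover have "maxnorm z' < rad' k" using V(1) kD(2) by linarith
 ultimately have "(z',y,eta') \<in> V_multi k UNIV" unfolding V_multi_iff[OF k] using V(3,5,6) s by auto
 then have 1: "chol psi (z',y,eta')" using psi by (simp add: holo_on_iff_chol)
 have "cmod (z' $ idx1 - y $ idx1) < rad' k/2" using V(3) s(2) r kD(2) norm_ge_zero[of eta'] by linarith
 then have yz: "cmod (z' $ i - y $ i) < rad' k/2" for i using V(4)[of i] by (cases "i = idx1") auto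
 have "maxnorm y < rad' k" unfolding maxnorm_less_iff
 proof
 fix i
 have "cmod (z' $ i) < rad' k/2" using V(1) maxnorm_nth[of z' i] by linarith
 then show "cmod (y $ i) < rad' k" using yz[of i] norm_triangle_sub[of "y $ i" "z' $ i"] by (simp add: norm_minus_commute)
 qed
 then have "(y,zeta,eta') \<in> sdom k" using s pos by (simp add: sdom_def) 
 then have 2: "chol (symbol_map k phi) (y,zeta,eta')" using holo_symbol_map[OF k phi] by (simp add: holo_on_iff_chol)
 have "chol (%p. psi p * symbol_map k phi (fst (snd p),zeta,snd (snd p))) p"
 by (intro chol_mult chol_compose[of "symbol_map k phi" "%p. (fst (snd p),zeta,snd (snd p))"] chol_intros) (simp_all add: 1 2)
 moreover have "(%p. psi p * symbol_map k phi (fst (snd p),zeta,snd (snd p))) = \<Psi>" by (auto simp: \<Psi>_def)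
 ultimately show "chol \<Psi> p" by simp
 qed
 have "symbol_map (hk k) \<Psi> (z,zeta,eta) = eta ^ CARD('n) * iter (G (hk k) ep) L0 (%u. \<Psi> (z,z + cmul eta u,eta) * exp (pairing (cmul eta u) zeta)) (u1 k)"
 if "0 < ep" "ep <= 1" for ep
 by (rule symbol_map_scaled[OF admissible_hk[OF k] h x that])
 moreover have "G (hk k) ep = (G k ep :: 'n => _)" for ep by (simp add: G_def fun_eq_iff)
 moreover have "(%u. \<Psi> (z,z + cmul eta u,eta) * exp (pairing (cmul eta u) zeta)) =
 (%u. psi (z,z + cmul eta u,eta) * exp (pairing (cmul eta u) zeta) * symbol_map k phi (z + cmul eta u,zeta,eta))"
 by (simp add: \<Psi>_def mult_ac)
 ultimately show ?thesis using ep unfolding Iop_def by (metis (no_types,lifting) prod.case less_numeral_extra(1) order_refl)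
qed

lemma compact_bound:
 fixes f :: "'a::topological_space => complex"
 assumes "compact K" "continuous_on K f" obtains M where "M \<ge> 0" "!!x. x \<in> K ==> cmod (f x) <= M"
proof -
 have "bounded (f ` K)" using assms compact_continuous_image compact_imp_bounded by blast
 then obtain M where "M > 0" "\<forall>y\<in>f ` K. norm y <= M" unfolding bounded_pos by blast
 then show thesis using that[of M] by auto
qed

lemma chol_symbol_slices:
 fixes phi :: "'n::{finite,linorder} triple => complex"
 assumes k: "admissible k" and phi: "holo_on phi (V_multi k UNIV)" and v: "maxnorm v < rad' k" "eta \<in> Sk k"
 shows "chol (%v. symbol_map k phi (v,zeta,eta)) v" "chol (%zeta. symbol_map k phi (v,zeta,eta)) zeta"
proof -
 have 1: "chol (symbol_map k phi) (v,zeta,eta)" using holo_symbol_map[OF k phi] v by (simp add: sdom_Sk holo_on_iff_chol)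
 show "chol (%v. symbol_map k phi (v,zeta,eta)) v" by (intro chol_compose[of "symbol_map k phi" "%v. (v,zeta,eta)"] 1 chol_intros)
 show "chol (%zeta. symbol_map k phi (v,zeta,eta)) zeta" by (intro chol_compose[of "symbol_map k phi" "%zeta. (v,zeta,eta)"] 1 chol_intros)
qed

text \<open>The Taylor series of sigma(phi) at z, evaluated at z + eta u, is integrated term by term
  against psi exp <eta u, zeta>. The powers (eta u)^\<alpha> together with the kernel integrate to
  the zeta-derivatives of sigma(psi) by \<open>pd2_multi_symbol_map\<close>.\<close>

theorem comp_term_has_sum:
 fixes psi phi :: "'n::{finite,linorder} triple => complex"
 assumes k: "admissible k" and psi: "holo_on psi (V_multi k UNIV)" and phi: "holo_on phi (V_multi k UNIV)"
 and x: "(z,zeta,eta) \<in> sdom (hk k)"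
 shows "((%al. comp_term (symbol_map k psi) (symbol_map k phi) al (z,zeta,eta)) has_sum Iop k psi phi (z,zeta,eta)) UNIV"
proof -
 note kD = admissibleD[OF k] and X = sdom_hk[OF k x]
 let ?H = "%v. symbol_map k phi (v,zeta,eta)" and ?K = "%u. psi (z,z + cmul eta u,eta) * exp (pairing (cmul eta u) zeta)"
 let ?A = "%i::'n. path_image (G k 1 i)" and ?B = "%i::'n. ball 0 (rad' k) :: complex set"
 define R where "R = rad' k/2"
 have R: "R > 0" using kD by (simp add: R_def)
 have A: "?A i <= ubox k UNIV i" for i using G_ubox[OF k,of 1 i UNIV] by simp
 have ub: "u \<in> cbx (ubox k UNIV)" if "u \<in> cbx ?A" for u using that A by (auto simp: cbx_def)
 have H: "chol ?H v" if "v \<in> cbx ?B" for v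
 using that X(2) by (intro chol_symbol_slices[OF k phi]) (auto simp: cbx_def maxnorm_less_iff)
 have cB: "cball (z $ i) R <= ?B i" for i
 proof
 fix s assume "s \<in> cball (z $ i) R"
 moreover have "cmod (z $ i) < rad' k/2" using X(1) maxnorm_nth[of z i] by linarith
 ultimately show "s \<in> ?B i" using norm_triangle_sub[of s "z $ i"] by (simp add: R_def dist_norm norm_minus_commute)
 qed
 have cK: "continuous_on (cbx ?A) ?K" by (rule integrand_continuous(1)[OF k psi X(4) A])
 obtain M1 where M1: "M1 \<ge> 0" "!!u. u \<in> cbx ?A ==> cmod (?K u) <= M1"
 by (rule compact_bound[OF compact_cbx cK],rule path_image_compact,rule npath_G,rule that)
 have cH: "continuous_on (cbx (%i. cball (z $ i) R)) ?H"
 proof (intro chol_imp_continuous_on H)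
 fix v assume "v \<in> cbx (%i. cball (z $ i) R)"
 then show "v \<in> cbx ?B" using cB unfolding cbx_def by blast
 qed
 obtain M2 where M2: "M2 \<ge> 0" "!!v. v \<in> cbx (%i. cball (z $ i) R) ==> cmod (?H v) <= M2"
 by (rule compact_bound[OF compact_cbx cH],rule compact_cball,rule that)
 have est: "cmod (PDm al L0 ?H z) <= (\<Prod>i\<in>UNIV. fact (al i)/R ^ al i) * M2" for al
 proof -
 have "cmod (PDm al L0 ?H z) <= (\<Prod>i\<in>set L0. fact (al i)/R ^ al i) * M2"
 by (rule PDm_estimate[OF _ R _ H cB]) (use R M2 in \<open>auto simp: cbx_def dist_norm norm_minus_commute\<close>)
 then show ?thesis by simp
 qed
 define f where "f al u = (PDm al L0 ?H z/mi_fact al) * ((\<Prod>i\<in>UNIV. (eta * u $ i) ^ al i) * ?K u)" for al u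
 \<comment> \<open>Bounds |eta u_i| / R; q < 1 makes the series converge uniformly on the
   contour.\<close>
 define q where "q = 3/rho k * cmod eta/R"
 have q: "0 <= q" "q < 1" using sdom_hk_shift(3)[OF k x u1_ubox[OF k]] R kD by (auto simp: q_def R_def field_simps)
 have fb: "cmod (f al u) <= (\<Prod>i\<in>UNIV. q ^ al i) * (M2 * M1)" if u: "u \<in> cbx ?A" for al u
 proof -
 have 1: "cmod (PDm al L0 ?H z/mi_fact al) <= (\<Prod>i\<in>UNIV. 1/R ^ al i) * M2"
 proof -
 have "cmod (mi_fact al) = (\<Prod>i\<in>UNIV. fact (al i))" unfolding mi_fact_def prod_norm[symmetric] by simp
 moreover have "(\<Prod>i\<in>UNIV. fact (al i)/R ^ al i) = (\<Prod>i\<in>UNIV. fact (al i)) * (\<Prod>i\<in>UNIV. 1/R ^ al i)"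
 by (simp add: prod_dividef)
 moreover have "(\<Prod>i\<in>(UNIV::'n set). fact (al i) :: real) > 0" by (intro prod_pos) auto
 ultimately show ?thesis using est[of al] by (simp only: norm_divide) (simp add: divide_le_eq mult_ac)
 qed
 have 2: "cmod (\<Prod>i\<in>UNIV. (eta * u $ i) ^ al i) <= (\<Prod>i\<in>UNIV. (3/rho k * cmod eta) ^ al i)"
 unfolding prod_norm[symmetric] norm_power
 using cmul_nth_bound[OF k ub[OF u],of eta] by (intro prod_mono conjI power_mono) auto
 have 3: "cmod ((\<Prod>i\<in>UNIV. (eta * u $ i) ^ al i) * ?K u) <= (\<Prod>i\<in>UNIV. (3/rho k * cmod eta) ^ al i) * M1"
 unfolding norm_mult[of "\<Prod>i\<in>UNIV. (eta * u $ i) ^ al i"] using 2 M1(2)[OF u] kD by (intro mult_mono prod_nonneg) auto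
 have "cmod (f al u) <= ((\<Prod>i\<in>UNIV. 1/R ^ al i) * M2) * ((\<Prod>i\<in>UNIV. (3/rho k * cmod eta) ^ al i) * M1)"
 unfolding f_def norm_mult[of "PDm al L0 ?H z/mi_fact al"] using 1 3 R M2 by (intro mult_mono mult_nonneg_nonneg prod_nonneg) auto
 also have "\<dots> = ((\<Prod>i\<in>UNIV. 1/R ^ al i) * (\<Prod>i\<in>UNIV. (3/rho k * cmod eta) ^ al i)) * (M2 * M1)" by (simp only: mult_ac)
 also have "(\<Prod>i\<in>UNIV. 1/R ^ al i) * (\<Prod>i\<in>UNIV. (3/rho k * cmod eta) ^ al i) = (\<Prod>i\<in>UNIV. q ^ al i)"
 unfolding prod.distrib[symmetric] q_def power_divide by simp
 finally show ?thesis .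
 qed
 have fS: "((%al. f al u) has_sum (?K u * ?H (z + cmul eta u))) UNIV" if u: "u \<in> cbx ?A" for u
 proof -
 have "((%al. (\<Prod>i\<in>UNIV. cmul eta u $ i ^ al i/fact (al i)) * PDm al L0 ?H z) has_sum ?H (z + cmul eta u)) UNIV"
 proof (rule PDm_taylor[OF _ _ R _ H cB])
 show "cmod (cmul eta u $ i) < R" for i using sdom_hk_shift(2)[OF k x ub[OF u],of i] kD by (simp add: R_def)
 qed auto
 then have "((%al. ?K u * ((\<Prod>i\<in>UNIV. cmul eta u $ i ^ al i/fact (al i)) * PDm al L0 ?H z)) has_sum (?K u * ?H (z + cmul eta u))) UNIV"
 by (rule has_sum_cmult_right)
 moreover have "?K u * ((\<Prod>i\<in>UNIV. cmul eta u $ i ^ al i/fact (al i)) * PDm al L0 ?H z) = f al u" for al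
 unfolding prod_dividef f_def mi_fact_def by simp
 ultimately show ?thesis by simp
 qed
 have "((%al. iter (G k 1) L0 (f al) (u1 k)) has_sum iter (G k 1) L0 (%u. ?K u * ?H (z + cmul eta u)) (u1 k)) UNIV"
 proof (rule iter_has_sum[where B = ?A and M = "%al. (\<Prod>i\<in>UNIV. q ^ al i) * (M2 * M1)"])
 show "continuous_on (cbx ?A) (f al)" for al unfolding f_def by (intro continuous_on_mult cK continuous_intros)
 show "(%al::'n => nat. (\<Prod>i\<in>UNIV. q ^ al i) * (M2 * M1)) summable_on UNIV"
 by (intro summable_on_cmult_left geometric_prod_summable q)
 show "u1 k \<in> cbx ?A" by (simp add: cbx_def u1_G)
 qed (use fb fS in auto)
 then have "((%al. eta ^ CARD('n) * iter (G k 1) L0 (f al) (u1 k)) has_sum Iop k psi phi (z,zeta,eta)) UNIV"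
 unfolding Iop_def prod.case by (rule has_sum_cmult_right)
 moreover have "eta ^ CARD('n) * iter (G k 1) L0 (f al) (u1 k) = comp_term (symbol_map k psi) (symbol_map k phi) al (z,zeta,eta)" for al
 unfolding f_def comp_term_def iter_cmult pd2_multi_symbol_map[OF k psi X(4)] pd1_multi_eq_PDm by simp
 ultimately show ?thesis by simp
qed

section \<open>Estimate of the tail of the composition series\<close>

lemma prod_fact_le: "finite I ==> (\<Prod>i\<in>I. fact (al i) :: real) <= fact (\<Sum>i\<in>I. al i)"
proof (induction I rule: finite_induct)
 case (insert i I)
 have "fact (al i) * fact (sum al I) <= (fact (al i + sum al I) :: nat)" by (rule dvd_imp_le[OF fact_fact_dvd_fact]) simp
 then have "real (fact (al i) * fact (sum al I)) <= real (fact (al i + sum al I))" by (simp only: of_nat_le_iff)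
 then have 1: "(fact (al i) :: real) * fact (sum al I) <= fact (al i + sum al I)" by (simp only: of_nat_mult of_nat_fact)
 have "fact (al i) * (\<Prod>i\<in>I. fact (al i) :: real) <= fact (al i) * fact (sum al I)" using insert.IH by (intro mult_left_mono) auto
 from order_trans[OF this 1] show ?case using insert.hyps by simp
qed simp

text \<open>Each factor j/x gained between m and N is at most b as long as j <= b x.\<close>

lemma fact_ratio:
 fixes x b :: real
 assumes "m <= N" "real N <= b * x" "0 < x" "1 <= b"
 shows "fact N/x ^ N <= fact m/x ^ m * b ^ N"
 using assms(1,2)
proof (induction N rule: dec_induct)
 case base
 have "fact m/x ^ m * 1 <= fact m/x ^ m * b ^ m" using assms by (intro mult_left_mono one_le_power) auto
 then show ?case by simp
next
 case (step j)
 have "fact (Suc j)/x ^ Suc j = fact j/x ^ j * (real (Suc j)/x)" by (simp add: mult_ac)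
 also have "\<dots> <= (fact m/x ^ m * b ^ j) * b"
 using step assms(3,4) by (intro mult_mono) (auto simp: divide_le_eq)
 finally show ?case by (simp add: mult_ac)
qed

lemma power_fact_le_exp:
 fixes x :: real assumes "0 <= x" shows "x ^ m/fact m <= exp x"
proof -
 have "(\<Sum>n\<in>{m}. x ^ n /\<^sub>R fact n) <= (\<Sum>n. x ^ n /\<^sub>R fact n)"
 by (rule sum_le_suminf) (use assms summable_exp_generic[of x] in auto)
 then show ?thesis by (simp add: exp_def divide_inverse mult.commute)
qed

text \<open>The terms of order at most \<open>b x\<close> are controlled by the first bound, those of larger order by the second.\<close>
lemma split_bound:
 fixes x b t \<tau> C :: real
 assumes "m <= N" "0 < x" "1 <= b" "0 <= t" "b * t <= 1/2" "0 <= \<tau>" "\<tau> * exp 2 <= 1/2" "0 <= C"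
 and A: "T <= C * (fact N * (t/x) ^ N)" and B: "T <= C * (\<tau> ^ N * exp (b * x))"
 shows "T <= C * (fact m/x ^ m * (1/2) ^ N)"
proof (cases "real N <= b * x")
 case True
 have "fact N * (t/x) ^ N = (fact N/x ^ N) * t ^ N" by (simp add: power_divide)
 also have "\<dots> <= (fact m/x ^ m * b ^ N) * t ^ N" using fact_ratio[OF assms(1) True assms(2,3)] assms(4) by (intro mult_right_mono) auto
 also have "\<dots> = fact m/x ^ m * (b * t) ^ N" by (simp add: power_mult_distrib)
 also have "\<dots> <= fact m/x ^ m * (1/2) ^ N" using assms by (intro mult_left_mono power_mono) auto
 finally show ?thesis by (intro order_trans[OF A mult_left_mono] assms(8))
next
 case False
 have "x <= b * x" using assms(2,3) by simp
 then have xN: "x <= real N" "b * x <= real N" using False by auto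
 \<comment> \<open>A single term of the exponential series. It brings in m!/x^m at the cost of a
   second factor e^N; the first came from exp (b x), and the hypothesis on \<tau> pays for
   both.\<close>
 have "x ^ m/fact m <= exp (real N)" using power_fact_le_exp[of x m] assms(2) xN(1) by (meson exp_le_cancel_iff less_imp_le order_trans)
 then have 1: "1 <= fact m/x ^ m * exp (real N)" using assms(2) by (simp add: field_simps)
 have s1: "\<tau> ^ N * exp (b * x) <= \<tau> ^ N * exp (real N)" using xN assms by (intro mult_left_mono) auto
 have s2: "\<tau> ^ N * exp (real N) <= \<tau> ^ N * exp (real N) * (fact m/x ^ m * exp (real N))"
 using mult_left_mono[OF 1,of "\<tau> ^ N * exp (real N)"] assms by simp
 have "exp (real N) * exp (real N) = exp 2 ^ N" by (simp add: exp_of_nat_mult[symmetric] exp_add[symmetric])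
 then have s3: "\<tau> ^ N * exp (real N) * (fact m/x ^ m * exp (real N)) = fact m/x ^ m * (\<tau> * exp 2) ^ N"
 unfolding power_mult_distrib by (metis (no_types,opaque_lifting) mult.assoc mult.left_commute)
 have s4: "fact m/x ^ m * (\<tau> * exp 2) ^ N <= fact m/x ^ m * (1/2) ^ N" using assms by (intro mult_left_mono power_mono) auto
 have "\<tau> ^ N * exp (b * x) <= fact m/x ^ m * (1/2) ^ N" using s1 s2 s3 s4 by linarith
 then show ?thesis by (intro order_trans[OF B mult_left_mono] assms(8))
qed

lemma finite_mi: "finite {al :: 'n::finite => nat. mi_abs al < m}"
proof -
 have "al i <= mi_abs al" for al :: "'n => nat" and i unfolding mi_abs_def by (intro member_le_sum) auto
 then have "{al :: 'n => nat. mi_abs al < m} <= (\<Pi>\<^sub>E i\<in>UNIV. {..m})" by (fastforce simp: PiE_def Pi_def intro: order_trans less_imp_le)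
 then show ?thesis by (rule finite_subset) (intro finite_PiE; simp)
qed

lemma sum_formal: "(\<Sum>\<nu><m. formal_comp q p \<nu> x) = (\<Sum>al | mi_abs al < m. comp_term q p al x)"
proof -
 have "(\<Sum>\<nu><m. formal_comp q p \<nu> x) = (\<Sum>\<nu>\<in>{..<m}. sum (%al. comp_term q p al x) {al \<in> {al. mi_abs al < m}. mi_abs al = \<nu>})"
 unfolding formal_comp_def by (intro sum.cong arg_cong2[where f = sum] refl) auto
 also have "\<dots> = (\<Sum>al | mi_abs al < m. comp_term q p al x)"
 by (rule sum.group) (use finite_mi in auto)
 finally show ?thesis .
qed

text \<open>Makes room for Cauchy estimates in zeta on polydiscs with radius proportional to |zeta|;
  they are the source of the negative powers of |zeta|.\<close>

lemma Cone_ball: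
 fixes zeta zeta' :: "'n::{finite,linorder} cvec"
 assumes b1: "0 < b1" "b1 <= 1" and zeta: "zeta \<in> Cone (b1/4)" and d: "!!i. cmod (zeta' $ i - zeta $ i) <= b1/8 * maxnorm zeta"
 shows "zeta' \<in> Cone b1" "maxnorm zeta' <= 2 * maxnorm zeta"
proof -
 let ?r = "Re (zeta $ idx1)"
 have c: "0 <= ?r" "maxnorm zeta <= 2 * ?r" using ConeD[OF zeta] b1 by auto
 have d': "cmod (zeta' $ i - zeta $ i) <= b1/4 * ?r" for i
 proof -
 have "b1/8 * maxnorm zeta <= b1/8 * (2 * ?r)" using c b1 by (intro mult_left_mono) auto
 also have "\<dots> = b1/4 * ?r" by simp
 finally show ?thesis using d[of i] by linarith
 qed
 have "b1 * ?r <= 1 * ?r" using b1 c by (intro mult_right_mono) auto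
 then have re: "3/4 * ?r <= Re (zeta' $ idx1)" using d'[of idx1] abs_Re_le_cmod[of "zeta' $ idx1 - zeta $ idx1"] by simp
 show "zeta' \<in> Cone b1" unfolding Cone_def mem_Collect_eq
 proof
 fix i
 have eq: "cone_dev zeta' i - cone_dev zeta i = (if i = idx1 then \<i> * of_real (Im (zeta' $ i - zeta $ i)) else zeta' $ i - zeta $ i)"
 by (auto simp: cone_dev_def complex_eq_iff)
 have "cmod (cone_dev zeta' i - cone_dev zeta i) <= cmod (zeta' $ i - zeta $ i)"
 proof (cases "i = idx1")
 case True
 show ?thesis unfolding eq if_P[OF True] norm_mult norm_ii norm_of_real mult_1_left by (rule abs_Im_le_cmod)
 next
 case False
 show ?thesis unfolding eq if_not_P[OF False] ..
 qed
 moreover have "cmod (cone_dev zeta i) <= b1/4 * ?r" using zeta by (simp add: Cone_def)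
 ultimately have "cmod (cone_dev zeta' i) <= b1/2 * ?r"
 using d'[of i] norm_triangle_sub[of "cone_dev zeta' i" "cone_dev zeta i"] by simp
 also have "\<dots> <= b1 * (3/4 * ?r)" using b1 c by simp
 also have "\<dots> <= b1 * Re (zeta' $ idx1)" using re b1 by (intro mult_left_mono) auto
 finally show "cmod (cone_dev zeta' i) <= b1 * Re (zeta' $ idx1)" .
 qed
 show "maxnorm zeta' <= 2 * maxnorm zeta" unfolding maxnorm_le_iff
 proof
 fix i
 have "b1/8 * maxnorm zeta <= 1 * maxnorm zeta" using b1 maxnorm_nonneg by (intro mult_right_mono) auto
 then show "cmod (zeta' $ i) <= 2 * maxnorm zeta"
 using d[of i] maxnorm_nth[of zeta i] norm_triangle_sub[of "zeta' $ i" "zeta $ i"] by simp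
 qed
qed

text \<open>Cauchy estimates in zeta and in z each produce \<alpha>!, of which the denominator
  cancels one and the other is at most |\<alpha>|!. In the second bound the zeta-derivative is
  estimated by \<open>pd2_multi_symbol_crude\<close>, and no factorial is left.\<close>

lemma comp_term_bounds:
 fixes psi phi :: "'n::{finite,linorder} triple => complex"
 assumes k: "admissible k" and psi: "psi \<in> ER k" and phi: "phi \<in> ER k" and Z: "compact Z" "Z <= Sk k" and h: "h > 0"
 shows "\<exists>C\<ge>0. ALL al z zeta eta. (z,zeta,eta) \<in> Rg (rad' k/4) (bk k (real CARD('n))/4) Z -->
 cmod (comp_term (symbol_map k psi) (symbol_map k phi) al (z,zeta,eta)) \<le>
 C * exp (h * maxnorm zeta) * (fact (mi_abs al)/(bk k (real CARD('n))/8 * (rad' k/4) * maxnorm zeta) ^ mi_abs al) &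
 cmod (comp_term (symbol_map k psi) (symbol_map k phi) al (z,zeta,eta)) \<le>
 C * exp (h * maxnorm zeta) * ((3/rho k * cmod eta/(rad' k/4)) ^ mi_abs al * exp (real CARD('n) * (3/rho k * cmod eta) * maxnorm zeta))"
proof -
 note kD = admissibleD[OF k]
 define b1 where "b1 = bk k (real CARD('n))"
 define R where "R = rad' k/4"
 have b1: "0 < b1" "b1 <= 1" using bk_bounds[OF k,of "real CARD('n)"] by (auto simp: b1_def)
 have R: "R > 0" using kD by (simp add: R_def)
 have psi0: "holo_on psi (V_multi k UNIV)" and phi0: "holo_on phi (V_multi k UNIV)" using psi phi by (auto simp: ER_def)
 have a: "rad' k/2 < rad' k" "rad' k/4 < rad' k" using kD by auto
 \<comment> \<open>The rate h/4 becomes h/2 on the polydisc about zeta, where the norm may double;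
   with h/2 for the other factor the total is h.\<close>
 obtain C1 where C1: "!!z zeta eta. maxnorm z <= rad' k/2 ==> zeta \<in> Cone b1 ==> eta \<in> Z ==> cmod (symbol_map k psi (z,zeta,eta)) <= C1 * exp (h/4 * maxnorm zeta)"
 using symbol_subexp[OF k psi a(1) Z,of "h/4"] h unfolding b1_def by auto
 obtain C2 where C2: "!!z zeta eta. maxnorm z <= rad' k/2 ==> zeta \<in> Cone b1 ==> eta \<in> Z ==> cmod (symbol_map k phi (z,zeta,eta)) <= C2 * exp (h/2 * maxnorm zeta)"
 using symbol_subexp[OF k phi a(1) Z,of "h/2"] h unfolding b1_def by auto
 obtain C3 where C3: "C3 > 0" "!!al z zeta eta. maxnorm z <= rad' k/4 ==> eta \<in> Z ==> cmod (pd2_multi al (symbol_map k psi) (z,zeta,eta)) \<le>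
 C3 * (\<Prod>i\<in>UNIV. (3/rho k * cmod eta) ^ al i) * exp (real CARD('n) * (3/rho k * cmod eta) * maxnorm zeta)"
 using pd2_multi_symbol_crude[OF k psi0 a(2) Z] by blast
 define C where "C = (\<bar>C1\<bar> + C3) * \<bar>C2\<bar>"
 have "cmod (comp_term (symbol_map k psi) (symbol_map k phi) al (z,zeta,eta)) \<le>
 C * exp (h * maxnorm zeta) * (fact (mi_abs al)/(b1/8 * R * maxnorm zeta) ^ mi_abs al) &
 cmod (comp_term (symbol_map k psi) (symbol_map k phi) al (z,zeta,eta)) \<le>
 C * exp (h * maxnorm zeta) * ((3/rho k * cmod eta/R) ^ mi_abs al * exp (real CARD('n) * (3/rho k * cmod eta) * maxnorm zeta))"
 if x: "(z,zeta,eta) \<in> Rg (rad' k/4) (b1/4) Z" for al z zeta eta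
 proof -
 have x': "maxnorm z <= rad' k/4" "zeta \<in> Cone (b1/4)" "zeta ~= 0" "eta \<in> Z" using x by (auto simp: Rg_def)
 have eta: "eta \<in> Sk k" using x' Z by auto
 have zzeta: "0 < maxnorm zeta" by (rule maxnorm_pos[OF x'(3)])
 have zeta1: "zeta \<in> Cone b1" using Cone_mono[of "b1/4" b1] x'(2) b1 by auto
 define c where "c = b1/8 * maxnorm zeta"
 have c: "c > 0" using b1 zzeta by (simp add: c_def)
 let ?F = "\<Prod>i\<in>(UNIV::'n set). (fact (al i) :: real)" and ?N = "mi_abs al"
 have F: "?F > 0" by (intro prod_pos) auto
 have FN: "?F <= fact ?N" unfolding mi_abs_def by (rule prod_fact_le) simp
 have pw: "(\<Prod>i\<in>(UNIV::'n set). s ^ al i) = s ^ ?N" for s :: real by (simp add: mi_abs_def power_sum)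
 have pw': "(\<Prod>i\<in>(UNIV::'n set). fact (al i)/s ^ al i) = ?F/s ^ ?N" for s :: real unfolding prod_dividef pw ..
 have "cmod (PDm al L0 (%v. symbol_map k psi (z,v,eta)) zeta) <= (\<Prod>i\<in>set L0. fact (al i)/c ^ al i) * (\<bar>C1\<bar> * exp (h/2 * maxnorm zeta))"
 proof (rule PDm_estimate[OF _ c,where B = "%_. UNIV"])
 show "chol (%v. symbol_map k psi (z,v,eta)) w" for w
 using x'(1) kD by (intro chol_symbol_slices(2)[OF k psi0 _ eta]) auto
 fix w assume w: "!!i. cmod (w $ i - zeta $ i) <= c"
 note cw = Cone_ball[OF b1 x'(2) w[unfolded c_def]]
 have "cmod (symbol_map k psi (z,w,eta)) <= C1 * exp (h/4 * maxnorm w)" using x' kD cw by (intro C1) auto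
 also have "\<dots> <= \<bar>C1\<bar> * exp (h/2 * maxnorm zeta)"
 proof (rule mult_mono)
 have "h/4 * maxnorm w <= h/4 * (2 * maxnorm zeta)" using cw(2) h by (intro mult_left_mono) auto
 then show "exp (h/4 * maxnorm w) <= exp (h/2 * maxnorm zeta)" by simp
 qed auto
 finally show "cmod (symbol_map k psi (z,w,eta)) <= \<bar>C1\<bar> * exp (h/2 * maxnorm zeta)" .
 qed (use c in auto)
 then have p2: "cmod (pd2_multi al (symbol_map k psi) (z,zeta,eta)) <= ?F/c ^ ?N * (\<bar>C1\<bar> * exp (h/2 * maxnorm zeta))"
 by (simp add: pd2_multi_eq_PDm pw')
 have "cmod (PDm al L0 (%v. symbol_map k phi (v,zeta,eta)) z) <= (\<Prod>i\<in>set L0. fact (al i)/R ^ al i) * (\<bar>C2\<bar> * exp (h/2 * maxnorm zeta))"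
 proof (rule PDm_estimate[OF _ R,where B = "%_. ball 0 (rad' k)"])
 show "chol (%v. symbol_map k phi (v,zeta,eta)) w" if "w \<in> cbx (%_. ball 0 (rad' k))" for w
 using that by (intro chol_symbol_slices(1)[OF k phi0 _ eta]) (auto simp: cbx_def maxnorm_less_iff)
 have zi: "cmod (z $ i) <= rad' k/4" for i using x'(1) maxnorm_nth[of z i] by linarith
 have s2: "cmod s <= rad' k/2" if "cmod (s - z $ i) <= R" for s i
 using that zi[of i] norm_triangle_sub[of s "z $ i"] by (simp add: R_def)
 show "cball (z $ i) R <= ball 0 (rad' k)" for i
 proof
 fix s assume "s \<in> cball (z $ i) R"
 then have "cmod s <= rad' k/2" by (intro s2[of s i]) (simp add: dist_norm norm_minus_commute)
 then show "s \<in> ball 0 (rad' k)" using kD by simp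
 qed
 fix w assume w: "!!i. cmod (w $ i - z $ i) <= R"
 have "maxnorm w <= rad' k/2" unfolding maxnorm_le_iff using s2[OF w] by blast
 then have "cmod (symbol_map k phi (w,zeta,eta)) <= C2 * exp (h/2 * maxnorm zeta)" by (intro C2 zeta1 x'(4))
 also have "\<dots> <= \<bar>C2\<bar> * exp (h/2 * maxnorm zeta)" by (intro mult_right_mono) auto
 finally show "cmod (symbol_map k phi (w,zeta,eta)) <= \<bar>C2\<bar> * exp (h/2 * maxnorm zeta)" .
 qed (use R in auto)
 then have p1: "cmod (pd1_multi al (symbol_map k phi) (z,zeta,eta)) <= ?F/R ^ ?N * (\<bar>C2\<bar> * exp (h/2 * maxnorm zeta))"
 by (simp add: pd1_multi_eq_PDm pw')
 have p3: "cmod (pd2_multi al (symbol_map k psi) (z,zeta,eta)) <= C3 * (3/rho k * cmod eta) ^ ?N * exp (real CARD('n) * (3/rho k * cmod eta) * maxnorm zeta)"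
 using C3(2)[OF x'(1,4),of al zeta] by (simp only: pw)
 have mf: "cmod (mi_fact al) = ?F" unfolding mi_fact_def prod_norm[symmetric] by simp
 let ?E = "exp (h/2 * maxnorm zeta)" and ?T = "comp_term (symbol_map k psi) (symbol_map k phi) al (z,zeta,eta)"
 have EE: "?E * ?E = exp (h * maxnorm zeta)" by (simp add: mult_exp_exp algebra_simps)
 have E1: "?E <= exp (h * maxnorm zeta)" using h zzeta by simp
 have T: "cmod ?T = cmod (pd2_multi al (symbol_map k psi) (z,zeta,eta)) * cmod (pd1_multi al (symbol_map k phi) (z,zeta,eta))/?F"
 unfolding comp_term_def norm_mult norm_divide mf by simp
 have "cmod ?T <= (?F/c ^ ?N * (\<bar>C1\<bar> * ?E)) * (?F/R ^ ?N * (\<bar>C2\<bar> * ?E))/?F"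
 unfolding T using p1 p2 F c R by (intro divide_right_mono mult_mono) auto
 also have "\<dots> = (?F/(c * R) ^ ?N) * (\<bar>C1\<bar> * \<bar>C2\<bar> * (?E * ?E))" using F by (simp add: power_mult_distrib field_simps)
 also have "\<dots> <= (fact ?N/(c * R) ^ ?N) * (C * (?E * ?E))"
 using FN c R F C3(1) unfolding C_def by (intro mult_mono divide_right_mono) (auto intro!: mult_right_mono mult_nonneg_nonneg)
 also have "\<dots> = C * exp (h * maxnorm zeta) * (fact ?N/(b1/8 * R * maxnorm zeta) ^ ?N)" unfolding EE c_def by (simp add: mult_ac)
 finally have A: "cmod ?T <= C * exp (h * maxnorm zeta) * (fact ?N/(b1/8 * R * maxnorm zeta) ^ ?N)" .
 let ?Y = "exp (real CARD('n) * (3/rho k * cmod eta) * maxnorm zeta)" and ?q = "3/rho k * cmod eta"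
 have q0: "?q \<ge> 0" using kD by simp
 have z: "0 <= (?q/R) ^ ?N * ?Y" by (intro mult_nonneg_nonneg zero_le_power divide_nonneg_pos q0 R) simp
 have y: "C3 * \<bar>C2\<bar> * ?E <= C * exp (h * maxnorm zeta)" using E1 C3(1) unfolding C_def by (intro mult_mono mult_right_mono) auto
 have "cmod ?T <= (C3 * ?q ^ ?N * ?Y) * (?F/R ^ ?N * (\<bar>C2\<bar> * ?E))/?F"
 unfolding T using p1 p3 F C3(1) R q0 by (intro divide_right_mono mult_mono) auto
 also have "\<dots> = (C3 * \<bar>C2\<bar> * ?E) * ((?q/R) ^ ?N * ?Y)" using F by (simp add: power_divide power_mult_distrib mult_ac)
 also have "\<dots> <= (C * exp (h * maxnorm zeta)) * ((?q/R) ^ ?N * ?Y)"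
 by (rule mult_right_mono[OF y z])
 finally show ?thesis using A by simp
 qed
 moreover have "C \<ge> 0" using C3 by (simp add: C_def)
 ultimately show ?thesis unfolding b1_def R_def by blast
qed

text \<open>\<open>split_bound\<close> with x = |eta| |zeta| bounds each term of order >= m by the
  required quantity times (1/2)^|\<alpha>|. The remaining multiple geometric series has a sum
  independent of m, so the constant A of \<open>frakN_cl\<close> can be 1 here.\<close>

theorem odot_tail:
 fixes psi phi :: "'n::{finite,linorder} triple => complex"
 assumes k: "admissible k" and psi: "psi \<in> ER k" and phi: "phi \<in> ER k"
 obtains r0 where "r0 > 0" "ALL Z h. compact Z --> Z <= Sk (hk k) --> (\<forall>eta\<in>Z. cmod eta <= r0) --> h > 0 -->
 (\<exists>C\<ge>0. ALL m z zeta eta. (z,zeta,eta) \<in> Rg (rad' k/4) (bk k (real CARD('n))/4) Z -->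
 cmod (odot (symbol_map k psi) (symbol_map k phi) (z,zeta,eta) - (\<Sum>\<nu><m. formal_comp (symbol_map k psi) (symbol_map k phi) \<nu> (z,zeta,eta))) \<le>
 C * fact m * exp (h * maxnorm zeta)/(cmod eta * maxnorm zeta) ^ m)"
proof -
 note kD = admissibleD[OF k]
 define \<kappa> where "\<kappa> = bk k (real CARD('n))/8 * (rad' k/4)"
 have \<kappa>: "\<kappa> > 0" using bk_bounds[OF k,of "real CARD('n)"] kD by (simp add: \<kappa>_def)
 define b where "b = max 1 (real CARD('n) * (3/rho k))"
 have b: "1 <= b" "real CARD('n) * (3/rho k) <= b" by (auto simp: b_def)
 \<comment> \<open>The first bound gives b t <= 1/2 and the second \<tau> e^2 <= 1/2 in
   \<open>split_bound\<close>.\<close>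
 define r0 where "r0 = min (\<kappa>/(2 * b)) (rho k * (rad' k/4)/(6 * exp 2))"
 have r0: "r0 > 0" using \<kappa> b kD by (simp add: r0_def)
 have psi0: "holo_on psi (V_multi k UNIV)" and phi0: "holo_on phi (V_multi k UNIV)" using psi phi by (auto simp: ER_def)
 let ?T = "comp_term (symbol_map k psi) (symbol_map k phi)"
 have half: "(%al::'n => nat. \<Prod>i\<in>UNIV. (1/2 :: real) ^ al i) summable_on UNIV" by (rule geometric_prod_summable) auto
 define Gs where "Gs = (\<Sum>\<^sub>\<infinity>al::'n => nat. \<Prod>i\<in>UNIV. (1/2 :: real) ^ al i)"
 have Gs0: "Gs \<ge> 0" unfolding Gs_def by (intro infsum_nonneg prod_nonneg) auto
 show thesis
 proof (rule that[OF r0],intro allI impI)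
 fix Z h assume Z: "compact Z" "Z <= Sk (hk k)" "\<forall>eta\<in>Z. cmod eta <= r0" and h: "h > (0::real)"
 have Zk: "Z <= Sk k" using Z(2) Sk_hk(1)[OF k] by blast
 obtain C where C: "C \<ge> 0" "!!al z zeta eta. (z,zeta,eta) \<in> Rg (rad' k/4) (bk k (real CARD('n))/4) Z ==>
 cmod (?T al (z,zeta,eta)) <= C * exp (h * maxnorm zeta) * (fact (mi_abs al)/(\<kappa> * maxnorm zeta) ^ mi_abs al) &
 cmod (?T al (z,zeta,eta)) <= C * exp (h * maxnorm zeta) * ((3/rho k * cmod eta/(rad' k/4)) ^ mi_abs al * exp (real CARD('n) * (3/rho k * cmod eta) * maxnorm zeta))"
 using comp_term_bounds[OF k psi phi Z(1) Zk h] unfolding \<kappa>_def by blast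
 have "cmod (odot (symbol_map k psi) (symbol_map k phi) (z,zeta,eta) - (\<Sum>\<nu><m. formal_comp (symbol_map k psi) (symbol_map k phi) \<nu> (z,zeta,eta))) \<le>
 (C * Gs) * fact m * exp (h * maxnorm zeta)/(cmod eta * maxnorm zeta) ^ m"
 if xR: "(z,zeta,eta) \<in> Rg (rad' k/4) (bk k (real CARD('n))/4) Z" for m z zeta eta
 proof -
 have x': "maxnorm z <= rad' k/4" "zeta ~= 0" "eta \<in> Z" using xR by (auto simp: Rg_def)
 have zzeta: "0 < maxnorm zeta" by (rule maxnorm_pos[OF x'(2)])
 have eta: "eta \<in> Sk (hk k)" "cmod eta <= r0" using x' Z by auto
 have eta0: "0 < cmod eta" using Sk_hk(3)[OF k eta(1)] by simp
 have sd: "(z,zeta,eta) \<in> sdom (hk k)" using x' eta kD by (simp add: sdom_Sk)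
 define x where "x = cmod eta * maxnorm zeta"
 have x: "x > 0" using eta0 zzeta by (simp add: x_def)
 have hs: "((%al. ?T al (z,zeta,eta)) has_sum Iop k psi phi (z,zeta,eta)) UNIV" by (rule comp_term_has_sum[OF k psi0 phi0 sd])
 have od: "odot (symbol_map k psi) (symbol_map k phi) (z,zeta,eta) = Iop k psi phi (z,zeta,eta)" unfolding odot_def by (rule infsumI[OF hs])
 let ?F = "{al :: 'n => nat. mi_abs al < m}"
 have tail: "((%al. ?T al (z,zeta,eta)) has_sum (Iop k psi phi (z,zeta,eta) - (\<Sum>al\<in>?F. ?T al (z,zeta,eta)))) (UNIV - ?F)"
 by (rule has_sum_Diff[OF hs has_sum_finite[OF finite_mi]]) simp
 let ?D = "C * exp (h * maxnorm zeta)"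
 have bd: "cmod (?T al (z,zeta,eta)) <= (?D * (fact m/x ^ m)) * (\<Prod>i\<in>UNIV. (1/2) ^ al i)" if al: "al \<in> UNIV - ?F" for al
 proof -
 have "cmod (?T al (z,zeta,eta)) <= ?D * (fact m/x ^ m * (1/2) ^ mi_abs al)"
 proof (rule split_bound[where b = b and t = "cmod eta/\<kappa>" and \<tau> = "3/rho k * cmod eta/(rad' k/4)"])
 have "b * cmod eta <= b * (\<kappa>/(2 * b))" using eta(2) b by (intro mult_left_mono) (auto simp: r0_def)
 also have "\<dots> = \<kappa>/2" using b by simp
 finally show "b * (cmod eta/\<kappa>) <= 1/2" using \<kappa> by (simp add: field_simps)
 have "cmod eta <= rho k * (rad' k/4)/(6 * exp 2)" using eta(2) by (simp add: r0_def)
 then show "3/rho k * cmod eta/(rad' k/4) * exp 2 <= 1/2" using kD by (simp add: field_simps)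
 have "cmod eta/\<kappa>/x = 1/(\<kappa> * maxnorm zeta)" using eta0 by (simp add: x_def)
 then show "cmod (?T al (z,zeta,eta)) <= ?D * (fact (mi_abs al) * (cmod eta/\<kappa>/x) ^ mi_abs al)"
 using C(2)[OF xR,of al] by (simp add: power_divide)
 have "real CARD('n) * (3/rho k) * x <= b * x" using b(2) x by (intro mult_right_mono) auto
 then have "exp (real CARD('n) * (3/rho k * cmod eta) * maxnorm zeta) <= exp (b * x)" by (simp add: x_def mult.assoc)
 then have "?D * ((3/rho k * cmod eta/(rad' k/4)) ^ mi_abs al * exp (real CARD('n) * (3/rho k * cmod eta) * maxnorm zeta)) \<le>
 ?D * ((3/rho k * cmod eta/(rad' k/4)) ^ mi_abs al * exp (b * x))"
 using C(1) kD by (intro mult_left_mono zero_le_power) auto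
 then show "cmod (?T al (z,zeta,eta)) <= ?D * ((3/rho k * cmod eta/(rad' k/4)) ^ mi_abs al * exp (b * x))"
 using C(2)[OF xR,of al] by linarith
 qed (use al x b \<kappa> kD C in auto)
 also have "(1/2 :: real) ^ mi_abs al = (\<Prod>i\<in>UNIV. (1/2) ^ al i)" by (simp add: mi_abs_def power_sum)
 finally show ?thesis by (simp only: mult.assoc)
 qed
 let ?c = "?D * (fact m/x ^ m)"
 have c0: "?c \<ge> 0" using C(1) x by simp
 have sub: "(%al::'n => nat. \<Prod>i\<in>UNIV. (1/2 :: real) ^ al i) summable_on (UNIV - ?F)"
 by (rule summable_on_subset_banach[OF half]) simp
 have "((%al. ?c * (\<Prod>i\<in>UNIV. (1/2) ^ al i)) has_sum (?c * (\<Sum>\<^sub>\<infinity>al\<in>UNIV - ?F. \<Prod>i\<in>UNIV. (1/2) ^ al i))) (UNIV - ?F)"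
 by (intro has_sum_cmult_right has_sum_infsum sub)
 from norm_infsum_le[OF tail this bd]
 have "cmod (Iop k psi phi (z,zeta,eta) - (\<Sum>al\<in>?F. ?T al (z,zeta,eta))) <= ?c * (\<Sum>\<^sub>\<infinity>al\<in>UNIV - ?F. \<Prod>i\<in>UNIV. (1/2) ^ al i)" by simp
 also have "\<dots> <= ?c * Gs" unfolding Gs_def
 by (rule mult_left_mono[OF infsum_mono_neutral[OF sub half] c0]) (auto intro!: prod_nonneg)
 finally show ?thesis unfolding od sum_formal x_def[symmetric] by (simp add: field_simps)
 qed
 moreover have "C * Gs \<ge> 0" using C Gs0 by simp
 ultimately show "\<exists>C\<ge>0. ALL m z zeta eta. (z,zeta,eta) \<in> Rg (rad' k/4) (bk k (real CARD('n))/4) Z -->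
 cmod (odot (symbol_map k psi) (symbol_map k phi) (z,zeta,eta) - (\<Sum>\<nu><m. formal_comp (symbol_map k psi) (symbol_map k phi) \<nu> (z,zeta,eta))) \<le>
 C * fact m * exp (h * maxnorm zeta)/(cmod eta * maxnorm zeta) ^ m" by blast
 qed
qed

section \<open>Comparison of the symbol of the product with the composition integral\<close>

lemma lf_le_cmod: "lf \<omega> u <= cmod u"
 using complex_Re_le_cmod[of "u * cis \<omega>"] by (simp add: lf_def norm_mult)

lemma lf_beta: "lf \<omega> (beta0 \<rho> th) = \<rho>/2 * cos ((pi + th)/2 - \<omega>)" "lf \<omega> (beta1 \<rho> th) = \<rho>/2 * cos ((pi + th)/2 + \<omega>)"
proof -
 have "- ((pi + th)/2) + \<omega> = - ((pi + th)/2 - \<omega>)" by simp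
 then show "lf \<omega> (beta0 \<rho> th) = \<rho>/2 * cos ((pi + th)/2 - \<omega>)" unfolding beta_rcis lf_simps by (simp only: cos_minus)
 show "lf \<omega> (beta1 \<rho> th) = \<rho>/2 * cos ((pi + th)/2 + \<omega>)" unfolding beta_rcis lf_simps ..
qed

text \<open>Either the rays dominate, and the functional \<open>lf \<omega>1\<close> is negative, or \<open>u\<close> lies beyond the end of its own ray, and \<open>lf \<omega>2\<close> is.\<close>
lemma seg_core:
 assumes th: "0 < th" "th < pi/2" and \<omega>: "\<bar>\<omega>1\<bar> <= th" "\<bar>\<omega>2\<bar> <= th"
 and p1: "lf \<omega>1 bb > 0" "lf \<omega>1 bl > 0" "lf \<omega>1 bo <= 0" and p2: "lf \<omega>2 bb < 0" "lf \<omega>2 bl > 0"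
 and u: "(\<exists>x\<ge>0. u = of_real x * bo) \<or> cmod u < lf \<omega>1 bl \<or> (\<exists>x\<ge>0. u = of_real x * bb)" and t: "0 <= t" "t <= 1"
 shows "of_real t * u - of_real (1 - t) * bb - of_real t * bl \<in> Sect th"
proof -
 have pos: "t * lf \<omega>1 bl + (1 - t) * lf \<omega>1 bb > 0"
 proof (cases "t = 0")
 case False
 then have "t * lf \<omega>1 bl > 0" "(1 - t) * lf \<omega>1 bb \<ge> 0" using p1 t by auto
 then show ?thesis by linarith
 qed (use p1 in simp)
 have S1: ?thesis if "t * lf \<omega>1 u - (1 - t) * lf \<omega>1 bb - t * lf \<omega>1 bl < 0"
 by (rule Sect_lfI[OF \<omega>(1) th]) (use that in \<open>simp only: lf_simps\<close>)
 from u show ?thesis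
 proof (elim disjE exE conjE)
 fix x assume x: "0 <= x" "u = of_real x * bo"
 have "t * lf \<omega>1 u <= 0" using x t p1 by (simp add: mult_nonneg_nonpos)
 then show ?thesis using S1 pos by linarith
 next
 assume c: "cmod u < lf \<omega>1 bl"
 show ?thesis
 proof (cases "t = 0")
 case False
 then have "t * lf \<omega>1 u < t * lf \<omega>1 bl" using c lf_le_cmod[of \<omega>1 u] t by (intro mult_strict_left_mono) auto
 moreover have "(1 - t) * lf \<omega>1 bb \<ge> 0" using p1 t by auto
 ultimately show ?thesis using S1 by linarith
 qed (use S1 p1 in simp)
 next
 fix x assume x: "0 <= x" "u = of_real x * bb"
 let ?c = "t * x - (1 - t)"
 have eq: "of_real t * u - of_real (1 - t) * bb - of_real t * bl = of_real ?c * bb - of_real t * bl"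
 unfolding x(2) of_real_diff of_real_mult by (simp add: algebra_simps)
 show ?thesis
 proof (cases "?c <= 0")
 case True
 have "?c * lf \<omega>1 bb - t * lf \<omega>1 bl < 0"
 proof (cases "t = 0")
 case False
 then have "t * lf \<omega>1 bl > 0" using p1 t by auto
 moreover have "?c * lf \<omega>1 bb <= 0" using True p1 by (intro mult_nonpos_nonneg) auto
 ultimately show ?thesis by linarith
 qed (use p1 in simp)
 then show ?thesis unfolding eq by (intro Sect_lfI[OF \<omega>(1) th]) (simp only: lf_simps)
 next
 case False
 then have "?c * lf \<omega>2 bb < 0" using p2 by (intro mult_pos_neg) auto
 moreover have "t * lf \<omega>2 bl \<ge> 0" using p2 t by auto
 ultimately have "?c * lf \<omega>2 bb - t * lf \<omega>2 bl < 0" by linarith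
 then show ?thesis unfolding eq by (intro Sect_lfI[OF \<omega>(2) th]) (simp only: lf_simps)
 qed
 qed
qed

text \<open>Corresponding points of the two circles are joined by straight segments. These avoid the
  disc of radius m about c because both circles go around it, and they stay within distance M of
  c.\<close>

lemma circle_recenter:
 assumes f: "f holomorphic_on {s. m < cmod (s - c)} Int {s. cmod (s - c) < M}" and r: "0 < m" "m < r" "m + cmod c < r'" "r < M" "r' + cmod c < M"
 shows "contour_integral (%t. c + 1 * circlepath 0 r t) f = contour_integral (circlepath 0 r') f"
proof -
 let ?S = "{s. m < cmod (s - c)} Int {s. cmod (s - c) < M}"
 have v: "valid_path (%t. c + 1 * circlepath 0 r t)" by (intro npath_valid npath_affine npath_circlepath)
 have S: "open ?S" by (intro open_Int open_Collect_less continuous_intros)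
 have "homotopic_loops ?S (%t. c + 1 * circlepath 0 r t) (circlepath 0 r')"
 proof (rule homotopic_loops_linear)
 show "path (%t. c + 1 * circlepath 0 r t)" using v by (rule valid_path_imp_path)
 show "pathfinish (%t. c + 1 * circlepath 0 r t) = pathstart (%t. c + 1 * circlepath 0 r t)"
 using pathfinish_circlepath[of 0 r] pathstart_circlepath[of 0 r] by (simp add: pathfinish_def pathstart_def)
 fix t :: real assume "t \<in> {0..1}"
 define e where "e = exp (2 * of_real pi * \<i> * of_real t)"
 have e: "cmod e = 1" by (simp add: e_def norm_exp_eq_Re)
 have c1: "circlepath 0 r t = of_real r * e" "circlepath 0 r' t = of_real r' * e" by (simp_all add: circlepath e_def)
 show "closed_segment (c + 1 * circlepath 0 r t) (circlepath 0 r' t) <= ?S"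
 proof
 fix s assume "s \<in> closed_segment (c + 1 * circlepath 0 r t) (circlepath 0 r' t)"
 then obtain \<tau> where \<tau>: "0 <= \<tau>" "\<tau> <= 1" "s = (1 - \<tau>) *\<^sub>R (c + of_real r * e) + \<tau> *\<^sub>R (of_real r' * e)"
 unfolding closed_segment_def c1 by auto
 have s: "s - c = of_real ((1 - \<tau>) * r + \<tau> * r') * e - of_real \<tau> * c" by (simp add: \<tau>(3) scaleR_conv_of_real algebra_simps)
 have r': "r' > 0" using r norm_ge_zero[of c] by linarith
 have q: "(1 - \<tau>) * r + \<tau> * r' \<ge> 0" using \<tau> r r' by simp
 have n1: "cmod (of_real ((1 - \<tau>) * r + \<tau> * r') * e) = (1 - \<tau>) * r + \<tau> * r'" unfolding norm_mult e norm_of_real using q by simp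
 have n2: "cmod (of_real \<tau> * c) = \<tau> * cmod c" using \<tau> by (simp add: norm_mult)
 have "(1 - \<tau>) * r + \<tau> * r' - \<tau> * cmod c <= cmod (s - c)" "cmod (s - c) <= (1 - \<tau>) * r + \<tau> * r' + \<tau> * cmod c"
 unfolding s using norm_triangle_ineq2[of "of_real ((1 - \<tau>) * r + \<tau> * r') * e" "of_real \<tau> * c"]
 norm_triangle_ineq4[of "of_real ((1 - \<tau>) * r + \<tau> * r') * e" "of_real \<tau> * c"] n1 n2 by linarith+
 moreover have "m < (1 - \<tau>) * r + \<tau> * (r' - cmod c)"
 proof -
 have "(1 - \<tau>) * (- r) + \<tau> * (cmod c - r') < - m" by (rule convex_bound_lt) (use r \<tau> in auto)
 then show ?thesis by (simp add: algebra_simps)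
 qed
 moreover have "(1 - \<tau>) * r + \<tau> * (r' + cmod c) < M"
 using convex_bound_lt[of r M "r' + cmod c" "1 - \<tau>" \<tau>] r \<tau> by auto
 ultimately show "s \<in> ?S" by (simp add: algebra_simps)
 qed
 qed (auto simp: valid_path_imp_path)
 from Cauchy_theorem_homotopic_loops[OF this S f v valid_path_circlepath] show ?thesis .
qed

lemma starlike_paths:
 assumes S: "open S" "starlike S" and f: "f holomorphic_on S"
 and g: "valid_path g" "path_image g <= S" and h: "valid_path h" "path_image h <= S"
 and s: "closed_segment (pathstart h) (pathstart g) <= S" "closed_segment (pathfinish h) (pathfinish g) <= S"
 shows "contour_integral g f - contour_integral h f =
 contour_integral (linepath (pathfinish h) (pathfinish g)) f - contour_integral (linepath (pathstart h) (pathstart g)) f"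
proof -
 obtain F where F: "!!p. valid_path p ==> path_image p <= S ==> (f has_contour_integral F (pathfinish p) - F (pathstart p)) p"
 by (rule starlike_primitive[OF S f],rule that)
 have "contour_integral p f = F (pathfinish p) - F (pathstart p)" if "valid_path p" "path_image p <= S" for p
 using F[OF that] by (rule contour_integral_unique)
 then show ?thesis using g h s by simp
qed

lemma pairing_add: "pairing (v + w) zeta = pairing v zeta + pairing w zeta"
 by (simp add: pairing_def distrib_right sum.distrib)

lemma cmul_add_right: "cmul c (x + y) = cmul c x + cmul c y"
 by (rule bounded_bilinear.add_right[OF bounded_bilinear_cmul])

lemma prod_list_one: "prod_list (map (($) ((\<chi> i. 1) :: complex ^ 'n::finite)) L) = 1"
 by (induction L) auto

context kappa_pair
begin

text \<open>One epsilon, fixed before z, zeta and eta, for which all positions of u on the first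
  path and of w on its own satisfy the sector conditions of the comparison. Besides, on the segments
  joining the ends u + beta of k to the ends of l, both the sector condition relative to u and the
  decay of Re (eta w_1) hold.\<close>

lemma good_eps:
 obtains ep R where "0 < ep" "ep <= 1" "0 < R" "R <= 3/4 * rho k" "ep * rho k < 2 * R"
 "!!w. w \<in> path_image (gam (rho l) (theta l) 1) ==> ball (- w) R <= Sect (3 * theta l/4)"
 "!!u w. u \<in> path_image (gam (rho k) (theta k) ep) ==> w \<in> path_image (gam (rho l) (theta l) 1) ==> u - w \<in> Sect (3 * theta k/4)"
 "!!u t. u \<in> path_image (gam (rho k) (theta k) ep) ==> 0 <= t ==> t <= 1 ==>
 u - (of_real (1 - t) * (u + beta0 (rho k) (theta k)) + of_real t * beta0 (rho l) (theta l)) \<in> Sect (3 * theta k/4)"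
 "!!u t. u \<in> path_image (gam (rho k) (theta k) ep) ==> 0 <= t ==> t <= 1 ==>
 u - (of_real (1 - t) * (u + beta1 (rho k) (theta k)) + of_real t * beta1 (rho l) (theta l)) \<in> Sect (3 * theta k/4)"
 "!!u t eta b b'. u \<in> path_image (gam (rho k) (theta k) ep) ==> 0 <= t ==> t <= 1 ==> \<bar>Arg eta\<bar> < theta l/4 ==>
 (b,b') \<in> {(beta0 (rho k) (theta k),beta0 (rho l) (theta l)),(beta1 (rho k) (theta k),beta1 (rho l) (theta l))} ==>
 Re (eta * (of_real (1 - t) * (u + b) + of_real t * b')) <= - mk l * cmod eta"
proof -
 note kD = admissibleD[OF k] and lD = admissibleD[OF l]
 let ?k0 = "beta0 (rho k) (theta k)" and ?k1 = "beta1 (rho k) (theta k)" and ?l0 = "beta0 (rho l) (theta l)" and ?l1 = "beta1 (rho l) (theta l)"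
 let ?gl = "path_image (gam (rho l) (theta l) 1)"
 have th: "0 < 3 * theta k/4" "3 * theta k/4 < pi/2" "3 * theta l/4 < theta k/2" "0 < theta l" using kD lD theta_le by auto
 \<comment> \<open>The claim mentions no index type, so \<open>G_ubox\<close> is taken at a concrete
   one, \<open>bool\<close>.\<close>
 have "- w \<in> Sect (3 * theta l/4)" if "w \<in> ?gl" for w
 using G_ubox[OF l,of 1 "idx1 :: bool" UNIV] that by (auto simp: G_def ubox_def)
 then have glS: "uminus ` ?gl <= Sect (3 * theta l/4)" by auto
 have cgl: "compact (uminus ` ?gl)" by (intro compact_continuous_image continuous_intros path_image_compact npath_gam)
 obtain R1 where R1: "R1 > 0" "(\<Union>s\<in>uminus ` ?gl. ball s R1) <= Sect (3 * theta l/4)"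
 using compact_subset_open_imp_ball_epsilon_subset[OF cgl open_Sect glS] by metis
 define R where "R = min R1 (3/4 * rho k)"
 have R: "0 < R" "R <= 3/4 * rho k" "R <= R1" using R1 kD by (auto simp: R_def)
 have bR: "ball (- w) R <= Sect (3 * theta l/4)" if "w \<in> ?gl" for w
 using R1(2) that subset_ball[OF R(3),of "- w"] by blast
 define c1 where "c1 = rho l/2 * cos ((pi + theta l)/2 - 3 * theta k/4)"
 have cp: "cos ((pi + theta l)/2 - 3 * theta k/4) > 0" "cos ((pi + theta k)/2 - 3 * theta k/4) > 0" "cos ((pi + theta l)/2 - 3 * theta l/4) > 0"
 using kD lD theta_le by (intro cos_gt_zero_pi; simp add: field_simps)+
 have cn: "cos ((pi + theta k)/2 + 3 * theta k/4) < 0" "cos ((pi + theta k)/2 - 3 * theta l/4) < 0"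
 using kD lD theta_le by (intro cos_neg; simp add: field_simps)+
 have c1: "c1 > 0" using cp lD by (simp add: c1_def)
 \<comment> \<open>Makes points on the small arc negligible in three comparisons: with the distance
   R to the boundary of the sector, with the margin c1 in \<open>seg_core\<close>, and with the rate
   mk k.\<close>
 define m where "m = min R (min c1 (mk k/2))"
 have m: "m > 0" "m <= R" "m <= c1" "m <= mk k/2" using R c1 mk_pos[OF k] by (auto simp: m_def)
 define ep where "ep = min 1 (m/rho k)"
 have ep: "0 < ep" "ep <= 1" using m kD by (auto simp: ep_def)
 have "ep <= m/rho k" by (simp add: ep_def)
 then have epm: "ep * rho k <= m" using kD by (simp add: field_simps)
 \<comment> \<open>A point of \<open>gam\<close> lies on one of the two rays or is small; all later
   claims distinguish these cases.\<close>
 have ucase: "(\<exists>x\<ge>0. u = of_real x * ?k0) \<or> cmod u <= m/2 \<or> (\<exists>x\<ge>0. u = of_real x * ?k1)" if u: "u \<in> path_image (gam (rho k) (theta k) ep)" for u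
 using ep kD(5,3) u
 proof (cases rule: gam_image)
 case (ray0 t) then show ?thesis using ep by (intro disjI1 exI[of _ t]) auto
 next
 case (arc x) then show ?thesis using ep epm kD by auto
 next
 case (ray1 t) then show ?thesis using ep by (intro disjI2 exI[of _ t]) auto
 qed
 have mkl: "mk l <= mk k/2"
 proof -
 have "rho l/2 * sin (theta l/4) <= rho l/2 * 1" using lD by (intro mult_left_mono) auto
 then show ?thesis using rho_mk mk_pos[OF k] lD unfolding mk_def[of l] by linarith
 qed
 show thesis
 proof (rule that[OF ep R(1,2) _ bR])
 show "ep * rho k < 2 * R" using epm m R by linarith
 next
 fix u w assume u: "u \<in> path_image (gam (rho k) (theta k) ep)" and w: "w \<in> ?gl"
 have wS: "- w \<in> Sect (3 * theta l/4)" using glS w by auto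
 have ray: "u - w \<in> Sect (3 * theta l/4)" if "x \<ge> 0" "u = of_real x * b" "b \<in> {?k0,?k1}" for x b
 proof -
 have "lf \<omega> u <= 0" if "\<bar>\<omega>\<bar> <= 3 * theta l/4" for \<omega>
 using lf_beta_neg[OF k,of \<omega>] that th \<open>x \<ge> 0\<close> \<open>u = _\<close> \<open>b \<in> _\<close> by (auto intro!: mult_nonneg_nonpos)
 then have "- w + u \<in> Sect (3 * theta l/4)" using th by (intro Sect_add[OF wS]) auto
 then show ?thesis by simp
 qed
 have "u - w \<in> Sect (3 * theta l/4)" using ucase[OF u]
 proof (elim disjE exE conjE)
 assume "cmod u <= m/2"
 then have "u - w \<in> ball (- w) R" using m by (simp add: dist_norm)
 then show ?thesis using bR[OF w] by blast
 qed (use ray in blast)+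
 then show "u - w \<in> Sect (3 * theta k/4)" using Sect_mono[of "3 * theta l/4" "3 * theta k/4"] th theta_le by auto
 next
 fix u t assume u: "u \<in> path_image (gam (rho k) (theta k) ep)" and t: "0 <= t" "t <= (1::real)"
 have eq: "u - (of_real (1 - t) * (u + b) + of_real t * b') = of_real t * u - of_real (1 - t) * b - of_real t * b'" for b b'
 unfolding of_real_diff by (simp add: algebra_simps)
 have mc: "cmod u <= m/2 ==> cmod u < c1" using m by linarith
 have s1: "(\<exists>x\<ge>0. u = of_real x * ?k1) \<or> cmod u < lf (3 * theta k/4) ?l0 \<or> (\<exists>x\<ge>0. u = of_real x * ?k0)"
 using ucase[OF u] mc by (auto simp: lf_beta c1_def)
 have s2: "(\<exists>x\<ge>0. u = of_real x * ?k0) \<or> cmod u < lf (- (3 * theta k/4)) ?l1 \<or> (\<exists>x\<ge>0. u = of_real x * ?k1)"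
 using ucase[OF u] mc by (auto simp: lf_beta c1_def)
 show "u - (of_real (1 - t) * (u + ?k0) + of_real t * ?l0) \<in> Sect (3 * theta k/4)" unfolding eq
 by (rule seg_core[OF th(1,2) _ _ _ _ _ _ _ s1 t,of "3 * theta l/4"])
 (use cp cn kD lD theta_le in \<open>auto simp: lf_beta mult_pos_neg less_imp_le\<close>)
 show "u - (of_real (1 - t) * (u + ?k1) + of_real t * ?l1) \<in> Sect (3 * theta k/4)" unfolding eq
 by (rule seg_core[OF th(1,2) _ _ _ _ _ _ _ s2 t,of "- (3 * theta l/4)"])
 (use cp cn kD lD theta_le in \<open>auto simp: lf_beta mult_pos_neg less_imp_le\<close>)
 next
 fix u t eta b b' assume u: "u \<in> path_image (gam (rho k) (theta k) ep)" and t: "0 <= t" "t <= (1::real)" and eta: "\<bar>Arg eta\<bar> < theta l/4"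
 and b: "(b,b') \<in> {(?k0,?l0),(?k1,?l1)}"
 have etak: "\<bar>Arg eta\<bar> < theta k/4" using eta theta_le kD by linarith
 have kk: "b \<in> closed_segment ?k0 ?k1" "b' \<in> closed_segment ?l0 ?l1" using b by auto
 have 1: "Re (eta * b) <= - mk k * cmod eta" by (rule Re_beta_le[OF k etak kk(1)])
 have 2: "Re (eta * b') <= - mk l * cmod eta" by (rule Re_beta_le[OF l eta kk(2)])
 have q: "0 <= mk k * cmod eta" using mk_pos[OF k] by simp
 have k01: "Re (eta * ?k0) <= 0" "Re (eta * ?k1) <= 0"
 using Re_beta_le[OF k etak ends_in_segment(1)] Re_beta_le[OF k etak ends_in_segment(2)] q unfolding mult_minus_left by linarith+
 have ray: "Re (eta * (of_real x * y)) <= 0" if "x \<ge> 0" "Re (eta * y) <= 0" for x y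
 proof -
 have "eta * (of_real x * y) = x *\<^sub>R (eta * y)" by (simp add: scaleR_conv_of_real)
 then have "Re (eta * (of_real x * y)) = x * Re (eta * y)" by (simp only: scaleR_complex.simps)
 then show ?thesis using that mult_nonneg_nonpos by metis
 qed
 have u0: "Re (eta * u) <= mk k/2 * cmod eta" using ucase[OF u]
 proof (elim disjE exE conjE)
 assume "cmod u <= m/2"
 then have "cmod eta * cmod u <= cmod eta * (mk k/2)" using m by (intro mult_left_mono) auto
 then show ?thesis using complex_Re_le_cmod[of "eta * u"] by (simp add: norm_mult mult.commute)
 next
 fix x assume "0 <= x" "u = of_real x * ?k0"
 then have "Re (eta * u) <= 0" using ray k01(1) by blast
 then show ?thesis using q by simp
 next
 fix x assume "0 <= x" "u = of_real x * ?k1"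
 then have "Re (eta * u) <= 0" using ray k01(2) by blast
 then show ?thesis using q by simp
 qed
 have "Re (eta * (u + b)) <= - (mk k/2) * cmod eta" using 1 u0 by (simp add: distrib_left)
 also have "\<dots> <= - mk l * cmod eta" using mkl by (intro mult_right_mono) auto
 finally have 3: "Re (eta * (u + b)) <= - mk l * cmod eta" .
 have "eta * (of_real (1 - t) * (u + b) + of_real t * b') = (1 - t) *\<^sub>R (eta * (u + b)) + t *\<^sub>R (eta * b')"
 by (simp only: scaleR_conv_of_real distrib_left mult.left_commute)
 then have "Re (eta * (of_real (1 - t) * (u + b) + of_real t * b')) = (1 - t) * Re (eta * (u + b)) + t * Re (eta * b')" by (simp only: plus_complex.simps scaleR_complex.simps)
 also have "\<dots> <= (1 - t) * (- mk l * cmod eta) + t * (- mk l * cmod eta)" using t 2 3 by (intro add_mono mult_left_mono) auto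
 also have "\<dots> = - mk l * cmod eta" by (simp add: algebra_simps)
 finally show "Re (eta * (of_real (1 - t) * (u + b) + of_real t * b')) <= - mk l * cmod eta" .
 qed
qed

text \<open>The w for which the pair (z + eta u, z + eta w) stays in the domain of phi. The annulus
  about u_i contains both the circle of radius 2/rho k about u_i and the circle of radius 2/rho l
  about 0.\<close>

definition Bw :: "'n::{finite,linorder} cvec => 'n => complex set" where
 "Bw u i = (if i = idx1 then {s \<in> ball (u $ i) (rho k). (- 1) * s + u $ i \<in> Sect (3 * theta k/4)}
 else {s. 1/rho k < cmod (s - u $ i)} Int {s. cmod (s - u $ i) < 4/rho l})"

lemma open_Bw: "open (Bw u i)"
proof -
 have "{s \<in> ball (u $ i) (rho k). (- 1) * s + u $ i \<in> Sect (3 * theta k/4)} = ball (u $ i) (rho k) Int (%s. (- 1) * s + u $ i) -` Sect (3 * theta k/4)" by auto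
 moreover have "open (ball (u $ i) (rho k) Int (%s. (- 1) * s + u $ i) -` Sect (3 * theta k/4))"
 by (intro open_Int open_ball open_vimage open_Sect continuous_intros)
 ultimately show ?thesis unfolding Bw_def by (auto intro!: open_Int open_Collect_less continuous_intros)
qed

lemma Sk_l:
 assumes "eta \<in> Sk l"
 shows "eta \<in> sector (rad l) (theta l)" "\<bar>Arg eta\<bar> < theta l/4" "eta ~= 0" "3 * cmod eta < rho l * rad' l" "eta \<in> Sk (hk k)"
proof -
 show 1: "eta \<in> sector (rad l) (theta l)" "3 * cmod eta < rho l * rad' l" using assms by (auto simp: Sk_def)
 note e = eta_bounds[OF 1(1)]
 show "\<bar>Arg eta\<bar> < theta l/4" "eta ~= 0" using e by auto
 have "cmod eta < rho k * rad' k/12" "3 * cmod eta < rho k * rad' k/2" using e(2,7) by linarith+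
 moreover have "eta \<in> sector (rad k) (theta k)" using e(5) by (simp add: Sk_def)
 ultimately show "eta \<in> Sk (hk k)" by (simp add: Sk_def sector_def)
qed

lemma V_Phi:
 fixes z u w :: "'n::{finite,linorder} cvec"
 assumes z: "maxnorm z < rad' l" and eta: "eta \<in> Sk l" and u: "u \<in> cbx (ubox k UNIV)" and w: "w \<in> cbx (Bw u)"
 shows "(z + cmul eta u,z + cmul eta w,eta) \<in> V_multi k UNIV"
proof -
 note kD = admissibleD[OF k] and lD = admissibleD[OF l] and e = Sk_l[OF eta]
 note e' = eta_bounds[OF e(1)]
 have eta0: "0 < cmod eta" using e by simp
 have sd: "(z,zeta,eta) \<in> sdom (hk k)" for zeta using z rad'_le kD e by (simp add: sdom_Sk)
 have "(z + cmul eta u,0,eta) \<in> sdom k" by (rule sdom_hk_shift(1)[OF k sd u])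
 then have m: "maxnorm (z + cmul eta u) < rad' k" "eta \<in> Sk k" by (auto simp: sdom_Sk)
 have w1: "cmod (u $ idx1 - w $ idx1) < rho k" "u $ idx1 - w $ idx1 \<in> Sect (3 * theta k/4)"
 using w by (auto simp: cbx_def Bw_def dist_norm dest!: spec[of _ idx1])
 have wi: "1/rho k < cmod (u $ i - w $ i)" "cmod (u $ i - w $ i) < 4/rho l" if "i ~= idx1" for i
 using w that by (auto simp: cbx_def Bw_def norm_minus_commute dest!: spec[of _ i])
 have d: "(z + cmul eta u) $ i - (z + cmul eta w) $ i = eta * (u $ i - w $ i)" for i by (simp add: algebra_simps)
 have "eta * (u $ idx1 - w $ idx1) \<in> Sect (theta k)"
 using kD e'(1,4) by (intro Sect_mult[OF w1(2)]) auto
 moreover have "cmod (eta * (u $ idx1 - w $ idx1)) < rho k * cmod eta" unfolding norm_mult using w1(1) eta0 by simp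
 moreover have "cmod (eta * (u $ i - w $ i)) < rad' k" if "i ~= idx1" for i
 proof -
 have "cmod eta * cmod (u $ i - w $ i) <= cmod eta * (4/rho l)" using wi(2)[OF that] by (intro mult_left_mono) auto
 also have "\<dots> < 4/3 * rad' l" using e(4) lD by (simp add: field_simps)
 also have "\<dots> <= rad' k" using rad'_le kD by linarith
 finally show ?thesis by (simp add: norm_mult)
 qed
 moreover have "cmod eta < rho k * cmod (eta * (u $ i - w $ i))" if "i ~= idx1" for i
 proof -
 have "cmod eta * 1 < cmod eta * (rho k * cmod (u $ i - w $ i))" using wi(1)[OF that] eta0 kD by (intro mult_strict_left_mono) (auto simp: field_simps)
 then show ?thesis by (simp add: norm_mult mult_ac)
 qed
 ultimately show ?thesis unfolding V_multi_iff[OF k] d using m by (auto simp: Sk_def)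
qed

text \<open>The inner integrand shared by both sides. The symbol of the product integrates it over w
  in \<open>G l\<close>, the composition integral over w = u + v with v in
  \<open>G k\<close>.\<close>

definition Phi :: "('n::{finite,linorder} triple => complex) => 'n cvec => 'n cvec => complex => 'n cvec => 'n cvec => complex" where
 "Phi phi z zeta eta u w = phi (z + cmul eta u,z + cmul eta w,eta) * exp (pairing (cmul eta w) zeta)"

lemma chol_Phi:
 fixes phi :: "'n::{finite,linorder} triple => complex"
 assumes phi: "holo_on phi (V_multi k UNIV)" and z: "maxnorm z < rad' l" and eta: "eta \<in> Sk l" and u: "u \<in> cbx (ubox k UNIV)" and w: "w \<in> cbx (Bw u)"
 shows "chol (%p. Phi phi z zeta eta (fst p) (snd p)) (u,w)" "chol (Phi phi z zeta eta u) w"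
proof -
 have c: "chol phi (z + cmul eta u,z + cmul eta w,eta)" using V_Phi[OF z eta u w] phi by (simp add: holo_on_iff_chol)
 show "chol (%p. Phi phi z zeta eta (fst p) (snd p)) (u,w)" unfolding Phi_def
 by (intro chol_mult chol_exp chol_compose[of phi "%p. (z + cmul eta (fst p),z + cmul eta (snd p),eta)"] chol_intros) (simp add: c)
 show "chol (Phi phi z zeta eta u) w" unfolding Phi_def[abs_def]
 by (intro chol_mult chol_exp chol_compose[of phi "%w. (z + cmul eta u,z + cmul eta w,eta)"] chol_intros c)
qed

lemma Bw_circ:
 fixes u :: "'n::{finite,linorder} cvec"
 assumes u: "!!i. i ~= idx1 ==> cmod (u $ i) = 2/rho k" and i: "i ~= idx1"
 shows "path_image (G l 1 i) <= Bw u i" "u $ i + 1 * s \<in> Bw u i \<longleftrightarrow> 1/rho k < cmod s & cmod s < 4/rho l"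
 "1/rho k + cmod (u $ i) < 2/rho l" "2/rho l + cmod (u $ i) < 4/rho l"
proof -
 note kD = admissibleD[OF k] and lD = admissibleD[OF l]
 have "6/rho k <= 1/rho l" using rho_le kD lD by (simp add: field_simps)
 then have "6 * (1/rho k) <= 1/rho l" by simp
 moreover have "1/rho k > 0" using kD by simp
 moreover have e: "2/rho k = 2 * (1/rho k)" "2/rho l = 2 * (1/rho l)" "4/rho l = 4 * (1/rho l)" by simp_all
 ultimately have q: "1/rho k + 2/rho k < 2/rho l" "2/rho l + 2/rho k < 4/rho l" unfolding e by linarith+
 then show "1/rho k + cmod (u $ i) < 2/rho l" "2/rho l + cmod (u $ i) < 4/rho l" unfolding u[OF i] by auto
 show "u $ i + 1 * s \<in> Bw u i \<longleftrightarrow> 1/rho k < cmod s & cmod s < 4/rho l" using i by (simp add: Bw_def)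
 show "path_image (G l 1 i) <= Bw u i"
 proof
 fix s assume "s \<in> path_image (G l 1 i)"
 then have "cmod s = 2/rho l" using i lD by (auto simp: G_def)
 then show "s \<in> Bw u i" using i q u[OF i] norm_triangle_ineq2[of s "u $ i"] norm_triangle_ineq4[of s "u $ i"] by (simp add: Bw_def)
 qed
qed

text \<open>The contour \<open>G k\<close> is translated by u, then its circles are recentred at 0,
  which changes nothing by homotopy. In the first variable the domain is starlike, so the two paths
  differ exactly by the segments between their ends.\<close>

lemma inner_deform:
 fixes u z zeta :: "'n::{finite,linorder} cvec" and phi :: "'n::{finite,linorder} triple => complex"
 assumes phi: "holo_on phi (V_multi k UNIV)" and z: "maxnorm z < rad' l" and eta: "eta \<in> Sk l" and u: "u \<in> cbx (ubox k UNIV)"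
 and ui: "!!i. i ~= idx1 ==> cmod (u $ i) = 2/rho k"
 and u1: "path_image (gam (rho l) (theta l) 1) <= Bw u idx1"
 and s0: "closed_segment (u $ idx1 + beta0 (rho k) (theta k)) (beta0 (rho l) (theta l)) <= Bw u idx1"
 and s1: "closed_segment (u $ idx1 + beta1 (rho k) (theta k)) (beta1 (rho l) (theta l)) <= Bw u idx1"
 shows "iter (G l 1) L0 (Phi phi z zeta eta u) (u1 l) - iter (G k 1) L0 (%v. Phi phi z zeta eta u (u + v)) (u1 k) =
 contour_integral (linepath (u $ idx1 + beta1 (rho k) (theta k)) (beta1 (rho l) (theta l))) (%s. iter (G l 1) Lr (Phi phi z zeta eta u) (set_coord (u1 l) idx1 s)) -
 contour_integral (linepath (u $ idx1 + beta0 (rho k) (theta k)) (beta0 (rho l) (theta l))) (%s. iter (G l 1) Lr (Phi phi z zeta eta u) (set_coord (u1 l) idx1 s))"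
proof -
 note kD = admissibleD[OF k] and lD = admissibleD[OF l]
 let ?P = "Phi phi z zeta eta u" and ?k0 = "beta0 (rho k) (theta k)" and ?k1 = "beta1 (rho k) (theta k)"
 let ?F = "%s. iter (G l 1) Lr ?P (set_coord (u1 l) idx1 s)"
 have ch: "chol ?P w" if "w \<in> cbx (Bw u)" for w by (rule chol_Phi(2)[OF phi z eta u that])
 define g where "g i = (%t. u $ i + 1 * G k 1 i t)" for i
 have ng: "npath (g i)" for i unfolding g_def by (intro npath_affine npath_G)
 have gB: "path_image (g i) <= Bw u i" for i
 proof
 fix s assume "s \<in> path_image (g i)"
 then obtain v where v: "v \<in> path_image (G k 1 i)" "s = u $ i + 1 * v" unfolding g_def path_image_affine by auto
 show "s \<in> Bw u i"
 proof (cases "i = idx1")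
 case True
 then have "v \<in> ubox k UNIV (idx1::'n)" using G_ubox[OF k,of 1 i UNIV] v by auto
 then show ?thesis using True v(2) by (simp add: Bw_def ubox_def dist_norm)
 next
 case False
 have "cmod v = 2/rho k" using v(1) False kD by (auto simp: G_def)
 moreover have "0 < 2/rho l" using lD by simp
 then have "2/rho k < 4/rho l" using Bw_circ(4)[OF ui False] ui[OF False] by linarith
 moreover have "1/rho k < 2/rho k" using kD by (intro divide_strict_right_mono) auto
 ultimately have "1/rho k < cmod v & cmod v < 4/rho l" by simp
 then show ?thesis unfolding v(2) using False by (simp add: Bw_def)
 qed
 qed
 have aff1: "aff u ((\<chi> i. 1) :: 'n cvec) v = u + v" for v by (simp add: vec_eq_iff)
 have w0: "u + u1 k \<in> cbx (Bw u)"
 proof -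
 have "u $ i + 1 * u1 k $ i \<in> path_image (g i)" for i unfolding g_def path_image_affine using u1_G[of k i 1] by blast
 then show ?thesis using gB by (auto simp: cbx_def)
 qed
 let ?o = "(\<chi> i. 1) :: 'n cvec"
 have e1: "iter g L0 ?P (u + u1 k) = iter (G k 1) L0 (%v. ?P (u + v)) (u1 k)"
 proof -
 have "iter (%i t. u $ i + ?o $ i * G k 1 i t) L0 ?P (aff u ?o (u1 k)) =
 prod_list (map (($) ?o) L0) * iter (G k 1) L0 (%w. ?P (aff u ?o w)) (u1 k)"
 proof (rule iter_aff[where B = "Bw u"])
 show "(%s. u $ i + ?o $ i * s) ` path_image (G k 1 i) <= Bw u i" for i using gB[of i] unfolding g_def path_image_affine by simp
 show "continuous_on (cbx (Bw u)) ?P" by (rule chol_imp_continuous_on[OF ch])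
 qed (use w0 aff1 in auto)
 moreover have "(%i t. u $ i + ?o $ i * G k 1 i t) = g" by (simp add: g_def fun_eq_iff)
 ultimately show ?thesis unfolding aff1 prod_list_one by simp
 qed
 define g' where "g' i = (if i = idx1 then g i else G l 1 i)" for i
 have e2: "iter g L0 ?P (u + u1 k) = iter g' L0 ?P (u + u1 k)"
 proof (rule iter_change_paths[where B = "Bw u",OF ng gB _ _ open_Bw ch w0])
 show "npath (g' i)" for i by (simp add: g'_def ng)
 show "path_image (g' i) <= Bw u i" for i using gB Bw_circ(1)[OF ui] by (auto simp: g'_def)
 fix i F assume F: "F holomorphic_on Bw u i"
 show "contour_integral (g i) F = contour_integral (g' i) F"
 proof (cases "i = idx1")
 case False
 have "0 < 2/rho l" using lD by simp
 then have lt: "2/rho k < 4/rho l" using Bw_circ(4)[OF ui False] ui[OF False] by linarith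
 have "contour_integral (%t. u $ i + 1 * circlepath 0 (2/rho k) t) F = contour_integral (circlepath 0 (2/rho l)) F"
 proof (rule circle_recenter[where m = "1/rho k" and M = "4/rho l"])
 show "F holomorphic_on {s. 1/rho k < cmod (s - u $ i)} Int {s. cmod (s - u $ i) < 4/rho l}" using F False by (simp only: Bw_def if_False)
 qed (use lt Bw_circ(3,4)[OF ui False] ui[OF False] kD lD in \<open>auto simp: divide_strict_right_mono\<close>)
 then show ?thesis using False by (simp only: g_def g'_def G_def if_False)
 qed (simp add: g'_def)
 qed
 have e3: "iter g' L0 ?P (u + u1 k) = contour_integral (g idx1) ?F"
 proof -
 have "iter g' Lr ?P (set_coord (u + u1 k) idx1 s) = ?F s" for s
 proof -
 have "iter g' Lr ?P (set_coord (u + u1 k) idx1 s) = iter (G l 1) Lr ?P (set_coord (u + u1 k) idx1 s)"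
 by (rule iter_path_cong) (simp add: g'_def)
 also have "\<dots> = ?F s" by (rule iter_start) simp
 finally show ?thesis .
 qed
 then show ?thesis unfolding L0_Cons iter_Cons by (simp add: g'_def)
 qed
 have e4: "iter (G l 1) L0 ?P (u1 l) = contour_integral (G l 1 (idx1::'n)) ?F"
 unfolding L0_Cons iter_Cons ..
 have Gl: "G l 1 (idx1::'n) = gam (rho l) (theta l) 1" by (simp add: G_def)
 have pg: "pathstart (g idx1) = u $ idx1 + ?k0" "pathfinish (g idx1) = u $ idx1 + ?k1"
 unfolding g_def G_def pathstart_def pathfinish_def by (simp_all add: gam_startfinish[unfolded pathstart_def pathfinish_def])
 have e5: "contour_integral (gam (rho l) (theta l) 1) ?F - contour_integral (g idx1) ?F =
 contour_integral (linepath (pathfinish (g idx1)) (pathfinish (gam (rho l) (theta l) 1))) ?F - contour_integral (linepath (pathstart (g idx1)) (pathstart (gam (rho l) (theta l) 1))) ?F"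
 proof (rule starlike_paths[OF open_Bw[of u idx1]])
 show "starlike (Bw u idx1)" unfolding Bw_def if_P[OF refl]
 by (rule starlike_Sect[where a = "u $ idx1 + of_real (rho k/2)" and \<tau> = "rho k/2"]) (use kD in \<open>auto simp: dist_norm\<close>)
 let ?w = "set_coord (u1 l) idx1 (u $ idx1 + ?k0)"
 have w: "?w \<in> cbx (Bw u)" unfolding cbx_def mem_Collect_eq
 proof
 fix i show "?w $ i \<in> Bw u i"
 proof (cases "i = idx1")
 case True then show ?thesis using s0 by auto
 next
 case False then show ?thesis using u1_G[of l i 1] Bw_circ(1)[OF ui False] by auto
 qed
 qed
 have "(%s. iter (G l 1) Lr ?P (set_coord ?w idx1 s)) holomorphic_on Bw u idx1"
 by (rule chol_holomorphic_coord[OF chol_iter[where B = "Bw u",OF npath_G _ open_Bw ch] w]) (use Bw_circ(1)[OF ui] in auto)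
 then show "?F holomorphic_on Bw u idx1" by simp
 show "path_image (g idx1) <= Bw u idx1" by (rule gB)
 show "valid_path (g idx1)" by (rule npath_valid[OF ng])
 qed (use s0 s1 u1 in \<open>simp_all add: npath_valid pg\<close>)
 show ?thesis by (simp only: e4 Gl e1[symmetric] e2 e3 e5 pg gam_startfinish)
qed

end

context kappa_pair
begin

text \<open>Fubini writes both terms as integrals over u of psi times an inner integral. By
  \<open>inner_deform\<close> the inner integrals differ by two segment integrals, on which phi is
  bounded by compactness and the exponential decays by \<open>good_eps\<close> and
  \<open>exp_decay\<close>.\<close>

theorem mu_NB:
 fixes psi phi :: "'n::{finite,linorder} triple => complex"
 assumes psi: "psi \<in> ER k" and phi: "phi \<in> ER k" and a: "a < rad' l" and S: "S <= Sk l" and b: "0 < b" "b <= bk l (real CARD('n))"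
 shows "NB a b S (mk l/4) (%x. symbol_map l (mu_prod k psi phi) x - Iop k psi phi x)"
proof -
 note kD = admissibleD[OF k] and lD = admissibleD[OF l]
 have hpsi: "holo_on psi (V_multi k UNIV)" and hphi: "holo_on phi (V_multi k UNIV)" using psi phi by (auto simp: ER_def)
 have h\<mu>: "holo_on (mu_prod k psi phi) (V_multi l UNIV)" by (rule holo_mu[OF hpsi hphi])
 let ?k0 = "beta0 (rho k) (theta k)" and ?k1 = "beta1 (rho k) (theta k)" and ?l0 = "beta0 (rho l) (theta l)" and ?l1 = "beta1 (rho l) (theta l)"
 obtain ep R where ep: "0 < ep" "ep <= 1" and R: "0 < R" "R <= 3/4 * rho k" "ep * rho k < 2 * R"
 and bR: "!!w. w \<in> path_image (gam (rho l) (theta l) 1) ==> ball (- w) R <= Sect (3 * theta l/4)"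
 and uw: "!!u w. u \<in> path_image (gam (rho k) (theta k) ep) ==> w \<in> path_image (gam (rho l) (theta l) 1) ==> u - w \<in> Sect (3 * theta k/4)"
 and sg0: "!!u t. u \<in> path_image (gam (rho k) (theta k) ep) ==> 0 <= t ==> t <= 1 ==>
 u - (of_real (1 - t) * (u + ?k0) + of_real t * ?l0) \<in> Sect (3 * theta k/4)"
 and sg1: "!!u t. u \<in> path_image (gam (rho k) (theta k) ep) ==> 0 <= t ==> t <= 1 ==>
 u - (of_real (1 - t) * (u + ?k1) + of_real t * ?l1) \<in> Sect (3 * theta k/4)"
 and re: "!!u t eta b b'. u \<in> path_image (gam (rho k) (theta k) ep) ==> 0 <= t ==> t <= 1 ==> \<bar>Arg eta\<bar> < theta l/4 ==>
 (b,b') \<in> {(?k0,?l0),(?k1,?l1)} ==> Re (eta * (of_real (1 - t) * (u + b) + of_real t * b')) <= - mk l * cmod eta"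
 by (rule good_eps) (rule that)
 let ?Au = "%i::'n. path_image (G k ep i)" and ?Al = "%i::'n. path_image (G l 1 i)"
 let ?circ = "path_image (circlepath 0 (2/rho l))"
 have Aub: "?Au i <= ubox k UNIV i" for i by (rule G_ubox[OF k ep])
 have Alb: "?Al i <= ubox l UNIV i" for i using G_ubox[OF l,of 1 i UNIV] by simp
 have Al_circ: "?Al i = ?circ" if "i ~= idx1" for i using that by (simp only: G_def if_False)
 have ub: "u \<in> cbx (ubox k UNIV)" if "u \<in> cbx ?Au" for u using that Aub by (auto simp: cbx_def)
 have ug: "u $ idx1 \<in> path_image (gam (rho k) (theta k) ep)" if "u \<in> cbx ?Au" for u :: "'n cvec"
 using that by (auto simp: cbx_def G_def dest: spec[of _ idx1])
 have uc: "cmod (u $ i) = 2/rho k" if u: "u \<in> cbx ?Au" and i: "i ~= idx1" for u :: "'n cvec" and i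
 proof -
 have "u $ i \<in> path_image (G k ep i)" using u by (simp add: cbx_def)
 then show ?thesis using i kD by (simp add: G_def)
 qed
 have gk: "cmod y <= rho k/2" if "y \<in> path_image (gam (rho k) (theta k) ep)" for y
 using ep kD(5,3) that by (rule gam_image_rcis) simp
 have gl: "cmod y <= rho l/2" if "y \<in> path_image (gam (rho l) (theta l) 1)" for y
 using zero_less_one order_refl lD(5,3) that by (rule gam_image_rcis) simp
 have Al1: "path_image (gam (rho l) (theta l) 1) <= Bw u idx1" if u: "u \<in> cbx ?Au" for u :: "'n cvec"
 proof
 fix w assume w: "w \<in> path_image (gam (rho l) (theta l) 1)"
 have "cmod (u $ idx1 - w) < rho k" using gk[OF ug[OF u]] gl[OF w] rho_le kD norm_triangle_ineq4[of "u $ idx1" w] by linarith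
 moreover have "u $ idx1 - w \<in> Sect (3 * theta k/4)" by (rule uw[OF ug[OF u] w])
 ultimately show "w \<in> Bw u idx1" by (simp add: Bw_def dist_norm)
 qed
 have AlB: "?Al i <= Bw u i" if u: "u \<in> cbx ?Au" for u i
 using Al1[OF u] Bw_circ(1)[OF uc[OF u]] by (cases "i = idx1") (auto simp: G_def)
 define pairs where "pairs = {(?k0,?l0),(?k1,?l1)}"
 \<comment> \<open>The two connecting segments, parametrised by t so that compactness can be used in
   (u, t) together.\<close>
 define sg where "sg bb u t = of_real (1 - t) * (u + fst bb) + of_real t * (snd bb :: complex)" for bb u t
 have sgB: "sg bb (u $ idx1) t \<in> Bw u idx1" if u: "u \<in> cbx ?Au" and t: "0 <= t" "t <= 1" and bb: "bb \<in> pairs" for u :: "'n cvec" and t bb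
 proof -
 have n: "cmod (fst bb) = rho k/2" "cmod (snd bb) = rho l/2" using bb by (auto simp: pairs_def beta_bound[OF k] beta_bound[OF l])
 have e: "u $ idx1 + fst bb \<in> ball (u $ idx1) (rho k)" "snd bb \<in> ball (u $ idx1) (rho k)"
 using n gk[OF ug[OF u]] rho_le kD norm_triangle_ineq4[of "u $ idx1" "snd bb"] by (auto simp: dist_norm)
 have "(1 - t) *\<^sub>R (u $ idx1 + fst bb) + t *\<^sub>R snd bb \<in> ball (u $ idx1) (rho k)"
 using convexD[OF convex_ball e,of "1 - t" t] t by simp
 then have "sg bb (u $ idx1) t \<in> ball (u $ idx1) (rho k)" unfolding sg_def by (simp only: scaleR_conv_of_real)
 moreover have "u $ idx1 - sg bb (u $ idx1) t \<in> Sect (3 * theta k/4)"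
 using bb sg0[OF ug[OF u] t] sg1[OF ug[OF u] t] unfolding pairs_def sg_def by auto
 ultimately show ?thesis by (simp add: Bw_def)
 qed
 have seg_sg: "EX t. 0 <= t & t <= 1 & s = sg bb y t" if "s \<in> closed_segment (y + fst bb) (snd bb)" for s y bb
 using that unfolding closed_segment_def sg_def scaleR_conv_of_real by blast
 have setB: "set_coord w idx1 s \<in> cbx (Bw u)" if u: "u \<in> cbx ?Au" and s: "s \<in> Bw u idx1" and w: "!!i. i ~= idx1 ==> w $ i \<in> ?circ" for u w :: "'n cvec" and s
 unfolding cbx_def mem_Collect_eq
 proof
 fix i show "set_coord w idx1 s $ i \<in> Bw u i"
 proof (cases "i = idx1")
 case False
 then have "w $ i \<in> ?Al i" using w Al_circ by simp
 then show ?thesis using AlB[OF u,of i] False by auto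
 qed (use s in simp)
 qed
 show ?thesis unfolding NB_def
 proof (intro conjI allI impI)
 have "Rg a b S <= (sdom l :: 'n triple set)" by (rule Rg_sdom[OF a S])
 moreover have "sdom l <= (sdom (hk k) :: 'n triple set)"
 proof
 fix x :: "'n triple" assume "x \<in> sdom l"
 then show "x \<in> sdom (hk k)" using Sk_l(5) rad'_le kD by (cases x) (auto simp: sdom_Sk)
 qed
 ultimately show "EX W. open W & Rg a b S <= W & holo_on (%x. symbol_map l (mu_prod k psi phi) x - Iop k psi phi x) W"
 using holo_symbol_map[OF l h\<mu>] holo_Iop[OF k hpsi hphi] open_sdom[OF l]
 by (intro exI[of _ "sdom l"]) (auto simp: holo_on_iff_chol intro!: chol_diff)
 next
 fix Z assume Z: "compact Z" "Z <= S"
 have Zl: "Z <= Sk l" using Z S by blast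
 have Zk: "Z <= Sk k" using Zl Sk_l(5) Sk_hk(1)[OF k] by blast
 have ak: "a < rad' k" using a rad'_le kD by linarith
 obtain C1 where C1: "C1 > 0" "!!z eta u. maxnorm z <= a ==> eta \<in> Z ==> u \<in> cbx ?Au ==> cmod (psi (z,z + cmul eta u,eta)) <= C1"
 by (rule compact_bound_V[OF k hpsi path_image_compact[OF npath_G] Aub ak Z(1) Zk],rule that)
 \<comment> \<open>The set of w to be covered varies with u; parametrising it by (z, eta, u, t, w)
   over a compact product gives a bound for phi that is uniform in u.\<close>
 have "\<exists>C\<ge>0. ALL z eta u t w. maxnorm z <= a --> eta \<in> Z --> u \<in> cbx ?Au --> t \<in> {0..1} --> w \<in> cbx (%_. ?circ) -->
 cmod (phi (z + cmul eta u,z + cmul eta (set_coord w idx1 (sg bb (u $ idx1) t)),eta)) <= C" if bb: "bb \<in> pairs" for bb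
 proof -
 let ?K = "cbx (%_::'n. cball 0 a) \<times> Z \<times> cbx ?Au \<times> {0..1::real} \<times> cbx (%_::'n. ?circ)"
 let ?T = "%(z,eta,u,t,w). (z + cmul eta u,z + cmul eta (set_coord w (idx1::'n) (sg bb (u $ idx1) t)),eta)"
 have K: "compact ?K" using Z by (intro compact_Times compact_cbx path_image_compact npath_G npath_circlepath) auto
 have T: "?T ` ?K <= V_multi k UNIV"
 proof
 fix y assume "y \<in> ?T ` ?K"
 then obtain z eta u t w where y: "y = (z + cmul eta u,z + cmul eta (set_coord w (idx1::'n) (sg bb (u $ idx1) t)),eta)"
 "z \<in> cbx (%_. cball 0 a)" "eta \<in> Z" "u \<in> cbx ?Au" "0 <= t" "t <= 1" "w \<in> cbx (%_. ?circ)" by auto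
 have "maxnorm z < rad' l" using y(2) a unfolding maxnorm_less_iff cbx_def by (auto intro: le_less_trans)
 moreover have "set_coord w idx1 (sg bb (u $ idx1) t) \<in> cbx (Bw u)"
 using y(7) by (intro setB[OF y(4)] sgB[OF y(4-6) bb]) (auto simp: cbx_def)
 ultimately show "y \<in> V_multi k UNIV" unfolding y(1) using y(3) Zl by (intro V_Phi ub[OF y(4)]) auto
 qed
 have "continuous_on ?K ?T" unfolding sg_def case_prod_unfold by (intro continuous_intros)
 moreover have "continuous_on (V_multi k UNIV) phi" using hphi by (intro chol_imp_continuous_on) (auto simp: holo_on_iff_chol)
 ultimately have "continuous_on ?K (%p. phi (?T p))" using T by (intro continuous_on_compose2[of "V_multi k UNIV" phi ?K ?T])
 then obtain M where M: "M \<ge> 0" "!!p. p \<in> ?K ==> cmod (phi (?T p)) <= M" by (rule compact_bound[OF K]) (rule that)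
 show ?thesis
 proof (intro exI[of _ M] conjI allI impI M(1))
 fix z :: "'n cvec" and eta and u :: "'n cvec" and t :: real and w :: "'n cvec"
 assume *: "maxnorm z <= a" "eta \<in> Z" "u \<in> cbx ?Au" "t \<in> {0..1}" "w \<in> cbx (%_. ?circ)"
 then have "(z,eta,u,t,w) \<in> ?K" by (simp add: cbx_def maxnorm_le_iff)
 from M(2)[OF this] show "cmod (phi (z + cmul eta u,z + cmul eta (set_coord w idx1 (sg bb (u $ idx1) t)),eta)) <= M" by simp
 qed
 qed
 then have "\<forall>bb\<in>pairs. \<exists>C\<ge>0. ALL z eta u t w. maxnorm z <= a --> eta \<in> Z --> u \<in> cbx ?Au --> t \<in> {0..1} --> w \<in> cbx (%_. ?circ) -->
 cmod (phi (z + cmul eta u,z + cmul eta (set_coord w idx1 (sg bb (u $ idx1) t)),eta)) <= C" by blast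
 then obtain CC where CC: "\<forall>bb\<in>pairs. 0 <= CC bb & (ALL z eta u t w. maxnorm z <= a --> eta \<in> Z --> u \<in> cbx ?Au --> t \<in> {0..1} --> w \<in> cbx (%_. ?circ) -->
 cmod (phi (z + cmul eta u,z + cmul eta (set_coord w idx1 (sg bb (u $ idx1) t)),eta)) <= CC bb)" by (rule bchoice[THEN exE])
 obtain C2 where C2: "C2 > 0" "!!f B M w. (!!i. i \<in> set Lr ==> path_image (G l 1 (i::'n)) <= B i) ==> continuous_on (cbx B) f ==>
 (!!w. w \<in> cbx B ==> cmod (f w) <= M) ==> w \<in> cbx B ==> cmod (iter (G l 1) Lr f w) <= C2 * M"
 using iter_bound[of Lr "G l 1 :: 'n => _",OF npath_G] by blast
 obtain C3 where C3: "C3 > 0" "!!f B M w. (!!i. i \<in> set L0 ==> path_image (G k ep (i::'n)) <= B i) ==> continuous_on (cbx B) f ==>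
 (!!w. w \<in> cbx B ==> cmod (f w) <= M) ==> w \<in> cbx B ==> cmod (iter (G k ep) L0 f w) <= C3 * M"
 using iter_bound[of L0 "G k ep :: 'n => _",OF npath_G] by blast
 define Rn where "Rn = max 1 (rad l) ^ CARD('n)"
 have Rn: "Rn \<ge> 0" by (simp add: Rn_def)
 define D where "D = C2 * CC (?k1,?l1) * 2 + C2 * CC (?k0,?l0) * 2"
 have "cmod (symbol_map l (mu_prod k psi phi) (z,zeta,eta) - Iop k psi phi (z,zeta,eta)) \<le>
 (Rn * (C3 * (C1 * (Rn * D)))) * exp (- (mk l/4) * (cmod eta * maxnorm zeta))"
 if x: "(z,zeta,eta) \<in> Rg a b Z" for z zeta :: "'n cvec" and eta
 proof -
 have x': "maxnorm z <= a" "zeta \<in> Cone b" "eta \<in> Z" using x by (auto simp: Rg_def)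
 have z: "maxnorm z < rad' l" using x' a by simp
 have eta: "eta \<in> Sk l" using x' Zl by auto
 note e = Sk_l[OF eta]
 note e' = eta_bounds[OF e(1)]
 have bl: "bk l (real CARD('n)) <= 1" using bk_bounds[OF l,of "real CARD('n)"] by simp
 have zeta: "zeta \<in> Cone (bk l (real CARD('n)))" using Cone_mono[OF b(2,1)] b bl x'(2) by auto
 have sdl: "(z,zeta,eta) \<in> sdom l" using z eta by (simp add: sdom_Sk)
 have sdh: "(z,zeta,eta) \<in> sdom (hk k)" using z rad'_le kD e(5) by (simp add: sdom_Sk)
 let ?X = "exp (- (mk l/4) * (cmod eta * maxnorm zeta))"
 let ?P = "Phi phi z zeta eta" and ?ps = "%u. psi (z,z + cmul eta u,eta)"
 let ?N = "eta ^ CARD('n)"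
 have NR: "cmod ?N <= Rn" unfolding Rn_def norm_power using sectorD(2)[OF e(1)] by (intro power_mono) auto
 define Jl where "Jl u = iter (G l 1) L0 (?P u) (u1 l)" for u
 define Kk where "Kk u = exp (pairing (cmul eta u) zeta) * symbol_map k phi (z + cmul eta u,zeta,eta)" for u
 have cP: "chol (%p. ?P (fst p) (snd p)) (u,w)" "chol (?P u) w" if "u \<in> cbx ?Au" "w \<in> cbx (Bw u)" for u w
 using chol_Phi[OF hphi z eta ub[OF that(1)] that(2)] by auto
 have AlBw: "w \<in> cbx (Bw u)" if "u \<in> cbx ?Au" "w \<in> cbx ?Al" for u w using AlB[OF that(1)] that(2) by (auto simp: cbx_def)
 have cps: "continuous_on (cbx ?Au) ?ps" by (rule integrand_continuous(2)[OF k hpsi sdom_hk(4)[OF k sdh] Aub])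
 have cPP: "continuous_on (cbx ?Au \<times> cbx ?Al) (%(u,w). ?P u w)"
 unfolding case_prod_unfold by (rule chol_imp_continuous_on) (use cP(1) AlBw in auto)
 have u1k: "u1 k \<in> cbx ?Au" and u1l: "u1 l \<in> cbx ?Al" by (auto simp: cbx_def u1_G)
 \<comment> \<open>Scaled by eta, the radius R of \<open>good_eps\<close> is a margin for every w on
   the contour, so the same epsilon computes the product at all of these points.\<close>
 have mu: "mu_prod k psi phi (z,z + cmul eta w,eta) * exp (pairing (cmul eta w) zeta) = ?N * iter (G k ep) L0 (%u. ?ps u * ?P u w) (u1 k)"
 if w: "w \<in> cbx ?Al" for w
 proof -
 have wb: "w \<in> cbx (ubox l UNIV)" using w Alb by (auto simp: cbx_def)
 have w1: "w $ idx1 \<in> path_image (gam (rho l) (theta l) 1)" using w by (auto simp: cbx_def G_def dest: spec[of _ idx1])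
 have V: "(z,z + cmul eta w,eta) \<in> V_multi l UNIV" by (rule ubox_V_multi[OF l sdl wb])
 have eta0: "0 < cmod eta" using e(3) by simp
 have "ball (z $ idx1 - (z + cmul eta w) $ idx1) (R * cmod eta) <= Sect (theta k)"
 proof
 fix s assume s: "s \<in> ball (z $ idx1 - (z + cmul eta w) $ idx1) (R * cmod eta)"
 have "cmod (- (w $ idx1) - s/eta) * cmod eta = cmod (- (eta * w $ idx1) - s)"
 unfolding norm_mult[symmetric] using e(3) by (simp add: algebra_simps)
 also have "\<dots> < R * cmod eta" using s by (simp add: dist_norm)
 finally have "s/eta \<in> ball (- (w $ idx1)) R" using eta0 by (simp add: dist_norm)
 then have "s/eta \<in> Sect (3 * theta l/4)" using bR[OF w1] by blast
 then have "eta * (s/eta) \<in> Sect (theta k)" using e(2,3) theta_le kD lD by (intro Sect_mult) auto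
 then show "s \<in> Sect (theta k)" using e(3) by simp
 qed
 moreover have "R * cmod eta <= 3/4 * rho k * cmod eta" using R(2) by (intro mult_right_mono) auto
 moreover have "ep * rho k * cmod eta < 2 * (R * cmod eta)" using mult_strict_right_mono[OF R(3) eta0] by simp
 ultimately have "mu_prod k psi phi (z,z + cmul eta w,eta) = mub k ep psi phi (z,z + cmul eta w,eta)"
 using R(1) eta0 by (intro mu_eq_mub[OF hpsi hphi V _ _ _ ep,of "R * cmod eta"]) auto
 also have "\<dots> = ?N * iter (G k ep) L0 (%u. ?ps u * phi (z + cmul eta u,z + cmul eta w,eta)) (u1 k)" by (simp add: mub_def)
 finally have "mu_prod k psi phi (z,z + cmul eta w,eta) * exp (pairing (cmul eta w) zeta) =
 ?N * (exp (pairing (cmul eta w) zeta) * iter (G k ep) L0 (%u. ?ps u * phi (z + cmul eta u,z + cmul eta w,eta)) (u1 k))" by (simp only: mult_ac)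
 also have "\<dots> = ?N * iter (G k ep) L0 (%u. exp (pairing (cmul eta w) zeta) * (?ps u * phi (z + cmul eta u,z + cmul eta w,eta))) (u1 k)" by (simp only: iter_cmult)
 also have "(%u. exp (pairing (cmul eta w) zeta) * (?ps u * phi (z + cmul eta u,z + cmul eta w,eta))) = (%u. ?ps u * ?P u w)" by (simp add: Phi_def mult_ac)
 finally show ?thesis .
 qed
 have "symbol_map l (mu_prod k psi phi) (z,zeta,eta) = ?N * iter (G l 1) L0 (%w. mu_prod k psi phi (z,z + cmul eta w,eta) * exp (pairing (cmul eta w) zeta)) (u1 l)"
 by (rule symbol_map_scaled[OF l h\<mu> sdl]) auto
 also have "iter (G l 1) L0 (%w. mu_prod k psi phi (z,z + cmul eta w,eta) * exp (pairing (cmul eta w) zeta)) (u1 l) =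
 iter (G l 1) L0 (%w. ?N * iter (G k ep) L0 (%u. ?ps u * ?P u w) (u1 k)) (u1 l)"
 by (rule iter_cong[where B = ?Al]) (use mu u1l in auto)
 also have "\<dots> = ?N * iter (G l 1) L0 (%w. iter (G k ep) L0 (%u. ?ps u * ?P u w) (u1 k)) (u1 l)" by (rule iter_cmult)
 also have "iter (G l 1) L0 (%w. iter (G k ep) L0 (%u. ?ps u * ?P u w) (u1 k)) (u1 l) = iter (G k ep) L0 (%u. iter (G l 1) L0 (%w. ?ps u * ?P u w) (u1 l)) (u1 k)"
 proof (rule iter_iter_swap[where A = ?Al and B = ?Au])
 have "continuous_on (cbx ?Au \<times> cbx ?Al) (%p. ?ps (fst p) * ?P (fst p) (snd p))"
 using cPP unfolding case_prod_unfold by (intro continuous_on_mult continuous_on_compose2[OF cps] continuous_intros) auto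
 then have "continuous_on (cbx ?Au \<times> cbx ?Al) (%(u,w). ?ps u * ?P u w)" by (simp only: case_prod_unfold)
 then show "continuous_on (cbx ?Al \<times> cbx ?Au) (%(w,u). ?ps u * ?P u w)" by (rule continuous_on_swap_args)
 qed (use u1k u1l in auto)
 also have "\<dots> = iter (G k ep) L0 (%u. ?ps u * Jl u) (u1 k)" by (simp only: iter_cmult Jl_def)
 also have "?N * \<dots> = iter (G k ep) L0 (%u. ?N * (?ps u * Jl u)) (u1 k)" by (rule iter_cmult[symmetric])
 finally have sym: "symbol_map l (mu_prod k psi phi) (z,zeta,eta) = ?N * iter (G k ep) L0 (%u. ?N * (?ps u * Jl u)) (u1 k)" .
 have iop: "Iop k psi phi (z,zeta,eta) = ?N * iter (G k ep) L0 (%u. ?ps u * Kk u) (u1 k)"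
 unfolding Iop_eps[OF k hpsi hphi sdh ep] Kk_def by (simp only: mult.assoc)
 \<comment> \<open>The exponentials of eta u and eta v combine to that of eta (u + v), which shifts
   the inner variable by u.\<close>
 have K: "Kk u = ?N * iter (G k 1) L0 (%v. ?P u (u + v)) (u1 k)" if u: "u \<in> cbx ?Au" for u
 proof -
 have "symbol_map k phi (z + cmul eta u,zeta,eta) = ?N * iter (G k 1) L0 (%v. phi (z + cmul eta u,z + cmul eta u + cmul eta v,eta) * exp (pairing (cmul eta v) zeta)) (u1 k)"
 by (rule symbol_map_scaled[OF k hphi sdom_hk_shift(1)[OF k sdh ub[OF u]]]) auto
 then have "Kk u = ?N * (exp (pairing (cmul eta u) zeta) * iter (G k 1) L0 (%v. phi (z + cmul eta u,z + cmul eta u + cmul eta v,eta) * exp (pairing (cmul eta v) zeta)) (u1 k))"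
 unfolding Kk_def by (simp only: mult.left_commute)
 also have "\<dots> = ?N * iter (G k 1) L0 (%v. exp (pairing (cmul eta u) zeta) * (phi (z + cmul eta u,z + cmul eta u + cmul eta v,eta) * exp (pairing (cmul eta v) zeta))) (u1 k)"
 by (simp only: iter_cmult)
 also have "(%v. exp (pairing (cmul eta u) zeta) * (phi (z + cmul eta u,z + cmul eta u + cmul eta v,eta) * exp (pairing (cmul eta v) zeta))) = (%v. ?P u (u + v))"
 by (simp add: Phi_def cmul_add_right pairing_add exp_add add.assoc mult_ac)
 finally show ?thesis .
 qed
 have cJ: "continuous_on (cbx ?Au) Jl"
 proof -
 have "continuous_on (cbx ?Au \<times> cbx ?Al) (%(u,w). iter (G l 1) L0 (?P u) w)"
 by (rule continuous_on_iter_param[OF npath_G _ cPP]) simp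
 from continuous_on_slice(2)[OF this u1l] show ?thesis by (simp only: Jl_def[abs_def])
 qed
 have cK: "continuous_on (cbx ?Au) Kk"
 proof (rule chol_imp_continuous_on)
 fix u assume u: "u \<in> cbx ?Au"
 have "chol (symbol_map k phi) (z + cmul eta u,zeta,eta)" using holo_symbol_map[OF k hphi] sdom_hk_shift(1)[OF k sdh ub[OF u]] by (simp add: holo_on_iff_chol)
 then show "chol Kk u" unfolding Kk_def[abs_def]
 by (intro chol_mult chol_exp chol_compose[of "symbol_map k phi" "%u. (z + cmul eta u,zeta,eta)"] chol_intros)
 qed
 let ?F = "%u s. iter (G l 1) Lr (?P u) (set_coord (u1 l) idx1 s)"
 have Fb: "cmod (?F u s) <= C2 * (CC bb * ?X)" if u: "u \<in> cbx ?Au" and bb: "bb \<in> pairs" and s: "s \<in> closed_segment (u $ idx1 + fst bb) (snd bb)" for u :: "'n cvec" and bb s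
 proof -
 obtain t where t: "0 <= t" "t <= 1" "s = sg bb (u $ idx1) t" using seg_sg[OF s] by blast
 have sB: "s \<in> Bw u idx1" unfolding t(3) by (rule sgB[OF u t(1,2) bb])
 have s2: "cmod s <= 2" using sB gk[OF ug[OF u]] kD norm_triangle_sub[of s "u $ idx1"] by (simp add: Bw_def dist_norm norm_minus_commute)
 let ?B = "%i::'n. if i = idx1 then {s} else ?circ"
 have wB: "w = set_coord w idx1 s" "w \<in> cbx (Bw u)" "!!i. i ~= idx1 ==> cmod (w $ i) = 2/rho l" if w: "w \<in> cbx ?B" for w :: "'n cvec"
 proof -
 have wi: "w $ i \<in> (if i = idx1 then {s} else ?circ)" for i using w unfolding cbx_def by blast
 show eq: "w = set_coord w idx1 s" using wi[of idx1] by (simp add: vec_eq_iff)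
 have "w $ i \<in> ?circ" if "i ~= idx1" for i using wi[of i] that by simp
 from setB[OF u sB this] show "w \<in> cbx (Bw u)" using eq by simp
 show "cmod (w $ i) = 2/rho l" if "i ~= idx1" for i using wi[of i] that lD by simp
 qed
 show ?thesis
 proof (rule C2(2)[of ?B])
 show "path_image (G l 1 i) <= ?B i" if "i \<in> set Lr" for i using that Al_circ[of i] by simp
 show "continuous_on (cbx ?B) (?P u)" by (rule chol_imp_continuous_on) (rule cP(2)[OF u wB(2)])
 show "set_coord (u1 l) idx1 s \<in> cbx ?B" unfolding cbx_def mem_Collect_eq
 proof
 fix i show "set_coord (u1 l) idx1 s $ i \<in> ?B i" using u1_G[of l i 1] Al_circ[of i] by (cases "i = idx1") auto
 qed
 fix w assume w: "w \<in> cbx ?B"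
 note wB = wB[OF w]
 have ws: "w $ idx1 = s" using wB(1) by (metis set_coord_nth)
 \<comment> \<open>The bound CC is stated for vectors with all entries on the circle; the first
   entry is overwritten by \<open>sg\<close> and may be put there arbitrarily.\<close>
 let ?w = "set_coord w idx1 (of_real (2/rho l))"
 have wc: "?w \<in> cbx (%_. ?circ)" unfolding cbx_def mem_Collect_eq
 proof
 fix i show "?w $ i \<in> ?circ" using wB(3)[of i] lD by (cases "i = idx1") (auto simp: norm_divide)
 qed
 have eqw: "w = set_coord ?w idx1 (sg bb (u $ idx1) t)" using wB(1) unfolding t(3) by simp
 have "cmod (phi (z + cmul eta u,z + cmul eta (set_coord ?w idx1 (sg bb (u $ idx1) t)),eta)) <= CC bb"
 using CC bb x'(1,3) u t(1,2) wc by fastforce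
 then have 1: "cmod (phi (z + cmul eta u,z + cmul eta w,eta)) <= CC bb" unfolding eqw[symmetric] .
 have 2: "cmod (exp (pairing (cmul eta w) zeta)) <= ?X"
 proof (rule exp_decay[OF l zeta])
 have "(fst bb,snd bb) \<in> {(?k0,?l0),(?k1,?l1)}" using bb by (simp add: pairs_def)
 from re[OF ug[OF u] t(1,2) e(2) this] show "Re (cmul eta w $ idx1) <= - mk l * cmod eta" unfolding cmul_simps ws t(3) sg_def .
 have "2 <= 6/rho l" using lD by (simp add: field_simps)
 then have "cmod (w $ i) <= 6/rho l" for i using wB(3)[of i] ws s2 lD by (cases "i = idx1") (auto simp: divide_right_mono)
 from mult_left_mono[OF this,of "cmod eta"] show "cmod (cmul eta w $ i) <= 6/rho l * cmod eta" for i by (simp add: norm_mult mult.commute)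
 qed
 show "cmod (?P u w) <= CC bb * ?X" unfolding Phi_def norm_mult using 1 2 CC bb by (intro mult_mono) auto
 qed
 qed
 have Sb: "cmod (contour_integral (linepath (u $ idx1 + fst bb) (snd bb)) (?F u)) <= (C2 * CC bb * 2) * ?X" if u: "u \<in> cbx ?Au" and bb: "bb \<in> pairs" for u :: "'n cvec" and bb
 proof -
 have segB: "closed_segment (u $ idx1 + fst bb) (snd bb) <= Bw u idx1" using seg_sg sgB[OF u _ _ bb] by blast
 have cF: "continuous_on (closed_segment (u $ idx1 + fst bb) (snd bb)) (?F u)"
 proof (rule continuous_on_compose2[of "cbx (Bw u)" "iter (G l 1) Lr (?P u)"])
 show "continuous_on (cbx (Bw u)) (iter (G l 1) Lr (?P u))"
 by (rule continuous_on_iter[OF npath_G AlB[OF u]]) (rule chol_imp_continuous_on,rule cP(2)[OF u])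
 show "set_coord (u1 l) idx1 ` closed_segment (u $ idx1 + fst bb) (snd bb) <= cbx (Bw u)"
 proof
 fix y :: "'n cvec" assume "y \<in> set_coord (u1 l) idx1 ` closed_segment (u $ idx1 + fst bb) (snd bb)"
 then obtain s where s: "y = set_coord (u1 l) idx1 s" "s \<in> Bw u idx1" using segB by blast
 show "y \<in> cbx (Bw u)" unfolding s(1)
 proof (rule setB[OF u s(2)])
 fix i :: 'n assume i: "i ~= idx1"
 show "u1 l $ i \<in> ?circ" using u1_G[of l i 1] unfolding Al_circ[OF i] .
 qed
 qed
 qed (intro continuous_intros)
 have n: "cmod (fst bb) = rho k/2" "cmod (snd bb) = rho l/2" using bb by (auto simp: pairs_def beta_bound[OF k] beta_bound[OF l])
 have len: "cmod (snd bb - (u $ idx1 + fst bb)) <= 2"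
 using n gk[OF ug[OF u]] rho_le kD norm_triangle_ineq4[of "snd bb" "u $ idx1 + fst bb"] norm_triangle_ineq[of "u $ idx1" "fst bb"] by linarith
 have B0: "0 <= C2 * (CC bb * ?X)" using C2(1) CC bb by (intro mult_nonneg_nonneg) auto
 have "cmod (contour_integral (linepath (u $ idx1 + fst bb) (snd bb)) (?F u)) <= C2 * (CC bb * ?X) * cmod (snd bb - (u $ idx1 + fst bb))"
 by (rule contour_integral_bound_linepath[OF contour_integrable_continuous_linepath[OF cF] B0 Fb[OF u bb]])
 also have "\<dots> <= C2 * (CC bb * ?X) * 2" by (rule mult_left_mono[OF len B0])
 finally show ?thesis by (simp only: mult_ac)
 qed
 have diff: "cmod (?N * Jl u - Kk u) <= Rn * (D * ?X)" if u: "u \<in> cbx ?Au" for u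
 proof -
 have p: "(?k0,?l0) \<in> pairs" "(?k1,?l1) \<in> pairs" by (auto simp: pairs_def)
 have sub: "closed_segment (u $ idx1 + fst bb) (snd bb) <= Bw u idx1" if "bb \<in> pairs" for bb using seg_sg sgB[OF u _ _ that] by blast
 have "Jl u - iter (G k 1) L0 (%v. ?P u (u + v)) (u1 k) =
 contour_integral (linepath (u $ idx1 + ?k1) ?l1) (?F u) - contour_integral (linepath (u $ idx1 + ?k0) ?l0) (?F u)"
 unfolding Jl_def by (rule inner_deform[OF hphi z eta ub[OF u] uc[OF u] Al1[OF u]]) (use sub[OF p(1)] sub[OF p(2)] in simp_all)
 then have "?N * Jl u - Kk u = ?N * (contour_integral (linepath (u $ idx1 + ?k1) ?l1) (?F u) - contour_integral (linepath (u $ idx1 + ?k0) ?l0) (?F u))"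
 unfolding K[OF u] by (metis right_diff_distrib)
 moreover have "cmod (contour_integral (linepath (u $ idx1 + ?k1) ?l1) (?F u) - contour_integral (linepath (u $ idx1 + ?k0) ?l0) (?F u)) <= D * ?X"
 using Sb[OF u p(1)] Sb[OF u p(2)] norm_triangle_ineq4[of "contour_integral (linepath (u $ idx1 + ?k1) ?l1) (?F u)" "contour_integral (linepath (u $ idx1 + ?k0) ?l0) (?F u)"]
 unfolding D_def fst_conv snd_conv distrib_right by linarith
 ultimately show ?thesis using NR Rn by (simp only: norm_mult) (intro mult_mono; simp)
 qed
 have "symbol_map l (mu_prod k psi phi) (z,zeta,eta) - Iop k psi phi (z,zeta,eta) = ?N * iter (G k ep) L0 (%u. ?N * (?ps u * Jl u) - ?ps u * Kk u) (u1 k)"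
 proof -
 have "iter (G k ep) L0 (%u. ?N * (?ps u * Jl u) - ?ps u * Kk u) (u1 k) = iter (G k ep) L0 (%u. ?N * (?ps u * Jl u)) (u1 k) - iter (G k ep) L0 (%u. ?ps u * Kk u) (u1 k)"
 by (rule iter_diff[where B = ?Au]) (use u1k in \<open>auto intro!: continuous_on_mult cps cJ cK continuous_intros\<close>)
 then show ?thesis unfolding sym iop by (simp only: right_diff_distrib)
 qed
 moreover have "cmod (iter (G k ep) L0 (%u. ?N * (?ps u * Jl u) - ?ps u * Kk u) (u1 k)) <= C3 * (C1 * (Rn * (D * ?X)))"
 proof (rule C3(2)[of ?Au])
 show "continuous_on (cbx ?Au) (%u. ?N * (?ps u * Jl u) - ?ps u * Kk u)" by (intro continuous_on_diff continuous_on_mult cps cJ cK continuous_on_const)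
 fix u assume u: "u \<in> cbx ?Au"
 have "?N * (?ps u * Jl u) - ?ps u * Kk u = ?ps u * (?N * Jl u - Kk u)" by (simp only: right_diff_distrib mult.left_commute)
 then show "cmod (?N * (?ps u * Jl u) - ?ps u * Kk u) <= C1 * (Rn * (D * ?X))"
 using diff[OF u] C1(2)[OF x'(1,3) u] C1(1) by (simp only: norm_mult) (intro mult_mono; simp)
 qed (use u1k in auto)
 ultimately have "cmod (symbol_map l (mu_prod k psi phi) (z,zeta,eta) - Iop k psi phi (z,zeta,eta)) <= Rn * (C3 * (C1 * (Rn * (D * ?X))))"
 using NR Rn by (simp only: norm_mult) (intro mult_mono; simp)
 then show ?thesis by (simp only: mult.assoc)
 qed
 then show "EX C. ALL z zeta eta. (z,zeta,eta) \<in> Rg a b Z --> cmod (symbol_map l (mu_prod k psi phi) (z,zeta,eta) - Iop k psi phi (z,zeta,eta)) <= C * exp (- (mk l/4) * (cmod eta * maxnorm zeta))"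
 by blast
 qed
qed

end

section \<open>From bounds to germs, and conclusion\<close>

lemma NB_cong:
 assumes "NB a b S dl P" and U: "open U" "Rg a b S <= U" and eq: "!!x. x \<in> U ==> P x = Q x"
 shows "NB a b S dl Q"
proof -
 obtain W where W: "open W" "Rg a b S <= W" "holo_on P W" using NB_D(1)[OF assms(1)] by blast
 have "chol Q x" if "x \<in> W Int U" for x
 using that W(1,3) U(1) eq by (intro chol_cong_open[of "W Int U" x P Q]) (auto simp: holo_on_iff_chol)
 then have 1: "EX W. open W & Rg a b S <= W & holo_on Q W" using W U by (intro exI[of _ "W Int U"]) (auto simp: holo_on_iff_chol)
 show ?thesis unfolding NB_def
 proof (intro conjI 1 allI impI)
 fix Z assume Z: "compact Z" "Z <= S"
 have "(z,zeta,eta) \<in> Rg a b Z ==> (z,zeta,eta) \<in> U" for z zeta eta using Z(2) U(2) by (auto simp: Rg_def)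
 then show "EX C. ALL z zeta eta. (z,zeta,eta) \<in> Rg a b Z --> cmod (Q (z,zeta,eta)) <= C * exp (- dl * (cmod eta * maxnorm zeta))"
 using NB_D(2)[OF assms(1) Z] eq by metis
 qed
qed

lemma holo_diff:
 assumes "EX W. open W & R <= W & holo_on P W" "EX W. open W & R <= W & holo_on Q W"
 shows "EX W. open W & R <= W & holo_on (%x. P x - Q x) W"
proof -
 obtain W W' where "open W" "R <= W" "holo_on P W" "open W'" "R <= W'" "holo_on Q W'" using assms by blast
 then show ?thesis by (intro exI[of _ "W Int W'"]) (auto simp: holo_on_iff_chol intro: chol_diff)
qed

lemma NB_diff:
 assumes P: "NB a b S dl1 P" and Q: "NB a b S dl2 Q" and d: "dl <= dl1" "dl <= dl2"
 shows "NB a b S dl (%x. P x - Q x)"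
 unfolding NB_def
proof (intro conjI holo_diff NB_D(1)[OF P] NB_D(1)[OF Q] allI impI)
 fix Z assume Z: "compact Z" "Z <= S"
 obtain C1 where C1: "!!z zeta eta. (z,zeta,eta) \<in> Rg a b Z ==> cmod (P (z,zeta,eta)) <= C1 * exp (- dl1 * (cmod eta * maxnorm zeta))" using NB_D(2)[OF P Z] by blast
 obtain C2 where C2: "!!z zeta eta. (z,zeta,eta) \<in> Rg a b Z ==> cmod (Q (z,zeta,eta)) <= C2 * exp (- dl2 * (cmod eta * maxnorm zeta))" using NB_D(2)[OF Q Z] by blast
 have e: "C * exp (- dl' * (cmod eta * maxnorm zeta)) <= \<bar>C\<bar> * exp (- dl * (cmod eta * maxnorm zeta))" if "dl <= dl'" for C dl' eta and zeta :: "'a cvec"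
 proof -
 have "- dl' * (cmod eta * maxnorm zeta) <= - dl * (cmod eta * maxnorm zeta)" using that by (intro mult_right_mono) (auto simp: maxnorm_nonneg)
 then show ?thesis by (intro mult_mono) auto
 qed
 show "EX C. ALL z zeta eta. (z,zeta,eta) \<in> Rg a b Z --> cmod (P (z,zeta,eta) - Q (z,zeta,eta)) <= C * exp (- dl * (cmod eta * maxnorm zeta))"
 proof (intro exI[of _ "\<bar>C1\<bar> + \<bar>C2\<bar>"] allI impI)
 fix z zeta :: "'a cvec" and eta assume x: "(z,zeta,eta) \<in> Rg a b Z"
 show "cmod (P (z,zeta,eta) - Q (z,zeta,eta)) <= (\<bar>C1\<bar> + \<bar>C2\<bar>) * exp (- dl * (cmod eta * maxnorm zeta))"
 using norm_triangle_ineq4[of "P (z,zeta,eta)" "Q (z,zeta,eta)"] C1[OF x] C2[OF x] e[OF d(1),of C1 eta zeta] e[OF d(2),of C2 eta zeta]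
 unfolding distrib_right by linarith
 qed
qed

lemma SB_diff_NB:
 assumes P: "SB a b S P" and Q: "NB a b S dl Q" and dl: "0 <= dl"
 shows "SB a b S (%x. P x - Q x)"
 unfolding SB_def
proof (intro conjI holo_diff SB_D(1)[OF P] NB_D(1)[OF Q] allI impI)
 fix Z h assume Z: "compact Z" "Z <= S" and h: "h > (0::real)"
 obtain C1 where C1: "!!z zeta eta. (z,zeta,eta) \<in> Rg a b Z ==> cmod (P (z,zeta,eta)) <= C1 * exp (h * maxnorm zeta)" using SB_D(2)[OF P Z h] by blast
 obtain C2 where C2: "!!z zeta eta. (z,zeta,eta) \<in> Rg a b Z ==> cmod (Q (z,zeta,eta)) <= C2 * exp (- dl * (cmod eta * maxnorm zeta))" using NB_D(2)[OF Q Z] by blast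
 show "EX C. ALL z zeta eta. (z,zeta,eta) \<in> Rg a b Z --> cmod (P (z,zeta,eta) - Q (z,zeta,eta)) <= C * exp (h * maxnorm zeta)"
 proof (intro exI[of _ "C1 + \<bar>C2\<bar>"] allI impI)
 fix z zeta :: "'a cvec" and eta assume x: "(z,zeta,eta) \<in> Rg a b Z"
 have "0 <= dl * (cmod eta * maxnorm zeta)" "0 <= h * maxnorm zeta" using h dl by (simp_all add: maxnorm_nonneg)
 then have "- dl * (cmod eta * maxnorm zeta) <= h * maxnorm zeta" unfolding mult_minus_left by linarith
 then have "C2 * exp (- dl * (cmod eta * maxnorm zeta)) <= \<bar>C2\<bar> * exp (h * maxnorm zeta)" by (intro mult_mono) auto
 then show "cmod (P (z,zeta,eta) - Q (z,zeta,eta)) <= (C1 + \<bar>C2\<bar>) * exp (h * maxnorm zeta)"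
 using norm_triangle_ineq4[of "P (z,zeta,eta)" "Q (z,zeta,eta)"] C1[OF x] C2[OF x] unfolding distrib_right by linarith
 qed
qed

lemma chol_eta_slice: "chol f (z,zeta,eta) ==> (%s. f (z,zeta,s)) field_differentiable (at eta)" for f :: "'n::finite triple => complex"
 unfolding chol_complex_iff[symmetric] by (intro chol_compose[of f "%s. (z,zeta,s)"] chol_intros)

text \<open>Cauchy's inequality on discs of radius e/2 about the points of Z, which stay in
  S.\<close>

lemma NB_pd_eta:
 assumes P: "NB a b S dl P" and S: "open S" "0 \<notin> S" and dl: "dl > 0"
 shows "NB a b S (dl/2) (pd_eta P)"
proof -
 obtain W where W: "open W" "Rg a b S <= W" "holo_on P W" using NB_D(1)[OF P] by blast
 show ?thesis unfolding NB_def
 proof (intro conjI allI impI)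
 show "EX W. open W & Rg a b S <= W & holo_on (pd_eta P) W" using W holo_pd(3) by blast
 fix Z assume Z: "compact Z" "Z <= S"
 obtain e where e: "e > 0" "(\<Union>x\<in>Z. ball x e) <= S" using compact_subset_open_imp_ball_epsilon_subset[OF Z(1) S(1) Z(2)] by metis
 have eb: "ball x e <= S" if "x \<in> Z" for x using e(2) that by blast
 have xe: "e <= cmod x" if "x \<in> Z" for x
 proof (rule ccontr)
 assume "\<not> e <= cmod x"
 then have "0 \<in> ball x e" by (simp add: dist_norm)
 then show False using eb[OF that] S(2) by blast
 qed
 define Z' where "Z' = {x + y | x y. x \<in> Z & y \<in> cball 0 (e/2)}"
 have Z': "compact Z'" unfolding Z'_def using compact_sums[OF Z(1),of "cball 0 (e/2)"] by simp
 have mem: "s \<in> Z'" if "eta \<in> Z" "cmod (s - eta) <= e/2" for s eta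
 unfolding Z'_def using that by (intro CollectI exI[of _ eta] exI[of _ "s - eta"]) simp
 have Z'S: "Z' <= S"
 proof
 fix s assume "s \<in> Z'"
 then obtain x y where "x \<in> Z" "cmod y <= e/2" "s = x + y" unfolding Z'_def by auto
 then have "s \<in> ball x e" using e(1) by (simp add: dist_norm)
 then show "s \<in> S" using eb \<open>x \<in> Z\<close> by blast
 qed
 obtain C where C: "!!z zeta eta. (z,zeta,eta) \<in> Rg a b Z' ==> cmod (P (z,zeta,eta)) <= C * exp (- dl * (cmod eta * maxnorm zeta))" using NB_D(2)[OF P Z' Z'S] by blast
 show "EX C. ALL z zeta eta. (z,zeta,eta) \<in> Rg a b Z --> cmod (pd_eta P (z,zeta,eta)) <= C * exp (- (dl/2) * (cmod eta * maxnorm zeta))"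
 proof (intro exI[of _ "\<bar>C\<bar>/(e/2)"] allI impI)
 fix z zeta :: "'a cvec" and eta assume x: "(z,zeta,eta) \<in> Rg a b Z"
 have eta: "eta \<in> Z" using x by (simp add: Rg_def)
 let ?f = "%s. P (z,zeta,s)"
 have d: "?f field_differentiable (at s)" if "s \<in> Z'" for s
 proof -
 have "(z,zeta,s) \<in> Rg a b S" using x that Z'S by (auto simp: Rg_def)
 then show ?thesis using W by (intro chol_eta_slice) (auto simp: holo_on_iff_chol)
 qed
 have sub: "cball eta (e/2) <= Z'" using mem[OF eta] by (auto simp: dist_norm norm_minus_commute)
 have hol: "?f holomorphic_on cball eta (e/2)" unfolding holomorphic_on_def
 using d sub by (blast intro: field_differentiable_at_within)
 have "norm ((deriv ^^ 1) ?f eta) <= fact 1 * (\<bar>C\<bar> * exp (- (dl/2) * (cmod eta * maxnorm zeta)))/(e/2) ^ 1"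
 proof (rule Cauchy_inequality)
 show "?f holomorphic_on ball eta (e/2)" by (rule holomorphic_on_subset[OF hol]) auto
 show "continuous_on (cball eta (e/2)) ?f" by (rule holomorphic_on_imp_continuous_on[OF hol])
 fix s assume s: "norm (eta - s) = e/2"
 then have sZ: "s \<in> Z'" using mem[OF eta,of s] by (simp add: norm_minus_commute)
 have "cmod eta <= cmod s + e/2" using s norm_triangle_sub[of eta s] by simp
 \<comment> \<open>As 0 is not in S, |eta| >= e on Z; hence |s| >= |eta| - e/2 >= |eta|/2 on the
   circle. This is the loss from dl to dl/2.\<close>
 then have "cmod eta/2 <= cmod s" using xe[OF eta] by linarith
 then have "dl * (cmod eta/2 * maxnorm zeta) <= dl * (cmod s * maxnorm zeta)" using dl maxnorm_nonneg by (intro mult_left_mono mult_right_mono) auto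
 then have "exp (- dl * (cmod s * maxnorm zeta)) <= exp (- (dl/2) * (cmod eta * maxnorm zeta))" by simp
 then have "C * exp (- dl * (cmod s * maxnorm zeta)) <= \<bar>C\<bar> * exp (- (dl/2) * (cmod eta * maxnorm zeta))" by (intro mult_mono) auto
 moreover have "(z,zeta,s) \<in> Rg a b Z'" using x sZ by (simp add: Rg_def)
 ultimately show "norm (?f s) <= \<bar>C\<bar> * exp (- (dl/2) * (cmod eta * maxnorm zeta))" using C by (meson order_trans)
 qed (use e in auto)
 then show "cmod (pd_eta P (z,zeta,eta)) <= \<bar>C\<bar>/(e/2) * exp (- (dl/2) * (cmod eta * maxnorm zeta))"
 by (simp add: pd_eta_def mult_ac)
 qed
 qed
qed

lemma Ncl_germ:
 fixes P :: "nat => 'n::{finite,linorder} triple => complex"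
 assumes holo: "!!\<nu>. EX W. open W & Rg a b (sector r th) <= W & holo_on (P \<nu>) W" and A: "A > 0"
 and bd: "!!Z h. compact Z ==> Z <= sector r th ==> h > 0 ==> EX C. ALL m z zeta eta. (z,zeta,eta) \<in> Rg a b Z -->
 cmod (\<Sum>\<nu><m. P \<nu> (z,zeta,eta)) <= C * fact m * A ^ m * exp (h * maxnorm zeta)/(cmod eta * maxnorm zeta) ^ m"
 and p: "0 < a" "0 < b" "b <= 1" "0 < r" "r < 1/2" "0 < th" "th < 1/2"
 shows "P \<in> germs z0star frakN_cl"
proof -
 obtain \<Omega> \<rho> where \<Omega>: "conic_nbhd (z0star :: 'n cvec \<times> 'n cvec) \<Omega>" "0 < \<rho>" "\<rho> < 1" "!!Z. sym_dom_times \<Omega> \<rho> 1 Z <= Rg a b Z"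
 by (rule sym_dom_Rg[OF p(1-3)],rule that)
 have "P \<in> frakN_cl \<Omega> (sector r th)" unfolding frakN_cl_def mem_Collect_eq
 proof (rule exI[of _ 1],intro conjI bexI[of _ \<rho>])
 show "\<forall>\<nu>. holo_near (P \<nu>) (sym_dom_times \<Omega> \<rho> 1 (sector r th))" using holo_near_sym_dom[OF \<Omega>(4) holo] by blast
 show "\<exists>A>0. ALL Z. rel_compact Z (sector r th) --> (\<forall>h>0. EX C. ALL m. \<forall>(z,zeta,eta)\<in>sym_dom_times \<Omega> \<rho> 1 Z.
 cmod (\<Sum>\<nu><m. P \<nu> (z,zeta,eta)) <= C * fact m * A ^ m * exp (h * maxnorm zeta)/maxnorm (eta *s zeta) ^ m)"
 proof (rule exI[of _ A],intro conjI allI impI A)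
 fix Z h assume Z: "rel_compact Z (sector r th)" and h: "h > (0::real)"
 define Q where "Q C x = (case x of (z,zeta,eta) => ALL m. cmod (\<Sum>\<nu><m. P \<nu> (z,zeta,eta)) <= C * fact m * A ^ m * exp (h * maxnorm zeta)/(cmod eta * maxnorm zeta) ^ m)" for C x
 have "EX C. \<forall>x\<in>sym_dom_times \<Omega> \<rho> 1 Z. Q C x"
 proof (rule sym_dom_bound[OF \<Omega>(4) Z])
 fix Z :: "complex set" assume Z: "compact Z" "Z <= sector r th"
 then show "EX C. ALL z zeta eta. (z,zeta,eta) \<in> Rg a b Z --> Q C (z,zeta,eta)" using bd[OF Z h] unfolding Q_def prod.case by blast
 qed
 then show "EX C. ALL m. \<forall>(z,zeta,eta)\<in>sym_dom_times \<Omega> \<rho> 1 Z. cmod (\<Sum>\<nu><m. P \<nu> (z,zeta,eta)) <= C * fact m * A ^ m * exp (h * maxnorm zeta)/maxnorm (eta *s zeta) ^ m"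
 unfolding Q_def maxnorm_scale by fast
 qed
 qed (use \<Omega> in auto)
 then show ?thesis unfolding germs_def mem_Collect_eq
 by - (rule exI[of _ \<Omega>],rule conjI,rule \<Omega>(1),rule bexI[of _ r],rule bexI[of _ th],use p in auto)
qed

lemma sum_series_const: "(\<Sum>\<nu><m. series_const P \<nu> x) = (if m = 0 then 0 else P x)"
 unfolding series_const_def by (induction m) auto

lemma holo_formal:
 assumes k: "admissible k" and "holo_on psi (V_multi k UNIV)" "holo_on phi (V_multi k UNIV)"
 shows "holo_on (formal_comp (symbol_map k psi) (symbol_map k phi) \<nu>) (sdom k)"
proof -
 have "holo_on (pd2_multi al (symbol_map k psi)) (sdom k)" "holo_on (pd1_multi al (symbol_map k phi)) (sdom k)" for al
 by (intro holo_pd_multi open_sdom k holo_symbol_map assms)+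
 then show ?thesis unfolding holo_on_iff_chol formal_comp_def[abs_def] comp_term_def
 by (intro ballI chol_sum chol_mult chol_const) auto
qed

lemma odot_Iop:
 assumes "admissible k" "holo_on psi (V_multi k UNIV)" "holo_on phi (V_multi k UNIV)" "x \<in> sdom (hk k)"
 shows "odot (symbol_map k psi) (symbol_map k phi) x = Iop k psi phi x"
 "(%al. comp_term (symbol_map k psi) (symbol_map k phi) al x) summable_on UNIV"
proof -
 obtain z zeta eta where [simp]: "x = (z,zeta,eta)" by (cases x)
 have "((%al. comp_term (symbol_map k psi) (symbol_map k phi) al x) has_sum Iop k psi phi x) UNIV" using comp_term_has_sum[OF assms(1-3)] assms(4) by simp
 then show "odot (symbol_map k psi) (symbol_map k phi) x = Iop k psi phi x" "(%al. comp_term (symbol_map k psi) (symbol_map k phi) al x) summable_on UNIV"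
 unfolding odot_def by (auto intro: infsumI has_sum_imp_summable)
qed

text \<open>An exponentially small E is carried along to treat two claims at once: E = 0 gives the
  composition itself, and E equal to the difference of (3) gives the symbol of the product.\<close>

lemma ncl_final:
 fixes psi phi :: "'n::{finite,linorder} triple => complex"
 assumes k: "admissible k" and psi: "psi \<in> ER k" and phi: "phi \<in> ER k"
 and tail: "ALL Z h. compact Z --> Z <= Sk (hk k) --> (\<forall>eta\<in>Z. cmod eta <= r0) --> h > 0 -->
 (\<exists>C\<ge>0. ALL m z zeta eta. (z,zeta,eta) \<in> Rg (rad' k/4) (bk k (real CARD('n))/4) Z -->
 cmod (odot (symbol_map k psi) (symbol_map k phi) (z,zeta,eta) - (\<Sum>\<nu><m. formal_comp (symbol_map k psi) (symbol_map k phi) \<nu> (z,zeta,eta))) \<le>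
 C * fact m * exp (h * maxnorm zeta)/(cmod eta * maxnorm zeta) ^ m)"
 and E: "NB a b (sector r th) dl E" and dl: "dl > 0" and ab: "0 < a" "a <= rad' k/4" "0 < b" "b <= bk k (real CARD('n))/4"
 and S: "sector r th <= Sk (hk k)" and r: "0 < r" "r < 1/2" "r <= r0" "0 < th" "th < 1/2"
 shows "(%\<nu> x. series_const (%x. odot (symbol_map k psi) (symbol_map k phi) x + E x) \<nu> x - formal_comp (symbol_map k psi) (symbol_map k phi) \<nu> x)
 \<in> germs z0star frakN_cl"
proof -
 note kD = admissibleD[OF k]
 have psi0: "holo_on psi (V_multi k UNIV)" and phi0: "holo_on phi (V_multi k UNIV)" using psi phi by (auto simp: ER_def)
 have b1: "b <= 1" using ab bk_bounds[OF k,of "real CARD('n)"] by simp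
 have Rh: "Rg a b (sector r th) <= (sdom (hk k) :: 'n triple set)" using Rg_sdom[of a "hk k" "sector r th" b] S ab kD by simp
 have hks: "sdom (hk k) <= (sdom k :: 'n triple set)" using sdom_hk(4)[OF k] by auto
 have od: "odot (symbol_map k psi) (symbol_map k phi) x = Iop k psi phi x" if "x \<in> sdom (hk k)" for x by (rule odot_Iop(1)[OF k psi0 phi0 that])
 obtain W where W: "open W" "Rg a b (sector r th) <= W" "holo_on E W" using NB_D(1)[OF E] by blast
 \<comment> \<open>The factor 1/dl comes from exp (- dl x) <= m! / (dl x)^m.\<close>
 define A where "A = max 1 (1/dl)"
 have A: "A \<ge> 1" "A \<ge> 1/dl" "A > 0" by (auto simp: A_def)
 show ?thesis
 proof (rule Ncl_germ[OF _ A(3) _ ab(1,3) b1 r(1,2,4,5)])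
 fix \<nu>
 show "EX W. open W & Rg a b (sector r th) <= W & holo_on (%x. series_const (%x. odot (symbol_map k psi) (symbol_map k phi) x + E x) \<nu> x - formal_comp (symbol_map k psi) (symbol_map k phi) \<nu> x) W"
 proof (intro exI[of _ "W Int sdom (hk k)"] conjI open_Int W open_sdom admissible_hk k Int_greatest Rh)
 show "holo_on (%x. series_const (%x. odot (symbol_map k psi) (symbol_map k phi) x + E x) \<nu> x - formal_comp (symbol_map k psi) (symbol_map k phi) \<nu> x) (W Int sdom (hk k))"
 unfolding holo_on_iff_chol
 proof
 fix x assume x: "x \<in> W Int sdom (hk k)"
 have 1: "chol (formal_comp (symbol_map k psi) (symbol_map k phi) \<nu>) x" using holo_formal[OF k psi0 phi0,of \<nu>] x hks by (auto simp: holo_on_iff_chol)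
 have 2: "chol (odot (symbol_map k psi) (symbol_map k phi)) x"
 by (rule chol_cong_open[OF open_sdom[OF admissible_hk[OF k]],of x "Iop k psi phi"])
 (use x od holo_Iop[OF k psi0 phi0] in \<open>auto simp: holo_on_iff_chol\<close>)
 have 3: "chol E x" using x W by (auto simp: holo_on_iff_chol)
 have "chol (%x. series_const (%x. odot (symbol_map k psi) (symbol_map k phi) x + E x) \<nu> x) x"
 unfolding series_const_def using chol_add[OF 2 3] chol_const by (cases "\<nu> = 0") simp_all
 then show "chol (%x. series_const (%x. odot (symbol_map k psi) (symbol_map k phi) x + E x) \<nu> x - formal_comp (symbol_map k psi) (symbol_map k phi) \<nu> x) x"
 using 1 by (rule chol_diff)
 qed
 qed
 next
 fix Z h assume Z: "compact Z" "Z <= sector r th" and h: "h > (0::real)"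
 have Zr: "cmod eta <= r0" "eta ~= 0" if "eta \<in> Z" for eta using that Z(2) r sectorD by force+
 obtain C1 where C1: "C1 \<ge> 0" "!!m z zeta eta. (z,zeta,eta) \<in> Rg (rad' k/4) (bk k (real CARD('n))/4) Z ==>
 cmod (odot (symbol_map k psi) (symbol_map k phi) (z,zeta,eta) - (\<Sum>\<nu><m. formal_comp (symbol_map k psi) (symbol_map k phi) \<nu> (z,zeta,eta))) \<le>
 C1 * fact m * exp (h * maxnorm zeta)/(cmod eta * maxnorm zeta) ^ m"
 using tail[rule_format,OF Z(1) order_trans[OF Z(2) S] Zr(1) h] by blast
 obtain C2 where C2: "!!z zeta eta. (z,zeta,eta) \<in> Rg a b Z ==> cmod (E (z,zeta,eta)) <= C2 * exp (- dl * (cmod eta * maxnorm zeta))" using NB_D(2)[OF E Z] by blast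
 show "EX C. ALL m z zeta eta. (z,zeta,eta) \<in> Rg a b Z -->
 cmod (\<Sum>\<nu><m. series_const (%x. odot (symbol_map k psi) (symbol_map k phi) x + E x) \<nu> (z,zeta,eta) - formal_comp (symbol_map k psi) (symbol_map k phi) \<nu> (z,zeta,eta)) \<le>
 C * fact m * A ^ m * exp (h * maxnorm zeta)/(cmod eta * maxnorm zeta) ^ m"
 proof (intro exI[of _ "C1 + \<bar>C2\<bar>"] allI impI)
 fix m and z zeta :: "'n cvec" and eta assume xR: "(z,zeta,eta) \<in> Rg a b Z"
 have x': "zeta ~= 0" "eta \<in> Z" using xR by (auto simp: Rg_def)
 define x where "x = cmod eta * maxnorm zeta"
 have x: "x > 0" using maxnorm_pos[OF x'(1)] Zr(2)[OF x'(2)] by (simp add: x_def)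
 let ?S = "\<Sum>\<nu><m. formal_comp (symbol_map k psi) (symbol_map k phi) \<nu> (z,zeta,eta)" and ?o = "odot (symbol_map k psi) (symbol_map k phi) (z,zeta,eta)"
 have "(z,zeta,eta) \<in> Rg (rad' k/4) (bk k (real CARD('n))/4) Z" using Rg_mono[OF ab(2,4,3) b1,of Z Z] xR by auto
 note c1 = C1(2)[OF this,of m,folded x_def]
 have A1: "1 <= A ^ m" using A by simp
 have e1: "1 <= exp (h * maxnorm zeta)" using h maxnorm_nonneg[of zeta] by simp
 let ?B = "fact m * A ^ m * exp (h * maxnorm zeta)/x ^ m"
 have B0: "?B \<ge> 0" using A x by simp
 show "cmod (\<Sum>\<nu><m. series_const (%x. odot (symbol_map k psi) (symbol_map k phi) x + E x) \<nu> (z,zeta,eta) - formal_comp (symbol_map k psi) (symbol_map k phi) \<nu> (z,zeta,eta)) \<le>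
 (C1 + \<bar>C2\<bar>) * fact m * A ^ m * exp (h * maxnorm zeta)/(cmod eta * maxnorm zeta) ^ m"
 \<comment> \<open>For m = 0 the sum is empty; for m >= 1 it contains the full function sitting in
   degree 0.\<close>
 proof (cases "m = 0")
 case True
 then show ?thesis using C1 by simp
 next
 case False
 have "(fact m * 1 * exp (h * maxnorm zeta))/x ^ m <= ?B" using A1 x by (intro divide_right_mono mult_right_mono mult_left_mono) auto
 then have "C1 * (fact m * 1 * exp (h * maxnorm zeta)/x ^ m) <= C1 * ?B" using C1(1) by (intro mult_left_mono) auto
 then have t1: "cmod (?o - ?S) <= C1 * ?B" using c1 by simp
 have "(dl * x) ^ m/fact m <= exp (dl * x)" using dl x by (intro power_fact_le_exp) simp
 then have "exp (- (dl * x)) <= fact m/(dl * x) ^ m" using dl x by (simp add: exp_minus field_simps)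
 also have "\<dots> = fact m * (1/dl) ^ m * 1/x ^ m" by (simp add: power_mult_distrib power_divide)
 also have "\<dots> <= ?B" using A e1 x dl by (intro divide_right_mono mult_mono mult_left_mono power_mono) auto
 finally have "\<bar>C2\<bar> * exp (- (dl * x)) <= \<bar>C2\<bar> * ?B" by (intro mult_left_mono) auto
 moreover have "C2 * exp (- (dl * x)) <= \<bar>C2\<bar> * exp (- (dl * x))" by (intro mult_right_mono) auto
 ultimately have t2: "cmod (E (z,zeta,eta)) <= \<bar>C2\<bar> * ?B" using C2[OF xR,folded x_def] unfolding mult_minus_left by linarith
 have "(\<Sum>\<nu><m. series_const (%x. odot (symbol_map k psi) (symbol_map k phi) x + E x) \<nu> (z,zeta,eta) - formal_comp (symbol_map k psi) (symbol_map k phi) \<nu> (z,zeta,eta)) = (?o - ?S) + E (z,zeta,eta)"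
 unfolding sum_subtractf sum_series_const using False by simp
 then have "cmod (\<Sum>\<nu><m. series_const (%x. odot (symbol_map k psi) (symbol_map k phi) x + E x) \<nu> (z,zeta,eta) - formal_comp (symbol_map k psi) (symbol_map k phi) \<nu> (z,zeta,eta)) <= C1 * ?B + \<bar>C2\<bar> * ?B"
 using norm_triangle_ineq[of "?o - ?S" "E (z,zeta,eta)"] t1 t2 by (simp only:,linarith?)
 then show ?thesis by (simp add: x_def algebra_simps add_divide_distrib)
 qed
 qed
 qed
qed

lemma conv_germ:
 fixes a b :: real and psi phi :: "'n::{finite,linorder} triple => complex"
 assumes k: "admissible k" and psi: "psi \<in> ER k" and phi: "phi \<in> ER k"
 and ab: "0 < a" "a < rad' k/2" "0 < b" "b <= 1" and S: "sector r th <= Sk (hk k)" and r: "0 < r" "r < 1/2" "0 < th" "th < 1/2"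
 shows "(symbol_map k psi,symbol_map k phi) \<in> germs z0star odot_conv"
proof -
 have psi0: "holo_on psi (V_multi k UNIV)" and phi0: "holo_on phi (V_multi k UNIV)" using psi phi by (auto simp: ER_def)
 obtain \<Omega> \<rho> where \<Omega>: "conic_nbhd (z0star :: 'n cvec \<times> 'n cvec) \<Omega>" "0 < \<rho>" "\<rho> < 1" "!!Z. sym_dom_times \<Omega> \<rho> 1 Z <= Rg a b Z"
 by (rule sym_dom_Rg[OF ab(1,3,4)],rule that)
 have "Rg a b (sector r th) <= (sdom (hk k) :: 'n triple set)" using Rg_sdom[of a "hk k" "sector r th" b] S ab by simp
 then have "\<forall>x\<in>sym_dom_times \<Omega> \<rho> 1 (sector r th). (%al. comp_term (symbol_map k psi) (symbol_map k phi) al x) summable_on UNIV"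
 using odot_Iop(2)[OF k psi0 phi0] \<Omega>(4)[of "sector r th"] by blast
 then have "(symbol_map k psi,symbol_map k phi) \<in> odot_conv \<Omega> (sector r th)" unfolding odot_conv_def
 using \<Omega>(2,3) by (auto intro!: exI[of _ 1] bexI[of _ \<rho>])
 then show ?thesis unfolding germs_def mem_Collect_eq
 by - (rule exI[of _ \<Omega>],rule conjI,rule \<Omega>(1),rule bexI[of _ r],rule bexI[of _ th],use r in auto)
qed

lemma ER_stalk_D: "\<Psi> \<in> ER_stalk ==> (k,psi) \<in> \<Psi> ==> admissible k & psi \<in> ER k"
 by (auto simp: ER_stalk_def quotient_def ER_rel_def ER_pairs_def)

lemma NB_zero: "NB a b S dl (%_. 0)"
 unfolding NB_def by (intro conjI exI[of _ UNIV] allI impI exI[of _ 0]) (auto simp: holo_on_iff_chol chol_const)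

text \<open>The estimate (3) comes first. The estimates for \<open>odot\<close> are then those for
  the symbol s of the product, corrected by the exponentially small difference.\<close>

lemma (in kappa_pair) product_symbol:
 fixes psi phi :: "'n::{finite,linorder} triple => complex"
 assumes psi: "psi \<in> ER k" and phi: "phi \<in> ER k"
 and q_def: "q = symbol_map k psi" and p_def: "p = symbol_map k phi" and s_def: "s = symbol_map l (mu_prod k psi phi)"
 shows "(q,p) \<in> germs z0star odot_conv" "odot q p \<in> germs z0star frakS" "(%x. s x - odot q p x) \<in> germs z0star frakN"
 "(%\<nu> x. series_const (odot q p) \<nu> x - formal_comp q p \<nu> x) \<in> germs z0star frakN_cl"
 "(%\<nu> x. series_const s \<nu> x - formal_comp q p \<nu> x) \<in> germs z0star frakN_cl"
proof -
 note kD = admissibleD[OF k] and lD = admissibleD[OF l]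
 have hpsi: "holo_on psi (V_multi k UNIV)" and hphi: "holo_on phi (V_multi k UNIV)" using psi phi by (auto simp: ER_def)
 have \<mu>: "mu_prod k psi phi \<in> ER l" by (rule mu_ER[OF psi phi])
 then have h\<mu>: "holo_on (mu_prod k psi phi) (V_multi l UNIV)" by (simp add: ER_def)
 obtain r0 where r0: "r0 > 0" and tail: "ALL Z h. compact Z --> Z <= Sk (hk k) --> (\<forall>eta\<in>Z. cmod eta <= r0) --> h > 0 -->
 (\<exists>C\<ge>0. ALL m z zeta eta. (z,zeta,eta) \<in> Rg (rad' k/4) (bk k (real CARD('n))/4) Z -->
 cmod (odot (symbol_map k psi) (symbol_map k phi) (z,zeta,eta) - (\<Sum>\<nu><m. formal_comp (symbol_map k psi) (symbol_map k phi) \<nu> (z,zeta,eta))) \<le>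
 C * fact m * exp (h * maxnorm zeta)/(cmod eta * maxnorm zeta) ^ m)"
 by (rule odot_tail[OF k psi phi])
 define th where "th = min (theta l) (1/3)"
 define r where "r = min (min (rad l) (rho l * rad' l/4)) (min r0 (1/3))"
 have th: "0 < th" "th < 1/2" "th <= theta l" "th < 4 * pi" using lD pi_gt3 by (auto simp: th_def)
 have r: "0 < r" "r < 1/2" "r <= r0" "r <= rad l" "r <= rho l * rad' l/4" using lD r0 by (auto simp: r_def)
 have S: "sector r th <= Sk l"
 proof
 fix eta assume eta: "eta \<in> sector r th"
 have "3 * cmod eta < rho l * rad' l" using sectorD(2,4)[OF eta] r(5) by linarith
 then show "eta \<in> Sk l" using sector_mono[OF r(4) th(3)] eta by (auto simp: Sk_def)
 qed
 have Sh: "sector r th <= Sk (hk k)" using S Sk_l(5) by blast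
 have oS: "open (sector r th)" "0 \<notin> sector r th" using open_sector[OF th(4)] sectorD(1) by auto
 define a where "a = rad' l/2"
 define b where "b = min (bk l (real CARD('n))) (bk k (real CARD('n))/4)"
 have a: "0 < a" "a < rad' l" "a <= rad' k/4" "a < rad' k/2" using lD kD rad'_le by (auto simp: a_def)
 have b: "0 < b" "b <= bk l (real CARD('n))" "b <= bk k (real CARD('n))/4" "b <= 1"
 using bk_bounds[OF l,of "real CARD('n)"] bk_bounds[OF k,of "real CARD('n)"] by (auto simp: b_def)
 have m: "mk l/4 > 0" using mk_pos[OF l] by simp
 have Rl: "Rg a b (sector r th) <= (sdom l :: 'n triple set)" by (rule Rg_sdom[OF a(2) S])
 have lh: "x \<in> sdom (hk k)" if "x \<in> sdom l" for x :: "'n triple"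
 using that Sk_l(5) rad'_le kD by (cases x) (auto simp: sdom_Sk)
 have od: "odot q p x = Iop k psi phi x" if "x \<in> sdom (hk k)" for x unfolding q_def p_def by (rule odot_Iop(1)[OF k hpsi hphi that])
 have E: "NB a b (sector r th) (mk l/4) (%x. s x - odot q p x)"
 by (rule NB_cong[OF mu_NB[OF psi phi a(2) S b(1,2)] open_sdom[OF l] Rl]) (simp add: od lh s_def)
 have sb: "SB a b (sector r th) s" "NB a b (sector r th) (mk l/4) (pd_eta s)"
 unfolding s_def by (rule symbol_NB_SB[OF l \<mu> a(2) S b(1,2)])+
 have SBo: "SB a b (sector r th) (odot q p)" using SB_diff_NB[OF sb(1) E] m by simp
 \<comment> \<open>The eta-derivative of \<open>odot\<close> is the derivative of s minus that of
   the difference; the first decays since mu lies in \<open>ER l\<close>, the second by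
   \<open>NB_pd_eta\<close> at half the rate.\<close>
 have "NB a b (sector r th) (mk l/4/2) (%x. pd_eta s x - pd_eta (%x. s x - odot q p x) x)"
 by (rule NB_diff[OF sb(2) NB_pd_eta[OF E oS m]]) (use m in auto)
 then have NBo: "NB a b (sector r th) (mk l/4/2) (pd_eta (odot q p))"
 proof (rule NB_cong[OF _ open_sdom[OF l] Rl])
 fix x :: "'n triple" assume x: "x \<in> sdom l"
 obtain z zeta eta where [simp]: "x = (z,zeta,eta)" by (cases x)
 have 1: "chol s (z,zeta,eta)" using holo_symbol_map[OF l h\<mu>] x by (simp add: s_def holo_on_iff_chol)
 have 2: "chol (odot q p) (z,zeta,eta)"
 by (rule chol_cong_open[OF open_sdom[OF admissible_hk[OF k]],of _ "Iop k psi phi"])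
 (use lh[OF x] od holo_Iop[OF k hpsi hphi] in \<open>auto simp: holo_on_iff_chol\<close>)
 show "pd_eta s x - pd_eta (%x. s x - odot q p x) x = pd_eta (odot q p) x"
 using chol_eta_slice[OF 1] chol_eta_slice[OF 2] by (simp add: pd_eta_def)
 qed
 show "(q,p) \<in> germs z0star odot_conv" unfolding q_def p_def by (rule conv_germ[OF k psi phi a(1,4) b(1,4) Sh r(1,2) th(1,2)])
 show "odot q p \<in> germs z0star frakS" by (rule SB_germ[OF SBo NBo _ a(1) b(1,4) r(1,2) th(1,2)]) (use m in simp)
 show "(%x. s x - odot q p x) \<in> germs z0star frakN" by (rule NB_germ[OF E m a(1) b(1,4) r(1,2) th(1,2)])
 note ncl = ncl_final[OF k psi phi tail _ _ a(1,3) b(1,3) Sh r(1-3) th(1,2),folded q_def p_def]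
 show "(%\<nu> x. series_const (odot q p) \<nu> x - formal_comp q p \<nu> x) \<in> germs z0star frakN_cl"
 using ncl[OF NB_zero m] by simp
 show "(%\<nu> x. series_const s \<nu> x - formal_comp q p \<nu> x) \<in> germs z0star frakN_cl"
 proof -
 have "(%x. odot q p x + (s x - odot q p x)) = s" by (rule ext) (simp add: algebra_simps)
 then show ?thesis using ncl[OF E m] by simp
 qed
qed

theorem theorem6p21:
  fixes \<Psi> \<Phi> :: "(kappa \<times> ('n::{finite,linorder} triple \<Rightarrow> complex)) set"
    and \<psi> \<phi> :: "'n triple \<Rightarrow> complex"
    and k :: kappa
  assumes "\<Psi> \<in> ER_stalk" and "\<Phi> \<in> ER_stalk"
    and "(k, \<psi>) \<in> \<Psi>" and "(k, \<phi>) \<in> \<Phi>"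
  shows
    "(symbol_map k \<psi>, symbol_map k \<phi>) \<in> germs z0star odot_conv \<and>
     odot (symbol_map k \<psi>) (symbol_map k \<phi>) \<in> germs z0star frakS \<and>
     (\<lambda>\<nu> x. series_const (odot (symbol_map k \<psi>) (symbol_map k \<phi>)) \<nu> x
          - formal_comp (symbol_map k \<psi>) (symbol_map k \<phi>) \<nu> x) \<in> germs z0star frakN_cl \<and>
     (\<exists>k0. admissible k0 \<and> (\<forall>l. admissible l \<and> kappa_le l k0 \<longrightarrow>
        mu_prod k \<psi> \<phi> \<in> ER l \<and>
        (\<lambda>x. symbol_map l (mu_prod k \<psi> \<phi>) x
           - odot (symbol_map k \<psi>) (symbol_map k \<phi>) x) \<in> germs z0star frakN \<and>
        (\<lambda>\<nu> x. series_const (symbol_map l (mu_prod k \<psi> \<phi>)) \<nu> x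
           - formal_comp (symbol_map k \<psi>) (symbol_map k \<phi>) \<nu> x) \<in> germs z0star frakN_cl))"
proof -
  have k: "admissible k" and \<psi>: "\<psi> \<in> ER k" and \<phi>: "\<phi> \<in> ER k" using ER_stalk_D assms by blast+
  note kD = admissibleD[OF k]
  define \<rho> where "\<rho> = min (rho k / 6) (mk k / 2)"
  \<comment> \<open>The numbers are the bounds of \<open>kappa_pair\<close>; the extra factor 1/2
    makes the admissibility condition rad < rho rad' strict.\<close>
  define k0 where "k0 = Kappa (min (rad k) (\<rho> * (rad' k / 4) / 2)) (rad' k / 4) \<rho> (theta k / 8)"
  have \<rho>: "0 < \<rho>" "\<rho> \<le> rho k / 6" "\<rho> \<le> mk k / 2" using mk_pos[OF k] kD by (auto simp: \<rho>_def)
  have "0 < \<rho> * (rad' k / 4)" using kD \<rho> by simp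
  then have lt: "min (rad k) (\<rho> * (rad' k / 4) / 2) < \<rho> * (rad' k / 4)" by (intro le_less_trans[OF min.cobounded2]) simp
  have k0: "admissible k0" unfolding admissible_def k0_def kappa.sel
    by (intro conjI lt) (use kD \<rho> in \<open>auto simp: min_less_iff_disj\<close>)
  have pair: "kappa_pair k l" if "admissible l" "kappa_le l k0" for l
    using that k \<rho> by unfold_locales (auto simp: kappa_le_def k0_def)
  \<comment> \<open>The claims that do not mention the product are read off with l = k0.\<close>
  have base: "kappa_pair k k0" by (rule pair[OF k0]) (simp add: kappa_le_def)
  note ps = kappa_pair.product_symbol[OF _ \<psi> \<phi> refl refl refl]
  show ?thesis
  proof (intro conjI exI[of _ k0] allI impI)
    show "(symbol_map k \<psi>, symbol_map k \<phi>) \<in> germs z0star odot_conv" by (rule ps(1)[OF base])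
    show "odot (symbol_map k \<psi>) (symbol_map k \<phi>) \<in> germs z0star frakS" by (rule ps(2)[OF base])
    show "(\<lambda>\<nu> x. series_const (odot (symbol_map k \<psi>) (symbol_map k \<phi>)) \<nu> x
          - formal_comp (symbol_map k \<psi>) (symbol_map k \<phi>) \<nu> x) \<in> germs z0star frakN_cl" by (rule ps(4)[OF base])
    show "admissible k0" by (rule k0)
    fix l assume l: "admissible l \<and> kappa_le l k0"
    note pl = pair[OF conjunct1[OF l] conjunct2[OF l]]
    show "mu_prod k \<psi> \<phi> \<in> ER l" by (rule kappa_pair.mu_ER[OF pl \<psi> \<phi>])
    show "(\<lambda>x. symbol_map l (mu_prod k \<psi> \<phi>) x - odot (symbol_map k \<psi>) (symbol_map k \<phi>) x) \<in> germs z0star frakN"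
      by (rule ps(3)[OF pl])
    show "(\<lambda>\<nu> x. series_const (symbol_map l (mu_prod k \<psi> \<phi>)) \<nu> x
          - formal_comp (symbol_map k \<psi>) (symbol_map k \<phi>) \<nu> x) \<in> germs z0star frakN_cl" by (rule ps(5)[OF pl])
  qed
qed

end
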